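(* Let $F=\mathsf{CAT}(-,\mathsf{Cat})\colon\mathsf{Cat}^{\mathrm{op}}\to\mathsf{CAT}$ and $F_D=\mathsf{CAT}(-,\mathsf{Set})\colon\mathsf{Cat}^{\mathrm{op}}\to\mathsf{CAT}$. Let $p\colon E\to B$ be a functor between small categories, let $\mathsf{CoDesc}(\mathsf{Ker}(p))$ be the lax codescent category of the kernel pair of $p$, and let $$E\to\mathsf{CoDesc}(\mathsf{Ker}(p))\xrightarrow{\ \mathcal K^{\mathsf{Ker}(p)}\ }B$$ be the induced lax codescent factorization of $p$. The following are equivalent: (i) $p$ is an effective $F$-descent morphism (respectively, an $F$-descent morphism); (ii) $\mathsf{CAT}(\mathcal K^{\mathsf{Ker}(p)},\mathsf{Cat})$ is an equivalence (respectively, fully faithful); (iii) $p$ is an effective $F_D$-descent morphism (respectively, an $F_D$-descent morphism); (iv) $\mathsf{CAT}(\mathcal K^{\mathsf{Ker}(p)},\mathsf{Set})$ is an equivalence (respectively, fully faithful); (v) $\mathcal K^{\mathsf{Ker}(p)}$ is a fully faithful lax epimorphism (respectively, a lax epimorphism); (vi) $\mathfrak C\mathcal K^{\mathsf{Ker}(p)}$ is an equivalence (respectively, a lax epimorphism), where $\mathfrak C$ denotes Cauchy completion.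
   Context: $\mathsf{Cat}$ is the 2-category of small categories, $\mathsf{CAT}$ that of large categories; in $\mathsf{CAT}(-,\mathsf{Cat})$ the category $\mathsf{Cat}$ is regarded as an ordinary category. $F$ and $F_D$ act on functors by precomposition. Kernel pair: $\mathsf{Ker}(p)$ is the diagram $E\times_BE\times_BE\rightrightarrows E\times_BE\rightrightarrows E$ with $d_i$ the projection omitting the $i$-th factor (factors numbered from $0$), together with the diagonal $s_0\colon E\to E\times_BE$. Descent: for a 2-functor $G\colon\mathsf{Cat}^{\mathrm{op}}\to\mathsf{CAT}$, $\mathsf{Desc}_G(p)$ has as objects pairs $(x,\varphi)$ with $x\in G(E)$ and $\varphi\colon G(d_1)x\to G(d_0)x$ a morphism in $G(E\times_BE)$ with $G(s_0)\varphi=\mathrm{id}$ and $G(d_0)\varphi\circ G(d_2)\varphi=G(d_1)\varphi$; morphisms $(x,\varphi)\to(y,\psi)$ are $\omega\colon x\to y$ with $G(d_0)\omega\circ\varphi=\psi\circ G(d_1)\omega$. The comparison $\mathcal K^p_G\colon G(B)\to\mathsf{Desc}_G(p)$ sends $z$ to $(G(p)z,\mathrm{id})$. $p$ is an effective $G$-descent (respectively, $G$-descent) morphism if $\mathcal K^p_G$ is an equivalence (respectively, fully faithful). Lax codescent category: $\mathsf{CoDesc}(\mathsf{Ker}(p))$ is the small category $C$ equipped with a functor $q\colon E\to C$ and a natural transformation $\psi\colon q d_1\Rightarrow q d_0$ with $\psi s_0=\mathrm{id}$ and $(\psi d_0)\circ(\psi d_2)=\psi d_1$, universal (in the 1- and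 2-dimensional sense) among such data. $\mathcal K^{\mathsf{Ker}(p)}\colon C\to B$ is the unique functor with $\mathcal K^{\mathsf{Ker}(p)}q=p$ and $\mathcal K^{\mathsf{Ker}(p)}\psi=\mathrm{id}$. A functor $f\colon x\to y$ between small categories is a lax epimorphism if $\mathsf{Cat}(f,z)$ is fully faithful for every small category $z$. The Cauchy completion $\mathfrak CX$ of a small category $X$ is the full subcategory of $[X^{\mathrm{op}},\mathsf{Set}]$ on the objects $P$ such that $\mathrm{Hom}(P,-)$ preserves small colimits; for $f\colon X\to Y$, $\mathfrak Cf\colon\mathfrak CX\to\mathfrak CY$ is the restriction of left Kan extension along $f^{\mathrm{op}}$. *)

theory Defs
  imports Main "HOL-Library.FuncSet" "HOL-Library.Equipollence"
begin

section \<open>Universes\<close>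

text \<open>
  Smallness is relative to a type \<open>'u\<close> of strongly inaccessible cardinality, which plays the role
  of a Grothendieck universe: a set, of whatever type, is small iff its cardinality is strictly
  below that of \<open>'u\<close>. Large categories may live on arbitrary types.
\<close>

definition small :: "'u itself \<Rightarrow> 'a set \<Rightarrow> bool" where
  "small (_ :: 'u itself) A \<longleftrightarrow> A \<prec> (UNIV :: 'u set)"

definition universe :: "'u itself \<Rightarrow> bool" where
  "universe U \<longleftrightarrow>
     small U (UNIV :: nat set) \<and>
     (\<forall>A :: 'u set. small U A \<longrightarrow> small U (Pow A)) \<and>
     (\<forall>(I :: 'u set) (A :: 'u \<Rightarrow> 'u set).
        small U I \<longrightarrow> (\<forall>i\<in>I. small U (A i)) \<longrightarrow> small U (\<Union>i\<in>I. A i))"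


section \<open>Categories, functors, natural transformations\<close>

text \<open>\<open>Comp C g f\<close> is the composite \<open>g \<circ> f\<close>; it is unconstrained on non-composable pairs.\<close>

record ('o, 'm) category =
  Obj :: "'o set"
  Arr :: "'m set"
  Dom :: "'m \<Rightarrow> 'o"
  Cod :: "'m \<Rightarrow> 'o"
  Ide :: "'o \<Rightarrow> 'm"
  Comp :: "'m \<Rightarrow> 'm \<Rightarrow> 'm"

definition hom :: "('o, 'm) category \<Rightarrow> 'o \<Rightarrow> 'o \<Rightarrow> 'm set" where
  "hom C a b = {f \<in> Arr C. Dom C f = a \<and> Cod C f = b}"

definition is_category :: "('o, 'm) category \<Rightarrow> bool" where
  "is_category C \<longleftrightarrow>
     (\<forall>f\<in>Arr C. Dom C f \<in> Obj C \<and> Cod C f \<in> Obj C) \<and>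
     (\<forall>a\<in>Obj C. Ide C a \<in> hom C a a) \<and>
     (\<forall>f\<in>Arr C. \<forall>g\<in>Arr C. Cod C f = Dom C g \<longrightarrow> Comp C g f \<in> hom C (Dom C f) (Cod C g)) \<and>
     (\<forall>f\<in>Arr C. Comp C f (Ide C (Dom C f)) = f \<and> Comp C (Ide C (Cod C f)) f = f) \<and>
     (\<forall>f\<in>Arr C. \<forall>g\<in>Arr C. \<forall>h\<in>Arr C. Cod C f = Dom C g \<longrightarrow> Cod C g = Dom C h \<longrightarrow>
        Comp C h (Comp C g f) = Comp C (Comp C h g) f)"

definition small_category :: "('u, 'u) category \<Rightarrow> bool" where
  "small_category X \<longleftrightarrow> is_category X \<and> small TYPE('u) (Obj X) \<and> small TYPE('u) (Arr X)"

definition op_cat :: "('o, 'm) category \<Rightarrow> ('o, 'm) category" where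
  "op_cat C = C\<lparr>Dom := Cod C, Cod := Dom C, Comp := (\<lambda>g f. Comp C f g)\<rparr>"

definition full_subcat :: "('o, 'm) category \<Rightarrow> 'o set \<Rightarrow> ('o, 'm) category" where
  "full_subcat C S =
     C\<lparr>Obj := Obj C \<inter> S, Arr := {f \<in> Arr C. Dom C f \<in> S \<and> Cod C f \<in> S}\<rparr>"

definition is_iso :: "('o, 'm) category \<Rightarrow> 'm \<Rightarrow> bool" where
  "is_iso C f \<longleftrightarrow> f \<in> Arr C \<and>
     (\<exists>g \<in> hom C (Cod C f) (Dom C f).
        Comp C g f = Ide C (Dom C f) \<and> Comp C f g = Ide C (Cod C f))"

text \<open>
  Functors and natural transformations are extensional (\<open>undefined\<close> off the carriers), so that
  equality in HOL is equality of functors and of natural transformations.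
\<close>

record ('o1, 'm1, 'o2, 'm2) fmaps =
  FObj :: "'o1 \<Rightarrow> 'o2"
  FArr :: "'m1 \<Rightarrow> 'm2"

definition is_functor ::
  "('o1, 'm1) category \<Rightarrow> ('o2, 'm2) category \<Rightarrow> ('o1, 'm1, 'o2, 'm2) fmaps \<Rightarrow> bool" where
  "is_functor X Y F \<longleftrightarrow>
     is_category X \<and> is_category Y \<and>
     FObj F \<in> Obj X \<rightarrow>\<^sub>E Obj Y \<and> FArr F \<in> Arr X \<rightarrow>\<^sub>E Arr Y \<and>
     (\<forall>f\<in>Arr X. Dom Y (FArr F f) = FObj F (Dom X f) \<and> Cod Y (FArr F f) = FObj F (Cod X f)) \<and>
     (\<forall>a\<in>Obj X. FArr F (Ide X a) = Ide Y (FObj F a)) \<and>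
     (\<forall>f\<in>Arr X. \<forall>g\<in>Arr X. Cod X f = Dom X g \<longrightarrow>
        FArr F (Comp X g f) = Comp Y (FArr F g) (FArr F f))"

definition functor_id :: "('o, 'm) category \<Rightarrow> ('o, 'm, 'o, 'm) fmaps" where
  "functor_id X = \<lparr>FObj = (\<lambda>a\<in>Obj X. a), FArr = (\<lambda>f\<in>Arr X. f)\<rparr>"

text \<open>\<open>functor_comp X G F\<close> is the composite \<open>G \<circ> F\<close>, where \<open>X\<close> is the domain of \<open>F\<close>.\<close>

definition functor_comp ::
  "('o1, 'm1) category \<Rightarrow> ('o2, 'm2, 'o3, 'm3) fmaps \<Rightarrow> ('o1, 'm1, 'o2, 'm2) fmaps
     \<Rightarrow> ('o1, 'm1, 'o3, 'm3) fmaps" where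
  "functor_comp X G F =
     \<lparr>FObj = (\<lambda>a\<in>Obj X. FObj G (FObj F a)), FArr = (\<lambda>f\<in>Arr X. FArr G (FArr F f))\<rparr>"

definition is_nat ::
  "('o1, 'm1) category \<Rightarrow> ('o2, 'm2) category \<Rightarrow> ('o1, 'm1, 'o2, 'm2) fmaps
     \<Rightarrow> ('o1, 'm1, 'o2, 'm2) fmaps \<Rightarrow> ('o1 \<Rightarrow> 'm2) \<Rightarrow> bool" where
  "is_nat X Y F G \<alpha> \<longleftrightarrow>
     is_functor X Y F \<and> is_functor X Y G \<and> \<alpha> \<in> extensional (Obj X) \<and>
     (\<forall>a\<in>Obj X. \<alpha> a \<in> hom Y (FObj F a) (FObj G a)) \<and>
     (\<forall>f\<in>Arr X. Comp Y (\<alpha> (Cod X f)) (FArr F f) = Comp Y (FArr G f) (\<alpha> (Dom X f)))"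

definition nat_id ::
  "('o1, 'm1) category \<Rightarrow> ('o2, 'm2) category \<Rightarrow> ('o1, 'm1, 'o2, 'm2) fmaps \<Rightarrow> 'o1 \<Rightarrow> 'm2" where
  "nat_id X Y F = (\<lambda>a\<in>Obj X. Ide Y (FObj F a))"

definition vcomp ::
  "('o1, 'm1) category \<Rightarrow> ('o2, 'm2) category \<Rightarrow> ('o1 \<Rightarrow> 'm2) \<Rightarrow> ('o1 \<Rightarrow> 'm2) \<Rightarrow> 'o1 \<Rightarrow> 'm2" where
  "vcomp X Y \<beta> \<alpha> = (\<lambda>a\<in>Obj X. Comp Y (\<beta> a) (\<alpha> a))"

text \<open>Whiskerings: \<open>whisker_pre X \<alpha> T\<close> is \<open>\<alpha> T\<close> with \<open>X\<close> the domain of the functor \<open>T\<close>, and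
  \<open>whisker_post X H \<alpha>\<close> is \<open>H \<alpha>\<close> with \<open>X\<close> the domain of the functors related by \<open>\<alpha>\<close>.\<close>

definition whisker_pre ::
  "('o1, 'm1) category \<Rightarrow> ('o2 \<Rightarrow> 'm3) \<Rightarrow> ('o1, 'm1, 'o2, 'm2) fmaps \<Rightarrow> 'o1 \<Rightarrow> 'm3" where
  "whisker_pre X \<alpha> T = (\<lambda>a\<in>Obj X. \<alpha> (FObj T a))"

definition whisker_post ::
  "('o1, 'm1) category \<Rightarrow> ('o2, 'm2, 'o3, 'm3) fmaps \<Rightarrow> ('o1 \<Rightarrow> 'm2) \<Rightarrow> 'o1 \<Rightarrow> 'm3" where
  "whisker_post X H \<alpha> = (\<lambda>a\<in>Obj X. FArr H (\<alpha> a))"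

definition fully_faithful ::
  "('o1, 'm1) category \<Rightarrow> ('o2, 'm2) category \<Rightarrow> ('o1, 'm1, 'o2, 'm2) fmaps \<Rightarrow> bool" where
  "fully_faithful X Y F \<longleftrightarrow> is_functor X Y F \<and>
     (\<forall>a\<in>Obj X. \<forall>b\<in>Obj X. bij_betw (FArr F) (hom X a b) (hom Y (FObj F a) (FObj F b)))"

definition is_nat_iso ::
  "('o1, 'm1) category \<Rightarrow> ('o2, 'm2) category \<Rightarrow> ('o1, 'm1, 'o2, 'm2) fmaps
     \<Rightarrow> ('o1, 'm1, 'o2, 'm2) fmaps \<Rightarrow> ('o1 \<Rightarrow> 'm2) \<Rightarrow> bool" where
  "is_nat_iso X Y F G \<alpha> \<longleftrightarrow> is_nat X Y F G \<alpha> \<and> (\<forall>a\<in>Obj X. is_iso Y (\<alpha> a))"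

definition is_equivalence ::
  "('o1, 'm1) category \<Rightarrow> ('o2, 'm2) category \<Rightarrow> ('o1, 'm1, 'o2, 'm2) fmaps \<Rightarrow> bool" where
  "is_equivalence X Y F \<longleftrightarrow> is_functor X Y F \<and>
     (\<exists>G. is_functor Y X G \<and>
        (\<exists>\<eta>. is_nat_iso X X (functor_id X) (functor_comp X G F) \<eta>) \<and>
        (\<exists>\<epsilon>. is_nat_iso Y Y (functor_comp Y F G) (functor_id Y) \<epsilon>))"


section \<open>Functor categories, and the categories of small sets and of small categories\<close>

text \<open>Arrows are triples consisting of the domain, the underlying map(s) and the codomain.\<close>

definition CAT ::
  "('o1, 'm1) category \<Rightarrow> ('o2, 'm2) category \<Rightarrow>
   (('o1, 'm1, 'o2, 'm2) fmaps,
    ('o1, 'm1, 'o2, 'm2) fmaps \<times> ('o1 \<Rightarrow> 'm2) \<times> ('o1, 'm1, 'o2, 'm2) fmaps) category" where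
  "CAT X Y =
     \<lparr>Obj = {F. is_functor X Y F},
      Arr = {(F, \<alpha>, G). is_nat X Y F G \<alpha>},
      Dom = (\<lambda>(F, \<alpha>, G). F),
      Cod = (\<lambda>(F, \<alpha>, G). G),
      Ide = (\<lambda>F. (F, nat_id X Y F, F)),
      Comp = (\<lambda>(G', \<beta>, H) (F, \<alpha>, G). (F, vcomp X Y \<beta> \<alpha>, H))\<rparr>"

text \<open>For \<open>T : X \<rightarrow> Y\<close>, the functor \<open>CAT(T, Z) : CAT(Y, Z) \<rightarrow> CAT(X, Z)\<close>.\<close>

definition precomp ::
  "('o1, 'm1) category \<Rightarrow> ('o2, 'm2) category \<Rightarrow> ('o1, 'm1, 'o2, 'm2) fmaps
   \<Rightarrow> ('o3, 'm3) category \<Rightarrow>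
   (('o2, 'm2, 'o3, 'm3) fmaps,
    ('o2, 'm2, 'o3, 'm3) fmaps \<times> ('o2 \<Rightarrow> 'm3) \<times> ('o2, 'm2, 'o3, 'm3) fmaps,
    ('o1, 'm1, 'o3, 'm3) fmaps,
    ('o1, 'm1, 'o3, 'm3) fmaps \<times> ('o1 \<Rightarrow> 'm3) \<times> ('o1, 'm1, 'o3, 'm3) fmaps) fmaps" where
  "precomp X Y T Z =
     \<lparr>FObj = (\<lambda>F\<in>Obj (CAT Y Z). functor_comp X F T),
      FArr = (\<lambda>(F, \<alpha>, G)\<in>Arr (CAT Y Z). (functor_comp X F T, whisker_pre X \<alpha> T, functor_comp X G T))\<rparr>"

text \<open>
  \<open>SET TYPE('u)\<close> has as objects the small sets of elements of an arbitrary type \<open>'a\<close>. For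
  \<open>'a = 'u\<close> this is the category of small sets; other choices of \<open>'a\<close> are used only as codomains
  of hom-functors, whose values are sets of arrows and hence not sets of elements of \<open>'u\<close>.
\<close>

definition SET ::
  "'u itself \<Rightarrow> ('a set, 'a set \<times> ('a \<Rightarrow> 'a) \<times> 'a set) category" where
  "SET U =
     \<lparr>Obj = {A. small U A},
      Arr = {(A, f, B). small U A \<and> small U B \<and> f \<in> A \<rightarrow>\<^sub>E B},
      Dom = (\<lambda>(A, f, B). A),
      Cod = (\<lambda>(A, f, B). B),
      Ide = (\<lambda>A. (A, (\<lambda>x\<in>A. x), A)),
      Comp = (\<lambda>(B', g, D) (A, f, B). (A, (\<lambda>x\<in>A. g (f x)), D))\<rparr>"

abbreviation Set_cat :: "('u set, 'u set \<times> ('u \<Rightarrow> 'u) \<times> 'u set) category" where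
  "Set_cat \<equiv> SET TYPE('u)"

text \<open>
  Two records that agree on their carriers but not on irrelevant values (e.g. on the composite of
  a non-composable pair) are different, isomorphic objects of \<open>Cat\<close>. This changes \<open>Cat\<close> only up to
  equivalence.
\<close>

definition Cat ::
  "(('u, 'u) category,
    ('u, 'u) category \<times> ('u, 'u, 'u, 'u) fmaps \<times> ('u, 'u) category) category" where
  "Cat =
     \<lparr>Obj = {X. small_category X},
      Arr = {(X, F, Y). small_category X \<and> small_category Y \<and> is_functor X Y F},
      Dom = (\<lambda>(X, F, Y). X),
      Cod = (\<lambda>(X, F, Y). Y),
      Ide = (\<lambda>X. (X, functor_id X, X)),
      Comp = (\<lambda>(Y', G, Z) (X, F, Y). (X, functor_comp X G F, Z))\<rparr>"

text \<open>
  The test categories \<open>Z\<close> range over all small categories. \<open>X\<close> and \<open>Y\<close> may live on other types,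
  because Cauchy completions, taken as full subcategories of presheaf categories, are only
  essentially small.
\<close>

definition lax_epi ::
  "'u itself \<Rightarrow> ('o1, 'm1) category \<Rightarrow> ('o2, 'm2) category
     \<Rightarrow> ('o1, 'm1, 'o2, 'm2) fmaps \<Rightarrow> bool" where
  "lax_epi (_ :: 'u itself) X Y f \<longleftrightarrow> is_functor X Y f \<and>
     (\<forall>Z :: ('u, 'u) category. small_category Z \<longrightarrow>
        fully_faithful (CAT Y Z) (CAT X Z) (precomp X Y f Z))"


section \<open>Kernel pairs\<close>

text \<open>The categories \<open>E \<times>\<^sub>B E\<close> and \<open>E \<times>\<^sub>B E \<times>\<^sub>B E\<close> live on pairs and triples.\<close>

definition ker2 ::
  "('o, 'm) category \<Rightarrow> ('o, 'm, 'o2, 'm2) fmaps \<Rightarrow> ('o \<times> 'o, 'm \<times> 'm) category" where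
  "ker2 E p =
     \<lparr>Obj = {(a, b). a \<in> Obj E \<and> b \<in> Obj E \<and> FObj p a = FObj p b},
      Arr = {(f, g). f \<in> Arr E \<and> g \<in> Arr E \<and> FArr p f = FArr p g},
      Dom = (\<lambda>(f, g). (Dom E f, Dom E g)),
      Cod = (\<lambda>(f, g). (Cod E f, Cod E g)),
      Ide = (\<lambda>(a, b). (Ide E a, Ide E b)),
      Comp = (\<lambda>(f', g') (f, g). (Comp E f' f, Comp E g' g))\<rparr>"

definition ker3 ::
  "('o, 'm) category \<Rightarrow> ('o, 'm, 'o2, 'm2) fmaps
     \<Rightarrow> ('o \<times> 'o \<times> 'o, 'm \<times> 'm \<times> 'm) category" where
  "ker3 E p =
     \<lparr>Obj = {(a, b, c). a \<in> Obj E \<and> b \<in> Obj E \<and> c \<in> Obj E \<and>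
               FObj p a = FObj p b \<and> FObj p b = FObj p c},
      Arr = {(f, g, h). f \<in> Arr E \<and> g \<in> Arr E \<and> h \<in> Arr E \<and>
               FArr p f = FArr p g \<and> FArr p g = FArr p h},
      Dom = (\<lambda>(f, g, h). (Dom E f, Dom E g, Dom E h)),
      Cod = (\<lambda>(f, g, h). (Cod E f, Cod E g, Cod E h)),
      Ide = (\<lambda>(a, b, c). (Ide E a, Ide E b, Ide E c)),
      Comp = (\<lambda>(f', g', h') (f, g, h). (Comp E f' f, Comp E g' g, Comp E h' h))\<rparr>"

text \<open>A parametric map on tuples, restricted to a functor on the category \<open>X\<close>.\<close>

definition tuple_fun ::
  "('o1, 'm1) category \<Rightarrow> ('o1 \<Rightarrow> 'o2) \<Rightarrow> ('m1 \<Rightarrow> 'm2) \<Rightarrow> ('o1, 'm1, 'o2, 'm2) fmaps" where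
  "tuple_fun X f g = \<lparr>FObj = restrict f (Obj X), FArr = restrict g (Arr X)\<rparr>"

text \<open>\<open>dij\<close> is the projection from \<open>ker_(i+1)\<close> omitting the factor number \<open>j\<close>, from \<open>0\<close>.\<close>

definition d10 where "d10 E p = tuple_fun (ker2 E p) (\<lambda>(a, b). b) (\<lambda>(a, b). b)"
definition d11 where "d11 E p = tuple_fun (ker2 E p) (\<lambda>(a, b). a) (\<lambda>(a, b). a)"
definition d20 where "d20 E p = tuple_fun (ker3 E p) (\<lambda>(a, b, c). (b, c)) (\<lambda>(a, b, c). (b, c))"
definition d21 where "d21 E p = tuple_fun (ker3 E p) (\<lambda>(a, b, c). (a, c)) (\<lambda>(a, b, c). (a, c))"
definition d22 where "d22 E p = tuple_fun (ker3 E p) (\<lambda>(a, b, c). (a, b)) (\<lambda>(a, b, c). (a, b))"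
definition s00 :: "('o, 'm) category \<Rightarrow> ('o, 'm, 'o \<times> 'o, 'm \<times> 'm) fmaps" where
  "s00 E = tuple_fun E (\<lambda>a. (a, a)) (\<lambda>a. (a, a))"


section \<open>Descent\<close>

text \<open>
  The descent category of a diagram of categories
  \<open>D\<^sub>0, D\<^sub>1 : A0 \<rightarrow> A1\<close>, \<open>S\<^sub>0 : A1 \<rightarrow> A0\<close>, \<open>T\<^sub>0, T\<^sub>1, T\<^sub>2 : A1 \<rightarrow> A2\<close>.
\<close>

definition desc_data where
  "desc_data A0 A1 A2 D\<^sub>0 D\<^sub>1 S\<^sub>0 T\<^sub>0 T\<^sub>1 T\<^sub>2 =
     {(x, \<phi>). x \<in> Obj A0 \<and> \<phi> \<in> hom A1 (FObj D\<^sub>1 x) (FObj D\<^sub>0 x) \<and>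
        FArr S\<^sub>0 \<phi> = Ide A0 x \<and>
        Comp A2 (FArr T\<^sub>0 \<phi>) (FArr T\<^sub>2 \<phi>) = FArr T\<^sub>1 \<phi>}"

definition desc_category ::
  "('o0, 'm0) category \<Rightarrow> ('o1, 'm1) category \<Rightarrow> ('o2, 'm2) category \<Rightarrow>
   ('o0, 'm0, 'o1, 'm1) fmaps \<Rightarrow> ('o0, 'm0, 'o1, 'm1) fmaps \<Rightarrow> ('o1, 'm1, 'o0, 'm0) fmaps \<Rightarrow>
   ('o1, 'm1, 'o2, 'm2) fmaps \<Rightarrow> ('o1, 'm1, 'o2, 'm2) fmaps \<Rightarrow> ('o1, 'm1, 'o2, 'm2) fmaps \<Rightarrow>
   ('o0 \<times> 'm1, ('o0 \<times> 'm1) \<times> 'm0 \<times> ('o0 \<times> 'm1)) category" where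
  "desc_category A0 A1 A2 D\<^sub>0 D\<^sub>1 S\<^sub>0 T\<^sub>0 T\<^sub>1 T\<^sub>2 =
     \<lparr>Obj = desc_data A0 A1 A2 D\<^sub>0 D\<^sub>1 S\<^sub>0 T\<^sub>0 T\<^sub>1 T\<^sub>2,
      Arr = {((x, \<phi>), \<omega>, (y, \<psi>)).
               (x, \<phi>) \<in> desc_data A0 A1 A2 D\<^sub>0 D\<^sub>1 S\<^sub>0 T\<^sub>0 T\<^sub>1 T\<^sub>2 \<and>
               (y, \<psi>) \<in> desc_data A0 A1 A2 D\<^sub>0 D\<^sub>1 S\<^sub>0 T\<^sub>0 T\<^sub>1 T\<^sub>2 \<and>
               \<omega> \<in> hom A0 x y \<and>
               Comp A1 (FArr D\<^sub>0 \<omega>) \<phi> = Comp A1 \<psi> (FArr D\<^sub>1 \<omega>)},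
      Dom = (\<lambda>(u, \<omega>, v). u),
      Cod = (\<lambda>(u, \<omega>, v). v),
      Ide = (\<lambda>u. (u, Ide A0 (fst u), u)),
      Comp = (\<lambda>(v', \<omega>', w) (u, \<omega>, v). (u, Comp A0 \<omega>' \<omega>, w))\<rparr>"

text \<open>
  For \<open>P : AB \<rightarrow> A0\<close> with \<open>D\<^sub>0 P = D\<^sub>1 P\<close>, the functor from \<open>AB\<close> to the descent category with
  \<open>z \<mapsto> (P z, id)\<close> and \<open>\<omega> \<mapsto> P \<omega>\<close>.
\<close>

definition desc_comparison ::
  "('ob, 'mb) category \<Rightarrow> ('o1, 'm1) category \<Rightarrow> ('o0, 'm0, 'o1, 'm1) fmaps
   \<Rightarrow> ('ob, 'mb, 'o0, 'm0) fmaps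
   \<Rightarrow> ('ob, 'mb, 'o0 \<times> 'm1, ('o0 \<times> 'm1) \<times> 'm0 \<times> ('o0 \<times> 'm1)) fmaps" where
  "desc_comparison AB A1 D\<^sub>1 P =
     (let k = (\<lambda>z. (FObj P z, Ide A1 (FObj D\<^sub>1 (FObj P z)))) in
      \<lparr>FObj = (\<lambda>z\<in>Obj AB. k z),
       FArr = (\<lambda>\<omega>\<in>Arr AB. (k (Dom AB \<omega>), FArr P \<omega>, k (Cod AB \<omega>)))\<rparr>)"

text \<open>The case of the 2-functor \<open>G = CAT(-, Z)\<close> applied to the kernel pair of \<open>p : E \<rightarrow> B\<close>.\<close>

definition Desc where
  "Desc Z E p =
     desc_category (CAT E Z) (CAT (ker2 E p) Z) (CAT (ker3 E p) Z)
       (precomp (ker2 E p) E (d10 E p) Z)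
       (precomp (ker2 E p) E (d11 E p) Z)
       (precomp E (ker2 E p) (s00 E) Z)
       (precomp (ker3 E p) (ker2 E p) (d20 E p) Z)
       (precomp (ker3 E p) (ker2 E p) (d21 E p) Z)
       (precomp (ker3 E p) (ker2 E p) (d22 E p) Z)"

definition Desc_comparison where
  "Desc_comparison Z E B p =
     desc_comparison (CAT B Z) (CAT (ker2 E p) Z)
       (precomp (ker2 E p) E (d11 E p) Z) (precomp E B p Z)"

definition effective_descent where
  "effective_descent Z E B p \<longleftrightarrow>
     is_equivalence (CAT B Z) (Desc Z E p) (Desc_comparison Z E B p)"

definition descent where
  "descent Z E B p \<longleftrightarrow>
     fully_faithful (CAT B Z) (Desc Z E p) (Desc_comparison Z E B p)"


section \<open>Lax codescent categories\<close>

definition codesc_cocone ::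
  "('u, 'u) category \<Rightarrow> ('u, 'u, 'u, 'u) fmaps
   \<Rightarrow> ('u, 'u) category \<Rightarrow> ('u, 'u, 'u, 'u) fmaps \<Rightarrow> ('u \<times> 'u \<Rightarrow> 'u) \<Rightarrow> bool" where
  "codesc_cocone E p C q \<psi> \<longleftrightarrow>
     small_category C \<and> is_functor E C q \<and>
     is_nat (ker2 E p) C (functor_comp (ker2 E p) q (d11 E p)) (functor_comp (ker2 E p) q (d10 E p)) \<psi> \<and>
     whisker_pre E \<psi> (s00 E) = nat_id E C q \<and>
     vcomp (ker3 E p) C (whisker_pre (ker3 E p) \<psi> (d20 E p)) (whisker_pre (ker3 E p) \<psi> (d22 E p))
       = whisker_pre (ker3 E p) \<psi> (d21 E p)"

definition is_codesc ::
  "('u, 'u) category \<Rightarrow> ('u, 'u, 'u, 'u) fmaps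
   \<Rightarrow> ('u, 'u) category \<Rightarrow> ('u, 'u, 'u, 'u) fmaps \<Rightarrow> ('u \<times> 'u \<Rightarrow> 'u) \<Rightarrow> bool" where
  "is_codesc E p C q \<psi> \<longleftrightarrow>
     codesc_cocone E p C q \<psi> \<and>
     (\<forall>D q' \<psi>'. codesc_cocone E p D q' \<psi>' \<longrightarrow>
        (\<exists>!H. is_functor C D H \<and> functor_comp E H q = q' \<and> whisker_post (ker2 E p) H \<psi> = \<psi>')) \<and>
     (\<forall>(D :: ('u, 'u) category) H H' \<omega>.
        small_category D \<and> is_functor C D H \<and> is_functor C D H' \<and>
        is_nat E D (functor_comp E H q) (functor_comp E H' q) \<omega> \<and>
        vcomp (ker2 E p) D (whisker_pre (ker2 E p) \<omega> (d10 E p)) (whisker_post (ker2 E p) H \<psi>)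
          = vcomp (ker2 E p) D (whisker_post (ker2 E p) H' \<psi>) (whisker_pre (ker2 E p) \<omega> (d11 E p))
        \<longrightarrow> (\<exists>!\<Omega>. is_nat C D H H' \<Omega> \<and> whisker_pre E \<Omega> q = \<omega>))"

definition is_codesc_comparison ::
  "('u, 'u) category \<Rightarrow> ('u, 'u) category \<Rightarrow> ('u, 'u, 'u, 'u) fmaps
   \<Rightarrow> ('u, 'u) category \<Rightarrow> ('u, 'u, 'u, 'u) fmaps \<Rightarrow> ('u \<times> 'u \<Rightarrow> 'u)
   \<Rightarrow> ('u, 'u, 'u, 'u) fmaps \<Rightarrow> bool" where
  "is_codesc_comparison E B p C q \<psi> K \<longleftrightarrow>
     is_functor C B K \<and> functor_comp E K q = p \<and>
     whisker_post (ker2 E p) K \<psi> = nat_id (ker2 E p) B (functor_comp (ker2 E p) p (d11 E p))"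


section \<open>Cauchy completion\<close>

definition is_cocone where
  "is_cocone J A D L \<mu> \<longleftrightarrow>
     is_functor J A D \<and> L \<in> Obj A \<and> (\<forall>j\<in>Obj J. \<mu> j \<in> hom A (FObj D j) L) \<and>
     (\<forall>f\<in>Arr J. Comp A (\<mu> (Cod J f)) (FArr D f) = \<mu> (Dom J f))"

definition is_colimit where
  "is_colimit J A D L \<mu> \<longleftrightarrow>
     is_cocone J A D L \<mu> \<and>
     (\<forall>M \<nu>. is_cocone J A D M \<nu> \<longrightarrow>
        (\<exists>!h. h \<in> hom A L M \<and> (\<forall>j\<in>Obj J. Comp A h (\<mu> j) = \<nu> j)))"

definition preserves_small_colimits ::
  "'u itself \<Rightarrow> ('o1, 'm1) category \<Rightarrow> ('o2, 'm2) category
     \<Rightarrow> ('o1, 'm1, 'o2, 'm2) fmaps \<Rightarrow> bool" where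
  "preserves_small_colimits (_ :: 'u itself) A A' H \<longleftrightarrow>
     (\<forall>(J :: ('u, 'u) category) D L \<mu>.
        small_category J \<longrightarrow> is_colimit J A D L \<mu> \<longrightarrow>
        is_colimit J A' (functor_comp J H D) (FObj H L) (\<lambda>j. FArr H (\<mu> j)))"

text \<open>\<open>Hom(P, -)\<close>, whose values are small sets of arrows when \<open>A\<close> is locally small.\<close>

definition hom_functor ::
  "('o, 'm) category \<Rightarrow> 'o \<Rightarrow> ('o, 'm, 'm set, 'm set \<times> ('m \<Rightarrow> 'm) \<times> 'm set) fmaps" where
  "hom_functor A P =
     \<lparr>FObj = (\<lambda>Q\<in>Obj A. hom A P Q),
      FArr = (\<lambda>f\<in>Arr A.
        (hom A P (Dom A f), (\<lambda>g\<in>hom A P (Dom A f). Comp A f g), hom A P (Cod A f)))\<rparr>"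

definition PSh where
  "PSh (X :: ('u, 'u) category) = CAT (op_cat X) (Set_cat :: ('u set, _) category)"

definition Cauchy where
  "Cauchy (X :: ('u, 'u) category) =
     full_subcat (PSh X)
       {P. preserves_small_colimits TYPE('u) (PSh X) (SET TYPE('u)) (hom_functor (PSh X) P)}"

text \<open>\<open>(Q, \<eta>)\<close> is a left Kan extension of \<open>P : X \<rightarrow> Z\<close> along \<open>T : X \<rightarrow> Y\<close>.\<close>

definition is_lan where
  "is_lan X Y Z T P Q \<eta> \<longleftrightarrow>
     is_functor Y Z Q \<and> is_nat X Z P (functor_comp X Q T) \<eta> \<and>
     (\<forall>R \<gamma>. is_functor Y Z R \<and> is_nat X Z P (functor_comp X R T) \<gamma> \<longrightarrow>
        (\<exists>!\<beta>. is_nat Y Z Q R \<beta> \<and> vcomp X Z (whisker_pre X \<beta> T) \<eta> = \<gamma>))"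

text \<open>A left Kan extension is determined up to isomorphism only; one is chosen for each functor.\<close>

definition lan where
  "lan X Y Z T P = (SOME (Q, \<eta>). is_lan X Y Z T P Q \<eta>)"

definition lan_obj where "lan_obj X Y Z T P = fst (lan X Y Z T P)"
definition lan_unit where "lan_unit X Y Z T P = snd (lan X Y Z T P)"

definition lan_nat where
  "lan_nat X Y Z T P P' \<alpha> =
     (THE \<beta>. is_nat Y Z (lan_obj X Y Z T P) (lan_obj X Y Z T P') \<beta> \<and>
        vcomp X Z (whisker_pre X \<beta> T) (lan_unit X Y Z T P)
          = vcomp X Z (lan_unit X Y Z T P') \<alpha>)"

text \<open>
  On underlying maps \<open>f\<^sup>o\<^sup>p\<close> is \<open>f\<close>, regarded as a functor \<open>op_cat X \<rightarrow> op_cat Y\<close>.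
\<close>

definition Cauchy_map where
  "Cauchy_map (X :: ('u, 'u) category) (Y :: ('u, 'u) category) f =
     \<lparr>FObj = (\<lambda>P\<in>Obj (Cauchy X). lan_obj (op_cat X) (op_cat Y) Set_cat f P),
      FArr = (\<lambda>(P, \<alpha>, P')\<in>Arr (Cauchy X).
        (lan_obj (op_cat X) (op_cat Y) Set_cat f P,
         lan_nat (op_cat X) (op_cat Y) Set_cat f P P' \<alpha>,
         lan_obj (op_cat X) (op_cat Y) Set_cat f P'))\<rparr>"


section \<open>Equivalence of a list of conditions\<close>

definition all_equivalent :: "bool list \<Rightarrow> bool" where
  "all_equivalent Ps \<longleftrightarrow> (\<forall>P\<in>set Ps. \<forall>Q\<in>set Ps. P \<longleftrightarrow> Q)"

end

theory Submission
  imports Defs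
begin

text \<open>
  \<open>Set\<close> and \<open>Cat\<close> are locally small, so functors from a small category into them, and descent data,
  live in small full subcategories. Hence the universal property of the lax codescent category \<open>C\<close>
  extends from small categories to \<open>Z = Set\<close> and \<open>Z = Cat\<close> and identifies \<open>CAT(C, Z)\<close> with the descent
  category; the comparison functor becomes restriction along \<open>K : C \<rightarrow> B\<close>.

  If restriction along \<open>K\<close> is fully faithful for \<open>Z = Set\<close>, then every object \<open>b\<close> of \<open>B\<close> is a retract of
  some \<open>K c\<close>: the subfunctor of \<open>B(b, -)\<close> of maps factoring through the image of \<open>K\<close> agrees with
  \<open>B(b, -)\<close> on that image. When \<open>K\<close> is moreover fully faithful, functors on \<open>C\<close> extend to \<open>B\<close> by splitting
  idempotents, which is possible in \<open>Set\<close> and in \<open>Cat\<close>. Conversely, if the representables of \<open>C\<close>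
  extend to \<open>B\<close>, the Yoneda lemma makes \<open>K\<close> fully faithful.

  The Cauchy completion consists of the retracts of representables: evaluation preserves colimits, and
  an object is the colimit of its elements, so that a colimit-preserving \<open>Hom(P, -)\<close> lifts the identity
  of \<open>P\<close> to a representable. The Yoneda embedding into it is thus again fully faithful with every object
  a retract of its image, and the conditions on \<open>K\<close> transfer to the functor between Cauchy completions.
\<close>


section \<open>Small sets\<close>

text \<open>Beyond size, types are an obstacle. The test categories in \<open>lax_epi\<close> and
  \<open>is_codesc\<close> are carried by \<open>'u\<close>, since HOL cannot quantify over types
  inside a formula, while small full subcategories of \<open>Set_cat\<close> and \<open>Cat\<close>
  live on other types. Hence the copies on \<open>'u\<close>, isomorphic rather than merely
  equivalent because the universal property of \<open>C\<close> is strict.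

  A Cauchy completion is closed under isomorphism among presheaves, so its objects need not form a
  small set and functors out of it need not have small image. This blocks testing a lax epimorphism
  between completions against \<open>Set_cat\<close> itself. It is tested instead against small full
  subcategories of sets closed under subsets: these split idempotents, which is what brings the
  property back to \<open>K\<close>.

  Properties of \<open>K\<close> are recovered from \<open>Cat\<close> through
  \<open>Set_cat\<close>: sets embed fully faithfully as discrete categories, with the functor of
  object sets as a strict retraction. Finally \<open>lan\<close> is an arbitrary choice, so the
  functor between completions commutes with the Yoneda embeddings only up to isomorphism, and every
  comparison with \<open>K\<close> has to be insensitive to that.\<close>

lemma small_lepoll:
  assumes "small TYPE('u) A" and "B \<lesssim> A"
  shows "small TYPE('u) B"
  using assms lesspoll_trans1 unfolding small_def by blast

lemma small_subset: "small TYPE('u) A \<Longrightarrow> B \<subseteq> A \<Longrightarrow> small TYPE('u) B"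
  by (rule small_lepoll) (auto intro: subset_imp_lepoll)

lemma small_image: "small TYPE('u) A \<Longrightarrow> small TYPE('u) (f ` A)"
  by (rule small_lepoll) (auto intro: image_lepoll)

lemma small_inj_image: "small TYPE('u) (f ` A) \<Longrightarrow> inj_on f A \<Longrightarrow> small TYPE('u) A"
  by (erule small_lepoll) (simp add: eqpoll_imp_lepoll eqpoll_sym inj_on_image_eqpoll_self)

lemma small_encoding:
  assumes "small TYPE('u) A"
  obtains f :: "'a \<Rightarrow> 'u" where "inj_on f A"
  using assms unfolding small_def lesspoll_def lepoll_def by blast

lemma infinite_universe:
  assumes "universe TYPE('u)"
  shows "infinite (UNIV :: 'u set)"
  using assms unfolding universe_def small_def by (meson infinite_le_lepoll lesspoll_imp_lepoll)

text \<open>An infinite cardinal equals its square. The injection lets pairs of codes be coded in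
  \<open>'u\<close> again.\<close>

lemma universe_pairing:
  assumes "universe TYPE('u)"
  obtains f :: "'u \<times> 'u \<Rightarrow> 'u" where "inj f"
proof -
  have "(UNIV :: 'u set) \<times> (UNIV :: 'u set) \<approx> (UNIV :: 'u set)"
    unfolding eqpoll_iff_card_of_ordIso
    by (rule card_of_Times_same_infinite[OF infinite_universe[OF assms]])
  then obtain f :: "'u \<times> 'u \<Rightarrow> 'u" where "bij_betw f (UNIV \<times> UNIV) UNIV"
    unfolding eqpoll_def by blast
  then show ?thesis using that[of f] by (simp add: bij_betw_def)
qed

text \<open>\<open>universe\<close> speaks only of unions of subsets of \<open>'u\<close> indexed by
  a subset of \<open>'u\<close>. Coding indices and elements injectively, and pairing the two codes
  to keep the fibres apart, embeds the sum in one such union.\<close>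

lemma small_Sigma:
  fixes I :: "'i set" and A :: "'i \<Rightarrow> 'a set"
  assumes u: "universe TYPE('u)" and I: "small TYPE('u) I"
    and A: "\<And>i. i \<in> I \<Longrightarrow> small TYPE('u) (A i)"
  shows "small TYPE('u) (Sigma I A)"
proof -
  obtain g :: "'i \<Rightarrow> 'u" where g: "inj_on g I" using small_encoding[OF I] by blast
  have "\<forall>i\<in>I. \<exists>f :: 'a \<Rightarrow> 'u. inj_on f (A i)"
    using A small_encoding by metis
  then obtain f :: "'i \<Rightarrow> 'a \<Rightarrow> 'u" where f: "\<And>i. i \<in> I \<Longrightarrow> inj_on (f i) (A i)" by metis
  obtain h :: "'u \<times> 'u \<Rightarrow> 'u" where h: "inj h" using universe_pairing[OF u] by blast
  \<comment> \<open>The fibres are indexed by codes \<open>k\<close> of indices, so each is decoded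
    first; the code \<open>k\<close> in the pair keeps fibres of different indices disjoint.\<close>
  define S where "S = (\<lambda>k. (\<lambda>x. h (k, f (inv_into I g k) x)) ` A (inv_into I g k))"
  have S: "small TYPE('u) (S k)" if "k \<in> g ` I" for k
    unfolding S_def by (rule small_image, rule A) (use that in \<open>simp add: inv_into_into\<close>)
  have U: "small TYPE('u) (\<Union>k\<in>g ` I. S k)"
    using u small_image[OF I, of g] S unfolding universe_def by blast
  have "inj_on (\<lambda>(i, x). h (g i, f i x)) (Sigma I A)"
    using inj_onD[OF g] inj_onD[OF f] by (intro inj_onI) (clarsimp simp: inj_eq[OF h], metis)
  moreover have "(\<lambda>(i, x). h (g i, f i x)) ` Sigma I A \<subseteq> (\<Union>k\<in>g ` I. S k)"
    using inv_into_f_f[OF g] by (auto simp: S_def)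
  ultimately show ?thesis using small_inj_image small_subset[OF U] by blast
qed

lemma small_UN:
  assumes "universe TYPE('u)" "small TYPE('u) I" "\<And>i. i \<in> I \<Longrightarrow> small TYPE('u) (A i)"
  shows "small TYPE('u) (\<Union>i\<in>I. A i)"
proof -
  have "(\<Union>i\<in>I. A i) = snd ` Sigma I A" by force
  then show ?thesis using small_image[OF small_Sigma[OF assms], where f = snd] by simp
qed

lemma small_Times:
  assumes "universe TYPE('u)" "small TYPE('u) A" "small TYPE('u) B"
  shows "small TYPE('u) (A \<times> B)"
  by (rule small_Sigma[OF assms(1,2)]) (use assms(3) in simp)

lemma small_finite:
  assumes "universe TYPE('u)" "finite A"
  shows "small TYPE('u) A"
  using finite_lesspoll_infinite[OF infinite_universe[OF assms(1)] assms(2)] by (simp add: small_def)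

lemma small_Un:
  assumes "universe TYPE('u)" "small TYPE('u) A" "small TYPE('u) B"
  shows "small TYPE('u) (A \<union> B)"
proof -
  have "A \<union> B = (\<Union>b\<in>(UNIV :: bool set). if b then A else B)" by (auto split: if_splits)
  moreover have "small TYPE('u) (\<Union>b\<in>(UNIV :: bool set). if b then A else B)"
    by (rule small_UN[OF assms(1) small_finite[OF assms(1)]]) (use assms(2,3) in simp_all)
  ultimately show ?thesis by (simp only:)
qed

lemma small_Pow:
  assumes u: "universe TYPE('u)" and A: "small TYPE('u) A"
  shows "small TYPE('u) (Pow A)"
proof -
  obtain f :: "_ \<Rightarrow> 'u" where f: "inj_on f A" using small_encoding[OF A] by blast
  have "small TYPE('u) (Pow (f ` A))"
    using u small_image[OF A] unfolding universe_def by blast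
  then show ?thesis
    using small_inj_image[OF _ inj_on_image_Pow[OF f]] image_Pow_surj[OF refl[of "f ` A"]] by simp
qed

text \<open>A function is determined by its graph, a subset of the sum of the family, so function
  sets embed in a power set of a small set.\<close>

lemma small_PiE:
  assumes u: "universe TYPE('u)" and I: "small TYPE('u) I"
    and A: "\<And>i. i \<in> I \<Longrightarrow> small TYPE('u) (A i)"
  shows "small TYPE('u) (PiE I A)"
proof -
  have "small TYPE('u) (Pow (Sigma I A))"
    by (intro small_Pow small_Sigma u I A)
  moreover have "(\<lambda>f. {(i, f i) | i. i \<in> I}) ` PiE I A \<subseteq> Pow (Sigma I A)"
    by (auto simp: PiE_def)
  moreover have "inj_on (\<lambda>f. {(i, f i) | i. i \<in> I}) (PiE I A)"
    by (rule inj_onI, rule PiE_ext) (auto simp: set_eq_iff)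
  ultimately show ?thesis using small_inj_image small_subset by blast
qed


section \<open>Categories and functors in terms of hom-sets\<close>

lemma homD:
  assumes "f \<in> hom C a b"
  shows "f \<in> Arr C" "Dom C f = a" "Cod C f = b"
  using assms by (simp_all add: hom_def)

lemma Arr_hom: "f \<in> Arr C \<Longrightarrow> f \<in> hom C (Dom C f) (Cod C f)"
  by (simp add: hom_def)

text \<open>The definition states composability as an equation between \<open>Cod\<close> and
  \<open>Dom\<close>. Arrows with named end points let the axioms apply by unification, and this
  form is used almost throughout.\<close>

lemma is_categoryI:
  assumes "\<And>f a b. f \<in> hom C a b \<Longrightarrow> a \<in> Obj C \<and> b \<in> Obj C"
    and "\<And>a. a \<in> Obj C \<Longrightarrow> Ide C a \<in> hom C a a"
    and "\<And>f g a b c. f \<in> hom C a b \<Longrightarrow> g \<in> hom C b c \<Longrightarrow> Comp C g f \<in> hom C a c"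
    and "\<And>f a b. f \<in> hom C a b \<Longrightarrow> Comp C f (Ide C a) = f"
    and "\<And>f a b. f \<in> hom C a b \<Longrightarrow> Comp C (Ide C b) f = f"
    and "\<And>f g h a b c d. f \<in> hom C a b \<Longrightarrow> g \<in> hom C b c \<Longrightarrow> h \<in> hom C c d \<Longrightarrow>
           Comp C h (Comp C g f) = Comp C (Comp C h g) f"
  shows "is_category C"
  unfolding is_category_def
proof (intro conjI ballI impI)
  fix f assume f: "f \<in> Arr C"
  show "Dom C f \<in> Obj C" "Cod C f \<in> Obj C"
    "Comp C f (Ide C (Dom C f)) = f" "Comp C (Ide C (Cod C f)) f = f"
    using assms(1,4,5)[OF Arr_hom[OF f]] by auto
  fix g assume g: "g \<in> Arr C" and fg: "Cod C f = Dom C g"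
  have f': "f \<in> hom C (Dom C f) (Dom C g)" using Arr_hom[OF f] fg by simp
  show "Comp C g f \<in> hom C (Dom C f) (Cod C g)" by (rule assms(3)[OF f' Arr_hom[OF g]])
  fix h assume h: "h \<in> Arr C" and gh: "Cod C g = Dom C h"
  have g': "g \<in> hom C (Dom C g) (Dom C h)" using Arr_hom[OF g] gh by simp
  show "Comp C h (Comp C g f) = Comp C (Comp C h g) f" by (rule assms(6)[OF f' g' Arr_hom[OF h]])
qed (rule assms(2))

lemma hom_Obj:
  assumes "is_category C" "f \<in> hom C a b"
  shows "a \<in> Obj C" "b \<in> Obj C"
  using assms unfolding is_category_def hom_def by auto

lemma Ide_hom: "is_category C \<Longrightarrow> a \<in> Obj C \<Longrightarrow> Ide C a \<in> hom C a a"
  unfolding is_category_def by blast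

lemma Comp_hom:
  "is_category C \<Longrightarrow> f \<in> hom C a b \<Longrightarrow> g \<in> hom C b c \<Longrightarrow> Comp C g f \<in> hom C a c"
  unfolding is_category_def hom_def by auto

lemma Comp_Ide_right: "is_category C \<Longrightarrow> f \<in> hom C a b \<Longrightarrow> Comp C f (Ide C a) = f"
  unfolding is_category_def hom_def by auto

lemma Comp_Ide_left: "is_category C \<Longrightarrow> f \<in> hom C a b \<Longrightarrow> Comp C (Ide C b) f = f"
  unfolding is_category_def hom_def by auto

lemma Comp_assoc:
  "is_category C \<Longrightarrow> f \<in> hom C a b \<Longrightarrow> g \<in> hom C b c \<Longrightarrow> h \<in> hom C c d \<Longrightarrow>
     Comp C (Comp C h g) f = Comp C h (Comp C g f)"
  unfolding is_category_def hom_def by auto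

section \<open>Functors\<close>

lemma is_functorI:
  assumes "is_category X" "is_category Y"
    and "FObj F \<in> extensional (Obj X)" "FArr F \<in> extensional (Arr X)"
    and "\<And>a. a \<in> Obj X \<Longrightarrow> FObj F a \<in> Obj Y"
    and "\<And>f a b. f \<in> hom X a b \<Longrightarrow> FArr F f \<in> hom Y (FObj F a) (FObj F b)"
    and "\<And>a. a \<in> Obj X \<Longrightarrow> FArr F (Ide X a) = Ide Y (FObj F a)"
    and "\<And>f g a b c. f \<in> hom X a b \<Longrightarrow> g \<in> hom X b c \<Longrightarrow>
           FArr F (Comp X g f) = Comp Y (FArr F g) (FArr F f)"
  shows "is_functor X Y F"
  unfolding is_functor_def
proof (intro conjI ballI impI)
  show "FObj F \<in> Obj X \<rightarrow>\<^sub>E Obj Y" using assms(3,5) by (auto simp: PiE_def)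
  show "FArr F \<in> Arr X \<rightarrow>\<^sub>E Arr Y"
    using assms(4) assms(6)[OF Arr_hom] by (auto simp: PiE_def dest: homD(1))
  fix f assume f: "f \<in> Arr X"
  show "Dom Y (FArr F f) = FObj F (Dom X f)" "Cod Y (FArr F f) = FObj F (Cod X f)"
    using assms(6)[OF Arr_hom[OF f]] by (simp_all add: homD)
  fix g assume g: "g \<in> Arr X" and fg: "Cod X f = Dom X g"
  have "f \<in> hom X (Dom X f) (Dom X g)" using Arr_hom[OF f] fg by simp
  then show "FArr F (Comp X g f) = Comp Y (FArr F g) (FArr F f)" by (rule assms(8)[OF _ Arr_hom[OF g]])
qed (use assms(1,2,7) in auto)

lemma functor_cats:
  assumes "is_functor X Y F"
  shows "is_category X" "is_category Y"
  using assms by (simp_all add: is_functor_def)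

lemma functor_ext:
  assumes "is_functor X Y F"
  shows "FObj F \<in> extensional (Obj X)" "FArr F \<in> extensional (Arr X)"
  using assms by (auto simp: is_functor_def PiE_def)

lemma functor_Obj: "is_functor X Y F \<Longrightarrow> a \<in> Obj X \<Longrightarrow> FObj F a \<in> Obj Y"
  by (auto simp: is_functor_def)

lemma functor_hom:
  "is_functor X Y F \<Longrightarrow> f \<in> hom X a b \<Longrightarrow> FArr F f \<in> hom Y (FObj F a) (FObj F b)"
  by (auto simp: is_functor_def hom_def)

lemma functor_Arr: "is_functor X Y F \<Longrightarrow> f \<in> Arr X \<Longrightarrow> FArr F f \<in> Arr Y"
  by (auto simp: is_functor_def)

lemma functor_Ide: "is_functor X Y F \<Longrightarrow> a \<in> Obj X \<Longrightarrow> FArr F (Ide X a) = Ide Y (FObj F a)"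
  by (auto simp: is_functor_def)

lemma functor_Comp:
  "is_functor X Y F \<Longrightarrow> f \<in> hom X a b \<Longrightarrow> g \<in> hom X b c \<Longrightarrow>
     FArr F (Comp X g f) = Comp Y (FArr F g) (FArr F f)"
  by (auto simp: is_functor_def hom_def)

lemma functor_eqI:
  fixes F G :: "('o1, 'm1, 'o2, 'm2) fmaps"
  assumes "FObj F \<in> extensional (Obj X)" "FArr F \<in> extensional (Arr X)"
    and "FObj G \<in> extensional (Obj X)" "FArr G \<in> extensional (Arr X)"
    and "\<And>a. a \<in> Obj X \<Longrightarrow> FObj F a = FObj G a" "\<And>f. f \<in> Arr X \<Longrightarrow> FArr F f = FArr G f"
  shows "F = G"
  using extensionalityI[OF assms(1,3,5)] extensionalityI[OF assms(2,4,6)]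
  by (cases F; cases G) auto

lemma functor_id_simps:
  "a \<in> Obj X \<Longrightarrow> FObj (functor_id X) a = a"
  "f \<in> Arr X \<Longrightarrow> FArr (functor_id X) f = f"
  "f \<in> hom X a b \<Longrightarrow> FArr (functor_id X) f = f"
  "FObj (functor_id X) \<in> extensional (Obj X)"
  "FArr (functor_id X) \<in> extensional (Arr X)"
  by (auto simp: functor_id_def homD)

lemma functor_id: "is_category X \<Longrightarrow> is_functor X X (functor_id X)"
proof (rule is_functorI)
  fix f g a b c assume X: "is_category X" and fg: "f \<in> hom X a b" "g \<in> hom X b c"
  show "FArr (functor_id X) (Comp X g f) = Comp X (FArr (functor_id X) g) (FArr (functor_id X) f)"
    using homD(1)[OF Comp_hom[OF X fg]] fg by (simp add: functor_id_simps)
qed (auto simp: functor_id_simps homD hom_Obj Ide_hom dest: homD(1)[OF Ide_hom])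

lemma functor_comp_simps:
  "a \<in> Obj X \<Longrightarrow> FObj (functor_comp X G F) a = FObj G (FObj F a)"
  "f \<in> Arr X \<Longrightarrow> FArr (functor_comp X G F) f = FArr G (FArr F f)"
  "f \<in> hom X a b \<Longrightarrow> FArr (functor_comp X G F) f = FArr G (FArr F f)"
  "FObj (functor_comp X G F) \<in> extensional (Obj X)"
  "FArr (functor_comp X G F) \<in> extensional (Arr X)"
  by (auto simp: functor_comp_def homD)

lemma functor_comp:
  assumes F: "is_functor X Y F" and G: "is_functor Y Z G"
  shows "is_functor X Z (functor_comp X G F)"
proof (rule is_functorI)
  fix f g a b c assume fg: "f \<in> hom X a b" "g \<in> hom X b c"
  note X = functor_cats(1)[OF F]
  show "FArr (functor_comp X G F) (Comp X g f)
      = Comp Z (FArr (functor_comp X G F) g) (FArr (functor_comp X G F) f)"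
    using Comp_hom[OF X fg] fg functor_Comp[OF F fg]
      functor_Comp[OF G functor_hom[OF F fg(1)] functor_hom[OF F fg(2)]]
    by (simp add: functor_comp_simps)
next
  fix f a b assume f: "f \<in> hom X a b"
  show "FArr (functor_comp X G F) f
      \<in> hom Z (FObj (functor_comp X G F) a) (FObj (functor_comp X G F) b)"
    using f hom_Obj[OF functor_cats(1)[OF F] f] functor_hom[OF G functor_hom[OF F f]]
    by (simp add: functor_comp_simps)
next
  fix a assume a: "a \<in> Obj X"
  show "FArr (functor_comp X G F) (Ide X a) = Ide Z (FObj (functor_comp X G F) a)"
    using a Ide_hom[OF functor_cats(1)[OF F] a] functor_Obj[OF F a]
    by (simp add: functor_comp_simps functor_Ide[OF F] functor_Ide[OF G])
qed (use F G in \<open>auto simp: functor_comp_simps functor_cats intro: functor_Obj\<close>)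

lemma functor_comp_assoc:
  assumes F: "is_functor X Y F"
  shows "functor_comp X (functor_comp Y H G) F = functor_comp X H (functor_comp X G F)"
proof -
  show ?thesis
    by (auto simp: functor_comp_def functor_Obj[OF F] functor_Arr[OF F])
qed

lemma functor_comp_id:
  assumes "is_functor X Y F"
  shows "functor_comp X F (functor_id X) = F" "functor_comp X (functor_id Y) F = F"
  by (rule functor_eqI[of _ X];
      use assms functor_ext[OF assms] functor_Arr[OF assms] functor_Obj[OF assms] in
      \<open>auto simp: functor_comp_simps functor_id_simps\<close>)+

section \<open>Natural transformations\<close>

lemma is_natI:
  assumes "is_functor X Y F" "is_functor X Y G" "\<alpha> \<in> extensional (Obj X)"
    and "\<And>a. a \<in> Obj X \<Longrightarrow> \<alpha> a \<in> hom Y (FObj F a) (FObj G a)"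
    and "\<And>f a b. f \<in> hom X a b \<Longrightarrow> Comp Y (\<alpha> b) (FArr F f) = Comp Y (FArr G f) (\<alpha> a)"
  shows "is_nat X Y F G \<alpha>"
  unfolding is_nat_def using assms(1-4) assms(5)[OF Arr_hom] by auto

lemma nat_functors:
  assumes "is_nat X Y F G \<alpha>"
  shows "is_functor X Y F" "is_functor X Y G" "is_category X" "is_category Y"
  using assms by (auto simp: is_nat_def is_functor_def)

lemma nat_ext: "is_nat X Y F G \<alpha> \<Longrightarrow> \<alpha> \<in> extensional (Obj X)"
  by (simp add: is_nat_def)

lemma nat_hom: "is_nat X Y F G \<alpha> \<Longrightarrow> a \<in> Obj X \<Longrightarrow> \<alpha> a \<in> hom Y (FObj F a) (FObj G a)"
  by (simp add: is_nat_def)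

lemma nat_comm:
  "is_nat X Y F G \<alpha> \<Longrightarrow> f \<in> hom X a b \<Longrightarrow>
     Comp Y (\<alpha> b) (FArr F f) = Comp Y (FArr G f) (\<alpha> a)"
  by (auto simp: is_nat_def hom_def)

lemma nat_eqI:
  "is_nat X Y F G \<alpha> \<Longrightarrow> is_nat X Y F' G' \<beta> \<Longrightarrow> (\<And>a. a \<in> Obj X \<Longrightarrow> \<alpha> a = \<beta> a) \<Longrightarrow> \<alpha> = \<beta>"
  by (meson extensionalityI nat_ext)

section \<open>Opposite categories, full subcategories, isomorphisms\<close>

lemma op_cat_simps [simp]:
  "Obj (op_cat C) = Obj C" "Arr (op_cat C) = Arr C" "Dom (op_cat C) = Cod C"
  "Cod (op_cat C) = Dom C" "Ide (op_cat C) = Ide C" "Comp (op_cat C) g f = Comp C f g"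
  "hom (op_cat C) a b = hom C b a"
  by (auto simp: op_cat_def hom_def)

lemma op_cat_category: "is_category C \<Longrightarrow> is_category (op_cat C)"
  by (rule is_categoryI) (auto simp: Comp_hom hom_Obj Ide_hom Comp_assoc Comp_Ide_left Comp_Ide_right)

lemma op_cat_functor:
  assumes "is_functor X Y F"
  shows "is_functor (op_cat X) (op_cat Y) F"
  by (rule is_functorI)
    (use assms in \<open>auto simp: functor_cats op_cat_category functor_ext functor_Obj functor_Ide
      intro: functor_hom functor_Comp\<close>)

lemma full_subcat_simps [simp]:
  "Obj (full_subcat C S) = Obj C \<inter> S" "Dom (full_subcat C S) = Dom C"
  "Cod (full_subcat C S) = Cod C" "Ide (full_subcat C S) = Ide C"
  "Comp (full_subcat C S) = Comp C"
  by (auto simp: full_subcat_def)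

lemma full_subcat_hom: "f \<in> hom (full_subcat C S) a b \<longleftrightarrow> f \<in> hom C a b \<and> a \<in> S \<and> b \<in> S"
  by (auto simp: full_subcat_def hom_def)

lemma full_subcat_category: "is_category C \<Longrightarrow> is_category (full_subcat C S)"
  by (rule is_categoryI) (auto simp: full_subcat_hom Comp_hom hom_Obj Ide_hom Comp_assoc Comp_Ide_left Comp_Ide_right)

lemma isoI:
  assumes "f \<in> hom C a b" "g \<in> hom C b a" "Comp C g f = Ide C a" "Comp C f g = Ide C b"
  shows "is_iso C f"
  using assms unfolding is_iso_def hom_def by auto

lemma isoE:
  assumes "is_iso C f" "f \<in> hom C a b"
  obtains g where "g \<in> hom C b a" "Comp C g f = Ide C a" "Comp C f g = Ide C b"
  using assms unfolding is_iso_def hom_def by auto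


section \<open>Fully faithful functors, retracts and equivalences\<close>

lemma Arr_Comp:
  assumes "is_category C" "f \<in> Arr C" "g \<in> Arr C" "Cod C f = Dom C g"
  shows "Comp C g f \<in> Arr C" "Dom C (Comp C g f) = Dom C f" "Cod C (Comp C g f) = Cod C g"
  using assms Comp_hom[OF assms(1), of f "Dom C f" "Dom C g" g] by (auto simp: hom_def)

lemma Arr_assoc:
  assumes "is_category C" "f \<in> Arr C" "g \<in> Arr C" "h \<in> Arr C"
    "Cod C f = Dom C g" "Cod C g = Dom C h"
  shows "Comp C (Comp C h g) f = Comp C h (Comp C g f)"
  using Comp_assoc[OF assms(1), of f "Dom C f" "Dom C g" g "Dom C h" h "Cod C h"] assms
  by (auto simp: hom_def)

lemma Arr_Ide:
  assumes "is_category C" "f \<in> Arr C"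
  shows "Dom C f = a \<Longrightarrow> Comp C f (Ide C a) = f" "Cod C f = b \<Longrightarrow> Comp C (Ide C b) f = f"
  using assms unfolding is_category_def by auto

text \<open>As rewrite rules these bring composites to right-associated form. The side conditions
  are solved from the \<open>homD\<close> facts of the factors, so long composites are rebracketed
  in one simplifier call.\<close>

lemmas Arr_rules = Arr_Comp Arr_assoc Arr_Ide

text \<open>Together with its mirror image below, this carries most computations with retracts and
  with inverse arrows.\<close>

lemma section_cancel:
  assumes C: "is_category C" and s: "s \<in> hom C a b" and r: "r \<in> hom C b a"
    and rs: "Comp C r s = Ide C a" and f: "f \<in> hom C x a"
  shows "Comp C r (Comp C s f) = f"
  using Comp_assoc[OF C f s r] rs Comp_Ide_left[OF C f] by simp

lemma section_cancel':
  assumes C: "is_category C" and s: "s \<in> hom C a b" and r: "r \<in> hom C b a"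
    and rs: "Comp C r s = Ide C a" and f: "f \<in> hom C a x"
  shows "Comp C (Comp C f r) s = f"
  using Comp_assoc[OF C s r f] rs Comp_Ide_right[OF C f] by simp

lemma iso_cancel_left:
  assumes C: "is_category C" and i: "is_iso C i" "i \<in> hom C b c"
    and f: "f \<in> hom C a b" "g \<in> hom C a b" "Comp C i f = Comp C i g"
  shows "f = g"
proof -
  obtain j where j: "j \<in> hom C c b" "Comp C j i = Ide C b" using isoE[OF i] by blast
  show ?thesis using arg_cong[OF f(3), of "Comp C j"]
    by (simp add: section_cancel[OF C i(2) j f(1)] section_cancel[OF C i(2) j f(2)])
qed

lemma iso_cancel_right:
  assumes C: "is_category C" and i: "is_iso C i" "i \<in> hom C a b"
    and f: "f \<in> hom C b c" "g \<in> hom C b c" "Comp C f i = Comp C g i"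
  shows "f = g"
proof -
  obtain j where j: "j \<in> hom C b a" "Comp C i j = Ide C b" using isoE[OF i] by blast
  show ?thesis using arg_cong[OF f(3), of "\<lambda>k. Comp C k j"]
    by (simp add: section_cancel'[OF C j(1) i(2) j(2) f(1)] section_cancel'[OF C j(1) i(2) j(2) f(2)])
qed

lemma iso_Ide: "is_category C \<Longrightarrow> a \<in> Obj C \<Longrightarrow> is_iso C (Ide C a)"
  by (rule isoI[OF Ide_hom Ide_hom]) (auto intro: Comp_Ide_left Ide_hom)

lemma iso_Comp:
  assumes C: "is_category C" and f: "f \<in> hom C a b" "is_iso C f" and g: "g \<in> hom C b c" "is_iso C g"
  shows "is_iso C (Comp C g f)"
proof -
  obtain f' where f': "f' \<in> hom C b a" "Comp C f' f = Ide C a" "Comp C f f' = Ide C b"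
    using isoE[OF f(2,1)] by blast
  obtain g' where g': "g' \<in> hom C c b" "Comp C g' g = Ide C b" "Comp C g g' = Ide C c"
    using isoE[OF g(2,1)] by blast
  show ?thesis
  proof (rule isoI[OF Comp_hom[OF C f(1) g(1)] Comp_hom[OF C g'(1) f'(1)]])
    show "Comp C (Comp C f' g') (Comp C g f) = Ide C a"
      using section_cancel[OF C g(1) g'(1,2) f(1)] Comp_assoc[OF C Comp_hom[OF C f(1) g(1)] g'(1) f'(1)] f'
      by simp
    show "Comp C (Comp C g f) (Comp C f' g') = Ide C c"
      using section_cancel[OF C f'(1) f(1) f'(3) g'(1)]
        Comp_assoc[OF C Comp_hom[OF C g'(1) f'(1)] f(1) g(1)] g' by simp
  qed
qed

lemma functor_iso:
  assumes F: "is_functor X Y F" and f: "f \<in> hom X a b" "is_iso X f"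
  shows "is_iso Y (FArr F f)"
proof -
  obtain g where g: "g \<in> hom X b a" "Comp X g f = Ide X a" "Comp X f g = Ide X b"
    using isoE[OF f(2,1)] by blast
  have "a \<in> Obj X" "b \<in> Obj X" using hom_Obj[OF functor_cats(1)[OF F] f(1)] by auto
  then show ?thesis
    by (intro isoI[OF functor_hom[OF F f(1)] functor_hom[OF F g(1)]])
      (simp_all add: g functor_Ide[OF F] flip: functor_Comp[OF F f(1) g(1)] functor_Comp[OF F g(1) f(1)])
qed

section \<open>Retracts\<close>

definition retract :: "('o, 'm) category \<Rightarrow> 'o \<Rightarrow> 'o \<Rightarrow> bool" where
  "retract C a b \<longleftrightarrow> (\<exists>s\<in>hom C a b. \<exists>r\<in>hom C b a. Comp C r s = Ide C a)"

definition ess_surj ::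
  "('o1, 'm1) category \<Rightarrow> ('o2, 'm2) category \<Rightarrow> ('o1, 'm1, 'o2, 'm2) fmaps \<Rightarrow> bool" where
  "ess_surj X Y F \<longleftrightarrow>
     is_functor X Y F \<and> (\<forall>b\<in>Obj Y. \<exists>a\<in>Obj X. \<exists>f\<in>hom Y (FObj F a) b. is_iso Y f)"

text \<open>The intrinsic form of "fully faithful lax epimorphism": no test category occurs in it,
  and all conditions of the effective case are compared with it.\<close>

definition retract_dense ::
  "('o1, 'm1) category \<Rightarrow> ('o2, 'm2) category \<Rightarrow> ('o1, 'm1, 'o2, 'm2) fmaps \<Rightarrow> bool" where
  "retract_dense X Y F \<longleftrightarrow>
     fully_faithful X Y F \<and> (\<forall>b\<in>Obj Y. \<exists>a\<in>Obj X. retract Y b (FObj F a))"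

lemma retract_trans:
  assumes C: "is_category C" and "retract C a b" "retract C b c"
  shows "retract C a c"
proof -
  obtain s r where s: "s \<in> hom C a b" "r \<in> hom C b a" "Comp C r s = Ide C a"
    using assms(2) unfolding retract_def by blast
  obtain s' r' where s': "s' \<in> hom C b c" "r' \<in> hom C c b" "Comp C r' s' = Ide C b"
    using assms(3) unfolding retract_def by blast
  have "Comp C (Comp C r r') (Comp C s' s) = Comp C r (Comp C r' (Comp C s' s))"
    by (rule Comp_assoc[OF C Comp_hom[OF C s(1) s'(1)] s'(2) s(2)])
  then have "Comp C (Comp C r r') (Comp C s' s) = Ide C a"
    using section_cancel[OF C s' s(1)] s(3) by simp
  then show ?thesis unfolding retract_def
    using Comp_hom[OF C s(1) s'(1)] Comp_hom[OF C s'(2) s(2)] by blast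
qed

lemma iso_retract:
  assumes "is_iso C f" "f \<in> hom C a b"
  shows "retract C b a" "retract C a b"
proof -
  obtain g where "g \<in> hom C b a" "Comp C g f = Ide C a" "Comp C f g = Ide C b"
    using isoE[OF assms] by blast
  then show "retract C b a" "retract C a b" using assms(2) unfolding retract_def by blast+
qed

lemma functor_retract:
  assumes F: "is_functor X Y F" and "retract X a b"
  shows "retract Y (FObj F a) (FObj F b)"
proof -
  obtain s r where s: "s \<in> hom X a b" "r \<in> hom X b a" "Comp X r s = Ide X a"
    using assms(2) unfolding retract_def by blast
  have "a \<in> Obj X" using hom_Obj[OF functor_cats(1)[OF F] s(1)] by auto
  then have "Comp Y (FArr F r) (FArr F s) = Ide Y (FObj F a)"
    using functor_Comp[OF F s(1,2)] s(3) functor_Ide[OF F] by simp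
  then show ?thesis
    using functor_hom[OF F s(1)] functor_hom[OF F s(2)] unfolding retract_def by blast
qed

section \<open>Fully faithful functors\<close>

lemma fully_faithfulI:
  assumes "is_functor X Y F"
    and "\<And>a b f g. f \<in> hom X a b \<Longrightarrow> g \<in> hom X a b \<Longrightarrow> FArr F f = FArr F g \<Longrightarrow> f = g"
    and "\<And>a b h. a \<in> Obj X \<Longrightarrow> b \<in> Obj X \<Longrightarrow> h \<in> hom Y (FObj F a) (FObj F b) \<Longrightarrow>
           \<exists>f\<in>hom X a b. FArr F f = h"
  shows "fully_faithful X Y F"
  unfolding fully_faithful_def bij_betw_def
proof (intro conjI ballI assms(1))
  fix a b assume ab: "a \<in> Obj X" "b \<in> Obj X"
  show "inj_on (FArr F) (hom X a b)" using assms(2) by (rule inj_onI)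
  show "FArr F ` hom X a b = hom Y (FObj F a) (FObj F b)"
    using functor_hom[OF assms(1)] assms(3)[OF ab] by blast
qed

lemma ff_functor: "fully_faithful X Y F \<Longrightarrow> is_functor X Y F"
  by (simp add: fully_faithful_def)

lemma ff_faithful:
  assumes F: "fully_faithful X Y F" and f: "f \<in> hom X a b" "g \<in> hom X a b" "FArr F f = FArr F g"
  shows "f = g"
proof -
  have "a \<in> Obj X" "b \<in> Obj X" using hom_Obj[OF functor_cats(1)[OF ff_functor[OF F]] f(1)] .
  then have "inj_on (FArr F) (hom X a b)" using F by (simp add: fully_faithful_def bij_betw_def)
  then show ?thesis using f by (simp add: inj_onD)
qed

lemma ff_full:
  assumes "fully_faithful X Y F" "a \<in> Obj X" "b \<in> Obj X" "h \<in> hom Y (FObj F a) (FObj F b)"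
  obtains f where "f \<in> hom X a b" "FArr F f = h"
proof -
  have "FArr F ` hom X a b = hom Y (FObj F a) (FObj F b)"
    using assms by (simp add: fully_faithful_def bij_betw_def)
  then have "h \<in> FArr F ` hom X a b" using assms(4) by simp
  then show ?thesis using that by blast
qed

lemma ff_reflects_section:
  assumes F: "fully_faithful X Y F" and f: "f \<in> hom X a b" and g: "g \<in> hom X b a"
    and "Comp Y (FArr F g) (FArr F f) = Ide Y (FObj F a)"
  shows "Comp X g f = Ide X a"
proof (rule ff_faithful[OF F])
  note F' = ff_functor[OF F]
  note X = functor_cats(1)[OF F']
  show "Comp X g f \<in> hom X a a" "Ide X a \<in> hom X a a"
    using Comp_hom[OF X f g] Ide_hom[OF X hom_Obj(1)[OF X f]] .
  show "FArr F (Comp X g f) = FArr F (Ide X a)"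
    using functor_Comp[OF F' f g] functor_Ide[OF F' hom_Obj(1)[OF X f]] assms(4) by simp
qed

lemma ff_reflects_retract:
  assumes F: "fully_faithful X Y F" and ab: "a \<in> Obj X" "b \<in> Obj X"
    and "retract Y (FObj F a) (FObj F b)"
  shows "retract X a b"
proof -
  obtain s r where s: "s \<in> hom Y (FObj F a) (FObj F b)" "r \<in> hom Y (FObj F b) (FObj F a)"
    "Comp Y r s = Ide Y (FObj F a)"
    using assms(4) unfolding retract_def by blast
  obtain s' where s': "s' \<in> hom X a b" "FArr F s' = s" using ff_full[OF F ab s(1)] by blast
  obtain r' where r': "r' \<in> hom X b a" "FArr F r' = r" using ff_full[OF F ab(2,1) s(2)] by blast
  show ?thesis using ff_reflects_section[OF F s'(1) r'(1)] s s' r' unfolding retract_def by blast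
qed

lemma ff_lifts_iso:
  assumes F: "fully_faithful X Y F" and ab: "a \<in> Obj X" "b \<in> Obj X"
    and h: "h \<in> hom Y (FObj F a) (FObj F b)" "is_iso Y h"
  obtains f where "f \<in> hom X a b" "FArr F f = h" "is_iso X f"
proof -
  obtain h' where h': "h' \<in> hom Y (FObj F b) (FObj F a)"
    "Comp Y h' h = Ide Y (FObj F a)" "Comp Y h h' = Ide Y (FObj F b)" using isoE[OF h(2,1)] by blast
  obtain f where f: "f \<in> hom X a b" "FArr F f = h" using ff_full[OF F ab h(1)] by blast
  obtain g where g: "g \<in> hom X b a" "FArr F g = h'" using ff_full[OF F ab(2,1) h'(1)] by blast
  have "is_iso X f"
    using isoI[OF f(1) g(1)] ff_reflects_section[OF F f(1) g(1)]
      ff_reflects_section[OF F g(1) f(1)] h' f g by simp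
  with that[OF f] show ?thesis .
qed

lemma ff_comp:
  assumes F: "fully_faithful X Y F" and G: "fully_faithful Y Z G"
  shows "fully_faithful X Z (functor_comp X G F)"
proof (rule fully_faithfulI)
  note F' = ff_functor[OF F]
  show "is_functor X Z (functor_comp X G F)" by (rule functor_comp[OF F' ff_functor[OF G]])
  fix a b
  show "f = g" if "f \<in> hom X a b" "g \<in> hom X a b"
    "FArr (functor_comp X G F) f = FArr (functor_comp X G F) g" for f g
    using that ff_faithful[OF F that(1,2)]
      ff_faithful[OF G functor_hom[OF F' that(1)] functor_hom[OF F' that(2)]]
    by (simp add: functor_comp_simps)
  fix h assume ab: "a \<in> Obj X" "b \<in> Obj X"
    and "h \<in> hom Z (FObj (functor_comp X G F) a) (FObj (functor_comp X G F) b)"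
  then have h: "h \<in> hom Z (FObj G (FObj F a)) (FObj G (FObj F b))" by (simp add: functor_comp_simps)
  obtain k where k: "k \<in> hom Y (FObj F a) (FObj F b)" "FArr G k = h"
    using ff_full[OF G functor_Obj[OF F' ab(1)] functor_Obj[OF F' ab(2)] h] by blast
  obtain f where "f \<in> hom X a b" "FArr F f = k" using ff_full[OF F ab k(1)] by blast
  then show "\<exists>f\<in>hom X a b. FArr (functor_comp X G F) f = h"
    using k by (auto simp: functor_comp_simps)
qed

lemma ff_cancel:
  assumes F: "is_functor X Y F" and G: "fully_faithful Y Z G"
    and GF: "fully_faithful X Z (functor_comp X G F)"
  shows "fully_faithful X Y F"
proof (rule fully_faithfulI[OF F])
  fix a b
  show "f = g" if "f \<in> hom X a b" "g \<in> hom X a b" "FArr F f = FArr F g" for f g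
    using that ff_faithful[OF GF that(1,2)] by (simp add: functor_comp_simps)
  fix h assume ab: "a \<in> Obj X" "b \<in> Obj X" and h: "h \<in> hom Y (FObj F a) (FObj F b)"
  have "FArr G h \<in> hom Z (FObj (functor_comp X G F) a) (FObj (functor_comp X G F) b)"
    using functor_hom[OF ff_functor[OF G] h] ab by (simp add: functor_comp_simps)
  then obtain f where f: "f \<in> hom X a b" "FArr (functor_comp X G F) f = FArr G h"
    using ff_full[OF GF ab] by blast
  then have "FArr F f = h"
    using ff_faithful[OF G functor_hom[OF F f(1)] h] by (simp add: functor_comp_simps)
  then show "\<exists>f\<in>hom X a b. FArr F f = h" using f by blast
qed

text \<open>Each object of \<open>Y\<close> is a retract of an object in the image of
  \<open>T\<close>, so each hom-set of \<open>Y\<close> is a retract of one between image objects.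
  There \<open>F T\<close> decides injectivity and surjectivity, and the retractions carry both
  back.\<close>

lemma ff_cancel_retract_dense:
  assumes T: "retract_dense X Y T" and F: "is_functor Y Z F"
    and FT: "fully_faithful X Z (functor_comp X F T)"
  shows "fully_faithful Y Z F"
proof (rule fully_faithfulI[OF F])
  have T': "fully_faithful X Y T" using T by (simp add: retract_dense_def)
  note TF = ff_functor[OF T']
  note Y = functor_cats(1)[OF F] and Z = functor_cats(2)[OF F]
  have dense: "\<exists>c s r. c \<in> Obj X \<and> s \<in> hom Y b (FObj T c) \<and> r \<in> hom Y (FObj T c) b \<and> Comp Y r s = Ide Y b"
    if "b \<in> Obj Y" for b
    using T that unfolding retract_dense_def retract_def by blast
  fix a b
  show "f = g" if f: "f \<in> hom Y a b" and g: "g \<in> hom Y a b" and fg: "FArr F f = FArr F g" for f g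
  proof -
    have ab: "a \<in> Obj Y" "b \<in> Obj Y" using hom_Obj[OF Y f] .
    obtain c s r where c: "c \<in> Obj X" "s \<in> hom Y a (FObj T c)" "r \<in> hom Y (FObj T c) a" "Comp Y r s = Ide Y a"
      using dense[OF ab(1)] by blast
    obtain c' s' r' where c': "c' \<in> Obj X" "s' \<in> hom Y b (FObj T c')" "r' \<in> hom Y (FObj T c') b" "Comp Y r' s' = Ide Y b"
      using dense[OF ab(2)] by blast
    have lift: "\<exists>k\<in>hom X c c'. FArr T k = Comp Y s' (Comp Y k' r)" if "k' \<in> hom Y a b" for k'
      using ff_full[OF T' c(1) c'(1) Comp_hom[OF Y Comp_hom[OF Y c(3) that] c'(2)]] by metis
    obtain k where k: "k \<in> hom X c c'" "FArr T k = Comp Y s' (Comp Y f r)" using lift[OF f] by blast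
    obtain l where l: "l \<in> hom X c c'" "FArr T l = Comp Y s' (Comp Y g r)" using lift[OF g] by blast
    have "FArr F (FArr T k) = FArr F (FArr T l)"
      using functor_Comp[OF F Comp_hom[OF Y c(3) f] c'(2)] functor_Comp[OF F c(3) f]
        functor_Comp[OF F Comp_hom[OF Y c(3) g] c'(2)] functor_Comp[OF F c(3) g] k l fg by simp
    then have "k = l"
      using ff_faithful[OF FT k(1) l(1)] k(1) l(1) by (simp add: functor_comp_simps)
    then have "Comp Y s' (Comp Y f r) = Comp Y s' (Comp Y g r)" using k l by simp
    then have "Comp Y f r = Comp Y g r"
      using arg_cong[of _ _ "Comp Y r'"] section_cancel[OF Y c'(2,3,4) Comp_hom[OF Y c(3) f]]
        section_cancel[OF Y c'(2,3,4) Comp_hom[OF Y c(3) g]] by metis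
    then have "Comp Y (Comp Y f r) s = Comp Y (Comp Y g r) s" by simp
    then show ?thesis
      by (simp only: section_cancel'[OF Y c(2,3,4) f] section_cancel'[OF Y c(2,3,4) g])
  qed
  fix h assume ab: "a \<in> Obj Y" "b \<in> Obj Y" and h: "h \<in> hom Z (FObj F a) (FObj F b)"
  obtain c s r where c: "c \<in> Obj X" "s \<in> hom Y a (FObj T c)" "r \<in> hom Y (FObj T c) a" "Comp Y r s = Ide Y a"
    using dense[OF ab(1)] by blast
  obtain c' s' r' where c': "c' \<in> Obj X" "s' \<in> hom Y b (FObj T c')" "r' \<in> hom Y (FObj T c') b" "Comp Y r' s' = Ide Y b"
    using dense[OF ab(2)] by blast
  note Fs = functor_hom[OF F c(2)] functor_hom[OF F c(3)] functor_hom[OF F c'(2)] functor_hom[OF F c'(3)]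
  have rs: "Comp Z (FArr F r) (FArr F s) = Ide Z (FObj F a)"
    using functor_Comp[OF F c(2,3)] c(4) functor_Ide[OF F ab(1)] by simp
  have rs': "Comp Z (FArr F r') (FArr F s') = Ide Z (FObj F b)"
    using functor_Comp[OF F c'(2,3)] c'(4) functor_Ide[OF F ab(2)] by simp
  have hr: "Comp Z h (FArr F r) \<in> hom Z (FObj F (FObj T c)) (FObj F b)" by (rule Comp_hom[OF Z Fs(2) h])
  \<comment> \<open>An arbitrary \<open>h\<close> is not covered by \<open>F T\<close>, but its
    conjugate by \<open>F s'\<close> and \<open>F r\<close> runs between image objects. The lift
    \<open>k\<close> of that conjugate is then compressed by \<open>r'\<close> and \<open>s\<close>
    to a lift of \<open>h\<close>.\<close>
  have shr: "Comp Z (FArr F s') (Comp Z h (FArr F r)) \<in> hom Z (FObj F (FObj T c)) (FObj F (FObj T c'))"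
    by (rule Comp_hom[OF Z hr Fs(3)])
  then obtain k where k: "k \<in> hom X c c'" "FArr F (FArr T k) = Comp Z (FArr F s') (Comp Z h (FArr F r))"
    using ff_full[OF FT c(1) c'(1)] c(1) c'(1) by (metis functor_comp_simps(1,3))
  have Tk: "FArr T k \<in> hom Y (FObj T c) (FObj T c')" by (rule functor_hom[OF TF k(1)])
  have "FArr F (Comp Y r' (Comp Y (FArr T k) s)) = Comp Z (FArr F r') (Comp Z (FArr F (FArr T k)) (FArr F s))"
    using functor_Comp[OF F Comp_hom[OF Y c(2) Tk] c'(3)] functor_Comp[OF F c(2) Tk] by simp
  also have "\<dots> = Comp Z (Comp Z (FArr F r') (FArr F (FArr T k))) (FArr F s)"
    using Comp_assoc[OF Z Fs(1) functor_hom[OF F Tk] Fs(4)] by simp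
  also have "\<dots> = Comp Z (Comp Z h (FArr F r)) (FArr F s)"
    using k section_cancel[OF Z Fs(3,4) rs' hr] by simp
  also have "\<dots> = h" by (rule section_cancel'[OF Z Fs(1,2) rs h])
  finally show "\<exists>f\<in>hom Y a b. FArr F f = h"
    using Comp_hom[OF Y Comp_hom[OF Y c(2) Tk] c'(3)] by blast
qed

section \<open>Natural isomorphisms\<close>

lemma nat_iso_nat: "is_nat_iso X Y F G \<alpha> \<Longrightarrow> is_nat X Y F G \<alpha>"
  by (simp add: is_nat_iso_def)

lemma nat_iso_iso: "is_nat_iso X Y F G \<alpha> \<Longrightarrow> a \<in> Obj X \<Longrightarrow> is_iso Y (\<alpha> a)"
  by (simp add: is_nat_iso_def)

lemma nat_iso_inverse:
  assumes \<alpha>: "is_nat_iso X Y F G \<alpha>"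
  obtains \<beta> where "is_nat_iso X Y G F \<beta>"
    "\<And>a. a \<in> Obj X \<Longrightarrow> Comp Y (\<beta> a) (\<alpha> a) = Ide Y (FObj F a)"
    "\<And>a. a \<in> Obj X \<Longrightarrow> Comp Y (\<alpha> a) (\<beta> a) = Ide Y (FObj G a)"
proof -
  note nat = nat_iso_nat[OF \<alpha>]
  note F = nat_functors(1)[OF nat] and G = nat_functors(2)[OF nat]
  note X = nat_functors(3)[OF nat] and Y = nat_functors(4)[OF nat]
  have "\<forall>a\<in>Obj X. \<exists>g. g \<in> hom Y (FObj G a) (FObj F a) \<and> Comp Y g (\<alpha> a) = Ide Y (FObj F a) \<and>
      Comp Y (\<alpha> a) g = Ide Y (FObj G a)"
    using isoE[OF nat_iso_iso[OF \<alpha>] nat_hom[OF nat]] by metis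
  then obtain g where g: "\<And>a. a \<in> Obj X \<Longrightarrow> g a \<in> hom Y (FObj G a) (FObj F a)"
    "\<And>a. a \<in> Obj X \<Longrightarrow> Comp Y (g a) (\<alpha> a) = Ide Y (FObj F a)"
    "\<And>a. a \<in> Obj X \<Longrightarrow> Comp Y (\<alpha> a) (g a) = Ide Y (FObj G a)" by metis
  have "is_nat X Y G F (restrict g (Obj X))"
  proof (rule is_natI[OF G F])
    fix f a b assume f: "f \<in> hom X a b"
    have ab: "a \<in> Obj X" "b \<in> Obj X" using hom_Obj[OF X f] .
    note Ff = functor_hom[OF F f] and Gf = functor_hom[OF G f]
    have "Comp Y (g b) (FArr G f) = Comp Y (g b) (Comp Y (Comp Y (FArr G f) (\<alpha> a)) (g a))"
      using section_cancel'[OF Y g(1)[OF ab(1)] nat_hom[OF nat ab(1)] g(3)[OF ab(1)] Gf] by simp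
    also have "\<dots> = Comp Y (g b) (Comp Y (\<alpha> b) (Comp Y (FArr F f) (g a)))"
      using nat_comm[OF nat f] Comp_assoc[OF Y g(1)[OF ab(1)] Ff nat_hom[OF nat ab(2)]] by simp
    also have "\<dots> = Comp Y (FArr F f) (g a)"
      by (rule section_cancel[OF Y nat_hom[OF nat ab(2)] g(1)[OF ab(2)] g(2)[OF ab(2)]
          Comp_hom[OF Y g(1)[OF ab(1)] Ff]])
    finally show "Comp Y (restrict g (Obj X) b) (FArr G f) = Comp Y (FArr F f) (restrict g (Obj X) a)"
      using ab by simp
  qed (use g in auto)
  moreover have "is_iso Y (restrict g (Obj X) a)" if a: "a \<in> Obj X" for a
    using isoI[OF g(1)[OF a] nat_hom[OF nat a] g(3)[OF a] g(2)[OF a]] a by simp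
  ultimately have "is_nat_iso X Y G F (restrict g (Obj X))" by (simp add: is_nat_iso_def)
  then show ?thesis using that g by simp
qed

lemma ff_iso:
  assumes \<theta>: "is_nat_iso X Y F G \<theta>" and F: "fully_faithful X Y F"
  shows "fully_faithful X Y G"
proof -
  note nat = nat_iso_nat[OF \<theta>]
  note G = nat_functors(2)[OF nat] and F' = ff_functor[OF F]
  note X = nat_functors(3)[OF nat] and Y = nat_functors(4)[OF nat]
  obtain \<beta> where \<beta>: "is_nat_iso X Y G F \<beta>"
    "\<And>a. a \<in> Obj X \<Longrightarrow> Comp Y (\<beta> a) (\<theta> a) = Ide Y (FObj F a)"
    "\<And>a. a \<in> Obj X \<Longrightarrow> Comp Y (\<theta> a) (\<beta> a) = Ide Y (FObj G a)"
    using nat_iso_inverse[OF \<theta>] by blast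
  note \<beta>n = nat_hom[OF nat_iso_nat[OF \<beta>(1)]]
  show ?thesis
  proof (rule fully_faithfulI[OF G])
    fix a b
    show "f = g" if f: "f \<in> hom X a b" and g: "g \<in> hom X a b" and "FArr G f = FArr G g" for f g
    proof -
      have ab: "a \<in> Obj X" "b \<in> Obj X" using hom_Obj[OF X f] .
      have "Comp Y (\<theta> b) (FArr F f) = Comp Y (\<theta> b) (FArr F g)"
        using nat_comm[OF nat f] nat_comm[OF nat g] that by simp
      then have "FArr F f = FArr F g"
        by (rule iso_cancel_left[OF Y nat_iso_iso[OF \<theta> ab(2)] nat_hom[OF nat ab(2)]
            functor_hom[OF F' f] functor_hom[OF F' g]])
      then show ?thesis by (rule ff_faithful[OF F f g])
    qed
    fix h assume ab: "a \<in> Obj X" "b \<in> Obj X" and h: "h \<in> hom Y (FObj G a) (FObj G b)"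
    note ht = Comp_hom[OF Y nat_hom[OF nat ab(1)] h]
    obtain f where f: "f \<in> hom X a b" "FArr F f = Comp Y (\<beta> b) (Comp Y h (\<theta> a))"
      using ff_full[OF F ab Comp_hom[OF Y ht \<beta>n[OF ab(2)]]] by blast
    have "Comp Y (FArr G f) (\<theta> a) = Comp Y h (\<theta> a)"
      using nat_comm[OF nat f(1)] f(2)
        section_cancel[OF Y \<beta>n[OF ab(2)] nat_hom[OF nat ab(2)] \<beta>(3)[OF ab(2)] ht] by simp
    then have "FArr G f = h"
      by (rule iso_cancel_right[OF Y nat_iso_iso[OF \<theta> ab(1)] nat_hom[OF nat ab(1)]
            functor_hom[OF G f(1)] h])
    then show "\<exists>f\<in>hom X a b. FArr G f = h" using f by blast
  qed
qed

lemma ff_iso_iff: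
  assumes \<theta>: "is_nat_iso X Y F G \<theta>"
  shows "fully_faithful X Y F \<longleftrightarrow> fully_faithful X Y G"
  using ff_iso[OF \<theta>] nat_iso_inverse[OF \<theta>] ff_iso by metis

section \<open>Essential surjectivity\<close>

lemma ess_surjI:
  assumes "is_functor X Y F" "\<And>b. b \<in> Obj Y \<Longrightarrow> \<exists>a\<in>Obj X. \<exists>f\<in>hom Y (FObj F a) b. is_iso Y f"
  shows "ess_surj X Y F"
  using assms by (simp add: ess_surj_def)

lemma ess_surj_comp:
  assumes F: "ess_surj X Y F" and G: "ess_surj Y Z G"
  shows "ess_surj X Z (functor_comp X G F)"
proof (rule ess_surjI)
  have F': "is_functor X Y F" and G': "is_functor Y Z G" using F G by (auto simp: ess_surj_def)
  show "is_functor X Z (functor_comp X G F)" by (rule functor_comp[OF F' G'])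
  fix c assume "c \<in> Obj Z"
  then obtain b g where b: "b \<in> Obj Y" "g \<in> hom Z (FObj G b) c" "is_iso Z g"
    using G unfolding ess_surj_def by blast
  then obtain a f where a: "a \<in> Obj X" "f \<in> hom Y (FObj F a) b" "is_iso Y f"
    using F unfolding ess_surj_def by blast
  note Gf = functor_hom[OF G' a(2)] functor_iso[OF G' a(2,3)]
  show "\<exists>a\<in>Obj X. \<exists>f\<in>hom Z (FObj (functor_comp X G F) a) c. is_iso Z f"
    using a(1) Comp_hom[OF functor_cats(2)[OF G'] Gf(1) b(2)]
      iso_Comp[OF functor_cats(2)[OF G'] Gf b(2,3)] by (metis functor_comp_simps(1))
qed

lemma ess_surj_cancel:
  assumes F: "is_functor X Y F" and G: "fully_faithful Y Z G"
    and GF: "ess_surj X Z (functor_comp X G F)"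
  shows "ess_surj X Y F"
proof (rule ess_surjI[OF F])
  fix b assume b: "b \<in> Obj Y"
  have "FObj G b \<in> Obj Z" by (rule functor_Obj[OF ff_functor[OF G] b])
  then obtain a f where a: "a \<in> Obj X" "f \<in> hom Z (FObj (functor_comp X G F) a) (FObj G b)" "is_iso Z f"
    using GF unfolding ess_surj_def by blast
  then have "f \<in> hom Z (FObj G (FObj F a)) (FObj G b)" by (simp add: functor_comp_simps)
  then obtain h where "h \<in> hom Y (FObj F a) b" "is_iso Y h"
    using ff_lifts_iso[OF G functor_Obj[OF F a(1)] b _ a(3)] by blast
  then show "\<exists>a\<in>Obj X. \<exists>f\<in>hom Y (FObj F a) b. is_iso Y f" using a(1) by blast
qed

lemma ess_surj_retract_dense:
  assumes "fully_faithful X Y F" "ess_surj X Y F"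
  shows "retract_dense X Y F"
  using assms iso_retract(1) unfolding retract_dense_def ess_surj_def by metis

lemma ff_id: "is_category X \<Longrightarrow> fully_faithful X X (functor_id X)"
  by (rule fully_faithfulI[OF functor_id]) (auto simp: functor_id_simps)

text \<open>Both composites are isomorphic to identities and hence fully faithful. Faithfulness of
  \<open>G F\<close> gives that of \<open>F\<close>; faithfulness of \<open>F G\<close> gives that
  of \<open>G\<close>, and so a lift of \<open>G h\<close> along \<open>G F\<close> is a lift of
  \<open>h\<close> along \<open>F\<close>.\<close>

lemma equivalence_fully_faithful:
  assumes "is_equivalence X Y F"
  shows "fully_faithful X Y F"
proof -
  obtain G \<eta> \<epsilon> where F: "is_functor X Y F" and G: "is_functor Y X G"
    and \<eta>: "is_nat_iso X X (functor_id X) (functor_comp X G F) \<eta>"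
    and \<epsilon>: "is_nat_iso Y Y (functor_comp Y F G) (functor_id Y) \<epsilon>"
    using assms unfolding is_equivalence_def by blast
  have GF: "fully_faithful X X (functor_comp X G F)"
    using ff_iso[OF \<eta> ff_id[OF functor_cats(1)[OF F]]] .
  have FG: "fully_faithful Y Y (functor_comp Y F G)"
    using ff_iso_iff[OF \<epsilon>] ff_id[OF functor_cats(1)[OF G]] by blast
  have faithG: "f = g" if "f \<in> hom Y a b" "g \<in> hom Y a b" "FArr G f = FArr G g" for f g a b
    using ff_faithful[OF FG that(1,2)] that by (simp add: functor_comp_simps)
  show ?thesis
  proof (rule fully_faithfulI[OF F])
    fix a b
    show "f = g" if "f \<in> hom X a b" "g \<in> hom X a b" "FArr F f = FArr F g" for f g
      using ff_faithful[OF GF that(1,2)] that by (simp add: functor_comp_simps)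
    fix h assume ab: "a \<in> Obj X" "b \<in> Obj X" and h: "h \<in> hom Y (FObj F a) (FObj F b)"
    have "FArr G h \<in> hom X (FObj (functor_comp X G F) a) (FObj (functor_comp X G F) b)"
      using functor_hom[OF G h] ab by (simp add: functor_comp_simps)
    then obtain f where f: "f \<in> hom X a b" "FArr (functor_comp X G F) f = FArr G h"
      using ff_full[OF GF ab] by blast
    then have "FArr F f = h"
      using faithG[OF functor_hom[OF F f(1)] h] by (simp add: functor_comp_simps)
    then show "\<exists>f\<in>hom X a b. FArr F f = h" using f by blast
  qed
qed

text \<open>Choice provides for each \<open>b\<close> a preimage \<open>g b\<close> and inverse
  isomorphisms \<open>i b\<close>, \<open>j b\<close>. The quasi-inverse sends an arrow to the lift
  of its conjugate by these, and all laws are checked after applying the faithful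
  \<open>F\<close>.\<close>

lemma ff_ess_surj_equivalence:
  assumes ff: "fully_faithful X Y F" and es: "ess_surj X Y F"
  shows "is_equivalence X Y F"
proof -
  note F = ff_functor[OF ff]
  note X = functor_cats(1)[OF F] and Y = functor_cats(2)[OF F]
  have "\<forall>b\<in>Obj Y. \<exists>a i j. a \<in> Obj X \<and> i \<in> hom Y (FObj F a) b \<and> j \<in> hom Y b (FObj F a) \<and>
      Comp Y j i = Ide Y (FObj F a) \<and> Comp Y i j = Ide Y b"
    using es isoE unfolding ess_surj_def by (metis (no_types, lifting))
  then obtain g i j where g: "\<And>b. b \<in> Obj Y \<Longrightarrow> g b \<in> Obj X"
    and i: "\<And>b. b \<in> Obj Y \<Longrightarrow> i b \<in> hom Y (FObj F (g b)) b"
    and j: "\<And>b. b \<in> Obj Y \<Longrightarrow> j b \<in> hom Y b (FObj F (g b))"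
    and ji: "\<And>b. b \<in> Obj Y \<Longrightarrow> Comp Y (j b) (i b) = Ide Y (FObj F (g b))"
    and ij: "\<And>b. b \<in> Obj Y \<Longrightarrow> Comp Y (i b) (j b) = Ide Y b" by metis
  have conj: "Comp Y (j b) (Comp Y h (i a)) \<in> hom Y (FObj F (g a)) (FObj F (g b))"
    if h: "h \<in> hom Y a b" for a b h
    using hom_Obj[OF Y h] Comp_hom[OF Y Comp_hom[OF Y i h] j] by blast
  \<comment> \<open>The chosen lift is a function of the arrow alone, because an arrow determines
    its end points; off \<open>Arr Y\<close> the requirement is vacuous.\<close>
  have "\<exists>k. \<forall>a b h. h \<in> hom Y a b \<longrightarrow> k h \<in> hom X (g a) (g b) \<and> FArr F (k h) = Comp Y (j b) (Comp Y h (i a))"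
  proof -
    have "\<exists>k. \<forall>a b. h \<in> hom Y a b \<longrightarrow> k \<in> hom X (g a) (g b) \<and> FArr F k = Comp Y (j b) (Comp Y h (i a))" for h
    proof (cases "h \<in> Arr Y")
      case True
      note h = Arr_hom[OF True]
      show ?thesis using ff_full[OF ff g[OF hom_Obj(1)[OF Y h]] g[OF hom_Obj(2)[OF Y h]] conj[OF h]]
        by (metis homD(2,3))
    qed (auto simp: hom_def)
    then show ?thesis by metis
  qed
  then obtain k where k: "\<And>a b h. h \<in> hom Y a b \<Longrightarrow> k h \<in> hom X (g a) (g b)"
    and Fk: "\<And>a b h. h \<in> hom Y a b \<Longrightarrow> FArr F (k h) = Comp Y (j b) (Comp Y h (i a))" by metis
  define G where "G = \<lparr>FObj = restrict g (Obj Y), FArr = restrict k (Arr Y)\<rparr>"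
  have G: "is_functor Y X G"
  proof (rule is_functorI[OF Y X])
    fix a assume a: "a \<in> Obj Y"
    have "k (Ide Y a) = Ide X (g a)"
      using ff_faithful[OF ff k[OF Ide_hom[OF Y a]] Ide_hom[OF X g[OF a]]] Fk[OF Ide_hom[OF Y a]]
        Comp_Ide_left[OF Y i[OF a]] ji[OF a] functor_Ide[OF F g[OF a]] by simp
    then show "FArr G (Ide Y a) = Ide X (FObj G a)"
      using a homD(1)[OF Ide_hom[OF Y a]] by (simp add: G_def)
  next
    fix f h a b c assume f: "f \<in> hom Y a b" and h: "h \<in> hom Y b c"
    have abc: "a \<in> Obj Y" "b \<in> Obj Y" "c \<in> Obj Y" using hom_Obj[OF Y f] hom_Obj[OF Y h] by auto
    note hf = Comp_hom[OF Y f h]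
    have "k (Comp Y h f) = Comp X (k h) (k f)"
    proof (rule ff_faithful[OF ff k[OF hf] Comp_hom[OF X k[OF f] k[OF h]]])
      have "FArr F (Comp X (k h) (k f)) = Comp Y (FArr F (k h)) (FArr F (k f))"
        by (rule functor_Comp[OF F k[OF f] k[OF h]])
      also have "\<dots> = Comp Y (j c) (Comp Y h (Comp Y (i b) (Comp Y (j b) (Comp Y f (i a)))))"
        using homD[OF f] homD[OF h] homD[OF i[OF abc(1)]] homD[OF i[OF abc(2)]] homD[OF j[OF abc(2)]]
          homD[OF j[OF abc(3)]] by (simp add: Arr_rules[OF Y] Fk[OF f] Fk[OF h])
      also have "\<dots> = Comp Y (j c) (Comp Y h (Comp Y f (i a)))"
        using section_cancel[OF Y j[OF abc(2)] i[OF abc(2)] ij[OF abc(2)] Comp_hom[OF Y i[OF abc(1)] f]] by simp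
      also have "\<dots> = FArr F (k (Comp Y h f))"
        using Fk[OF hf] Comp_assoc[OF Y i[OF abc(1)] f h] by simp
      finally show "FArr F (k (Comp Y h f)) = FArr F (Comp X (k h) (k f))" by simp
    qed
    then show "FArr G (Comp Y h f) = Comp X (FArr G h) (FArr G f)"
      using homD(1)[OF hf] homD(1)[OF f] homD(1)[OF h] by (simp add: G_def)
  next
    fix f a b assume f: "f \<in> hom Y a b"
    show "FArr G f \<in> hom X (FObj G a) (FObj G b)"
      using k[OF f] hom_Obj[OF Y f] homD(1)[OF f] by (simp add: G_def)
  qed (use g in \<open>auto simp: G_def\<close>)
  have Gh: "FArr G h = k h" if "h \<in> hom Y a b" for h a b using homD(1)[OF that] by (simp add: G_def)
  have GO: "FObj G a = g a" if "a \<in> Obj Y" for a using that by (simp add: G_def)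
  have \<epsilon>: "is_nat_iso Y Y (functor_comp Y F G) (functor_id Y) (restrict i (Obj Y))"
    unfolding is_nat_iso_def
  proof (intro conjI ballI)
    show "is_nat Y Y (functor_comp Y F G) (functor_id Y) (restrict i (Obj Y))"
    proof (rule is_natI[OF functor_comp[OF G F] functor_id[OF Y]])
      fix h a b assume h: "h \<in> hom Y a b"
      have ab: "a \<in> Obj Y" "b \<in> Obj Y" using hom_Obj[OF Y h] .
      show "Comp Y (restrict i (Obj Y) b) (FArr (functor_comp Y F G) h)
          = Comp Y (FArr (functor_id Y) h) (restrict i (Obj Y) a)"
        using ab h Fk[OF h] Gh[OF h] section_cancel[OF Y j[OF ab(2)] i[OF ab(2)] ij[OF ab(2)] Comp_hom[OF Y i[OF ab(1)] h]]
        by (simp add: functor_comp_simps functor_id_simps)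
    qed (use i GO in \<open>auto simp: functor_comp_simps functor_id_simps\<close>)
    show "is_iso Y (restrict i (Obj Y) a)" if "a \<in> Obj Y" for a
      using isoI[OF i[OF that] j[OF that] ji[OF that] ij[OF that]] that by simp
  qed
  \<comment> \<open>The unit at \<open>a\<close> is the lift of \<open>j (F a)\<close>; a fully
    faithful functor reflects invertibility.\<close>
  have "\<forall>a\<in>Obj X. \<exists>e. e \<in> hom X a (g (FObj F a)) \<and> FArr F e = j (FObj F a) \<and> is_iso X e"
  proof
    fix a assume a: "a \<in> Obj X"
    note Fa = functor_Obj[OF F a]
    show "\<exists>e. e \<in> hom X a (g (FObj F a)) \<and> FArr F e = j (FObj F a) \<and> is_iso X e"
      using ff_lifts_iso[OF ff a g[OF Fa] j[OF Fa] isoI[OF j[OF Fa] i[OF Fa] ij[OF Fa] ji[OF Fa]]] by metis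
  qed
  then obtain e where e: "\<And>a. a \<in> Obj X \<Longrightarrow> e a \<in> hom X a (g (FObj F a))"
    "\<And>a. a \<in> Obj X \<Longrightarrow> FArr F (e a) = j (FObj F a)" "\<And>a. a \<in> Obj X \<Longrightarrow> is_iso X (e a)" by metis
  have \<eta>: "is_nat_iso X X (functor_id X) (functor_comp X G F) (restrict e (Obj X))"
    unfolding is_nat_iso_def
  proof (intro conjI ballI)
    show "is_nat X X (functor_id X) (functor_comp X G F) (restrict e (Obj X))"
    proof (rule is_natI[OF functor_id[OF X] functor_comp[OF F G]])
      fix h a b assume h: "h \<in> hom X a b"
      have ab: "a \<in> Obj X" "b \<in> Obj X" using hom_Obj[OF X h] .
      note Fab = functor_Obj[OF F ab(1)] functor_Obj[OF F ab(2)] and Fh = functor_hom[OF F h]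
      have "Comp X (e b) h = Comp X (k (FArr F h)) (e a)"
      proof (rule ff_faithful[OF ff Comp_hom[OF X h e(1)[OF ab(2)]] Comp_hom[OF X e(1)[OF ab(1)] k[OF Fh]]])
        have "FArr F (Comp X (k (FArr F h)) (e a)) = Comp Y (FArr F (k (FArr F h))) (j (FObj F a))"
          using functor_Comp[OF F e(1)[OF ab(1)] k[OF Fh]] e(2)[OF ab(1)] by simp
        also have "\<dots> = Comp Y (j (FObj F b)) (Comp Y (FArr F h) (Comp Y (i (FObj F a)) (j (FObj F a))))"
          using homD[OF Fh] homD[OF i[OF Fab(1)]] homD[OF j[OF Fab(1)]] homD[OF j[OF Fab(2)]]
          by (simp add: Arr_rules[OF Y] Fk[OF Fh])
        also have "\<dots> = FArr F (Comp X (e b) h)"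
          using ij[OF Fab(1)] Comp_Ide_right[OF Y Fh] functor_Comp[OF F h e(1)[OF ab(2)]] e(2)[OF ab(2)] by simp
        finally show "FArr F (Comp X (e b) h) = FArr F (Comp X (k (FArr F h)) (e a))" by simp
      qed
      then show "Comp X (restrict e (Obj X) b) (FArr (functor_id X) h)
          = Comp X (FArr (functor_comp X G F) h) (restrict e (Obj X) a)"
        using ab h Gh[OF Fh] by (simp add: functor_comp_simps functor_id_simps)
    qed (use e GO functor_Obj[OF F] in \<open>auto simp: functor_comp_simps functor_id_simps\<close>)
    show "is_iso X (restrict e (Obj X) a)" if "a \<in> Obj X" for a using e(3) that by simp
  qed
  show ?thesis unfolding is_equivalence_def using F G \<eta> \<epsilon> by blast
qed

text \<open>The two halves of every equivalence below are proved separately, since full faithfulness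
  and essential surjectivity transfer along functors by different cancellation laws.\<close>

lemma equivalence_iff: "is_equivalence X Y F \<longleftrightarrow> fully_faithful X Y F \<and> ess_surj X Y F"
proof (intro iffI conjI)
  assume eq: "is_equivalence X Y F"
  then show "fully_faithful X Y F" by (rule equivalence_fully_faithful)
  obtain G \<epsilon> where F: "is_functor X Y F" and G: "is_functor Y X G"
    and \<epsilon>: "is_nat_iso Y Y (functor_comp Y F G) (functor_id Y) \<epsilon>"
    using eq unfolding is_equivalence_def by blast
  show "ess_surj X Y F"
  proof (rule ess_surjI[OF F])
    fix b assume b: "b \<in> Obj Y"
    then show "\<exists>a\<in>Obj X. \<exists>f\<in>hom Y (FObj F a) b. is_iso Y f"
      using functor_Obj[OF G b] nat_hom[OF nat_iso_nat[OF \<epsilon>] b] nat_iso_iso[OF \<epsilon> b]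
      by (metis functor_comp_simps(1) functor_id_simps(1))
  qed
qed (use ff_ess_surj_equivalence in blast)


section \<open>Functor categories and restriction functors\<close>

lemma CAT_Obj [simp]: "F \<in> Obj (CAT X Z) \<longleftrightarrow> is_functor X Z F"
  by (simp add: CAT_def)

lemma CAT_hom: "t \<in> hom (CAT X Z) F G \<longleftrightarrow> (\<exists>\<alpha>. t = (F, \<alpha>, G) \<and> is_nat X Z F G \<alpha>)"
  by (auto simp: CAT_def hom_def)

lemma CAT_homI: "is_nat X Z F G \<alpha> \<Longrightarrow> (F, \<alpha>, G) \<in> hom (CAT X Z) F G"
  by (simp add: CAT_hom)

lemma CAT_simps [simp]:
  "Ide (CAT X Z) F = (F, nat_id X Z F, F)"
  "Comp (CAT X Z) (G', \<beta>, H) (F, \<alpha>, G) = (F, vcomp X Z \<beta> \<alpha>, H)"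
  "Dom (CAT X Z) (F, \<alpha>, G) = F" "Cod (CAT X Z) (F, \<alpha>, G) = G"
  "(F, \<alpha>, G) \<in> Arr (CAT X Z) \<longleftrightarrow> is_nat X Z F G \<alpha>"
  by (simp_all add: CAT_def)

lemma vcomp_apply: "a \<in> Obj X \<Longrightarrow> vcomp X Z \<beta> \<alpha> a = Comp Z (\<beta> a) (\<alpha> a)"
  by (simp add: vcomp_def)

lemma nat_id_apply: "a \<in> Obj X \<Longrightarrow> nat_id X Z F a = Ide Z (FObj F a)"
  by (simp add: nat_id_def)

lemma whisker_pre_apply: "a \<in> Obj X \<Longrightarrow> whisker_pre X \<alpha> T a = \<alpha> (FObj T a)"
  by (simp add: whisker_pre_def)

lemma whisker_post_apply: "a \<in> Obj X \<Longrightarrow> whisker_post X H \<alpha> a = FArr H (\<alpha> a)"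
  by (simp add: whisker_post_def)

lemmas nat_apply = vcomp_apply nat_id_apply whisker_pre_apply whisker_post_apply

lemma nat_id:
  assumes F: "is_functor X Z F"
  shows "is_nat X Z F F (nat_id X Z F)"
proof (rule is_natI[OF F F])
  note X = functor_cats(1)[OF F] and Z = functor_cats(2)[OF F]
  show "nat_id X Z F a \<in> hom Z (FObj F a) (FObj F a)" if "a \<in> Obj X" for a
    using that Ide_hom[OF Z functor_Obj[OF F that]] by (simp add: nat_apply)
  show "Comp Z (nat_id X Z F b) (FArr F f) = Comp Z (FArr F f) (nat_id X Z F a)"
    if f: "f \<in> hom X a b" for f a b
    using hom_Obj[OF X f] functor_hom[OF F f]
    by (simp add: nat_apply Comp_Ide_left[OF Z] Comp_Ide_right[OF Z])
qed (simp add: nat_id_def)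

lemma vcomp_nat:
  assumes \<alpha>: "is_nat X Z F G \<alpha>" and \<beta>: "is_nat X Z G H \<beta>"
  shows "is_nat X Z F H (vcomp X Z \<beta> \<alpha>)"
proof (rule is_natI)
  note X = nat_functors(3)[OF \<alpha>] and Z = nat_functors(4)[OF \<alpha>]
  show "is_functor X Z F" "is_functor X Z H" using nat_functors \<alpha> \<beta> by blast+
  show "vcomp X Z \<beta> \<alpha> a \<in> hom Z (FObj F a) (FObj H a)" if "a \<in> Obj X" for a
    using that Comp_hom[OF Z nat_hom[OF \<alpha> that] nat_hom[OF \<beta> that]] by (simp add: nat_apply)
  fix f a b assume f: "f \<in> hom X a b"
  note ab = hom_Obj[OF X f]
  note Ff = functor_hom[OF nat_functors(1)[OF \<alpha>] f] functor_hom[OF nat_functors(2)[OF \<alpha>] f]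
    functor_hom[OF nat_functors(2)[OF \<beta>] f]
  note h = nat_hom[OF \<alpha> ab(1)] nat_hom[OF \<alpha> ab(2)] nat_hom[OF \<beta> ab(1)] nat_hom[OF \<beta> ab(2)]
  show "Comp Z (vcomp X Z \<beta> \<alpha> b) (FArr F f) = Comp Z (FArr H f) (vcomp X Z \<beta> \<alpha> a)"
    using ab Comp_assoc[OF Z Ff(1) h(2,4)] nat_comm[OF \<alpha> f] Comp_assoc[OF Z h(1) Ff(2) h(4)]
      nat_comm[OF \<beta> f] Comp_assoc[OF Z h(1,3) Ff(3)] by (simp add: nat_apply)
qed (simp add: vcomp_def)

lemma whisker_pre_nat:
  assumes T: "is_functor X Y T" and \<alpha>: "is_nat Y Z F G \<alpha>"
  shows "is_nat X Z (functor_comp X F T) (functor_comp X G T) (whisker_pre X \<alpha> T)"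
proof (rule is_natI)
  show "is_functor X Z (functor_comp X F T)" "is_functor X Z (functor_comp X G T)"
    using functor_comp[OF T] nat_functors[OF \<alpha>] by blast+
  show "whisker_pre X \<alpha> T a \<in> hom Z (FObj (functor_comp X F T) a) (FObj (functor_comp X G T) a)"
    if "a \<in> Obj X" for a
    using that nat_hom[OF \<alpha> functor_Obj[OF T that]] by (simp add: nat_apply functor_comp_simps)
  show "Comp Z (whisker_pre X \<alpha> T b) (FArr (functor_comp X F T) f)
      = Comp Z (FArr (functor_comp X G T) f) (whisker_pre X \<alpha> T a)" if f: "f \<in> hom X a b" for f a b
    using hom_Obj[OF functor_cats(1)[OF T] f] nat_comm[OF \<alpha> functor_hom[OF T f]] homD(1)[OF f]
    by (simp add: nat_apply functor_comp_simps)
qed (simp add: whisker_pre_def)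

lemma whisker_post_nat:
  assumes \<alpha>: "is_nat X Y F G \<alpha>" and H: "is_functor Y Z H"
  shows "is_nat X Z (functor_comp X H F) (functor_comp X H G) (whisker_post X H \<alpha>)"
proof (rule is_natI)
  note F = nat_functors(1)[OF \<alpha>] and G = nat_functors(2)[OF \<alpha>]
  show "is_functor X Z (functor_comp X H F)" "is_functor X Z (functor_comp X H G)"
    using functor_comp[OF F H] functor_comp[OF G H] .
  show "whisker_post X H \<alpha> a \<in> hom Z (FObj (functor_comp X H F) a) (FObj (functor_comp X H G) a)"
    if "a \<in> Obj X" for a
    using that functor_hom[OF H nat_hom[OF \<alpha> that]] by (simp add: nat_apply functor_comp_simps)
  fix f a b assume f: "f \<in> hom X a b"
  note ab = hom_Obj[OF functor_cats(1)[OF F] f]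
  have "FArr H (Comp Y (\<alpha> b) (FArr F f)) = FArr H (Comp Y (FArr G f) (\<alpha> a))"
    using nat_comm[OF \<alpha> f] by simp
  then show "Comp Z (whisker_post X H \<alpha> b) (FArr (functor_comp X H F) f)
      = Comp Z (FArr (functor_comp X H G) f) (whisker_post X H \<alpha> a)"
    using ab homD(1)[OF f] functor_Comp[OF H functor_hom[OF F f] nat_hom[OF \<alpha> ab(2)]]
      functor_Comp[OF H nat_hom[OF \<alpha> ab(1)] functor_hom[OF G f]]
    by (simp add: nat_apply functor_comp_simps)
qed (simp add: whisker_post_def)

lemma CAT_category: "is_category (CAT X Z)"
proof (rule is_categoryI)
  show "f \<in> hom (CAT X Z) a b \<Longrightarrow> a \<in> Obj (CAT X Z) \<and> b \<in> Obj (CAT X Z)" for f a b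
    using nat_functors by (fastforce simp: CAT_hom)
  show "a \<in> Obj (CAT X Z) \<Longrightarrow> Ide (CAT X Z) a \<in> hom (CAT X Z) a a" for a
    by (simp add: CAT_hom nat_id)
  show "f \<in> hom (CAT X Z) a b \<Longrightarrow> g \<in> hom (CAT X Z) b c \<Longrightarrow> Comp (CAT X Z) g f \<in> hom (CAT X Z) a c"
    for f g a b c
    by (auto simp: CAT_hom vcomp_nat)
next
  fix t F G assume "t \<in> hom (CAT X Z) F G"
  then obtain \<alpha> where t: "t = (F, \<alpha>, G)" and \<alpha>: "is_nat X Z F G \<alpha>" by (auto simp: CAT_hom)
  note h = Comp_Ide_right[OF nat_functors(4)[OF \<alpha>] nat_hom[OF \<alpha>]]
    Comp_Ide_left[OF nat_functors(4)[OF \<alpha>] nat_hom[OF \<alpha>]]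
  have "vcomp X Z \<alpha> (nat_id X Z F) = \<alpha>"
    by (rule nat_eqI[OF vcomp_nat[OF nat_id[OF nat_functors(1)[OF \<alpha>]] \<alpha>] \<alpha>]) (simp add: nat_apply h)
  then show "Comp (CAT X Z) t (Ide (CAT X Z) F) = t" by (simp add: t)
  have "vcomp X Z (nat_id X Z G) \<alpha> = \<alpha>"
    by (rule nat_eqI[OF vcomp_nat[OF \<alpha> nat_id[OF nat_functors(2)[OF \<alpha>]]] \<alpha>]) (simp add: nat_apply h)
  then show "Comp (CAT X Z) (Ide (CAT X Z) G) t = t" by (simp add: t)
next
  fix t u v F G H I assume "t \<in> hom (CAT X Z) F G" "u \<in> hom (CAT X Z) G H" "v \<in> hom (CAT X Z) H I"
  then obtain \<alpha> \<beta> \<gamma> where t: "t = (F, \<alpha>, G)" "u = (G, \<beta>, H)" "v = (H, \<gamma>, I)"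
    and \<alpha>: "is_nat X Z F G \<alpha>" and \<beta>: "is_nat X Z G H \<beta>" and \<gamma>: "is_nat X Z H I \<gamma>" by (auto simp: CAT_hom)
  have "vcomp X Z \<gamma> (vcomp X Z \<beta> \<alpha>) = vcomp X Z (vcomp X Z \<gamma> \<beta>) \<alpha>"
  proof (rule nat_eqI[OF vcomp_nat[OF vcomp_nat[OF \<alpha> \<beta>] \<gamma>] vcomp_nat[OF \<alpha> vcomp_nat[OF \<beta> \<gamma>]]])
    show "vcomp X Z \<gamma> (vcomp X Z \<beta> \<alpha>) a = vcomp X Z (vcomp X Z \<gamma> \<beta>) \<alpha> a" if a: "a \<in> Obj X" for a
      using a Comp_assoc[OF nat_functors(4)[OF \<alpha>] nat_hom[OF \<alpha> a] nat_hom[OF \<beta> a] nat_hom[OF \<gamma> a]]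
      by (simp add: nat_apply)
  qed
  then show "Comp (CAT X Z) v (Comp (CAT X Z) u t) = Comp (CAT X Z) (Comp (CAT X Z) v u) t"
    by (simp add: t)
qed

lemma CAT_iso:
  assumes "is_nat X Z F G \<alpha>"
  shows "is_iso (CAT X Z) (F, \<alpha>, G) \<longleftrightarrow> is_nat_iso X Z F G \<alpha>"
proof
  assume "is_iso (CAT X Z) (F, \<alpha>, G)"
  then obtain t where t: "t \<in> hom (CAT X Z) G F" "Comp (CAT X Z) t (F, \<alpha>, G) = Ide (CAT X Z) F"
    "Comp (CAT X Z) (F, \<alpha>, G) t = Ide (CAT X Z) G"
    using isoE[OF _ CAT_homI[OF assms]] by blast
  then obtain \<beta> where \<beta>: "is_nat X Z G F \<beta>" and t': "t = (G, \<beta>, F)" by (auto simp: CAT_hom)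
  have "vcomp X Z \<beta> \<alpha> = nat_id X Z F" "vcomp X Z \<alpha> \<beta> = nat_id X Z G" using t(2,3) by (simp_all add: t')
  then have "Comp Z (\<beta> a) (\<alpha> a) = Ide Z (FObj F a) \<and> Comp Z (\<alpha> a) (\<beta> a) = Ide Z (FObj G a)"
    if "a \<in> Obj X" for a
    using that by (metis nat_apply(1,2))
  then have "is_iso Z (\<alpha> a)" if "a \<in> Obj X" for a
    using isoI[OF nat_hom[OF assms that] nat_hom[OF \<beta> that]] that by blast
  then show "is_nat_iso X Z F G \<alpha>" using assms by (simp add: is_nat_iso_def)
next
  assume iso: "is_nat_iso X Z F G \<alpha>"
  obtain \<beta> where \<beta>: "is_nat_iso X Z G F \<beta>"
    "\<And>a. a \<in> Obj X \<Longrightarrow> Comp Z (\<beta> a) (\<alpha> a) = Ide Z (FObj F a)"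
    "\<And>a. a \<in> Obj X \<Longrightarrow> Comp Z (\<alpha> a) (\<beta> a) = Ide Z (FObj G a)"
    using nat_iso_inverse[OF iso] by blast
  note \<beta>' = nat_iso_nat[OF \<beta>(1)]
  have "vcomp X Z \<beta> \<alpha> = nat_id X Z F" "vcomp X Z \<alpha> \<beta> = nat_id X Z G"
    unfolding vcomp_def nat_id_def using \<beta>(2,3) by (simp_all cong: restrict_cong)
  then show "is_iso (CAT X Z) (F, \<alpha>, G)"
    by (intro isoI[OF CAT_homI[OF assms] CAT_homI[OF \<beta>']]) simp_all
qed

section \<open>Restriction functors\<close>

abbreviation restriction_ff where
  "restriction_ff X Y T Z \<equiv> fully_faithful (CAT Y Z) (CAT X Z) (precomp X Y T Z)"

abbreviation restriction_ess_surj where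
  "restriction_ess_surj X Y T Z \<equiv> ess_surj (CAT Y Z) (CAT X Z) (precomp X Y T Z)"

abbreviation restriction_equivalence where
  "restriction_equivalence X Y T Z \<equiv> is_equivalence (CAT Y Z) (CAT X Z) (precomp X Y T Z)"

lemma precomp_Obj: "is_functor Y Z F \<Longrightarrow> FObj (precomp X Y T Z) F = functor_comp X F T"
  by (simp add: precomp_def)

lemma precomp_Arr:
  "is_nat Y Z F G \<alpha> \<Longrightarrow>
     FArr (precomp X Y T Z) (F, \<alpha>, G) = (functor_comp X F T, whisker_pre X \<alpha> T, functor_comp X G T)"
  by (simp add: precomp_def)

lemma precomp_functor:
  assumes T: "is_functor X Y T"
  shows "is_functor (CAT Y Z) (CAT X Z) (precomp X Y T Z)"
proof (rule is_functorI[OF CAT_category CAT_category])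
  fix F assume "F \<in> Obj (CAT Y Z)"
  then have F: "is_functor Y Z F" by simp
  then show "FObj (precomp X Y T Z) F \<in> Obj (CAT X Z)" by (simp add: precomp_Obj functor_comp[OF T])
  have "whisker_pre X (nat_id Y Z F) T = nat_id X Z (functor_comp X F T)"
    by (rule nat_eqI[OF whisker_pre_nat[OF T nat_id[OF F]] nat_id[OF functor_comp[OF T F]]])
      (simp add: nat_apply functor_comp_simps functor_Obj[OF T])
  then show "FArr (precomp X Y T Z) (Ide (CAT Y Z) F) = Ide (CAT X Z) (FObj (precomp X Y T Z) F)"
    using F by (simp add: precomp_Obj precomp_Arr nat_id)
next
  fix t F G assume "t \<in> hom (CAT Y Z) F G"
  then obtain \<alpha> where t: "t = (F, \<alpha>, G)" and \<alpha>: "is_nat Y Z F G \<alpha>" by (auto simp: CAT_hom)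
  show "FArr (precomp X Y T Z) t \<in> hom (CAT X Z) (FObj (precomp X Y T Z) F) (FObj (precomp X Y T Z) G)"
    using \<alpha> nat_functors(1,2)[OF \<alpha>] CAT_homI[OF whisker_pre_nat[OF T \<alpha>]]
    by (simp add: t precomp_Arr precomp_Obj)
next
  fix t u F G H assume "t \<in> hom (CAT Y Z) F G" "u \<in> hom (CAT Y Z) G H"
  then obtain \<alpha> \<beta> where t: "t = (F, \<alpha>, G)" "u = (G, \<beta>, H)"
    and \<alpha>: "is_nat Y Z F G \<alpha>" and \<beta>: "is_nat Y Z G H \<beta>" by (auto simp: CAT_hom)
  note w = whisker_pre_nat[OF T \<alpha>] whisker_pre_nat[OF T \<beta>] whisker_pre_nat[OF T vcomp_nat[OF \<alpha> \<beta>]]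
  have "whisker_pre X (vcomp Y Z \<beta> \<alpha>) T = vcomp X Z (whisker_pre X \<beta> T) (whisker_pre X \<alpha> T)"
    by (rule nat_eqI[OF w(3) vcomp_nat[OF w(1,2)]]) (simp add: nat_apply functor_Obj[OF T])
  then show "FArr (precomp X Y T Z) (Comp (CAT Y Z) u t)
      = Comp (CAT X Z) (FArr (precomp X Y T Z) u) (FArr (precomp X Y T Z) t)"
    using \<alpha> \<beta> vcomp_nat[OF \<alpha> \<beta>] by (simp add: t precomp_Arr)
qed (auto simp: precomp_def)

lemma precomp_comp:
  assumes T: "is_functor X Y T" and S: "is_functor Y W S"
  shows "functor_comp (CAT W Z) (precomp X Y T Z) (precomp Y W S Z) = precomp X W (functor_comp X S T) Z"
proof (rule functor_eqI)
  note ST = functor_comp[OF T S]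
  fix F assume "F \<in> Obj (CAT W Z)"
  then have F: "is_functor W Z F" by simp
  then show "FObj (functor_comp (CAT W Z) (precomp X Y T Z) (precomp Y W S Z)) F
      = FObj (precomp X W (functor_comp X S T) Z) F"
    by (simp add: functor_comp_simps precomp_Obj functor_comp[OF S] functor_comp_assoc[OF T])
next
  fix t assume t: "t \<in> Arr (CAT W Z)"
  then obtain F \<alpha> G where t': "t = (F, \<alpha>, G)" and \<alpha>: "is_nat W Z F G \<alpha>" by (auto simp: CAT_def)
  have "whisker_pre X (whisker_pre Y \<alpha> S) T = whisker_pre X \<alpha> (functor_comp X S T)"
    unfolding whisker_pre_def using functor_Obj[OF T]
    by (simp add: functor_comp_simps cong: restrict_cong)
  then show "FArr (functor_comp (CAT W Z) (precomp X Y T Z) (precomp Y W S Z)) t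
      = FArr (precomp X W (functor_comp X S T) Z) t"
    using t \<alpha> whisker_pre_nat[OF S \<alpha>]
    by (simp add: functor_comp_simps t' precomp_Arr functor_comp_assoc[OF T])
qed (simp_all add: functor_comp_simps, simp_all add: precomp_def)

text \<open>Whiskering with \<open>\<theta>\<close> gives the components. The case of interest is
  the square of Yoneda embeddings for the Cauchy completions, which commutes only up to
  isomorphism.\<close>

lemma precomp_nat_iso:
  assumes \<theta>: "is_nat_iso X Y T T' \<theta>"
  shows "\<exists>\<Theta>. is_nat_iso (CAT Y Z) (CAT X Z) (precomp X Y T Z) (precomp X Y T' Z) \<Theta>"
proof -
  note nat = nat_iso_nat[OF \<theta>]
  note T = nat_functors(1)[OF nat] and T' = nat_functors(2)[OF nat]
  define \<Theta> where "\<Theta> = (\<lambda>H\<in>Obj (CAT Y Z). (functor_comp X H T, whisker_post X H \<theta>, functor_comp X H T'))"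
  have "is_nat (CAT Y Z) (CAT X Z) (precomp X Y T Z) (precomp X Y T' Z) \<Theta>"
  proof (rule is_natI[OF precomp_functor[OF T] precomp_functor[OF T']])
    fix H assume "H \<in> Obj (CAT Y Z)"
    then have H: "is_functor Y Z H" by simp
    then show "\<Theta> H \<in> hom (CAT X Z) (FObj (precomp X Y T Z) H) (FObj (precomp X Y T' Z) H)"
      using whisker_post_nat[OF nat H] by (simp add: \<Theta>_def precomp_Obj CAT_hom)
  next
    fix t F G assume "t \<in> hom (CAT Y Z) F G"
    then obtain \<alpha> where t: "t = (F, \<alpha>, G)" and \<alpha>: "is_nat Y Z F G \<alpha>" by (auto simp: CAT_hom)
    note F = nat_functors(1)[OF \<alpha>] and G = nat_functors(2)[OF \<alpha>]
    have "vcomp X Z (whisker_post X G \<theta>) (whisker_pre X \<alpha> T) = vcomp X Z (whisker_pre X \<alpha> T') (whisker_post X F \<theta>)"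
      unfolding vcomp_def using nat_comm[OF \<alpha> nat_hom[OF nat]]
      by (simp add: nat_apply cong: restrict_cong)
    then show "Comp (CAT X Z) (\<Theta> G) (FArr (precomp X Y T Z) t) = Comp (CAT X Z) (FArr (precomp X Y T' Z) t) (\<Theta> F)"
      using \<alpha> F G by (simp add: t \<Theta>_def precomp_Arr)
  qed (simp add: \<Theta>_def)
  moreover have "is_iso (CAT X Z) (\<Theta> H)" if "H \<in> Obj (CAT Y Z)" for H
  proof -
    have H: "is_functor Y Z H" using that by simp
    have "is_iso Z (whisker_post X H \<theta> a)" if a: "a \<in> Obj X" for a
      using functor_iso[OF H nat_hom[OF nat a] nat_iso_iso[OF \<theta> a]] a by (simp add: nat_apply)
    then show ?thesis using H CAT_iso[OF whisker_post_nat[OF nat H]] whisker_post_nat[OF nat H]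
      by (simp add: \<Theta>_def is_nat_iso_def)
  qed
  ultimately show ?thesis unfolding is_nat_iso_def by blast
qed

text \<open>Full faithfulness becomes unique extension of natural transformations, with equations
  only at the objects \<open>T a\<close>. The triples of \<open>CAT\<close> then disappear from
  later arguments; the two lemmas after this one go the opposite way.\<close>

lemma ff_precompI:
  assumes T: "is_functor X Y T"
    and uniq: "\<And>H H' \<Omega> \<Omega>' b. is_nat Y Z H H' \<Omega> \<Longrightarrow> is_nat Y Z H H' \<Omega>' \<Longrightarrow>
       (\<And>a. a \<in> Obj X \<Longrightarrow> \<Omega> (FObj T a) = \<Omega>' (FObj T a)) \<Longrightarrow> b \<in> Obj Y \<Longrightarrow> \<Omega> b = \<Omega>' b"
    and ex: "\<And>H H' \<omega>. is_functor Y Z H \<Longrightarrow> is_functor Y Z H' \<Longrightarrow>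
       is_nat X Z (functor_comp X H T) (functor_comp X H' T) \<omega> \<Longrightarrow>
       \<exists>\<Omega>. is_nat Y Z H H' \<Omega> \<and> (\<forall>a\<in>Obj X. \<Omega> (FObj T a) = \<omega> a)"
  shows "restriction_ff X Y T Z"
proof (rule fully_faithfulI[OF precomp_functor[OF T]])
  fix H H' t u assume tu: "t \<in> hom (CAT Y Z) H H'" "u \<in> hom (CAT Y Z) H H'"
    and eq: "FArr (precomp X Y T Z) t = FArr (precomp X Y T Z) u"
  obtain \<Omega> \<Omega>' where t: "t = (H, \<Omega>, H')" "u = (H, \<Omega>', H')" and \<Omega>: "is_nat Y Z H H' \<Omega>" "is_nat Y Z H H' \<Omega>'"
    using tu by (auto simp: CAT_hom)
  have "whisker_pre X \<Omega> T = whisker_pre X \<Omega>' T" using eq \<Omega> by (simp add: t precomp_Arr)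
  then have "\<Omega> (FObj T a) = \<Omega>' (FObj T a)" if "a \<in> Obj X" for a
    using that by (metis whisker_pre_apply)
  then have "\<Omega> = \<Omega>'" using nat_eqI[OF \<Omega>] uniq[OF \<Omega>] by blast
  then show "t = u" by (simp add: t)
next
  fix H H' t assume H: "H \<in> Obj (CAT Y Z)" "H' \<in> Obj (CAT Y Z)"
    and t: "t \<in> hom (CAT X Z) (FObj (precomp X Y T Z) H) (FObj (precomp X Y T Z) H')"
  have H': "is_functor Y Z H" "is_functor Y Z H'" using H by simp_all
  obtain \<omega> where \<omega>: "is_nat X Z (functor_comp X H T) (functor_comp X H' T) \<omega>"
    and t': "t = (functor_comp X H T, \<omega>, functor_comp X H' T)"
    using t H' by (auto simp: CAT_hom precomp_Obj)
  obtain \<Omega> where \<Omega>: "is_nat Y Z H H' \<Omega>" "\<forall>a\<in>Obj X. \<Omega> (FObj T a) = \<omega> a" using ex[OF H' \<omega>] by blast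
  have "whisker_pre X \<Omega> T = \<omega>"
    by (rule nat_eqI[OF whisker_pre_nat[OF T \<Omega>(1)] \<omega>]) (simp add: nat_apply \<Omega>)
  then show "\<exists>f\<in>hom (CAT Y Z) H H'. FArr (precomp X Y T Z) f = t"
    using CAT_homI[OF \<Omega>(1)] by (intro bexI[of _ "(H, \<Omega>, H')"]) (simp_all add: precomp_Arr \<Omega> t')
qed

lemma ff_precomp_unique:
  assumes ff: "restriction_ff X Y T Z"
    and \<Omega>: "is_nat Y Z H H' \<Omega>" "is_nat Y Z H H' \<Omega>'"
    and eq: "\<And>a. a \<in> Obj X \<Longrightarrow> \<Omega> (FObj T a) = \<Omega>' (FObj T a)"
  shows "\<Omega> = \<Omega>'"
proof -
  have "whisker_pre X \<Omega> T = whisker_pre X \<Omega>' T"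
    unfolding whisker_pre_def using eq by (simp cong: restrict_cong)
  then have "FArr (precomp X Y T Z) (H, \<Omega>, H') = FArr (precomp X Y T Z) (H, \<Omega>', H')"
    using \<Omega> by (simp add: precomp_Arr)
  then show ?thesis using ff_faithful[OF ff CAT_homI[OF \<Omega>(1)] CAT_homI[OF \<Omega>(2)]] by simp
qed

lemma ff_precomp_extend:
  assumes ff: "restriction_ff X Y T Z"
    and H: "is_functor Y Z H" "is_functor Y Z H'"
    and \<omega>: "is_nat X Z (functor_comp X H T) (functor_comp X H' T) \<omega>"
  obtains \<Omega> where "is_nat Y Z H H' \<Omega>" "\<And>a. a \<in> Obj X \<Longrightarrow> \<Omega> (FObj T a) = \<omega> a"
proof -
  have "(functor_comp X H T, \<omega>, functor_comp X H' T)
      \<in> hom (CAT X Z) (FObj (precomp X Y T Z) H) (FObj (precomp X Y T Z) H')"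
    using CAT_homI[OF \<omega>] H by (simp add: precomp_Obj)
  moreover have "H \<in> Obj (CAT Y Z)" "H' \<in> Obj (CAT Y Z)" using H by simp_all
  ultimately obtain t where t: "t \<in> hom (CAT Y Z) H H'"
    "FArr (precomp X Y T Z) t = (functor_comp X H T, \<omega>, functor_comp X H' T)"
    using ff_full[OF ff] by metis
  then obtain \<Omega> where \<Omega>: "is_nat Y Z H H' \<Omega>" "t = (H, \<Omega>, H')" by (auto simp: CAT_hom)
  then have "\<omega> = whisker_pre X \<Omega> T" using t(2) by (simp add: precomp_Arr)
  then show ?thesis using that[OF \<Omega>(1)] by (simp add: nat_apply)
qed

lemma ess_surj_precompI:
  assumes T: "is_functor X Y T"
    and "\<And>P. is_functor X Z P \<Longrightarrow> \<exists>Q \<alpha>. is_functor Y Z Q \<and> is_nat_iso X Z (functor_comp X Q T) P \<alpha>"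
  shows "restriction_ess_surj X Y T Z"
proof (rule ess_surjI[OF precomp_functor[OF T]])
  fix P assume "P \<in> Obj (CAT X Z)"
  then have P: "is_functor X Z P" by simp
  obtain Q \<alpha> where Q: "is_functor Y Z Q" and \<alpha>: "is_nat_iso X Z (functor_comp X Q T) P \<alpha>"
    using assms(2)[OF P] by blast
  have "(functor_comp X Q T, \<alpha>, P) \<in> hom (CAT X Z) (FObj (precomp X Y T Z) Q) P"
    using CAT_homI[OF nat_iso_nat[OF \<alpha>]] Q by (simp add: precomp_Obj)
  moreover have "is_iso (CAT X Z) (functor_comp X Q T, \<alpha>, P)"
    using CAT_iso[OF nat_iso_nat[OF \<alpha>]] \<alpha> by simp
  ultimately show "\<exists>a\<in>Obj (CAT Y Z). \<exists>f\<in>hom (CAT X Z) (FObj (precomp X Y T Z) a) P. is_iso (CAT X Z) f"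
    using Q by (intro bexI[of _ Q]) auto
qed

lemma ess_surj_precompD:
  assumes es: "restriction_ess_surj X Y T Z" and P: "is_functor X Z P"
  obtains Q \<alpha> where "is_functor Y Z Q" "is_nat_iso X Z (functor_comp X Q T) P \<alpha>"
proof -
  obtain Q t where Q: "Q \<in> Obj (CAT Y Z)" and t: "t \<in> hom (CAT X Z) (FObj (precomp X Y T Z) Q) P" "is_iso (CAT X Z) t"
    using es P unfolding ess_surj_def by (metis CAT_Obj)
  have Q': "is_functor Y Z Q" using Q by simp
  then obtain \<alpha> where \<alpha>: "is_nat X Z (functor_comp X Q T) P \<alpha>" and t': "t = (functor_comp X Q T, \<alpha>, P)"
    using t(1) by (auto simp: CAT_hom precomp_Obj)
  show ?thesis using that[OF Q'] CAT_iso[OF \<alpha>] t(2) by (simp add: t')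
qed

text \<open>Transformations between functors into \<open>Z\<close> correspond to transformations
  between their composites with \<open>J\<close>, so an extension found in \<open>W\<close> lifts
  component by component. Applied to discrete categories in \<open>Cat\<close> and to copies of
  small categories on \<open>'u\<close>.\<close>

lemma ff_precomp_into_ff:
  assumes T: "is_functor X Y T" and J: "fully_faithful Z W J"
    and ff: "restriction_ff X Y T W"
  shows "restriction_ff X Y T Z"
proof (rule ff_precompI[OF T])
  note JF = ff_functor[OF J]
  note Z = functor_cats(1)[OF JF] and W = functor_cats(2)[OF JF]
  note Y = functor_cats(2)[OF T]
  show "\<Omega> b = \<Omega>' b" if \<Omega>: "is_nat Y Z H H' \<Omega>" "is_nat Y Z H H' \<Omega>'"
    and "\<And>a. a \<in> Obj X \<Longrightarrow> \<Omega> (FObj T a) = \<Omega>' (FObj T a)" and b: "b \<in> Obj Y" for H H' \<Omega> \<Omega>' b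
  proof -
    have "whisker_post Y J \<Omega> = whisker_post Y J \<Omega>'"
      by (rule ff_precomp_unique[OF ff whisker_post_nat[OF \<Omega>(1) JF] whisker_post_nat[OF \<Omega>(2) JF]])
        (simp add: nat_apply functor_Obj[OF T] that(3))
    then have "FArr J (\<Omega> b) = FArr J (\<Omega>' b)" using b by (metis whisker_post_apply)
    then show ?thesis by (rule ff_faithful[OF J nat_hom[OF \<Omega>(1) b] nat_hom[OF \<Omega>(2) b]])
  qed
  fix H H' \<omega> assume H: "is_functor Y Z H" and H': "is_functor Y Z H'"
    and \<omega>: "is_nat X Z (functor_comp X H T) (functor_comp X H' T) \<omega>"
  have "is_nat X W (functor_comp X (functor_comp Y J H) T) (functor_comp X (functor_comp Y J H') T) (whisker_post X J \<omega>)"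
    using whisker_post_nat[OF \<omega> JF] by (simp add: functor_comp_assoc[OF T])
  then obtain \<Omega> where \<Omega>: "is_nat Y W (functor_comp Y J H) (functor_comp Y J H') \<Omega>"
    "\<And>a. a \<in> Obj X \<Longrightarrow> \<Omega> (FObj T a) = FArr J (\<omega> a)"
    using ff_precomp_extend[OF ff functor_comp[OF H JF] functor_comp[OF H' JF]] by (metis whisker_post_apply)
  have "\<forall>b\<in>Obj Y. \<exists>k. k \<in> hom Z (FObj H b) (FObj H' b) \<and> FArr J k = \<Omega> b"
  proof
    fix b assume b: "b \<in> Obj Y"
    have "\<Omega> b \<in> hom W (FObj J (FObj H b)) (FObj J (FObj H' b))"
      using nat_hom[OF \<Omega>(1) b] b by (simp add: functor_comp_simps)
    then show "\<exists>k. k \<in> hom Z (FObj H b) (FObj H' b) \<and> FArr J k = \<Omega> b"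
      using ff_full[OF J functor_Obj[OF H b] functor_Obj[OF H' b]] by metis
  qed
  then obtain k where k: "\<And>b. b \<in> Obj Y \<Longrightarrow> k b \<in> hom Z (FObj H b) (FObj H' b)"
    "\<And>b. b \<in> Obj Y \<Longrightarrow> FArr J (k b) = \<Omega> b" by metis
  have "is_nat Y Z H H' (restrict k (Obj Y))"
  proof (rule is_natI[OF H H'])
    fix f a b assume f: "f \<in> hom Y a b"
    note ab = hom_Obj[OF Y f]
    have "Comp Z (k b) (FArr H f) = Comp Z (FArr H' f) (k a)"
    proof (rule ff_faithful[OF J])
      show "FArr J (Comp Z (k b) (FArr H f)) = FArr J (Comp Z (FArr H' f) (k a))"
        using nat_comm[OF \<Omega>(1) f] homD(1)[OF f] ab functor_Comp[OF JF functor_hom[OF H f] k(1)[OF ab(2)]]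
          functor_Comp[OF JF k(1)[OF ab(1)] functor_hom[OF H' f]]
        by (simp add: functor_comp_simps k(2))
    qed (use Comp_hom[OF Z functor_hom[OF H f] k(1)[OF ab(2)]] Comp_hom[OF Z k(1)[OF ab(1)] functor_hom[OF H' f]] in auto)
    then show "Comp Z (restrict k (Obj Y) b) (FArr H f) = Comp Z (FArr H' f) (restrict k (Obj Y) a)"
      using ab by simp
  qed (use k in auto)
  moreover have "restrict k (Obj Y) (FObj T a) = \<omega> a" if a: "a \<in> Obj X" for a
  proof -
    note Ta = functor_Obj[OF T a]
    have "\<omega> a \<in> hom Z (FObj H (FObj T a)) (FObj H' (FObj T a))"
      using nat_hom[OF \<omega> a] a by (simp add: functor_comp_simps)
    then have "k (FObj T a) = \<omega> a"
      by (rule ff_faithful[OF J k(1)[OF Ta]]) (simp add: k(2)[OF Ta] \<Omega>(2)[OF a])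
    then show ?thesis using Ta by simp
  qed
  ultimately show "\<exists>\<Omega>. is_nat Y Z H H' \<Omega> \<and> (\<forall>a\<in>Obj X. \<Omega> (FObj T a) = \<omega> a)" by blast
qed

text \<open>Extend \<open>J P\<close> in \<open>W\<close> and apply \<open>R\<close>: since
  \<open>R J\<close> is the identity, the result extends \<open>P\<close>. This complements the
  previous lemma, where full faithfulness of \<open>J\<close> is enough.\<close>

lemma ess_surj_precomp_retract:
  assumes T: "is_functor X Y T" and J: "is_functor Z W J" and R: "is_functor W Z R"
    and RJ: "functor_comp Z R J = functor_id Z"
    and es: "restriction_ess_surj X Y T W"
  shows "restriction_ess_surj X Y T Z"
proof (rule ess_surj_precompI[OF T])
  fix P assume P: "is_functor X Z P"
  obtain Q \<alpha> where Q: "is_functor Y W Q" and \<alpha>: "is_nat_iso X W (functor_comp X Q T) (functor_comp X J P) \<alpha>"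
    using ess_surj_precompD[OF es functor_comp[OF P J]] by blast
  note \<alpha>n = nat_iso_nat[OF \<alpha>]
  have "functor_comp X R (functor_comp X J P) = P"
    using functor_comp_assoc[OF P, where H = R and G = J] by (simp add: RJ functor_comp_id(2)[OF P])
  then have "is_nat X Z (functor_comp X (functor_comp Y R Q) T) P (whisker_post X R \<alpha>)"
    using whisker_post_nat[OF \<alpha>n R] by (simp add: functor_comp_assoc[OF T])
  moreover have "is_iso Z (whisker_post X R \<alpha> a)" if a: "a \<in> Obj X" for a
    using functor_iso[OF R nat_hom[OF \<alpha>n a] nat_iso_iso[OF \<alpha> a]] a by (simp add: nat_apply)
  ultimately show "\<exists>Q \<alpha>. is_functor Y Z Q \<and> is_nat_iso X Z (functor_comp X Q T) P \<alpha>"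
    using functor_comp[OF Q R] unfolding is_nat_iso_def by blast
qed

text \<open>A transformation is determined by its components on the image, since every other object
  is a retract of one there. The resulting formula also defines the extension, whatever retracts
  were chosen.\<close>

lemma retract_dense_ff_precomp:
  assumes T: "retract_dense X Y T" and Z: "is_category Z"
  shows "restriction_ff X Y T Z"
proof -
  have T': "fully_faithful X Y T" using T by (simp add: retract_dense_def)
  note TF = ff_functor[OF T']
  note X = functor_cats(1)[OF TF] and Y = functor_cats(2)[OF TF]
  have "\<forall>b\<in>Obj Y. \<exists>c s r. c \<in> Obj X \<and> s \<in> hom Y b (FObj T c) \<and> r \<in> hom Y (FObj T c) b \<and> Comp Y r s = Ide Y b"
    using T unfolding retract_dense_def retract_def by blast
  then obtain c s r where c: "\<And>b. b \<in> Obj Y \<Longrightarrow> c b \<in> Obj X"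
    and s: "\<And>b. b \<in> Obj Y \<Longrightarrow> s b \<in> hom Y b (FObj T (c b))"
    and r: "\<And>b. b \<in> Obj Y \<Longrightarrow> r b \<in> hom Y (FObj T (c b)) b"
    and rs: "\<And>b. b \<in> Obj Y \<Longrightarrow> Comp Y (r b) (s b) = Ide Y b" by metis
  show ?thesis
  proof (rule ff_precompI[OF TF])
    \<comment> \<open>Naturality at the section \<open>s b\<close> leaves no freedom for the
      component at \<open>b\<close>; \<open>\<Omega>\<close> below is defined by the same
      formula.\<close>
    have rec: "\<Omega> b = Comp Z (FArr H' (r b)) (Comp Z (\<Omega> (FObj T (c b))) (FArr H (s b)))"
      if \<Omega>: "is_nat Y Z H H' \<Omega>" and b: "b \<in> Obj Y" for H H' \<Omega> b
    proof -
      note H' = nat_functors(2)[OF \<Omega>]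
      have "FArr H' (Comp Y (r b) (s b)) = Ide Z (FObj H' b)"
        using functor_Ide[OF H' b] rs[OF b] by simp
      then show ?thesis
        using nat_comm[OF \<Omega> s[OF b]] functor_Comp[OF H' s[OF b] r[OF b]]
          section_cancel[OF Z functor_hom[OF H' s[OF b]] functor_hom[OF H' r[OF b]] _ nat_hom[OF \<Omega> b]] by simp
    qed
    show "\<Omega> b = \<Omega>' b" if \<Omega>: "is_nat Y Z H H' \<Omega>" "is_nat Y Z H H' \<Omega>'"
      and "\<And>a. a \<in> Obj X \<Longrightarrow> \<Omega> (FObj T a) = \<Omega>' (FObj T a)" and b: "b \<in> Obj Y" for H H' \<Omega> \<Omega>' b
      using rec[OF \<Omega>(1) b] rec[OF \<Omega>(2) b] that(3)[OF c[OF b]] by simp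
    fix H H' \<omega> assume H: "is_functor Y Z H" and H': "is_functor Y Z H'"
      and \<omega>: "is_nat X Z (functor_comp X H T) (functor_comp X H' T) \<omega>"
    have \<omega>h: "\<omega> a \<in> hom Z (FObj H (FObj T a)) (FObj H' (FObj T a))" if "a \<in> Obj X" for a
      using nat_hom[OF \<omega> that] that by (simp add: functor_comp_simps)
    \<comment> \<open>Naturality of \<open>\<omega>\<close> concerns arrows of \<open>X\<close>.
      Fullness of \<open>T\<close> extends it to all arrows of \<open>Y\<close> between image
      objects, including the composites through chosen retracts.\<close>
    have \<omega>c: "Comp Z (\<omega> a') (FArr H h) = Comp Z (FArr H' h) (\<omega> a)"
      if a: "a \<in> Obj X" "a' \<in> Obj X" and h: "h \<in> hom Y (FObj T a) (FObj T a')" for a a' h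
    proof -
      obtain k where "k \<in> hom X a a'" "FArr T k = h" using ff_full[OF T' a h] by blast
      then show ?thesis using nat_comm[OF \<omega>] homD(1) by (metis functor_comp_simps(2))
    qed
    define \<Omega> where "\<Omega> = (\<lambda>b\<in>Obj Y. Comp Z (FArr H' (r b)) (Comp Z (\<omega> (c b)) (FArr H (s b))))"
    \<comment> \<open>Sliding \<open>\<omega>\<close> along an arrow between two image objects
      compares the formulas for different retracts. It yields both naturality of
      \<open>\<Omega>\<close> and its agreement with \<open>\<omega>\<close>.\<close>
    have step: "Comp Z (Comp Z (FArr H' f) (\<omega> a')) (FArr H h) = Comp Z (FArr H' (Comp Y f h)) (\<omega> a)"
      if a: "a \<in> Obj X" "a' \<in> Obj X" and h: "h \<in> hom Y (FObj T a) (FObj T a')"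
        and f: "f \<in> hom Y (FObj T a') b" for a a' f h b
    proof -
      have "Comp Z (Comp Z (FArr H' f) (\<omega> a')) (FArr H h) = Comp Z (FArr H' f) (Comp Z (FArr H' h) (\<omega> a))"
        using Comp_assoc[OF Z functor_hom[OF H h] \<omega>h[OF a(2)] functor_hom[OF H' f]] \<omega>c[OF a h] by simp
      also have "\<dots> = Comp Z (FArr H' (Comp Y f h)) (\<omega> a)"
        using Comp_assoc[OF Z \<omega>h[OF a(1)] functor_hom[OF H' h] functor_hom[OF H' f]] functor_Comp[OF H' h f] by simp
      finally show ?thesis .
    qed
    have "is_nat Y Z H H' \<Omega>"
    proof (rule is_natI[OF H H'])
      show "\<Omega> b \<in> hom Z (FObj H b) (FObj H' b)" if b: "b \<in> Obj Y" for b
        using b Comp_hom[OF Z Comp_hom[OF Z functor_hom[OF H s[OF b]] \<omega>h[OF c[OF b]]] functor_hom[OF H' r[OF b]]]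
        by (simp add: \<Omega>_def)
      fix f a b assume f: "f \<in> hom Y a b"
      note ab = hom_Obj[OF Y f]
      note Hs = functor_hom[OF H s[OF ab(1)]] functor_hom[OF H s[OF ab(2)]]
      note Hr = functor_hom[OF H' r[OF ab(1)]] functor_hom[OF H' r[OF ab(2)]]
      note Hf = functor_hom[OF H f] functor_hom[OF H' f]
      note w = \<omega>h[OF c[OF ab(1)]] \<omega>h[OF c[OF ab(2)]]
      define h where "h = Comp Y (s b) (Comp Y f (r a))"
      have h: "h \<in> hom Y (FObj T (c a)) (FObj T (c b))"
        unfolding h_def by (rule Comp_hom[OF Y Comp_hom[OF Y r[OF ab(1)] f] s[OF ab(2)]])
      have hs: "Comp Y h (s a) = Comp Y (s b) f"
        using Comp_assoc[OF Y s[OF ab(1)] Comp_hom[OF Y r[OF ab(1)] f] s[OF ab(2)]]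
          section_cancel'[OF Y s[OF ab(1)] r[OF ab(1)] rs[OF ab(1)] f] by (simp add: h_def)
      have rh: "Comp Y (r b) h = Comp Y f (r a)"
        unfolding h_def by (rule section_cancel[OF Y s[OF ab(2)] r[OF ab(2)] rs[OF ab(2)] Comp_hom[OF Y r[OF ab(1)] f]])
      have "Comp Z (\<Omega> b) (FArr H f) = Comp Z (Comp Z (FArr H' (r b)) (\<omega> (c b))) (Comp Z (FArr H (s b)) (FArr H f))"
        using ab homD[OF Hs(2)] homD[OF Hr(2)] homD[OF Hf(1)] homD[OF w(2)] by (simp add: \<Omega>_def Arr_rules[OF Z])
      also have "\<dots> = Comp Z (Comp Z (FArr H' (r b)) (\<omega> (c b))) (Comp Z (FArr H h) (FArr H (s a)))"
        using functor_Comp[OF H f s[OF ab(2)]] functor_Comp[OF H s[OF ab(1)] h] hs by simp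
      also have "\<dots> = Comp Z (Comp Z (Comp Z (FArr H' (r b)) (\<omega> (c b))) (FArr H h)) (FArr H (s a))"
        using Comp_assoc[OF Z Hs(1) functor_hom[OF H h] Comp_hom[OF Z w(2) Hr(2)]] by simp
      also have "\<dots> = Comp Z (Comp Z (FArr H' (Comp Y f (r a))) (\<omega> (c a))) (FArr H (s a))"
        using step[OF c[OF ab(1)] c[OF ab(2)] h r[OF ab(2)]] rh by simp
      also have "\<dots> = Comp Z (FArr H' f) (\<Omega> a)"
        using ab homD[OF Hs(1)] homD[OF Hr(1)] homD[OF Hf(2)] homD[OF w(1)] functor_Comp[OF H' r[OF ab(1)] f]
        by (simp add: \<Omega>_def Arr_rules[OF Z])
      finally show "Comp Z (\<Omega> b) (FArr H f) = Comp Z (FArr H' f) (\<Omega> a)" .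
    qed (simp add: \<Omega>_def)
    moreover have "\<Omega> (FObj T a) = \<omega> a" if a: "a \<in> Obj X" for a
    proof -
      note b = functor_Obj[OF TF a]
      have "\<Omega> (FObj T a) = Comp Z (Comp Z (FArr H' (r (FObj T a))) (\<omega> (c (FObj T a)))) (FArr H (s (FObj T a)))"
        using b Comp_assoc[OF Z functor_hom[OF H s[OF b]] \<omega>h[OF c[OF b]] functor_hom[OF H' r[OF b]]]
        by (simp add: \<Omega>_def)
      also have "\<dots> = Comp Z (FArr H' (Comp Y (r (FObj T a)) (s (FObj T a)))) (\<omega> a)"
        by (rule step[OF a c[OF b] s[OF b] r[OF b]])
      also have "\<dots> = \<omega> a"
        using rs[OF b] functor_Ide[OF H' b] Comp_Ide_left[OF Z \<omega>h[OF a]] by simp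
      finally show ?thesis .
    qed
    ultimately show "\<exists>\<Omega>. is_nat Y Z H H' \<Omega> \<and> (\<forall>a\<in>Obj X. \<Omega> (FObj T a) = \<omega> a)" by blast
  qed
qed

section \<open>Splitting idempotents and extending functors\<close>

definition splits_idempotents :: "('o, 'm) category \<Rightarrow> bool" where
  "splits_idempotents Z \<longleftrightarrow> is_category Z \<and>
     (\<forall>a e. e \<in> hom Z a a \<longrightarrow> Comp Z e e = e \<longrightarrow>
        (\<exists>b. \<exists>s\<in>hom Z b a. \<exists>r\<in>hom Z a b. Comp Z r s = Ide Z b \<and> Comp Z s r = e))"

text \<open>The idempotent of \<open>b\<close> on \<open>T (c b)\<close> lifts to an idempotent
  \<open>e b\<close> on \<open>c b\<close>. Any extension of \<open>P\<close> must send
  \<open>b\<close> to a splitting of \<open>P (e b)\<close>, so \<open>Q\<close> is assembled from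
  chosen splittings.\<close>

lemma retract_dense_ess_surj_precomp:
  assumes T: "retract_dense X Y T" and split: "splits_idempotents Z"
  shows "restriction_ess_surj X Y T Z"
proof -
  have T': "fully_faithful X Y T" using T by (simp add: retract_dense_def)
  note TF = ff_functor[OF T']
  note X = functor_cats(1)[OF TF] and Y = functor_cats(2)[OF TF]
  have Z: "is_category Z" using split by (simp add: splits_idempotents_def)
  have "\<forall>b\<in>Obj Y. \<exists>c s r. c \<in> Obj X \<and> s \<in> hom Y b (FObj T c) \<and> r \<in> hom Y (FObj T c) b \<and> Comp Y r s = Ide Y b"
    using T unfolding retract_dense_def retract_def by blast
  then obtain c s r where c: "\<And>b. b \<in> Obj Y \<Longrightarrow> c b \<in> Obj X"
    and s: "\<And>b. b \<in> Obj Y \<Longrightarrow> s b \<in> hom Y b (FObj T (c b))"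
    and r: "\<And>b. b \<in> Obj Y \<Longrightarrow> r b \<in> hom Y (FObj T (c b)) b"
    and rs: "\<And>b. b \<in> Obj Y \<Longrightarrow> Comp Y (r b) (s b) = Ide Y b" by metis
  have sfr: "Comp Y (s b) (Comp Y f (r a)) \<in> hom Y (FObj T (c a)) (FObj T (c b))" if f: "f \<in> hom Y a b" for f a b
    using hom_Obj[OF Y f] Comp_hom[OF Y Comp_hom[OF Y r f] s] by blast
  \<comment> \<open>\<open>t f\<close> lifts \<open>s f r\<close> through \<open>T\<close>. It
    respects composition, but it is not a functor: identities go to the idempotents
    \<open>e b\<close>, and this defect is what splitting repairs.\<close>
  define t where "t f = (SOME k. k \<in> hom X (c (Dom Y f)) (c (Cod Y f)) \<and>
      FArr T k = Comp Y (s (Cod Y f)) (Comp Y f (r (Dom Y f))))" for f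
  have t: "t f \<in> hom X (c a) (c b) \<and> FArr T (t f) = Comp Y (s b) (Comp Y f (r a))" if f: "f \<in> hom Y a b" for f a b
  proof -
    have "\<exists>k. k \<in> hom X (c a) (c b) \<and> FArr T k = Comp Y (s b) (Comp Y f (r a))"
      using ff_full[OF T' c[OF hom_Obj(1)[OF Y f]] c[OF hom_Obj(2)[OF Y f]] sfr[OF f]] by metis
    from someI_ex[OF this] show ?thesis using homD[OF f] by (simp add: t_def)
  qed
  note th = conjunct1[OF t] and Tt = conjunct2[OF t]
  have tcomp: "t (Comp Y g f) = Comp X (t g) (t f)" if f: "f \<in> hom Y a b" and g: "g \<in> hom Y b d" for f g a b d
  proof (rule ff_faithful[OF T' th[OF Comp_hom[OF Y f g]] Comp_hom[OF X th[OF f] th[OF g]]])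
    have abd: "a \<in> Obj Y" "b \<in> Obj Y" "d \<in> Obj Y" using hom_Obj[OF Y f] hom_Obj[OF Y g] by auto
    have "FArr T (Comp X (t g) (t f)) = Comp Y (s d) (Comp Y g (Comp Y (r b) (Comp Y (s b) (Comp Y f (r a)))))"
      using functor_Comp[OF TF th[OF f] th[OF g]] homD[OF f] homD[OF g] homD[OF r[OF abd(1)]] homD[OF r[OF abd(2)]]
        homD[OF s[OF abd(2)]] homD[OF s[OF abd(3)]] by (simp add: Tt[OF f] Tt[OF g] Arr_rules[OF Y])
    also have "\<dots> = FArr T (t (Comp Y g f))"
      using section_cancel[OF Y s[OF abd(2)] r[OF abd(2)] rs[OF abd(2)] Comp_hom[OF Y r[OF abd(1)] f]]
        Tt[OF Comp_hom[OF Y f g]] Comp_assoc[OF Y r[OF abd(1)] f g] by simp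
    finally show "FArr T (t (Comp Y g f)) = FArr T (Comp X (t g) (t f))" by simp
  qed
  define e where "e b = t (Ide Y b)" for b
  have e: "e b \<in> hom X (c b) (c b)" if "b \<in> Obj Y" for b using th[OF Ide_hom[OF Y that]] by (simp add: e_def)
  have te: "Comp X (t f) (e a) = t f" "Comp X (e b) (t f) = t f" if f: "f \<in> hom Y a b" for f a b
    using tcomp[OF Ide_hom[OF Y hom_Obj(1)[OF Y f]] f] tcomp[OF f Ide_hom[OF Y hom_Obj(2)[OF Y f]]]
      Comp_Ide_left[OF Y f] Comp_Ide_right[OF Y f] by (simp_all add: e_def)
  have ee: "Comp X (e b) (e b) = e b" if "b \<in> Obj Y" for b
    using te(1)[OF Ide_hom[OF Y that]] by (simp add: e_def)
  show ?thesis
  proof (rule ess_surj_precompI[OF TF])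
    fix P assume P: "is_functor X Z P"
    have "\<forall>b\<in>Obj Y. \<exists>q \<sigma> \<rho>. \<sigma> \<in> hom Z q (FObj P (c b)) \<and> \<rho> \<in> hom Z (FObj P (c b)) q \<and>
        Comp Z \<rho> \<sigma> = Ide Z q \<and> Comp Z \<sigma> \<rho> = FArr P (e b)"
    proof
      fix b assume b: "b \<in> Obj Y"
      have "Comp Z (FArr P (e b)) (FArr P (e b)) = FArr P (e b)"
        using functor_Comp[OF P e[OF b] e[OF b]] ee[OF b] by simp
      then show "\<exists>q \<sigma> \<rho>. \<sigma> \<in> hom Z q (FObj P (c b)) \<and> \<rho> \<in> hom Z (FObj P (c b)) q \<and>
        Comp Z \<rho> \<sigma> = Ide Z q \<and> Comp Z \<sigma> \<rho> = FArr P (e b)"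
        using split functor_hom[OF P e[OF b]] unfolding splits_idempotents_def by blast
    qed
    then obtain q \<sigma> \<rho> where \<sigma>: "\<And>b. b \<in> Obj Y \<Longrightarrow> \<sigma> b \<in> hom Z (q b) (FObj P (c b))"
      and \<rho>: "\<And>b. b \<in> Obj Y \<Longrightarrow> \<rho> b \<in> hom Z (FObj P (c b)) (q b)"
      and \<rho>\<sigma>: "\<And>b. b \<in> Obj Y \<Longrightarrow> Comp Z (\<rho> b) (\<sigma> b) = Ide Z (q b)"
      and \<sigma>\<rho>: "\<And>b. b \<in> Obj Y \<Longrightarrow> Comp Z (\<sigma> b) (\<rho> b) = FArr P (e b)" by metis
    \<comment> \<open>A pair \<open>\<sigma> \<rho>\<close> inside a composite equals
      \<open>P (e b)\<close> and is swallowed by the neighbouring arrow, because \<open>t f\<close>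
      and \<open>r0\<close> already absorb \<open>e\<close>.\<close>
    have absorb: "Comp Z (FArr P k) (Comp Z (\<sigma> b) (Comp Z (\<rho> b) g)) = Comp Z (FArr P (Comp X k (e b))) g"
      if b: "b \<in> Obj Y" and k: "k \<in> hom X (c b) d" and g: "g \<in> hom Z x (FObj P (c b))" for b k d g x
    proof -
      have "Comp Z (FArr P k) (Comp Z (\<sigma> b) (Comp Z (\<rho> b) g)) = Comp Z (FArr P k) (Comp Z (FArr P (e b)) g)"
        using Comp_assoc[OF Z g \<rho>[OF b] \<sigma>[OF b]] \<sigma>\<rho>[OF b] by simp
      then show ?thesis
        using Comp_assoc[OF Z g functor_hom[OF P e[OF b]] functor_hom[OF P k]] functor_Comp[OF P e[OF b] k] by simp
    qed
    define Q where "Q = \<lparr>FObj = restrict q (Obj Y),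
      FArr = (\<lambda>f\<in>Arr Y. Comp Z (\<rho> (Cod Y f)) (Comp Z (FArr P (t f)) (\<sigma> (Dom Y f))))\<rparr>"
    have Qf: "FArr Q f = Comp Z (\<rho> b) (Comp Z (FArr P (t f)) (\<sigma> a))" if "f \<in> hom Y a b" for f a b
      using homD[OF that] by (simp add: Q_def)
    have Q: "is_functor Y Z Q"
    proof (rule is_functorI[OF Y Z])
      show "FObj Q a \<in> Obj Z" if "a \<in> Obj Y" for a
        using hom_Obj(1)[OF Z \<sigma>[OF that]] that by (simp add: Q_def)
      show "FArr Q f \<in> hom Z (FObj Q a) (FObj Q b)" if f: "f \<in> hom Y a b" for f a b
        using hom_Obj[OF Y f] Comp_hom[OF Z Comp_hom[OF Z \<sigma> functor_hom[OF P th[OF f]]] \<rho>] Qf[OF f]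
        by (simp add: Q_def)
      show "FArr Q (Ide Y a) = Ide Z (FObj Q a)" if a: "a \<in> Obj Y" for a
      proof -
        have "FArr Q (Ide Y a) = Comp Z (\<rho> a) (Comp Z (Comp Z (\<sigma> a) (\<rho> a)) (\<sigma> a))"
          using Qf[OF Ide_hom[OF Y a]] \<sigma>\<rho>[OF a] by (simp add: e_def)
        also have "\<dots> = Comp Z (\<rho> a) (Comp Z (\<sigma> a) (Comp Z (\<rho> a) (\<sigma> a)))"
          using Comp_assoc[OF Z \<sigma>[OF a] \<rho>[OF a] \<sigma>[OF a]] by simp
        also have "\<dots> = Ide Z (q a)"
          using \<rho>\<sigma>[OF a] Comp_Ide_right[OF Z \<sigma>[OF a]] by simp
        finally show ?thesis using a by (simp add: Q_def)
      qed
      fix f g a b d assume f: "f \<in> hom Y a b" and g: "g \<in> hom Y b d"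
      have abd: "a \<in> Obj Y" "b \<in> Obj Y" "d \<in> Obj Y" using hom_Obj[OF Y f] hom_Obj[OF Y g] by auto
      note Pf = functor_hom[OF P th[OF f]] and Pg = functor_hom[OF P th[OF g]]
      have "Comp Z (FArr Q g) (FArr Q f)
          = Comp Z (\<rho> d) (Comp Z (FArr P (t g)) (Comp Z (\<sigma> b) (Comp Z (\<rho> b) (Comp Z (FArr P (t f)) (\<sigma> a)))))"
        using homD[OF Pf] homD[OF Pg] homD[OF \<rho>[OF abd(2)]] homD[OF \<rho>[OF abd(3)]]
          homD[OF \<sigma>[OF abd(1)]] homD[OF \<sigma>[OF abd(2)]] by (simp add: Qf[OF f] Qf[OF g] Arr_rules[OF Z])
      also have "\<dots> = Comp Z (\<rho> d) (Comp Z (FArr P (t g)) (Comp Z (FArr P (t f)) (\<sigma> a)))"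
        using absorb[OF abd(2) th[OF g] Comp_hom[OF Z \<sigma>[OF abd(1)] Pf]] te(1)[OF g] by simp
      also have "\<dots> = FArr Q (Comp Y g f)"
        using Qf[OF Comp_hom[OF Y f g]] tcomp[OF f g] functor_Comp[OF P th[OF f] th[OF g]]
          Comp_assoc[OF Z \<sigma>[OF abd(1)] Pf Pg] by simp
      finally show "FArr Q (Comp Y g f) = Comp Z (FArr Q g) (FArr Q f)" by simp
    qed (auto simp: Q_def)
    \<comment> \<open>At an object \<open>T a\<close> the section and the retraction lift to
      \<open>X\<close>. There \<open>e (T a)\<close> splits through \<open>a\<close> before
      \<open>P\<close> is applied.\<close>
    have "\<forall>a\<in>Obj X. \<exists>s0 r0. s0 \<in> hom X a (c (FObj T a)) \<and> r0 \<in> hom X (c (FObj T a)) a \<and>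
       FArr T s0 = s (FObj T a) \<and> FArr T r0 = r (FObj T a)"
    proof
      fix a assume a: "a \<in> Obj X"
      note b = functor_Obj[OF TF a]
      show "\<exists>s0 r0. s0 \<in> hom X a (c (FObj T a)) \<and> r0 \<in> hom X (c (FObj T a)) a \<and>
       FArr T s0 = s (FObj T a) \<and> FArr T r0 = r (FObj T a)"
        using ff_full[OF T' a c[OF b] s[OF b]] ff_full[OF T' c[OF b] a r[OF b]] by metis
    qed
    then obtain s0 r0 where s0: "\<And>a. a \<in> Obj X \<Longrightarrow> s0 a \<in> hom X a (c (FObj T a))"
      and r0: "\<And>a. a \<in> Obj X \<Longrightarrow> r0 a \<in> hom X (c (FObj T a)) a"
      and Ts0: "\<And>a. a \<in> Obj X \<Longrightarrow> FArr T (s0 a) = s (FObj T a)"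
      and Tr0: "\<And>a. a \<in> Obj X \<Longrightarrow> FArr T (r0 a) = r (FObj T a)" by metis
    have rs0: "Comp X (r0 a) (s0 a) = Ide X a" if a: "a \<in> Obj X" for a
      using ff_reflects_section[OF T' s0[OF a] r0[OF a]] Ts0[OF a] Tr0[OF a] rs[OF functor_Obj[OF TF a]] by simp
    have tT: "t (FArr T f) = Comp X (s0 b) (Comp X f (r0 a))" if f: "f \<in> hom X a b" for f a b
    proof -
      note ab = hom_Obj[OF X f] and Tf = functor_hom[OF TF f]
      note fr = Comp_hom[OF X r0[OF ab(1)] f]
      show ?thesis
      proof (rule ff_faithful[OF T' th[OF Tf] Comp_hom[OF X fr s0[OF ab(2)]]])
        show "FArr T (t (FArr T f)) = FArr T (Comp X (s0 b) (Comp X f (r0 a)))"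
          using functor_Comp[OF TF fr s0[OF ab(2)]] functor_Comp[OF TF r0[OF ab(1)] f] Tt[OF Tf] ab
          by (simp add: Ts0 Tr0)
      qed
    qed
    have e0: "e (FObj T a) = Comp X (s0 a) (r0 a)" if a: "a \<in> Obj X" for a
      using tT[OF Ide_hom[OF X a]] functor_Ide[OF TF a] Comp_Ide_left[OF X r0[OF a]] by (simp add: e_def)
    \<comment> \<open>\<open>P a\<close> and \<open>q (T a)\<close> both split
      \<open>P (e (T a))\<close>; this is the canonical comparison between two splittings of one
      idempotent, hence an isomorphism.\<close>
    define \<alpha> where "\<alpha> = (\<lambda>a\<in>Obj X. Comp Z (FArr P (r0 a)) (\<sigma> (FObj T a)))"
    have \<alpha>h: "\<alpha> a \<in> hom Z (q (FObj T a)) (FObj P a)" if a: "a \<in> Obj X" for a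
      using Comp_hom[OF Z \<sigma>[OF functor_Obj[OF TF a]] functor_hom[OF P r0[OF a]]] a by (simp add: \<alpha>_def)
    have "is_nat X Z (functor_comp X Q T) P \<alpha>"
    proof (rule is_natI[OF functor_comp[OF TF Q] P])
      show "\<alpha> a \<in> hom Z (FObj (functor_comp X Q T) a) (FObj P a)" if a: "a \<in> Obj X" for a
        using \<alpha>h[OF a] a functor_Obj[OF TF a] by (simp add: functor_comp_simps Q_def)
      fix f a b assume f: "f \<in> hom X a b"
      note ab = hom_Obj[OF X f] and Tf = functor_hom[OF TF f]
      note Tab = functor_Obj[OF TF ab(1)] functor_Obj[OF TF ab(2)]
      note fr = Comp_hom[OF X r0[OF ab(1)] f]
      note Pt = functor_hom[OF P th[OF Tf]]
      have re: "Comp X (r0 b) (e (FObj T b)) = r0 b"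
        using section_cancel[OF X s0[OF ab(2)] r0[OF ab(2)] rs0[OF ab(2)] r0[OF ab(2)]] e0[OF ab(2)] by simp
      have rt: "Comp X (r0 b) (t (FArr T f)) = Comp X f (r0 a)"
        using section_cancel[OF X s0[OF ab(2)] r0[OF ab(2)] rs0[OF ab(2)] fr] tT[OF f] by simp
      have "Comp Z (\<alpha> b) (FArr (functor_comp X Q T) f)
          = Comp Z (FArr P (r0 b)) (Comp Z (\<sigma> (FObj T b)) (Comp Z (\<rho> (FObj T b)) (Comp Z (FArr P (t (FArr T f))) (\<sigma> (FObj T a)))))"
        using ab homD(1)[OF f] homD[OF functor_hom[OF P r0[OF ab(2)]]] homD[OF \<sigma>[OF Tab(1)]] homD[OF \<sigma>[OF Tab(2)]]
          homD[OF \<rho>[OF Tab(2)]] homD[OF Pt]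
        by (simp add: \<alpha>_def functor_comp_simps Qf[OF Tf] Arr_rules[OF Z])
      also have "\<dots> = Comp Z (FArr P (r0 b)) (Comp Z (FArr P (t (FArr T f))) (\<sigma> (FObj T a)))"
        using absorb[OF Tab(2) r0[OF ab(2)] Comp_hom[OF Z \<sigma>[OF Tab(1)] Pt]] re by simp
      also have "\<dots> = Comp Z (FArr P (Comp X f (r0 a))) (\<sigma> (FObj T a))"
        using Comp_assoc[OF Z \<sigma>[OF Tab(1)] Pt functor_hom[OF P r0[OF ab(2)]]] functor_Comp[OF P th[OF Tf] r0[OF ab(2)]] rt by simp
      also have "\<dots> = Comp Z (FArr P f) (\<alpha> a)"
        using ab Comp_assoc[OF Z \<sigma>[OF Tab(1)] functor_hom[OF P r0[OF ab(1)]] functor_hom[OF P f]]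
          functor_Comp[OF P r0[OF ab(1)] f] by (simp add: \<alpha>_def)
      finally show "Comp Z (\<alpha> b) (FArr (functor_comp X Q T) f) = Comp Z (FArr P f) (\<alpha> a)" .
    qed (simp add: \<alpha>_def)
    moreover have "is_iso Z (\<alpha> a)" if a: "a \<in> Obj X" for a
    proof -
      note b = functor_Obj[OF TF a]
      note Ps = functor_hom[OF P s0[OF a]] and Pr = functor_hom[OF P r0[OF a]]
      have re: "Comp X (r0 a) (e (FObj T a)) = r0 a"
        using section_cancel[OF X s0[OF a] r0[OF a] rs0[OF a] r0[OF a]] e0[OF a] by simp
      have 1: "Comp Z (Comp Z (\<rho> (FObj T a)) (FArr P (s0 a))) (\<alpha> a) = Ide Z (q (FObj T a))"
      proof -
        have "Comp Z (Comp Z (\<rho> (FObj T a)) (FArr P (s0 a))) (\<alpha> a)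
            = Comp Z (\<rho> (FObj T a)) (Comp Z (FArr P (Comp X (s0 a) (r0 a))) (\<sigma> (FObj T a)))"
          using a homD[OF Ps] homD[OF Pr] homD[OF \<rho>[OF b]] homD[OF \<sigma>[OF b]] functor_Comp[OF P r0[OF a] s0[OF a]]
          by (simp add: \<alpha>_def Arr_rules[OF Z])
        also have "\<dots> = FArr Q (Ide Y (FObj T a))"
          using Qf[OF Ide_hom[OF Y b]] e0[OF a] by (simp add: e_def)
        also have "\<dots> = Ide Z (q (FObj T a))" using functor_Ide[OF Q b] b by (simp add: Q_def)
        finally show ?thesis .
      qed
      have 2: "Comp Z (\<alpha> a) (Comp Z (\<rho> (FObj T a)) (FArr P (s0 a))) = Ide Z (FObj P a)"
        using a homD[OF Ps] homD[OF Pr] homD[OF \<rho>[OF b]] homD[OF \<sigma>[OF b]] absorb[OF b r0[OF a] Ps] re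
          functor_Comp[OF P s0[OF a] r0[OF a]] rs0[OF a] functor_Ide[OF P a]
        by (simp add: \<alpha>_def Arr_rules[OF Z])
      show ?thesis by (rule isoI[OF \<alpha>h[OF a] Comp_hom[OF Z Ps \<rho>[OF b]] 1 2])
    qed
    ultimately have "is_nat_iso X Z (functor_comp X Q T) P \<alpha>" by (simp add: is_nat_iso_def)
    then show "\<exists>Q \<alpha>. is_functor Y Z Q \<and> is_nat_iso X Z (functor_comp X Q T) P \<alpha>" using Q by blast
  qed
qed


section \<open>Small test categories\<close>

lemma functor_into_full_subcat:
  assumes H: "is_functor Y Z H" and S: "\<And>b. b \<in> Obj Y \<Longrightarrow> FObj H b \<in> S"
  shows "is_functor Y (full_subcat Z S) H"
proof (rule is_functorI)
  show "is_category (full_subcat Z S)" by (rule full_subcat_category[OF functor_cats(2)[OF H]])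
  show "FArr H f \<in> hom (full_subcat Z S) (FObj H a) (FObj H b)" if "f \<in> hom Y a b" for f a b
    using functor_hom[OF H that] hom_Obj[OF functor_cats(1)[OF H] that] S by (simp add: full_subcat_hom)
qed (use H S in \<open>auto simp: functor_cats functor_ext functor_Obj functor_Ide intro: functor_Comp\<close>)

lemma functor_from_full_subcat:
  assumes Z: "is_category Z" and H: "is_functor Y (full_subcat Z S) H"
  shows "is_functor Y Z H"
proof (rule is_functorI[OF functor_cats(1)[OF H] Z])
  show "FArr H f \<in> hom Z (FObj H a) (FObj H b)" if "f \<in> hom Y a b" for f a b
    using functor_hom[OF H that] by (simp add: full_subcat_hom)
  show "FObj H a \<in> Obj Z" if "a \<in> Obj Y" for a using functor_Obj[OF H that] by simp
  show "FArr H (Ide Y a) = Ide Z (FObj H a)" if "a \<in> Obj Y" for a using functor_Ide[OF H that] by simp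
  show "FArr H (Comp Y g f) = Comp Z (FArr H g) (FArr H f)" if "f \<in> hom Y a b" "g \<in> hom Y b c" for f g a b c
    using functor_Comp[OF H that] by simp
qed (use functor_ext[OF H] in auto)

lemma nat_full_subcat:
  assumes Z: "is_category Z" and H: "is_functor Y (full_subcat Z S) H" "is_functor Y (full_subcat Z S) H'"
  shows "is_nat Y (full_subcat Z S) H H' \<alpha> \<longleftrightarrow> is_nat Y Z H H' \<alpha>"
proof -
  have "FObj H a \<in> S \<and> FObj H' a \<in> S" if "a \<in> Obj Y" for a
    using functor_Obj[OF H(1) that] functor_Obj[OF H(2) that] by simp
  then show ?thesis
    using H functor_from_full_subcat[OF Z H(1)] functor_from_full_subcat[OF Z H(2)]
    by (simp add: is_nat_def full_subcat_hom)
qed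

text \<open>Isomorphism instead of equivalence: the universal property of the codescent category
  demands equalities of functors, and only strict inverses carry these over.\<close>

definition inverse_functors where
  "inverse_functors X Y F G \<longleftrightarrow> is_functor X Y F \<and> is_functor Y X G \<and>
     functor_comp X G F = functor_id X \<and> functor_comp Y F G = functor_id Y"

lemma inverse_functors_sym: "inverse_functors X Y F G \<Longrightarrow> inverse_functors Y X G F"
  by (auto simp: inverse_functors_def)

lemma inverse_functors_apply:
  assumes "inverse_functors X Y F G"
  shows "is_functor X Y F"
    "a \<in> Obj X \<Longrightarrow> FObj G (FObj F a) = a" "f \<in> Arr X \<Longrightarrow> FArr G (FArr F f) = f"
proof -
  have eq: "functor_comp X G F = functor_id X" using assms by (simp add: inverse_functors_def)
  show "is_functor X Y F" using assms by (simp add: inverse_functors_def)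
  show "FObj G (FObj F a) = a" if "a \<in> Obj X"
    using arg_cong[OF eq, of "\<lambda>H. FObj H a"] that by (simp add: functor_comp_simps functor_id_simps)
  show "FArr G (FArr F f) = f" if "f \<in> Arr X"
    using arg_cong[OF eq, of "\<lambda>H. FArr H f"] that by (simp add: functor_comp_simps functor_id_simps)
qed

lemma inverse_functors_ff:
  assumes "inverse_functors X Y F G"
  shows "fully_faithful X Y F"
proof -
  note 1 = inverse_functors_apply[OF assms] and 2 = inverse_functors_apply[OF inverse_functors_sym[OF assms]]
  show ?thesis
  proof (rule fully_faithfulI[OF 1(1)])
    fix a b
    show "f = g" if "f \<in> hom X a b" "g \<in> hom X a b" "FArr F f = FArr F g" for f g
      using arg_cong[OF that(3), of "FArr G"] by (simp only: 1(3)[OF homD(1)[OF that(1)]] 1(3)[OF homD(1)[OF that(2)]])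
    fix h assume ab: "a \<in> Obj X" "b \<in> Obj X" and h: "h \<in> hom Y (FObj F a) (FObj F b)"
    show "\<exists>f\<in>hom X a b. FArr F f = h"
    proof (rule bexI)
      show "FArr F (FArr G h) = h" by (rule 2(3)[OF homD(1)[OF h]])
      show "FArr G h \<in> hom X a b" using functor_hom[OF 2(1) h] by (simp only: 1(2)[OF ab(1)] 1(2)[OF ab(2)])
    qed
  qed
qed

text \<open>Structure is transported along injective codings of objects and arrows. This is the
  passage from arbitrary types to \<open>'u\<close>, where the universal properties in the
  definitions are stated.\<close>

lemma small_transport:
  fixes J :: "('o, 'm) category"
  assumes J: "is_category J" and sm: "small TYPE('u) (Obj J)" "small TYPE('u) (Arr J)"
  obtains J' :: "('u, 'u) category" and F G where "small_category J'" "inverse_functors J J' F G"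
proof -
  obtain o' :: "'o \<Rightarrow> 'u" where o: "inj_on o' (Obj J)" using small_encoding[OF sm(1)] by blast
  obtain m' :: "'m \<Rightarrow> 'u" where m: "inj_on m' (Arr J)" using small_encoding[OF sm(2)] by blast
  define io where "io = inv_into (Obj J) o'"
  define im where "im = inv_into (Arr J) m'"
  have io [simp]: "io (o' a) = a" if "a \<in> Obj J" for a using that o by (simp add: io_def)
  have im [simp]: "im (m' f) = f" if "f \<in> Arr J" for f using that m by (simp add: im_def)
  define J' :: "('u, 'u) category" where
    "J' = \<lparr>Obj = o' ` Obj J, Arr = m' ` Arr J, Dom = (\<lambda>f. o' (Dom J (im f))), Cod = (\<lambda>f. o' (Cod J (im f))),
      Ide = (\<lambda>a. m' (Ide J (io a))), Comp = (\<lambda>g f. m' (Comp J (im g) (im f)))\<rparr>"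
  have DC: "Dom J f \<in> Obj J" "Cod J f \<in> Obj J" if "f \<in> Arr J" for f
    using J that by (auto simp: is_category_def)
  have hom': "k \<in> hom J' x y \<longleftrightarrow> (\<exists>f a b. f \<in> hom J a b \<and> k = m' f \<and> x = o' a \<and> y = o' b)" for k x y
    by (auto simp: J'_def hom_def)
  have o_eq: "o' a = o' b \<longleftrightarrow> a = b" if "a \<in> Obj J" "b \<in> Obj J" for a b
    using o that by (auto dest: inj_onD)
  have Arr: "f \<in> Arr J" if "f \<in> hom J a b" for f a b by (rule homD(1)[OF that])
  note ob = hom_Obj[OF J]
  have J': "is_category J'"
  proof (rule is_categoryI)
    show "Ide J' x \<in> hom J' x x" if "x \<in> Obj J'" for x
    proof -
      obtain a where a: "a \<in> Obj J" "x = o' a" using \<open>x \<in> Obj J'\<close> by (auto simp: J'_def)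
      then have "Ide J' x = m' (Ide J a)" by (simp add: J'_def)
      then show ?thesis using Ide_hom[OF J a(1)] a(2) unfolding hom' by blast
    qed
    show "k \<in> hom J' x y \<Longrightarrow> x \<in> Obj J' \<and> y \<in> Obj J'" for k x y
      using ob by (auto simp: hom') (auto simp: J'_def)
    show "Comp J' k (Ide J' x) = k" "Comp J' (Ide J' y) k = k" if "k \<in> hom J' x y" for k x y
    proof -
      obtain f a b where f: "f \<in> hom J a b" "k = m' f" "x = o' a" "y = o' b" using \<open>k \<in> hom J' x y\<close> unfolding hom' by blast
      then show "Comp J' k (Ide J' x) = k" "Comp J' (Ide J' y) k = k"
        using ob[OF f(1)] Arr[OF f(1)] Comp_Ide_left[OF J f(1)] Comp_Ide_right[OF J f(1)]
          Arr[OF Ide_hom[OF J]] by (auto simp: J'_def)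
    qed
    fix k l x y z assume "k \<in> hom J' x y" "l \<in> hom J' y z"
    then obtain f a b g b' c where f: "f \<in> hom J a b" "k = m' f" "x = o' a" "y = o' b"
      and g: "g \<in> hom J b' c" "l = m' g" "y = o' b'" "z = o' c" unfolding hom' by blast
    \<comment> \<open>Composability of coded arrows only says that two codes agree; injectivity on
      objects turns this into equality of the objects.\<close>
    have "b' = b" using o_eq[OF ob(2)[OF f(1)] ob(1)[OF g(1)]] f(4) g(3) by simp
    then have gf: "Comp J g f \<in> hom J a c" using Comp_hom[OF J f(1)] g(1) by simp
    have kl: "Comp J' l k = m' (Comp J g f)" using Arr[OF f(1)] Arr[OF g(1)] f g by (simp add: J'_def)
    then show "Comp J' l k \<in> hom J' x z" using gf f g unfolding hom' by blast
    fix n w assume "n \<in> hom J' z w"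
    then obtain h c' d where h: "h \<in> hom J c' d" "n = m' h" "z = o' c'" "w = o' d" unfolding hom' by blast
    have "c' = c" using o_eq[OF ob(2)[OF g(1)] ob(1)[OF h(1)]] h(3) g(4) by simp
    then show "Comp J' n (Comp J' l k) = Comp J' (Comp J' n l) k"
      using kl Arr[OF f(1)] Arr[OF g(1)] Arr[OF h(1)] Arr[OF gf] f g h \<open>b' = b\<close>
        Arr[OF Comp_hom[OF J, of g b c h d]] Comp_assoc[OF J, of f a b g c h d] by (simp add: J'_def)
  qed
  have "small_category J'"
    using J' small_image[OF sm(1), where f = o'] small_image[OF sm(2), where f = m']
    by (simp add: small_category_def J'_def)
  moreover
  define F where "F = \<lparr>FObj = restrict o' (Obj J), FArr = restrict m' (Arr J)\<rparr>"
  define G where "G = \<lparr>FObj = restrict io (Obj J'), FArr = restrict im (Arr J')\<rparr>"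
  have F: "is_functor J J' F"
  proof (rule is_functorI[OF J J'])
    show "FArr F f \<in> hom J' (FObj F a) (FObj F b)" if "f \<in> hom J a b" for f a b
      using that ob[OF that] Arr[OF that] unfolding hom' by (auto simp: F_def)
    show "FArr F (Comp J g f) = Comp J' (FArr F g) (FArr F f)" if "f \<in> hom J a b" "g \<in> hom J b c" for f g a b c
      using Arr[OF that(1)] Arr[OF that(2)] Arr[OF Comp_hom[OF J that]] by (simp add: F_def J'_def)
    show "FArr F (Ide J a) = Ide J' (FObj F a)" if "a \<in> Obj J" for a
      using that Arr[OF Ide_hom[OF J that]] by (simp add: F_def J'_def)
  qed (auto simp: F_def J'_def)
  have G: "is_functor J' J G"
  proof (rule is_functorI[OF J' J])
    show "FArr G k \<in> hom J (FObj G x) (FObj G y)" if k: "k \<in> hom J' x y" for k x y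
    proof -
      obtain f a b where f: "f \<in> hom J a b" "k = m' f" "x = o' a" "y = o' b" using k unfolding hom' by blast
      then show ?thesis using ob[OF f(1)] Arr[OF f(1)] by (simp add: G_def J'_def)
    qed
    show "FArr G (Comp J' l k) = Comp J (FArr G l) (FArr G k)" if k: "k \<in> hom J' x y" and l: "l \<in> hom J' y z" for k l x y z
    proof -
      obtain f a b where f: "f \<in> hom J a b" "k = m' f" "x = o' a" "y = o' b" using k unfolding hom' by blast
      obtain g b' c where g: "g \<in> hom J b' c" "l = m' g" "y = o' b'" "z = o' c" using l unfolding hom' by blast
      have "b' = b" using o_eq[OF ob(2)[OF f(1)] ob(1)[OF g(1)]] f(4) g(3) by simp
      then have "Comp J g f \<in> Arr J" using Arr[OF Comp_hom[OF J f(1)]] g(1) by simp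
      then show ?thesis using f(2) g(2) Arr[OF f(1)] Arr[OF g(1)] by (simp add: G_def J'_def)
    qed
    show "FArr G (Ide J' x) = Ide J (FObj G x)" if "x \<in> Obj J'" for x
    proof -
      obtain a where a: "a \<in> Obj J" "x = o' a" using \<open>x \<in> Obj J'\<close> by (auto simp: J'_def)
      show ?thesis using a Arr[OF Ide_hom[OF J a(1)]] by (simp add: G_def J'_def)
    qed
  qed (auto simp: G_def J'_def)
  have "functor_comp J G F = functor_id J" "functor_comp J' F G = functor_id J'"
    by (auto simp: functor_comp_def functor_id_def F_def G_def J'_def intro!: restrict_ext)
  then have "inverse_functors J J' F G" using F G by (simp add: inverse_functors_def)
  ultimately show ?thesis using that by blast
qed

section \<open>Locally small categories and their small full subcategories\<close>

definition locally_small :: "'u itself \<Rightarrow> ('o, 'm) category \<Rightarrow> bool" where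
  "locally_small U Z \<longleftrightarrow> is_category Z \<and> (\<forall>a\<in>Obj Z. \<forall>b\<in>Obj Z. small U (hom Z a b))"

lemma small_locally_small: "small_category (Z :: ('u, 'u) category) \<Longrightarrow> locally_small TYPE('u) Z"
  by (auto simp: small_category_def locally_small_def hom_def elim: small_subset)

lemma locally_small_full_subcat:
  assumes u: "universe TYPE('u)" and Z: "locally_small TYPE('u) Z" and S: "small TYPE('u) S"
  shows "is_category (full_subcat Z S)" "small TYPE('u) (Obj (full_subcat Z S))"
    "small TYPE('u) (Arr (full_subcat Z S))"
proof -
  have Z': "is_category Z" using Z by (simp add: locally_small_def)
  then show "is_category (full_subcat Z S)" by (rule full_subcat_category)
  show ob: "small TYPE('u) (Obj (full_subcat Z S))" using small_subset[OF S] by simp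
  have "small TYPE('u) (\<Union>(a, b)\<in>(Obj Z \<inter> S) \<times> (Obj Z \<inter> S). hom Z a b)"
    using Z ob by (intro small_UN[OF u] small_Times[OF u]) (auto simp: locally_small_def)
  moreover have "Arr (full_subcat Z S) \<subseteq> (\<Union>(a, b)\<in>(Obj Z \<inter> S) \<times> (Obj Z \<inter> S). hom Z a b)"
    using Z' by (auto simp: full_subcat_def hom_def is_category_def)
  ultimately show "small TYPE('u) (Arr (full_subcat Z S))" by (rule small_subset)
qed

lemma lax_epi_ff_small:
  assumes f: "lax_epi TYPE('u) X Y f"
    and J: "is_category J" "small TYPE('u) (Obj J)" "small TYPE('u) (Arr J)"
  shows "restriction_ff X Y f J"
proof -
  obtain J' :: "('u, 'u) category" and F G where J': "small_category J'" "inverse_functors J J' F G"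
    using small_transport[OF J] by blast
  have f': "is_functor X Y f" and ff: "restriction_ff X Y f J'"
    using f J' by (simp_all add: lax_epi_def)
  show ?thesis by (rule ff_precomp_into_ff[OF f' inverse_functors_ff[OF J'(2)] ff])
qed

text \<open>A transformation involves two functors, whose values on the small set of objects of
  \<open>Y\<close> form a small set \<open>S\<close>. The hypothesis may enlarge \<open>S\<close> to
  some \<open>S'\<close>, which leaves room for closure conditions such as closure under
  subsets.\<close>

lemma ff_precomp_full_subcats:
  assumes u: "universe TYPE('u)" and f: "is_functor X Y f" and Y: "small TYPE('u) (Obj Y)" and Z: "is_category Z"
    and sub: "\<And>S. small TYPE('u) S \<Longrightarrow> S \<subseteq> Obj Z \<Longrightarrow> \<exists>S'. S \<subseteq> S' \<and>
      restriction_ff X Y f (full_subcat Z S')"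
  shows "restriction_ff X Y f Z"
proof -
  have img: "\<exists>S. is_functor Y (full_subcat Z S) H \<and> is_functor Y (full_subcat Z S) H' \<and>
      restriction_ff X Y f (full_subcat Z S)"
    if H: "is_functor Y Z H" and H': "is_functor Y Z H'" for H H'
  proof -
    define S where "S = FObj H ` Obj Y \<union> FObj H' ` Obj Y"
    have "small TYPE('u) S" unfolding S_def by (intro small_Un[OF u] small_image Y)
    moreover have "S \<subseteq> Obj Z" using functor_Obj[OF H] functor_Obj[OF H'] by (auto simp: S_def)
    ultimately obtain S' where S': "S \<subseteq> S'"
      "restriction_ff X Y f (full_subcat Z S')"
      using sub by blast
    have "is_functor Y (full_subcat Z S') H" "is_functor Y (full_subcat Z S') H'"
      by (rule functor_into_full_subcat[OF H], use S'(1) in \<open>auto simp: S_def\<close>)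
        (rule functor_into_full_subcat[OF H'], use S'(1) in \<open>auto simp: S_def\<close>)
    then show ?thesis using S'(2) by blast
  qed
  show ?thesis
  proof (rule ff_precompI[OF f])
    show "\<Omega> b = \<Omega>' b" if \<Omega>: "is_nat Y Z H H' \<Omega>" "is_nat Y Z H H' \<Omega>'"
      and eq: "\<And>a. a \<in> Obj X \<Longrightarrow> \<Omega> (FObj f a) = \<Omega>' (FObj f a)" for H H' \<Omega> \<Omega>' b
    proof -
      obtain S where S: "is_functor Y (full_subcat Z S) H" "is_functor Y (full_subcat Z S) H'"
        "restriction_ff X Y f (full_subcat Z S)"
        using img[OF nat_functors(1,2)[OF \<Omega>(1)]] by blast
      have \<Omega>': "is_nat Y (full_subcat Z S) H H' \<Omega>" "is_nat Y (full_subcat Z S) H H' \<Omega>'"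
        using \<Omega> nat_full_subcat[OF Z S(1,2)] by auto
      have "\<Omega> = \<Omega>'" by (rule ff_precomp_unique[OF S(3) \<Omega>' eq])
      then show ?thesis by simp
    qed
    fix H H' \<omega> assume H: "is_functor Y Z H" "is_functor Y Z H'"
      and \<omega>: "is_nat X Z (functor_comp X H f) (functor_comp X H' f) \<omega>"
    obtain S where S: "is_functor Y (full_subcat Z S) H" "is_functor Y (full_subcat Z S) H'"
      "restriction_ff X Y f (full_subcat Z S)"
      using img[OF H] by blast
    have "is_nat X (full_subcat Z S) (functor_comp X H f) (functor_comp X H' f) \<omega>"
      using nat_full_subcat[OF Z functor_comp[OF f S(1)] functor_comp[OF f S(2)]] \<omega> by simp
    then obtain \<Omega> where \<Omega>: "is_nat Y (full_subcat Z S) H H' \<Omega>" "\<And>a. a \<in> Obj X \<Longrightarrow> \<Omega> (FObj f a) = \<omega> a"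
      using ff_precomp_extend[OF S(3,1,2)] by blast
    have "is_nat Y Z H H' \<Omega>" using nat_full_subcat[OF Z S(1,2)] \<Omega>(1) by simp
    then show "\<exists>\<Omega>. is_nat Y Z H H' \<Omega> \<and> (\<forall>a\<in>Obj X. \<Omega> (FObj f a) = \<omega> a)"
      using \<Omega>(2) by blast
  qed
qed

lemma lax_epi_ff_locally_small:
  assumes u: "universe TYPE('u)" and f: "lax_epi TYPE('u) X Y f"
    and Y: "small TYPE('u) (Obj Y)" and Z: "locally_small TYPE('u) Z"
  shows "restriction_ff X Y f Z"
proof (rule ff_precomp_full_subcats[OF u _ Y])
  show "is_functor X Y f" using f by (simp add: lax_epi_def)
  show "is_category Z" using Z by (simp add: locally_small_def)
  show "\<exists>S'. S \<subseteq> S' \<and>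
      restriction_ff X Y f (full_subcat Z S')"
    if "small TYPE('u) S" for S
    using lax_epi_ff_small[OF f locally_small_full_subcat[OF u Z that]] by blast
qed


section \<open>The category of small sets\<close>

definition app :: "'a set \<times> ('a \<Rightarrow> 'a) \<times> 'a set \<Rightarrow> 'a \<Rightarrow> 'a" where
  "app t = fst (snd t)"

definition set_arr :: "'a set \<Rightarrow> ('a \<Rightarrow> 'a) \<Rightarrow> 'a set \<Rightarrow> 'a set \<times> ('a \<Rightarrow> 'a) \<times> 'a set" where
  "set_arr A f B = (A, restrict f A, B)"

lemma SET_Obj [simp]: "A \<in> Obj (SET U) \<longleftrightarrow> small U A"
  by (simp add: SET_def)

lemma SET_hom:
  "t \<in> hom (SET U) A B \<longleftrightarrow> small U A \<and> small U B \<and> (\<exists>f\<in>A \<rightarrow>\<^sub>E B. t = (A, f, B))"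
  by (auto simp: SET_def hom_def)

lemma set_arr_hom:
  "small U A \<Longrightarrow> small U B \<Longrightarrow> (\<And>x. x \<in> A \<Longrightarrow> f x \<in> B) \<Longrightarrow> set_arr A f B \<in> hom (SET U) A B"
  by (auto simp: SET_hom set_arr_def)

lemma app_set_arr: "x \<in> A \<Longrightarrow> app (set_arr A f B) x = f x"
  by (simp add: app_def set_arr_def)

lemma app_in: "t \<in> hom (SET U) A B \<Longrightarrow> x \<in> A \<Longrightarrow> app t x \<in> B"
  by (auto simp: SET_hom app_def)

lemma SET_Comp: "Comp (SET U) (B', g, D) (A, f, B) = (A, \<lambda>x\<in>A. g (f x), D)"
  by (simp add: SET_def)

lemma app_Comp:
  "t \<in> hom (SET U) A B \<Longrightarrow> u \<in> hom (SET U) B D \<Longrightarrow> x \<in> A \<Longrightarrow> app (Comp (SET U) u t) x = app u (app t x)"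
  by (auto simp: SET_hom app_def SET_Comp)

lemma app_Ide: "x \<in> A \<Longrightarrow> app (Ide (SET U) A) x = x"
  by (simp add: app_def SET_def)

lemma SET_eqI:
  assumes "t \<in> hom (SET U) A B" "u \<in> hom (SET U) A B" "\<And>x. x \<in> A \<Longrightarrow> app t x = app u x"
  shows "t = u"
proof -
  obtain f g where "t = (A, f, B)" "f \<in> A \<rightarrow>\<^sub>E B" "u = (A, g, B)" "g \<in> A \<rightarrow>\<^sub>E B"
    using assms(1,2) by (auto simp: SET_hom)
  then show ?thesis using assms(3) PiE_ext[of f A _ g] by (simp add: app_def)
qed

lemma SET_Comp_hom:
  "t \<in> hom (SET U) A B \<Longrightarrow> u \<in> hom (SET U) B D \<Longrightarrow> Comp (SET U) u t \<in> hom (SET U) A D"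
  by (auto simp: SET_hom SET_Comp PiE_def Pi_def)

lemma SET_Ide_hom: "small U A \<Longrightarrow> Ide (SET U) A \<in> hom (SET U) A A"
  by (auto simp: SET_hom) (auto simp: SET_def)

lemma SET_category: "is_category (SET U)"
proof (rule is_categoryI)
  fix f g h a b c d
  show "Comp (SET U) f (Ide (SET U) a) = f" "Comp (SET U) (Ide (SET U) b) f = f"
    if f: "f \<in> hom (SET U) a b"
  proof -
    have ab: "small U a" "small U b" using f by (auto simp: SET_hom)
    note i = SET_Ide_hom[OF ab(1)] SET_Ide_hom[OF ab(2)]
    show "Comp (SET U) f (Ide (SET U) a) = f"
      by (rule SET_eqI[OF SET_Comp_hom[OF i(1) f] f]) (simp add: app_Comp[OF i(1) f] app_Ide)
    show "Comp (SET U) (Ide (SET U) b) f = f"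
      by (rule SET_eqI[OF SET_Comp_hom[OF f i(2)] f]) (simp add: app_Comp[OF f i(2)] app_Ide app_in[OF f])
  qed
  assume f: "f \<in> hom (SET U) a b" and g: "g \<in> hom (SET U) b c" and h: "h \<in> hom (SET U) c d"
  note gf = SET_Comp_hom[OF f g] and hg = SET_Comp_hom[OF g h]
  show "Comp (SET U) h (Comp (SET U) g f) = Comp (SET U) (Comp (SET U) h g) f"
    by (rule SET_eqI[OF SET_Comp_hom[OF gf h] SET_Comp_hom[OF f hg]])
      (simp add: app_Comp[OF gf h] app_Comp[OF f hg] app_Comp[OF f g] app_Comp[OF g h] app_in[OF f])
qed (auto simp: SET_Comp_hom SET_Ide_hom, auto simp: SET_hom)

lemma SET_locally_small:
  assumes u: "universe TYPE('u)"
  shows "locally_small TYPE('u) (SET TYPE('u))"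
proof -
  have "small TYPE('u) (hom (SET TYPE('u)) A B)" if "small TYPE('u) A" "small TYPE('u) B" for A B :: "'a set"
  proof -
    have "small TYPE('u) ((\<lambda>f. (A, f, B)) ` (A \<rightarrow>\<^sub>E B))" by (intro small_image small_PiE[OF u] that)
    moreover have "hom (SET TYPE('u)) A B \<subseteq> (\<lambda>f. (A, f, B)) ` (A \<rightarrow>\<^sub>E B)" by (auto simp: SET_hom)
    ultimately show ?thesis by (rule small_subset)
  qed
  then show ?thesis by (simp add: locally_small_def SET_category)
qed

text \<open>Idempotents are split by their sets of fixed points, so full subcategories closed under
  subsets have split idempotents as well.\<close>

lemma SET_splits_idempotents:
  assumes closed: "\<And>A B. A \<in> S \<Longrightarrow> B \<subseteq> A \<Longrightarrow> B \<in> S"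
  shows "splits_idempotents (full_subcat (SET U) S)"
  unfolding splits_idempotents_def
proof (intro conjI allI impI)
  show "is_category (full_subcat (SET U) S)" by (rule full_subcat_category[OF SET_category])
  fix A e assume "e \<in> hom (full_subcat (SET U) S) A A" and ee: "Comp (full_subcat (SET U) S) e e = e"
  then have e: "e \<in> hom (SET U) A A" "A \<in> S" by (auto simp: full_subcat_hom)
  have A: "small U A" using e by (simp add: SET_hom)
  define B where "B = {x \<in> A. app e x = x}"
  have BA: "B \<subseteq> A" by (auto simp: B_def)
  have Bx: "x \<in> A \<and> app e x = x" if "x \<in> B" for x using that by (simp add: B_def)
  have BS: "B \<in> S" by (rule closed[OF e(2) BA])
  have B: "small U B" using A BA unfolding small_def by (meson lesspoll_trans1 subset_imp_lepoll)
  have eB: "app e x \<in> B" if "x \<in> A" for x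
    using app_Comp[OF e(1) e(1) that] ee app_in[OF e(1) that] by (simp add: B_def)
  have s: "set_arr B (\<lambda>x. x) A \<in> hom (SET U) B A" by (rule set_arr_hom[OF B A]) (use BA in auto)
  have r: "set_arr A (app e) B \<in> hom (SET U) A B" by (rule set_arr_hom[OF A B eB])
  have 1: "Comp (SET U) (set_arr A (app e) B) (set_arr B (\<lambda>x. x) A) = Ide (SET U) B"
    by (rule SET_eqI[OF SET_Comp_hom[OF s r] SET_Ide_hom[OF B]])
      (simp add: app_Comp[OF s r] app_set_arr app_Ide Bx)
  have 2: "Comp (SET U) (set_arr B (\<lambda>x. x) A) (set_arr A (app e) B) = e"
    by (rule SET_eqI[OF SET_Comp_hom[OF r s] e(1)])
      (auto simp: app_Comp[OF r s] app_set_arr eB)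
  show "\<exists>b. \<exists>s\<in>hom (full_subcat (SET U) S) b A. \<exists>r\<in>hom (full_subcat (SET U) S) A b.
      Comp (full_subcat (SET U) S) r s = Ide (full_subcat (SET U) S) b \<and> Comp (full_subcat (SET U) S) s r = e"
    using s r 1 2 BS e(2) by (intro exI[of _ B] bexI[of _ "set_arr B (\<lambda>x. x) A"] bexI[of _ "set_arr A (app e) B"])
      (auto simp: full_subcat_hom)
qed

lemma full_subcat_UNIV: "is_category C \<Longrightarrow> full_subcat C UNIV = C"
  by (simp add: full_subcat_def)

lemma SET_splits: "splits_idempotents (SET U)"
  using SET_splits_idempotents[of UNIV U] by (simp add: full_subcat_UNIV SET_category)

section \<open>Set-valued functors and their transformations\<close>

definition set_functor where
  "set_functor W A \<phi> = \<lparr>FObj = restrict A (Obj W),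
     FArr = (\<lambda>f\<in>Arr W. set_arr (A (Dom W f)) (\<phi> f) (A (Cod W f)))\<rparr>"

lemma set_functor_simps:
  "a \<in> Obj W \<Longrightarrow> FObj (set_functor W A \<phi>) a = A a"
  "f \<in> hom W a b \<Longrightarrow> FArr (set_functor W A \<phi>) f = set_arr (A a) (\<phi> f) (A b)"
  by (auto simp: set_functor_def hom_def)

lemma set_functor:
  assumes W: "is_category W" and sm: "\<And>a. a \<in> Obj W \<Longrightarrow> small U (A a)"
    and cl: "\<And>f a b x. f \<in> hom W a b \<Longrightarrow> x \<in> A a \<Longrightarrow> \<phi> f x \<in> A b"
    and id: "\<And>a x. a \<in> Obj W \<Longrightarrow> x \<in> A a \<Longrightarrow> \<phi> (Ide W a) x = x"
    and comp: "\<And>f g a b c x. f \<in> hom W a b \<Longrightarrow> g \<in> hom W b c \<Longrightarrow> x \<in> A a \<Longrightarrow>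
       \<phi> (Comp W g f) x = \<phi> g (\<phi> f x)"
  shows "is_functor W (SET U) (set_functor W A \<phi>)"
proof (rule is_functorI[OF W SET_category])
  have h: "set_arr (A a) (\<phi> f) (A b) \<in> hom (SET U) (A a) (A b)" if "f \<in> hom W a b" for f a b
    by (rule set_arr_hom[OF sm[OF hom_Obj(1)[OF W that]] sm[OF hom_Obj(2)[OF W that]] cl[OF that]])
  then show "FArr (set_functor W A \<phi>) f \<in> hom (SET U) (FObj (set_functor W A \<phi>) a) (FObj (set_functor W A \<phi>) b)"
    if "f \<in> hom W a b" for f a b
    using hom_Obj[OF W that] that by (simp add: set_functor_simps)
  show "FArr (set_functor W A \<phi>) (Ide W a) = Ide (SET U) (FObj (set_functor W A \<phi>) a)" if a: "a \<in> Obj W" for a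
    using SET_eqI[OF h[OF Ide_hom[OF W a]] SET_Ide_hom[OF sm[OF a]]] a id[OF a]
    by (simp add: set_functor_simps(1) set_functor_simps(2)[OF Ide_hom[OF W a]] app_set_arr app_Ide)
  fix f g a b c assume f: "f \<in> hom W a b" and g: "g \<in> hom W b c"
  show "FArr (set_functor W A \<phi>) (Comp W g f) = Comp (SET U) (FArr (set_functor W A \<phi>) g) (FArr (set_functor W A \<phi>) f)"
    using SET_eqI[OF h[OF Comp_hom[OF W f g]] SET_Comp_hom[OF h[OF f] h[OF g]]] comp[OF f g] cl[OF f]
    by (simp add: set_functor_simps(2)[OF Comp_hom[OF W f g]] set_functor_simps(2)[OF f] set_functor_simps(2)[OF g]
        app_set_arr app_Comp[OF h[OF f] h[OF g]])
qed (auto simp: set_functor_def sm)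

lemma SET_functor_small: "is_functor W (SET U) P \<Longrightarrow> a \<in> Obj W \<Longrightarrow> small U (FObj P a)"
  using functor_Obj by fastforce

lemma SET_functor_in: "is_functor W (SET U) P \<Longrightarrow> f \<in> hom W a b \<Longrightarrow> x \<in> FObj P a \<Longrightarrow> app (FArr P f) x \<in> FObj P b"
  by (rule app_in[OF functor_hom])

lemma SET_functor_Ide: "is_functor W (SET U) P \<Longrightarrow> a \<in> Obj W \<Longrightarrow> x \<in> FObj P a \<Longrightarrow> app (FArr P (Ide W a)) x = x"
  by (simp add: functor_Ide app_Ide)

lemma SET_functor_Comp:
  assumes P: "is_functor W (SET U) P" and f: "f \<in> hom W a b" and g: "g \<in> hom W b c" and x: "x \<in> FObj P a"
  shows "app (FArr P (Comp W g f)) x = app (FArr P g) (app (FArr P f) x)"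
  using app_Comp[OF functor_hom[OF P f] functor_hom[OF P g] x] functor_Comp[OF P f g] by simp

definition set_nat where
  "set_nat W P \<tau> Q = (\<lambda>a\<in>Obj W. set_arr (FObj P a) (\<tau> a) (FObj Q a))"

lemma set_nat:
  assumes P: "is_functor W (SET U) P" and Q: "is_functor W (SET U) Q"
    and cl: "\<And>a x. a \<in> Obj W \<Longrightarrow> x \<in> FObj P a \<Longrightarrow> \<tau> a x \<in> FObj Q a"
    and nat: "\<And>f a b x. f \<in> hom W a b \<Longrightarrow> x \<in> FObj P a \<Longrightarrow> \<tau> b (app (FArr P f) x) = app (FArr Q f) (\<tau> a x)"
  shows "is_nat W (SET U) P Q (set_nat W P \<tau> Q)"
proof (rule is_natI[OF P Q])
  have h: "set_arr (FObj P a) (\<tau> a) (FObj Q a) \<in> hom (SET U) (FObj P a) (FObj Q a)" if "a \<in> Obj W" for a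
    by (rule set_arr_hom[OF SET_functor_small[OF P that] SET_functor_small[OF Q that] cl[OF that]])
  then show "set_nat W P \<tau> Q a \<in> hom (SET U) (FObj P a) (FObj Q a)" if "a \<in> Obj W" for a
    using that by (simp add: set_nat_def)
  fix f a b assume f: "f \<in> hom W a b"
  note ab = hom_Obj[OF functor_cats(1)[OF P] f]
  show "Comp (SET U) (set_nat W P \<tau> Q b) (FArr P f) = Comp (SET U) (FArr Q f) (set_nat W P \<tau> Q a)"
    using ab SET_eqI[OF SET_Comp_hom[OF functor_hom[OF P f] h[OF ab(2)]] SET_Comp_hom[OF h[OF ab(1)] functor_hom[OF Q f]]]
      nat[OF f] by (simp add: set_nat_def app_Comp[OF functor_hom[OF P f] h[OF ab(2)]]
        app_Comp[OF h[OF ab(1)] functor_hom[OF Q f]] app_set_arr SET_functor_in[OF P f])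
qed (simp add: set_nat_def)

lemma app_set_nat: "a \<in> Obj W \<Longrightarrow> x \<in> FObj P a \<Longrightarrow> app (set_nat W P \<tau> Q a) x = \<tau> a x"
  by (simp add: set_nat_def app_set_arr)

lemma SET_nat_in: "is_nat W (SET U) P Q \<alpha> \<Longrightarrow> a \<in> Obj W \<Longrightarrow> x \<in> FObj P a \<Longrightarrow> app (\<alpha> a) x \<in> FObj Q a"
  by (rule app_in[OF nat_hom])

lemma SET_nat_comm:
  assumes \<alpha>: "is_nat W (SET U) P Q \<alpha>" and f: "f \<in> hom W a b" and x: "x \<in> FObj P a"
  shows "app (\<alpha> b) (app (FArr P f) x) = app (FArr Q f) (app (\<alpha> a) x)"
proof -
  note ab = hom_Obj[OF nat_functors(3)[OF \<alpha>] f]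
  show ?thesis
    using arg_cong[OF nat_comm[OF \<alpha> f], of "\<lambda>t. app t x"]
      app_Comp[OF functor_hom[OF nat_functors(1)[OF \<alpha>] f] nat_hom[OF \<alpha> ab(2)] x]
      app_Comp[OF nat_hom[OF \<alpha> ab(1)] functor_hom[OF nat_functors(2)[OF \<alpha>] f] x] by simp
qed

lemma SET_nat_eqI:
  assumes \<alpha>: "is_nat W (SET U) P Q \<alpha>" and \<beta>: "is_nat W (SET U) P Q \<beta>"
    and "\<And>a x. a \<in> Obj W \<Longrightarrow> x \<in> FObj P a \<Longrightarrow> app (\<alpha> a) x = app (\<beta> a) x"
  shows "\<alpha> = \<beta>"
  by (rule nat_eqI[OF \<alpha> \<beta>], rule SET_eqI[OF nat_hom[OF \<alpha>] nat_hom[OF \<beta>]]) (use assms(3) in auto)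

section \<open>Representable functors and the Yoneda lemma\<close>

lemma hom_functor_set_functor: "hom_functor W c = set_functor W (hom W c) (\<lambda>f g. Comp W f g)"
  by (simp add: hom_functor_def set_functor_def set_arr_def)

lemma hom_functor:
  assumes W: "locally_small U W" and c: "c \<in> Obj W"
  shows "is_functor W (SET U) (hom_functor W c)"
proof -
  have W': "is_category W" using W by (simp add: locally_small_def)
  show ?thesis
    unfolding hom_functor_set_functor
    by (rule set_functor[OF W'])
      (use W c in \<open>auto simp: locally_small_def Comp_hom[OF W'] Comp_Ide_left[OF W'] Comp_assoc[OF W']\<close>)
qed

lemma hom_functor_Obj: "a \<in> Obj W \<Longrightarrow> FObj (hom_functor W c) a = hom W c a"
  by (simp add: hom_functor_def)

lemma app_hom_functor:
  "f \<in> hom W a b \<Longrightarrow> g \<in> hom W c a \<Longrightarrow> app (FArr (hom_functor W c) f) g = Comp W f g"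
  by (simp add: hom_functor_set_functor set_functor_simps app_set_arr)

definition yoneda where
  "yoneda W P c x = set_nat W (hom_functor W c) (\<lambda>a g. app (FArr P g) x) P"

lemma yoneda:
  assumes W: "locally_small U W" and P: "is_functor W (SET U) P" and c: "c \<in> Obj W" and x: "x \<in> FObj P c"
  shows "is_nat W (SET U) (hom_functor W c) P (yoneda W P c x)"
proof -
  have W': "is_category W" using W by (simp add: locally_small_def)
  show ?thesis
    unfolding yoneda_def
  proof (rule set_nat[OF hom_functor[OF W c] P])
    show "app (FArr P g) x \<in> FObj P a" if "a \<in> Obj W" "g \<in> FObj (hom_functor W c) a" for a g
      using that SET_functor_in[OF P _ x] by (simp add: hom_functor_Obj)
    show "app (FArr P (app (FArr (hom_functor W c) f) g)) x = app (FArr P f) (app (FArr P g) x)"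
      if f: "f \<in> hom W a b" and g: "g \<in> FObj (hom_functor W c) a" for f a b g
      using g hom_Obj[OF W' f] SET_functor_Comp[OF P _ f x, of g]
      by (simp add: hom_functor_Obj app_hom_functor[OF f])
  qed
qed

lemma app_yoneda: "g \<in> hom W c a \<Longrightarrow> a \<in> Obj W \<Longrightarrow> app (yoneda W P c x a) g = app (FArr P g) x"
  by (simp add: yoneda_def app_set_nat hom_functor_Obj)

text \<open>Naturality at \<open>g\<close>, evaluated on the identity of \<open>c\<close>.\<close>

lemma yoneda_element:
  assumes W: "locally_small U W" and \<alpha>: "is_nat W (SET U) (hom_functor W c) P \<alpha>" and c: "c \<in> Obj W"
    and g: "g \<in> hom W c a"
  shows "app (\<alpha> a) g = app (FArr P g) (app (\<alpha> c) (Ide W c))"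
proof -
  have W': "is_category W" using W by (simp add: locally_small_def)
  show ?thesis
    using SET_nat_comm[OF \<alpha> g, of "Ide W c"] c Ide_hom[OF W' c] Comp_Ide_right[OF W' g]
    by (simp add: hom_functor_Obj app_hom_functor[OF g])
qed


section \<open>The category of small categories\<close>

lemma Cat_Obj [simp]: "X \<in> Obj Cat \<longleftrightarrow> small_category X"
  by (simp add: Cat_def)

lemma Cat_hom:
  "t \<in> hom Cat X Y \<longleftrightarrow> small_category X \<and> small_category Y \<and> (\<exists>F. is_functor X Y F \<and> t = (X, F, Y))"
  by (auto simp: Cat_def hom_def)

lemma Cat_homI: "small_category X \<Longrightarrow> small_category Y \<Longrightarrow> is_functor X Y F \<Longrightarrow> (X, F, Y) \<in> hom Cat X Y"
  by (simp add: Cat_hom)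

lemma Cat_simps [simp]:
  "Comp Cat (Y', G, Z) (X, F, Y) = (X, functor_comp X G F, Z)" "Ide Cat X = (X, functor_id X, X)"
  "(X, F, Y) \<in> Arr Cat \<longleftrightarrow> small_category X \<and> small_category Y \<and> is_functor X Y F"
  by (simp_all add: Cat_def)

lemma Cat_category: "is_category (Cat :: (('u, 'u) category, _) category)"
proof (rule is_categoryI)
  show "Ide Cat X \<in> hom Cat X X" if "X \<in> Obj Cat" for X :: "('u, 'u) category"
    using that functor_id by (auto simp: Cat_hom small_category_def)
  show "Comp Cat u t \<in> hom Cat X Z" if "t \<in> hom Cat X Y" "u \<in> hom Cat Y Z"
    for t u and X Y Z :: "('u, 'u) category"
    using that by (auto simp: Cat_hom functor_comp)
  show "Comp Cat v (Comp Cat u t) = Comp Cat (Comp Cat v u) t"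
    if "t \<in> hom Cat X Y" "u \<in> hom Cat Y Z" "v \<in> hom Cat Z W" for t u v and X Y Z W :: "('u, 'u) category"
    using that by (auto simp: Cat_hom functor_comp_assoc)
qed (auto simp: Cat_hom functor_comp_id)

text \<open>A functor is given by its two component maps, so a hom-set of \<open>Cat\<close> embeds
  in a product of two function sets.\<close>

lemma Cat_locally_small:
  assumes u: "universe TYPE('u)"
  shows "locally_small TYPE('u) (Cat :: (('u, 'u) category, _) category)"
proof -
  have "small TYPE('u) (hom Cat X Y)" if X: "small_category X" and Y: "small_category Y"
    for X Y :: "('u, 'u) category"
  proof -
    have "small TYPE('u) ((\<lambda>(f, g). (X, \<lparr>FObj = f, FArr = g\<rparr>, Y)) `
        ((Obj X \<rightarrow>\<^sub>E Obj Y) \<times> (Arr X \<rightarrow>\<^sub>E Arr Y)))"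
      using X Y by (intro small_image small_Times[OF u] small_PiE[OF u]) (auto simp: small_category_def)
    moreover have "hom Cat X Y \<subseteq> (\<lambda>(f, g). (X, \<lparr>FObj = f, FArr = g\<rparr>, Y)) `
        ((Obj X \<rightarrow>\<^sub>E Obj Y) \<times> (Arr X \<rightarrow>\<^sub>E Arr Y))"
    proof
      fix t assume "t \<in> hom Cat X Y"
      then obtain F where F: "is_functor X Y F" "t = (X, F, Y)" by (auto simp: Cat_hom)
      then have "t = (\<lambda>(f, g). (X, \<lparr>FObj = f, FArr = g\<rparr>, Y)) (FObj F, FArr F)" by simp
      moreover have "(FObj F, FArr F) \<in> (Obj X \<rightarrow>\<^sub>E Obj Y) \<times> (Arr X \<rightarrow>\<^sub>E Arr Y)"
        using F(1) by (simp add: is_functor_def)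
      ultimately show "t \<in> (\<lambda>(f, g). (X, \<lparr>FObj = f, FArr = g\<rparr>, Y)) `
        ((Obj X \<rightarrow>\<^sub>E Obj Y) \<times> (Arr X \<rightarrow>\<^sub>E Arr Y))" by (rule image_eqI)
    qed
    ultimately show ?thesis by (rule small_subset)
  qed
  then show ?thesis by (simp add: locally_small_def Cat_category)
qed

text \<open>An idempotent functor splits through the subcategory of the objects and arrows it fixes.
  This subcategory is in general not full.\<close>

lemma Cat_splits: "splits_idempotents (Cat :: (('u, 'u) category, _) category)"
  unfolding splits_idempotents_def
proof (intro conjI allI impI)
  show "is_category (Cat :: (('u, 'u) category, _) category)" by (rule Cat_category)
  fix X :: "('u, 'u) category" and e assume "e \<in> hom Cat X X" and ee: "Comp Cat e e = e"
  then obtain F where X: "small_category X" and F: "is_functor X X F" and e: "e = (X, F, X)"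
    by (auto simp: Cat_hom)
  have X': "is_category X" using X by (simp add: small_category_def)
  have FF: "functor_comp X F F = F" using ee by (simp add: e)
  have FO: "FObj F (FObj F a) = FObj F a" if "a \<in> Obj X" for a
    using arg_cong[OF FF, of "\<lambda>H. FObj H a"] that by (simp add: functor_comp_simps)
  have FA: "FArr F (FArr F f) = FArr F f" if "f \<in> Arr X" for f
    using arg_cong[OF FF, of "\<lambda>H. FArr H f"] that by (simp add: functor_comp_simps)
  define W where "W = X\<lparr>Obj := {a \<in> Obj X. FObj F a = a}, Arr := {f \<in> Arr X. FArr F f = f}\<rparr>"
  have W: "Obj W = {a \<in> Obj X. FObj F a = a}" "Arr W = {f \<in> Arr X. FArr F f = f}" "Ide W = Ide X" "Comp W = Comp X"
    by (simp_all add: W_def)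
  have Wh: "f \<in> hom W a b \<longleftrightarrow> f \<in> hom X a b \<and> FArr F f = f" for f a b
    by (auto simp: W_def hom_def)
  \<comment> \<open>A functor commutes with domain and codomain, so an arrow can be fixed only if
    its end points are.\<close>
  have WO: "a \<in> Obj X" "FObj F a = a" if "f \<in> hom X a b" "FArr F f = f" for f a b
    using homD[OF that(1)] homD[OF functor_hom[OF F that(1)]] that(2) hom_Obj[OF X' that(1)] by auto
  have WO': "b \<in> Obj X" "FObj F b = b" if "f \<in> hom X a b" "FArr F f = f" for f a b
    using homD[OF that(1)] homD[OF functor_hom[OF F that(1)]] that(2) hom_Obj[OF X' that(1)] by auto
  have cat: "is_category W"
  proof (rule is_categoryI)
    show "a \<in> Obj W \<and> b \<in> Obj W" if "f \<in> hom W a b" for f a b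
      using that WO WO' by (auto simp: Wh W)
    show "Ide W a \<in> hom W a a" if "a \<in> Obj W" for a
      using that Ide_hom[OF X'] functor_Ide[OF F] by (simp add: Wh W)
    show "Comp W g f \<in> hom W a c" if "f \<in> hom W a b" "g \<in> hom W b c" for f g a b c
      using that Comp_hom[OF X'] functor_Comp[OF F, of f a b g c] by (auto simp: Wh W)
  qed (auto simp: Wh W Comp_Ide_left[OF X'] Comp_Ide_right[OF X'] Comp_assoc[OF X'])
  have Ws: "small_category W"
    using cat X by (auto simp: small_category_def W elim: small_subset)
  define s where "s = \<lparr>FObj = restrict (\<lambda>a. a) (Obj W), FArr = restrict (\<lambda>f. f) (Arr W)\<rparr>"
  have s: "is_functor W X s"
    by (rule is_functorI[OF cat X'])
      (auto simp: s_def W Wh homD WO WO' Ide_hom[OF X'] functor_Ide[OF F] functor_Comp[OF F]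
        intro: homD(1)[OF Ide_hom[OF X']] homD(1)[OF Comp_hom[OF X']])
  have r: "is_functor X W F"
  proof (rule is_functorI[OF X' cat functor_ext[OF F]])
    show "FArr F f \<in> hom W (FObj F a) (FObj F b)" if "f \<in> hom X a b" for f a b
      using functor_hom[OF F that] FA[OF homD(1)[OF that]] by (simp add: Wh)
  qed (auto simp: W FO functor_Obj[OF F] functor_Ide[OF F] intro: functor_Comp[OF F])
  have "functor_comp W F s = functor_id W"
    by (auto simp: functor_comp_def functor_id_def s_def W intro!: restrict_ext)
  moreover have "functor_comp X s F = F"
    by (rule functor_eqI[of _ X])
      (auto simp: functor_comp_simps functor_ext[OF F] s_def W FO FA functor_Obj[OF F] functor_Arr[OF F])
  ultimately show "\<exists>b. \<exists>s\<in>hom Cat b X. \<exists>r\<in>hom Cat X b. Comp Cat r s = Ide Cat b \<and> Comp Cat s r = e"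
    using Cat_homI[OF Ws X s] Cat_homI[OF X Ws r] e
    by (intro exI[of _ W] bexI[of _ "(W, s, X)"] bexI[of _ "(X, F, W)"]) auto
qed

section \<open>Sets as discrete categories\<close>

definition discrete :: "'u set \<Rightarrow> ('u, 'u) category" where
  "discrete A = \<lparr>Obj = A, Arr = A, Dom = (\<lambda>x. x), Cod = (\<lambda>x. x), Ide = (\<lambda>x. x), Comp = (\<lambda>g f. f)\<rparr>"

definition Discrete where
  "Discrete = \<lparr>FObj = (\<lambda>A\<in>Obj (SET TYPE('u)). discrete (A :: 'u set)),
     FArr = (\<lambda>(A, f, B)\<in>Arr (SET TYPE('u) :: ('u set, _) category). (discrete A, \<lparr>FObj = f, FArr = f\<rparr>, discrete B))\<rparr>"

definition Objects where
  "Objects = \<lparr>FObj = (\<lambda>X\<in>Obj (Cat :: (('u, 'u) category, _) category). Obj X),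
     FArr = (\<lambda>(X, F, Y)\<in>Arr Cat. (Obj X, FObj F, Obj Y))\<rparr>"

lemma discrete_small_category: "small TYPE('u) (A :: 'u set) \<Longrightarrow> small_category (discrete A)"
  by (simp add: small_category_def is_category_def discrete_def hom_def)

lemma discrete_functor:
  assumes "small TYPE('u) (A :: 'u set)" "small TYPE('u) (B :: 'u set)"
  shows "is_functor (discrete A) (discrete B) F \<longleftrightarrow> (\<exists>f\<in>A \<rightarrow>\<^sub>E B. F = \<lparr>FObj = f, FArr = f\<rparr>)"
proof
  assume F: "is_functor (discrete A) (discrete B) F"
  have F': "FObj F \<in> A \<rightarrow>\<^sub>E B" "FArr F \<in> A \<rightarrow>\<^sub>E B" "\<forall>x\<in>A. FArr F x = FObj F x"
    using F by (auto simp: is_functor_def discrete_def)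
  have "FArr F = FObj F" by (rule PiE_ext[OF F'(2,1)]) (use F'(3) in simp)
  then show "\<exists>f\<in>A \<rightarrow>\<^sub>E B. F = \<lparr>FObj = f, FArr = f\<rparr>"
    using F'(1) by (intro bexI[of _ "FObj F"]) (cases F, auto)
next
  assume "\<exists>f\<in>A \<rightarrow>\<^sub>E B. F = \<lparr>FObj = f, FArr = f\<rparr>"
  then show "is_functor (discrete A) (discrete B) F"
    using discrete_small_category[OF assms(1)] discrete_small_category[OF assms(2)]
    by (auto simp: is_functor_def small_category_def) (auto simp: discrete_def)
qed

lemma Discrete_simps:
  "small TYPE('u) A \<Longrightarrow> FObj Discrete A = discrete (A :: 'u set)"
  "(A, f, B) \<in> hom (SET TYPE('u)) A B \<Longrightarrow>
     FArr Discrete (A, f, B) = (discrete A, \<lparr>FObj = f, FArr = f\<rparr>, discrete (B :: 'u set))"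
  by (auto simp: Discrete_def dest: homD(1))

text \<open>A functor between discrete categories is one function in both roles. Through this
  embedding, full faithfulness of restriction passes from \<open>Cat\<close> to
  \<open>Set_cat\<close>.\<close>

lemma Discrete_ff: "fully_faithful (SET TYPE('u)) Cat (Discrete :: ('u set, _, _, _) fmaps)"
proof (rule fully_faithfulI)
  have h: "FArr Discrete t \<in> hom Cat (FObj Discrete A) (FObj Discrete B)" if t: "t \<in> hom (SET TYPE('u)) A B"
    for t and A B :: "'u set"
  proof -
    obtain f where f: "small TYPE('u) A" "small TYPE('u) B" "f \<in> A \<rightarrow>\<^sub>E B" "t = (A, f, B)"
      using t by (auto simp: SET_hom)
    then have "is_functor (discrete A) (discrete B) \<lparr>FObj = f, FArr = f\<rparr>"
      using discrete_functor[OF f(1,2)] by blast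
    then show ?thesis
      using f t Cat_homI[OF discrete_small_category[OF f(1)] discrete_small_category[OF f(2)]]
      by (simp add: Discrete_simps)
  qed
  show "is_functor (SET TYPE('u)) Cat (Discrete :: ('u set, _, _, _) fmaps)"
  proof (rule is_functorI[OF SET_category Cat_category])
    show "FArr Discrete (Comp (SET TYPE('u)) u t) = Comp Cat (FArr Discrete u) (FArr Discrete t)"
      if t: "t \<in> hom (SET TYPE('u)) A B" and u: "u \<in> hom (SET TYPE('u)) B D" for t u and A B D :: "'u set"
    proof -
      obtain f g where "t = (A, f, B)" "u = (B, g, D)" using t u by (auto simp: SET_hom)
      then show ?thesis
        using t u SET_Comp_hom[OF t u] by (simp add: SET_Comp Discrete_simps functor_comp_def discrete_def)
    qed
    show "FArr Discrete (Ide (SET TYPE('u)) A) = Ide Cat (FObj Discrete A)"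
      if "A \<in> Obj (SET TYPE('u))" for A :: "'u set"
    proof -
      have i: "Ide (SET TYPE('u)) A = (A, \<lambda>x\<in>A. x, A)" by (simp add: SET_def)
      show ?thesis
        using SET_Ide_hom[of "TYPE('u)" A] that
        by (simp add: i Discrete_simps functor_id_def discrete_def)
    qed
    show "FObj Discrete A \<in> Obj Cat" if "A \<in> Obj (SET TYPE('u))" for A :: "'u set"
      using that by (simp add: Discrete_simps discrete_small_category)
    show "FArr Discrete t \<in> hom Cat (FObj Discrete A) (FObj Discrete B)" if "t \<in> hom (SET TYPE('u)) A B"
      for t and A B :: "'u set" by (rule h[OF that])
  qed (auto simp: Discrete_def)
  fix A B :: "'u set"
  show "t = u" if t: "t \<in> hom (SET TYPE('u)) A B" and u: "u \<in> hom (SET TYPE('u)) A B"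
    and eq: "FArr Discrete t = FArr Discrete u" for t u
  proof -
    obtain f g where "t = (A, f, B)" "u = (A, g, B)" using t u by (auto simp: SET_hom)
    then show ?thesis using t u eq by (simp add: Discrete_simps)
  qed
  fix h assume "A \<in> Obj (SET TYPE('u))" "B \<in> Obj (SET TYPE('u))"
    and h: "h \<in> hom Cat (FObj Discrete A) (FObj Discrete B)"
  then have AB: "small TYPE('u) A" "small TYPE('u) B" by simp_all
  then obtain F where "is_functor (discrete A) (discrete B) F" "h = (discrete A, F, discrete B)"
    using h by (auto simp: Discrete_simps Cat_hom)
  then obtain f where f: "f \<in> A \<rightarrow>\<^sub>E B" "h = (discrete A, \<lparr>FObj = f, FArr = f\<rparr>, discrete B)"
    using discrete_functor[OF AB] by blast
  then have "(A, f, B) \<in> hom (SET TYPE('u)) A B" using AB by (simp add: SET_hom)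
  then show "\<exists>t\<in>hom (SET TYPE('u)) A B. FArr Discrete t = h"
    using f(2) by (intro bexI[of _ "(A, f, B)"]) (simp_all add: Discrete_simps)
qed

lemma Objects_simps:
  fixes X Y :: "('u, 'u) category"
  shows "small_category X \<Longrightarrow> FObj Objects X = Obj X"
    "small_category X \<Longrightarrow> small_category Y \<Longrightarrow> is_functor X Y F \<Longrightarrow>
       FArr Objects (X, F, Y) = (Obj X, FObj F, Obj Y)"
  by (simp_all add: Objects_def)

lemma Objects_functor: "is_functor Cat (SET TYPE('u)) (Objects :: (('u, 'u) category, _, _, _) fmaps)"
proof (rule is_functorI[OF Cat_category SET_category])
  show "FArr Objects t \<in> hom (SET TYPE('u)) (FObj Objects X) (FObj Objects Y)"
    if "t \<in> hom Cat X Y" for t and X Y :: "('u, 'u) category"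
    using that by (auto simp: Cat_hom SET_hom Objects_simps small_category_def is_functor_def)
  show "FArr Objects (Ide Cat X) = Ide (SET TYPE('u)) (FObj Objects X)"
    if "X \<in> Obj Cat" for X :: "('u, 'u) category"
  proof -
    have "small_category X" "is_functor X X (functor_id X)"
      using that functor_id by (auto simp: small_category_def)
    then show ?thesis by (simp add: Objects_simps) (simp add: functor_id_def SET_def)
  qed
  show "FArr Objects (Comp Cat u t) = Comp (SET TYPE('u)) (FArr Objects u) (FArr Objects t)"
    if t: "t \<in> hom Cat X Y" and u: "u \<in> hom Cat Y Z" for t u and X Y Z :: "('u, 'u) category"
  proof -
    obtain F G where F: "is_functor X Y F" "t = (X, F, Y)" and G: "is_functor Y Z G" "u = (Y, G, Z)"
      and sm: "small_category X" "small_category Y" "small_category Z"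
      using t u by (auto simp: Cat_hom)
    show ?thesis
      using F G sm functor_comp[OF F(1) G(1)] by (simp add: Objects_simps SET_Comp) (simp add: functor_comp_def)
  qed
  show "FObj Objects X \<in> Obj (SET TYPE('u))" if "X \<in> Obj Cat" for X :: "('u, 'u) category"
    using that by (simp add: Objects_simps) (simp add: small_category_def)
qed (auto simp: Objects_def)

text \<open>Supplies the retraction by which an extension problem posed in \<open>Set_cat\<close> is
  solved in \<open>Cat\<close> and brought back.\<close>

lemma Objects_Discrete:
  "functor_comp (SET TYPE('u)) Objects Discrete = functor_id (SET TYPE('u) :: ('u set, _) category)"
proof (rule functor_eqI)
  show "FObj (functor_comp (SET TYPE('u)) Objects Discrete) A = FObj (functor_id (SET TYPE('u))) A"
    if "A \<in> Obj (SET TYPE('u))" for A :: "'u set"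
    using that discrete_small_category[of A]
    by (simp add: functor_comp_simps functor_id_simps Discrete_simps Objects_def) (simp add: discrete_def)
  show "FArr (functor_comp (SET TYPE('u)) Objects Discrete) t = FArr (functor_id (SET TYPE('u))) t"
    if t: "t \<in> Arr (SET TYPE('u))" for t :: "'u set \<times> _"
  proof -
    obtain A f B where f: "t = (A, f, B)" by (cases t) auto
    then have h: "(A, f, B) \<in> hom (SET TYPE('u)) A B" using t by (auto simp: SET_def hom_def)
    have "FArr Discrete (A, f, B) \<in> hom Cat (FObj Discrete A) (FObj Discrete B)"
      by (rule functor_hom[OF ff_functor[OF Discrete_ff] h])
    then show ?thesis
      using t h homD(1) by (simp add: f functor_comp_simps functor_id_simps Discrete_simps Objects_def hom_def)
        (simp add: discrete_def)
  qed
qed (auto simp: functor_comp_simps functor_id_simps)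


section \<open>Restriction along a functor between small categories\<close>

text \<open>Yoneda reduction to sets: for each \<open>z\<close> the transformation obtained from
  \<open>\<omega>\<close> by applying \<open>Z(z, -)\<close> extends along \<open>K\<close> to some
  \<open>\<Omega> z\<close>. Uniqueness of extensions makes the family natural in \<open>z\<close>,
  so it is composition with arrows \<open>\<Theta> b\<close>.\<close>

lemma SET_ff_lax_epi:
  fixes C B :: "('u, 'u) category"
  assumes K: "is_functor C B K"
    and ff: "restriction_ff C B K (Set_cat :: ('u set, _) category)"
  shows "lax_epi TYPE('u) C B K"
  unfolding lax_epi_def
proof (intro conjI allI impI K)
  fix Z :: "('u, 'u) category" assume "small_category Z"
  then have Zs: "locally_small TYPE('u) Z" and Z: "is_category Z"
    by (simp_all add: small_locally_small small_category_def)
  note hf = hom_functor[OF Zs]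
  note B = functor_cats(2)[OF K]
  show "restriction_ff C B K Z"
  proof (rule ff_precompI[OF K])
    show "\<Omega> b = \<Omega>' b" if \<Omega>: "is_nat B Z H H' \<Omega>" "is_nat B Z H H' \<Omega>'"
      and eq: "\<And>a. a \<in> Obj C \<Longrightarrow> \<Omega> (FObj K a) = \<Omega>' (FObj K a)" and b: "b \<in> Obj B" for H H' \<Omega> \<Omega>' b
    proof -
      \<comment> \<open>With \<open>z\<close> equal to \<open>H b\<close>, a component at
        \<open>b\<close> can be read off as the image of an identity under
        \<open>Z(z, -)\<close>.\<close>
      define z where "z = FObj H b"
      have z: "z \<in> Obj Z" unfolding z_def by (rule functor_Obj[OF nat_functors(1)[OF \<Omega>(1)] b])
      have "whisker_post B (hom_functor Z z) \<Omega> = whisker_post B (hom_functor Z z) \<Omega>'"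
        by (rule ff_precomp_unique[OF ff whisker_post_nat[OF \<Omega>(1) hf[OF z]] whisker_post_nat[OF \<Omega>(2) hf[OF z]]])
          (simp add: nat_apply functor_Obj[OF K] eq)
      then have "app (FArr (hom_functor Z z) (\<Omega> b)) (Ide Z z) = app (FArr (hom_functor Z z) (\<Omega>' b)) (Ide Z z)"
        using b by (metis whisker_post_apply)
      then show ?thesis
        using app_hom_functor[OF nat_hom[OF \<Omega>(1) b], of "Ide Z z" z] app_hom_functor[OF nat_hom[OF \<Omega>(2) b], of "Ide Z z" z]
          Ide_hom[OF Z z] Comp_Ide_right[OF Z nat_hom[OF \<Omega>(1) b]] Comp_Ide_right[OF Z nat_hom[OF \<Omega>(2) b]]
        by (simp add: z_def)
    qed
    fix H H' \<omega> assume H: "is_functor B Z H" and H': "is_functor B Z H'"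
      and \<omega>: "is_nat C Z (functor_comp C H K) (functor_comp C H' K) \<omega>"
    have \<omega>h: "\<omega> a \<in> hom Z (FObj H (FObj K a)) (FObj H' (FObj K a))" if "a \<in> Obj C" for a
      using nat_hom[OF \<omega> that] that by (simp add: functor_comp_simps)
    have "\<forall>z\<in>Obj Z. \<exists>\<Omega>. is_nat B Set_cat (functor_comp B (hom_functor Z z) H) (functor_comp B (hom_functor Z z) H') \<Omega> \<and>
        (\<forall>a\<in>Obj C. \<Omega> (FObj K a) = FArr (hom_functor Z z) (\<omega> a))"
    proof
      fix z assume z: "z \<in> Obj Z"
      have "is_nat C Set_cat (functor_comp C (functor_comp B (hom_functor Z z) H) K)
          (functor_comp C (functor_comp B (hom_functor Z z) H') K) (whisker_post C (hom_functor Z z) \<omega>)"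
        using whisker_post_nat[OF \<omega> hf[OF z]] by (simp add: functor_comp_assoc[OF K])
      then obtain \<Omega> where "is_nat B Set_cat (functor_comp B (hom_functor Z z) H) (functor_comp B (hom_functor Z z) H') \<Omega>"
        "\<And>a. a \<in> Obj C \<Longrightarrow> \<Omega> (FObj K a) = whisker_post C (hom_functor Z z) \<omega> a"
        using ff_precomp_extend[OF ff functor_comp[OF H hf[OF z]] functor_comp[OF H' hf[OF z]]] by blast
      then show "\<exists>\<Omega>. is_nat B Set_cat (functor_comp B (hom_functor Z z) H) (functor_comp B (hom_functor Z z) H') \<Omega> \<and>
        (\<forall>a\<in>Obj C. \<Omega> (FObj K a) = FArr (hom_functor Z z) (\<omega> a))"
        by (auto simp: nat_apply)
    qed
    then obtain \<Omega> where \<Omega>: "\<And>z. z \<in> Obj Z \<Longrightarrow>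
        is_nat B Set_cat (functor_comp B (hom_functor Z z) H) (functor_comp B (hom_functor Z z) H') (\<Omega> z)"
      and \<Omega>K: "\<And>z a. z \<in> Obj Z \<Longrightarrow> a \<in> Obj C \<Longrightarrow> \<Omega> z (FObj K a) = FArr (hom_functor Z z) (\<omega> a)" by metis
    have hO: "FObj (functor_comp B (hom_functor Z z) G) b = hom Z z (FObj G b)"
      if "is_functor B Z G" "b \<in> Obj B" for G z b
      using functor_Obj[OF that] that(2) by (simp add: functor_comp_simps hom_functor_Obj)
    have hA: "app (FArr (functor_comp B (hom_functor Z z) G) f) g = Comp Z (FArr G f) g"
      if G: "is_functor B Z G" and f: "f \<in> hom B b b'" and g: "g \<in> hom Z z (FObj G b)" for G f g b b' z
      using app_hom_functor[OF functor_hom[OF G f] g] homD(1)[OF f] by (simp add: functor_comp_simps)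
    have \<Omega>in: "app (\<Omega> z b) g \<in> hom Z z (FObj H' b)" if z: "z \<in> Obj Z" and b: "b \<in> Obj B" and g: "g \<in> hom Z z (FObj H b)"
      for z b g
      using SET_nat_in[OF \<Omega>[OF z] b, of g] g hO[OF H b] hO[OF H' b] by simp
    \<comment> \<open>Naturality in \<open>z\<close>. Precomposition with \<open>k\<close> is a
      transformation from \<open>Z(z, -)\<close> to \<open>Z(z', -)\<close>; the two ways round
      agree on the image of \<open>K\<close>, where they are composition with
      \<open>\<omega>\<close>, and faithfulness of restriction does the rest.\<close>
    have dinat: "app (\<Omega> z' b) (Comp Z g k) = Comp Z (app (\<Omega> z b) g) k"
      if k: "k \<in> hom Z z' z" and b: "b \<in> Obj B" and g: "g \<in> hom Z z (FObj H b)" for k z z' b g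
    proof -
      note z = hom_Obj[OF Z k]
      have ks: "is_nat Z Set_cat (hom_functor Z z) (hom_functor Z z') (yoneda Z (hom_functor Z z') z k)"
        by (rule yoneda[OF Zs hf[OF z(1)] z(2)]) (simp add: hom_functor_Obj z k)
      have ksa: "app (yoneda Z (hom_functor Z z') z k w) m = Comp Z m k" if m: "m \<in> hom Z z w" for m w
        by (simp add: app_yoneda[OF m hom_Obj(2)[OF Z m]] app_hom_functor[OF m k])
      let ?k = "yoneda Z (hom_functor Z z') z k"
      have kh: "?k w \<in> hom Set_cat (hom Z z w) (hom Z z' w)" if "w \<in> Obj Z" for w
        using nat_hom[OF ks that] that by (simp add: hom_functor_Obj)
      note n1 = vcomp_nat[OF whisker_pre_nat[OF H ks] \<Omega>[OF z(1)]]
      note n2 = vcomp_nat[OF \<Omega>[OF z(2)] whisker_pre_nat[OF H' ks]]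
      have \<Omega>h: "\<Omega> w b \<in> hom Set_cat (hom Z w (FObj H b)) (hom Z w (FObj H' b))" if "w \<in> Obj Z" "b \<in> Obj B" for w b
        using nat_hom[OF \<Omega>[OF that(1)] that(2)] hO[OF H that(2)] hO[OF H' that(2)] by simp
      have e1: "app (vcomp B Set_cat (\<Omega> z') (whisker_pre B ?k H) b) g = app (\<Omega> z' b) (Comp Z g k)"
        if "b \<in> Obj B" "g \<in> hom Z z (FObj H b)" for b g
        using app_Comp[OF kh[OF functor_Obj[OF H that(1)]] \<Omega>h[OF z(1) that(1)] that(2)] ksa[OF that(2)] that(1)
        by (simp add: nat_apply)
      have e2: "app (vcomp B Set_cat (whisker_pre B ?k H') (\<Omega> z) b) g = Comp Z (app (\<Omega> z b) g) k"
        if "b \<in> Obj B" "g \<in> hom Z z (FObj H b)" for b g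
        using app_Comp[OF \<Omega>h[OF z(2) that(1)] kh[OF functor_Obj[OF H' that(1)]] that(2)]
          ksa[OF \<Omega>in[OF z(2) that]] that(1) by (simp add: nat_apply)
      have "vcomp B Set_cat (\<Omega> z') (whisker_pre B ?k H) = vcomp B Set_cat (whisker_pre B ?k H') (\<Omega> z)"
      proof (rule ff_precomp_unique[OF ff n1 n2])
        fix a assume a: "a \<in> Obj C"
        note Ka = functor_Obj[OF K a]
        show "vcomp B Set_cat (\<Omega> z') (whisker_pre B ?k H) (FObj K a)
            = vcomp B Set_cat (whisker_pre B ?k H') (\<Omega> z) (FObj K a)"
        proof (rule SET_eqI[OF nat_hom[OF n1 Ka] nat_hom[OF n2 Ka]])
          fix g assume "g \<in> FObj (functor_comp B (hom_functor Z z) H) (FObj K a)"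
          then have g: "g \<in> hom Z z (FObj H (FObj K a))" using hO[OF H Ka] by simp
          have "Comp Z (\<omega> a) (Comp Z g k) = Comp Z (Comp Z (\<omega> a) g) k"
            using Comp_assoc[OF Z k g \<omega>h[OF a]] by simp
          then show "app (vcomp B Set_cat (\<Omega> z') (whisker_pre B ?k H) (FObj K a)) g
              = app (vcomp B Set_cat (whisker_pre B ?k H') (\<Omega> z) (FObj K a)) g"
            using e1[OF Ka g] e2[OF Ka g] \<Omega>K[OF z(1) a] \<Omega>K[OF z(2) a] app_hom_functor[OF \<omega>h[OF a] g]
              app_hom_functor[OF \<omega>h[OF a] Comp_hom[OF Z k g]] by simp
        qed
      qed
      then show ?thesis using e1[OF b g] e2[OF b g] by simp
    qed
    define \<Theta> where "\<Theta> = (\<lambda>b\<in>Obj B. app (\<Omega> (FObj H b) b) (Ide Z (FObj H b)))"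
    have \<Theta>: "app (\<Omega> z b) g = Comp Z (\<Theta> b) g" if b: "b \<in> Obj B" and g: "g \<in> hom Z z (FObj H b)" for z b g
      using dinat[OF g b Ide_hom[OF Z functor_Obj[OF H b]]] b Comp_Ide_left[OF Z g] by (simp add: \<Theta>_def)
    have "is_nat B Z H H' \<Theta>"
    proof (rule is_natI[OF H H'])
      show "\<Theta> b \<in> hom Z (FObj H b) (FObj H' b)" if b: "b \<in> Obj B" for b
        using \<Omega>in[OF functor_Obj[OF H b] b Ide_hom[OF Z functor_Obj[OF H b]]] b by (simp add: \<Theta>_def)
      fix f a b assume f: "f \<in> hom B a b"
      note ab = hom_Obj[OF B f]
      note Ha = functor_Obj[OF H ab(1)]
      note Hf = functor_hom[OF H f]
      have "Comp Z (\<Theta> b) (FArr H f) = app (\<Omega> (FObj H a) b) (FArr H f)" using \<Theta>[OF ab(2) Hf] by simp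
      also have "\<dots> = app (\<Omega> (FObj H a) b) (app (FArr (functor_comp B (hom_functor Z (FObj H a)) H) f) (Ide Z (FObj H a)))"
        using hA[OF H f Ide_hom[OF Z Ha]] Comp_Ide_right[OF Z Hf] by simp
      also have "\<dots> = app (FArr (functor_comp B (hom_functor Z (FObj H a)) H') f) (app (\<Omega> (FObj H a) a) (Ide Z (FObj H a)))"
        by (rule SET_nat_comm[OF \<Omega>[OF Ha] f]) (simp add: hO[OF H ab(1)] Ide_hom[OF Z Ha])
      also have "\<dots> = Comp Z (FArr H' f) (\<Theta> a)"
        using hA[OF H' f \<Omega>in[OF Ha ab(1) Ide_hom[OF Z Ha]]] ab(1) by (simp add: \<Theta>_def)
      finally show "Comp Z (\<Theta> b) (FArr H f) = Comp Z (FArr H' f) (\<Theta> a)" .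
    qed (simp add: \<Theta>_def)
    moreover have "\<Theta> (FObj K a) = \<omega> a" if a: "a \<in> Obj C" for a
    proof -
      note Ka = functor_Obj[OF K a]
      note HKa = functor_Obj[OF H Ka]
      show ?thesis
        using Ka \<Omega>K[OF HKa a] app_hom_functor[OF \<omega>h[OF a] Ide_hom[OF Z HKa]] Comp_Ide_right[OF Z \<omega>h[OF a]]
        by (simp add: \<Theta>_def)
    qed
    ultimately show "\<exists>\<Omega>. is_nat B Z H H' \<Omega> \<and> (\<forall>a\<in>Obj C. \<Omega> (FObj K a) = \<omega> a)" by blast
  qed
qed

text \<open>The subfunctor of a representable consisting of the morphisms that factor through the image of
  \<open>K\<close> agrees with the representable on that image, so it is everything; in particular it contains
  the identity.\<close>

lemma SET_ff_retract:
  fixes C B :: "('u, 'u) category"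
  assumes K: "is_functor C B K" and Bs: "small_category B"
    and ff: "restriction_ff C B K (Set_cat :: ('u set, _) category)"
    and b: "b \<in> Obj B"
  shows "\<exists>c\<in>Obj C. retract B b (FObj K c)"
proof -
  note Bl = small_locally_small[OF Bs]
  have B: "is_category B" using Bs by (simp add: small_category_def)
  define S where "S x = {g \<in> hom B b x. \<exists>c\<in>Obj C. \<exists>u\<in>hom B b (FObj K c). \<exists>v\<in>hom B (FObj K c) x. g = Comp B v u}" for x
  define P where "P = set_functor B S (\<lambda>f g. Comp B f g)"
  let ?h = "hom_functor B b"
  have h: "is_functor B Set_cat ?h" by (rule hom_functor[OF Bl b])
  have S_hom: "g \<in> hom B b x" if "g \<in> S x" for g x using that by (simp add: S_def)
  have P: "is_functor B Set_cat P"
    unfolding P_def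
  proof (rule set_functor[OF B])
    show "small TYPE('u) (S x)" if "x \<in> Obj B" for x
      using Bl b that small_subset[of "hom B b x" "S x"] by (auto simp: locally_small_def S_def)
    show "Comp B f g \<in> S y" if f: "f \<in> hom B x y" and g: "g \<in> S x" for f g x y
    proof -
      obtain c u v where "c \<in> Obj C" "u \<in> hom B b (FObj K c)" "v \<in> hom B (FObj K c) x" "g = Comp B v u"
        using g by (auto simp: S_def)
      moreover from this have "Comp B f g = Comp B (Comp B f v) u" using Comp_assoc[OF B _ _ f] by simp
      ultimately show ?thesis
        using Comp_hom[OF B S_hom[OF g] f] Comp_hom[OF B _ f] unfolding S_def by blast
    qed
  qed (use S_hom in \<open>auto intro: Comp_Ide_left[OF B] Comp_assoc[OF B]\<close>)
  have PO: "FObj P x = S x" if "x \<in> Obj B" for x using that by (simp add: P_def set_functor_simps)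
  have PA: "app (FArr P f) g = Comp B f g" if "f \<in> hom B x y" "g \<in> S x" for f g x y
    using that by (simp add: P_def set_functor_simps app_set_arr)
  have SK: "S (FObj K c) = hom B b (FObj K c)" if c: "c \<in> Obj C" for c
    using c Ide_hom[OF B functor_Obj[OF K c]] Comp_Ide_left[OF B] unfolding S_def by (force)
  have \<iota>: "is_nat B Set_cat P ?h (set_nat B P (\<lambda>_ g. g) ?h)"
    by (rule set_nat[OF P h])
      (use S_hom hom_Obj[OF B] in \<open>auto simp: PO PA hom_functor_Obj app_hom_functor\<close>)
  \<comment> \<open>On the image of \<open>K\<close> the subfunctor is everything, so identity
    functions form a transformation into it. Fullness of restriction extends that to all of
    \<open>B\<close>.\<close>
  have J0: "is_nat C Set_cat (functor_comp C ?h K) (functor_comp C P K)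
      (set_nat C (functor_comp C ?h K) (\<lambda>_ g. g) (functor_comp C P K))"
  proof (rule set_nat[OF functor_comp[OF K h] functor_comp[OF K P]])
    show "g \<in> FObj (functor_comp C P K) a" if "a \<in> Obj C" "g \<in> FObj (functor_comp C ?h K) a" for a g
      using that functor_Obj[OF K that(1)] SK by (simp add: functor_comp_simps hom_functor_Obj PO)
    show "app (FArr (functor_comp C ?h K) f) g = app (FArr (functor_comp C P K) f) g"
      if f: "f \<in> hom C a a'" and g: "g \<in> FObj (functor_comp C ?h K) a" for f a a' g
    proof -
      have a: "a \<in> Obj C" using hom_Obj[OF functor_cats(1)[OF K] f] by simp
      have "g \<in> hom B b (FObj K a)"
        using g a functor_Obj[OF K a] by (simp add: functor_comp_simps hom_functor_Obj)
      then show ?thesis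
        using homD(1)[OF f] SK[OF a]
        by (simp add: functor_comp_simps PA[OF functor_hom[OF K f]] app_hom_functor[OF functor_hom[OF K f]])
    qed
  qed
  obtain J where J: "is_nat B Set_cat ?h P J"
    "\<And>a. a \<in> Obj C \<Longrightarrow> J (FObj K a) = set_nat C (functor_comp C ?h K) (\<lambda>_ g. g) (functor_comp C P K) a"
    using ff_precomp_extend[OF ff h P J0] by blast
  let ?\<iota> = "set_nat B P (\<lambda>_ g. g) ?h"
  \<comment> \<open>Both sides restrict to identities along \<open>K\<close>, so faithfulness makes
    \<open>J\<close> a section of the inclusion. Applied at \<open>b\<close>, it puts the identity
    of \<open>b\<close> into \<open>S b\<close>.\<close>
  have eq: "vcomp B Set_cat ?\<iota> J = nat_id B Set_cat ?h"
  proof (rule ff_precomp_unique[OF ff vcomp_nat[OF J(1) \<iota>] nat_id[OF h]])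
    fix a assume a: "a \<in> Obj C"
    note Ka = functor_Obj[OF K a]
    show "vcomp B Set_cat ?\<iota> J (FObj K a) = nat_id B Set_cat ?h (FObj K a)"
    proof (rule SET_eqI[OF nat_hom[OF vcomp_nat[OF J(1) \<iota>] Ka] nat_hom[OF nat_id[OF h] Ka]])
      fix g assume g: "g \<in> FObj ?h (FObj K a)"
      have g': "g \<in> FObj (functor_comp C ?h K) a" using g a by (simp add: functor_comp_simps)
      have "app (J (FObj K a)) g = g" using J(2)[OF a] by (simp add: app_set_nat[OF a g'])
      moreover have "g \<in> FObj P (FObj K a)" using g SK[OF a] by (simp add: PO Ka hom_functor_Obj)
      ultimately show "app (vcomp B Set_cat ?\<iota> J (FObj K a)) g = app (nat_id B Set_cat ?h (FObj K a)) g"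
        using g Ka app_Comp[OF nat_hom[OF J(1) Ka] nat_hom[OF \<iota> Ka] g]
        by (simp add: nat_apply app_Ide app_set_nat[OF Ka])
    qed
  qed
  have i: "Ide B b \<in> FObj ?h b" using Ide_hom[OF B b] b by (simp add: hom_functor_Obj)
  have "app (vcomp B Set_cat ?\<iota> J b) (Ide B b) = Ide B b" using i b by (simp add: eq nat_apply app_Ide)
  moreover have Ji: "app (J b) (Ide B b) \<in> FObj P b" by (rule SET_nat_in[OF J(1) b i])
  ultimately have "Ide B b \<in> S b"
    using app_Comp[OF nat_hom[OF J(1) b] nat_hom[OF \<iota> b] i] b Ji
    by (simp add: nat_apply PO app_set_nat[OF b Ji])
  then show ?thesis unfolding S_def retract_def by force
qed

text \<open>Let \<open>Q\<close> extend the representable of \<open>c\<close>, with \<open>x\<close>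
  in \<open>Q (K c)\<close> corresponding to the identity of \<open>c\<close>. Moving
  \<open>x\<close> along \<open>Q\<close> recovers an arrow \<open>f\<close> from
  \<open>K f\<close>, and the same recipe applied to an arbitrary \<open>h\<close> between image
  objects produces its preimage.\<close>

lemma SET_representables_ff:
  fixes C B :: "('u, 'u) category"
  assumes K: "is_functor C B K" and Cs: "small_category C" and Bs: "small_category B"
    and ff: "restriction_ff C B K (Set_cat :: ('u set, _) category)"
    and rep: "\<And>c. c \<in> Obj C \<Longrightarrow> \<exists>Q \<alpha>. is_functor B (Set_cat :: ('u set, _) category) Q \<and>
      is_nat_iso C Set_cat (functor_comp C Q K) (hom_functor C c) \<alpha>"
  shows "fully_faithful C B K"
proof (rule fully_faithfulI[OF K])
  note Bl = small_locally_small[OF Bs] and Cl = small_locally_small[OF Cs]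
  note C = functor_cats(1)[OF K] and B = functor_cats(2)[OF K]
  fix c d
  have data: "\<exists>Q \<alpha> x. is_functor B (Set_cat :: ('u set, _) category) Q \<and>
      is_nat C Set_cat (functor_comp C Q K) (hom_functor C c) \<alpha> \<and> x \<in> FObj Q (FObj K c) \<and> app (\<alpha> c) x = Ide C c"
    if c: "c \<in> Obj C"
  proof -
    obtain Q \<alpha> where Q: "is_functor B (Set_cat :: ('u set, _) category) Q"
      and \<alpha>: "is_nat_iso C Set_cat (functor_comp C Q K) (hom_functor C c) \<alpha>" using rep[OF c] by blast
    note \<alpha>' = nat_iso_nat[OF \<alpha>]
    obtain \<beta> where \<beta>: "is_nat_iso C Set_cat (hom_functor C c) (functor_comp C Q K) \<beta>"
      "\<And>a. a \<in> Obj C \<Longrightarrow> Comp Set_cat (\<alpha> a) (\<beta> a) = Ide Set_cat (FObj (hom_functor C c) a)"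
      using nat_iso_inverse[OF \<alpha>] by blast
    note \<beta>' = nat_iso_nat[OF \<beta>(1)]
    have i: "Ide C c \<in> FObj (hom_functor C c) c" using Ide_hom[OF C c] c by (simp add: hom_functor_Obj)
    have "app (\<alpha> c) (app (\<beta> c) (Ide C c)) = Ide C c"
      using app_Comp[OF nat_hom[OF \<beta>' c] nat_hom[OF \<alpha>' c] i] \<beta>(2)[OF c] by (simp add: app_Ide[OF i])
    moreover have "app (\<beta> c) (Ide C c) \<in> FObj Q (FObj K c)"
      using SET_nat_in[OF \<beta>' c i] c by (simp add: functor_comp_simps)
    ultimately show ?thesis using Q \<alpha>' by blast
  qed
  \<comment> \<open>The left-hand side mentions \<open>f\<close> only through \<open>K f\<close>,
    which gives faithfulness at once.\<close>
  have key: "app (\<alpha> d) (app (FArr Q (FArr K f)) x) = f"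
    if \<alpha>: "is_nat C Set_cat (functor_comp C Q K) (hom_functor C c) \<alpha>"
      and x: "x \<in> FObj Q (FObj K c)" "app (\<alpha> c) x = Ide C c" and f: "f \<in> hom C c d" for Q \<alpha> x f d
  proof -
    have c: "c \<in> Obj C" using hom_Obj[OF C f] by simp
    have "x \<in> FObj (functor_comp C Q K) c" using x(1) c by (simp add: functor_comp_simps)
    from SET_nat_comm[OF \<alpha> f this] show ?thesis
      using homD(1)[OF f] x(2) app_hom_functor[OF f Ide_hom[OF C c]] Comp_Ide_right[OF C f]
      by (simp add: functor_comp_simps)
  qed
  show "f = g" if f: "f \<in> hom C c d" and g: "g \<in> hom C c d" and eq: "FArr K f = FArr K g" for f g
  proof -
    obtain Q \<alpha> x where \<alpha>: "is_nat C Set_cat (functor_comp C Q K) (hom_functor C c) \<alpha>"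
      and x: "x \<in> FObj Q (FObj K c)" "app (\<alpha> c) x = Ide C c"
      using data[OF hom_Obj(1)[OF C f]] by blast
    show ?thesis by (rule trans[OF key[OF \<alpha> x f, symmetric] key[OF \<alpha> x g, folded eq]])
  qed
  fix h assume c: "c \<in> Obj C" and d: "d \<in> Obj C" and h: "h \<in> hom B (FObj K c) (FObj K d)"
  obtain Q \<alpha> x where Q: "is_functor B Set_cat Q" and \<alpha>: "is_nat C Set_cat (functor_comp C Q K) (hom_functor C c) \<alpha>"
    and x: "x \<in> FObj Q (FObj K c)" "app (\<alpha> c) x = Ide C c"
    using data[OF c] by blast
  note Kc = functor_Obj[OF K c] and Kd = functor_Obj[OF K d]
  let ?R = "hom_functor B (FObj K c)"
  have R: "is_functor B Set_cat ?R" by (rule hom_functor[OF Bl Kc])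
  have RO: "FObj (functor_comp C ?R K) a = hom B (FObj K c) (FObj K a)" if "a \<in> Obj C" for a
    using that functor_Obj[OF K that] by (simp add: functor_comp_simps hom_functor_Obj)
  \<comment> \<open>\<open>\<gamma>\<close> is the action of \<open>K\<close> on arrows out of
    \<open>c\<close>. Fullness of restriction extends \<open>\<gamma>\<close> after
    \<open>\<alpha>\<close> to \<open>\<delta>\<close> on all of \<open>B\<close>, and
    \<open>\<delta>\<close> sends \<open>x\<close> to the identity of \<open>K c\<close>.\<close>
  define \<gamma> where "\<gamma> = yoneda C (functor_comp C ?R K) c (Ide B (FObj K c))"
  have \<gamma>: "is_nat C Set_cat (hom_functor C c) (functor_comp C ?R K) \<gamma>"
    unfolding \<gamma>_def by (rule yoneda[OF Cl functor_comp[OF K R] c]) (simp add: RO[OF c] Ide_hom[OF B Kc])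
  have \<gamma>a: "app (\<gamma> a) f = FArr K f" if f: "f \<in> hom C c a" for f a
    using homD(1)[OF f] app_hom_functor[OF functor_hom[OF K f] Ide_hom[OF B Kc]]
      Comp_Ide_right[OF B functor_hom[OF K f]]
    by (simp add: \<gamma>_def functor_comp_simps app_yoneda[OF f hom_Obj(2)[OF C f]])
  obtain \<delta> where \<delta>: "is_nat B Set_cat Q ?R \<delta>"
    and \<delta>K: "\<And>a. a \<in> Obj C \<Longrightarrow> \<delta> (FObj K a) = vcomp C Set_cat \<gamma> \<alpha> a"
    using ff_precomp_extend[OF ff Q R vcomp_nat[OF \<alpha> \<gamma>]] by blast
  have \<delta>a: "app (\<delta> (FObj K a)) y = FArr K (app (\<alpha> a) y)" if a: "a \<in> Obj C" and y: "y \<in> FObj Q (FObj K a)" for a y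
  proof -
    have y': "y \<in> FObj (functor_comp C Q K) a" using y a by (simp add: functor_comp_simps)
    have "app (\<alpha> a) y \<in> hom C c a" using SET_nat_in[OF \<alpha> a y'] a by (simp add: hom_functor_Obj)
    then show ?thesis
      using \<delta>K[OF a] app_Comp[OF nat_hom[OF \<alpha> a] nat_hom[OF \<gamma> a] y'] \<gamma>a a by (simp add: nat_apply)
  qed
  \<comment> \<open>By naturality \<open>\<delta>\<close> sends \<open>y\<close> to
    \<open>h\<close>. Over the image object \<open>K d\<close> it also factors through
    \<open>K\<close>, so \<open>h\<close> is \<open>K\<close> of the arrow that
    \<open>\<alpha>\<close> assigns to \<open>y\<close>.\<close>
  define y where "y = app (FArr Q h) x"
  have y: "y \<in> FObj Q (FObj K d)" unfolding y_def by (rule SET_functor_in[OF Q h x(1)])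
  have "app (\<alpha> d) y \<in> hom C c d"
    using SET_nat_in[OF \<alpha> d, of y] y d by (simp add: functor_comp_simps hom_functor_Obj)
  moreover have "FArr K (app (\<alpha> d) y) = h"
  proof -
    have "FArr K (app (\<alpha> d) y) = app (FArr ?R h) (app (\<delta> (FObj K c)) x)"
      using \<delta>a[OF d y] SET_nat_comm[OF \<delta> h x(1)] by (simp add: y_def)
    also have "app (\<delta> (FObj K c)) x = Ide B (FObj K c)"
      using \<delta>a[OF c x(1)] x(2) functor_Ide[OF K c] by simp
    finally show ?thesis using app_hom_functor[OF h Ide_hom[OF B Kc]] Comp_Ide_right[OF B h] by simp
  qed
  ultimately show "\<exists>f\<in>hom C c d. FArr K f = h" by blast
qed

section \<open>Conditions on a functor between small categories\<close>

context
  fixes C B :: "('u, 'u) category" and K :: "('u, 'u, 'u, 'u) fmaps"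
  assumes u: "universe TYPE('u)" and Cs: "small_category C" and Bs: "small_category B"
    and K: "is_functor C B K"
begin

text \<open>The quantifier over all small test categories collapses to one large test category:
  Yoneda in one direction, small images in the other.\<close>

lemma lax_epi_iff_ff_SET:
  "lax_epi TYPE('u) C B K \<longleftrightarrow>
     restriction_ff C B K (Set_cat :: ('u set, _) category)"
  using SET_ff_lax_epi[OF K] lax_epi_ff_locally_small[OF u _ _ SET_locally_small[OF u]] Bs
  by (auto simp: small_category_def)

lemma lax_epi_iff_ff_Cat:
  "lax_epi TYPE('u) C B K \<longleftrightarrow>
     restriction_ff C B K (Cat :: (('u, 'u) category, _) category)"
proof
  assume "lax_epi TYPE('u) C B K"
  then show "restriction_ff C B K (Cat :: (('u, 'u) category, _) category)"
    using lax_epi_ff_locally_small[OF u _ _ Cat_locally_small[OF u]] Bs by (auto simp: small_category_def)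
next
  assume "restriction_ff C B K (Cat :: (('u, 'u) category, _) category)"
  from ff_precomp_into_ff[OF K Discrete_ff this] show "lax_epi TYPE('u) C B K" by (simp add: lax_epi_iff_ff_SET)
qed

text \<open>Retracts come from testing against sets; conversely retracts force unique extension into
  any category.\<close>

lemma lax_epi_retract_dense:
  "fully_faithful C B K \<and> lax_epi TYPE('u) C B K \<longleftrightarrow> retract_dense C B K"
proof
  assume "fully_faithful C B K \<and> lax_epi TYPE('u) C B K"
  then show "retract_dense C B K"
    using SET_ff_retract[OF K Bs] by (simp add: retract_dense_def lax_epi_iff_ff_SET)
next
  assume rd: "retract_dense C B K"
  then show "fully_faithful C B K \<and> lax_epi TYPE('u) C B K"
    using retract_dense_ff_precomp[OF rd SET_category] lax_epi_iff_ff_SET by (simp add: retract_dense_def)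
qed

lemma retract_dense_equivalence:
  assumes "retract_dense C B K" "splits_idempotents Z"
  shows "restriction_equivalence C B K Z"
proof -
  have Z: "is_category Z" using assms(2) by (simp add: splits_idempotents_def)
  show ?thesis
    using retract_dense_ff_precomp[OF assms(1) Z] retract_dense_ess_surj_precomp[OF assms]
    by (simp add: equivalence_iff)
qed

text \<open>For the implication from right to left, essential surjectivity is applied to the
  representables of \<open>C\<close> alone.\<close>

lemma retract_dense_iff_equivalence_SET:
  "retract_dense C B K \<longleftrightarrow>
     restriction_equivalence C B K (Set_cat :: ('u set, _) category)"
proof
  assume eq: "restriction_equivalence C B K (Set_cat :: ('u set, _) category)"
  then have ff: "restriction_ff C B K (Set_cat :: ('u set, _) category)"
    and es: "restriction_ess_surj C B K (Set_cat :: ('u set, _) category)"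
    by (simp_all add: equivalence_iff)
  have "fully_faithful C B K"
    by (rule SET_representables_ff[OF K Cs Bs ff])
      (use ess_surj_precompD[OF es hom_functor[OF small_locally_small[OF Cs]]] in blast)
  then show "retract_dense C B K" using lax_epi_retract_dense ff by (simp add: lax_epi_iff_ff_SET)
qed (rule retract_dense_equivalence[OF _ SET_splits])

text \<open>From \<open>Cat\<close> to sets, full faithfulness descends along the embedding of
  discrete categories and essential surjectivity along its retraction \<open>Objects\<close>. The
  converse uses that \<open>Cat\<close> splits idempotents.\<close>

lemma retract_dense_iff_equivalence_Cat:
  "retract_dense C B K \<longleftrightarrow>
     restriction_equivalence C B K (Cat :: (('u, 'u) category, _) category)"
proof
  assume "restriction_equivalence C B K (Cat :: (('u, 'u) category, _) category)"
  then have "restriction_ff C B K (Cat :: (('u, 'u) category, _) category)"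
    and es: "restriction_ess_surj C B K (Cat :: (('u, 'u) category, _) category)"
    by (simp_all add: equivalence_iff)
  then show "retract_dense C B K"
    using ff_precomp_into_ff[OF K Discrete_ff]
      ess_surj_precomp_retract[OF K ff_functor[OF Discrete_ff] Objects_functor Objects_Discrete es]
    by (simp add: retract_dense_iff_equivalence_SET equivalence_iff)
qed (rule retract_dense_equivalence[OF _ Cat_splits])

end


section \<open>Descent and lax codescent\<close>

lemma ker2_hom:
  "t \<in> hom (ker2 E p) u v \<longleftrightarrow> fst t \<in> hom E (fst u) (fst v) \<and> snd t \<in> hom E (snd u) (snd v) \<and>
     FArr p (fst t) = FArr p (snd t)"
  by (auto simp: ker2_def hom_def split_def prod_eq_iff)

lemma ker2_simps:
  "u \<in> Obj (ker2 E p) \<longleftrightarrow> fst u \<in> Obj E \<and> snd u \<in> Obj E \<and> FObj p (fst u) = FObj p (snd u)"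
  "Ide (ker2 E p) u = (Ide E (fst u), Ide E (snd u))"
  "Comp (ker2 E p) s t = (Comp E (fst s) (fst t), Comp E (snd s) (snd t))"
  by (auto simp: ker2_def split_def)

lemma ker3_hom:
  "t \<in> hom (ker3 E p) u v \<longleftrightarrow> fst t \<in> hom E (fst u) (fst v) \<and> fst (snd t) \<in> hom E (fst (snd u)) (fst (snd v)) \<and>
     snd (snd t) \<in> hom E (snd (snd u)) (snd (snd v)) \<and>
     FArr p (fst t) = FArr p (fst (snd t)) \<and> FArr p (fst (snd t)) = FArr p (snd (snd t))"
  by (auto simp: ker3_def hom_def split_def prod_eq_iff)

lemma ker3_simps:
  "u \<in> Obj (ker3 E p) \<longleftrightarrow> fst u \<in> Obj E \<and> fst (snd u) \<in> Obj E \<and> snd (snd u) \<in> Obj E \<and>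
     FObj p (fst u) = FObj p (fst (snd u)) \<and> FObj p (fst (snd u)) = FObj p (snd (snd u))"
  "Ide (ker3 E p) u = (Ide E (fst u), Ide E (fst (snd u)), Ide E (snd (snd u)))"
  "Comp (ker3 E p) s t =
     (Comp E (fst s) (fst t), Comp E (fst (snd s)) (fst (snd t)), Comp E (snd (snd s)) (snd (snd t)))"
  by (auto simp: ker3_def split_def)

lemma functor_hom_eq_Obj:
  assumes p: "is_functor E B p" and "f \<in> hom E a b" "g \<in> hom E c d" "FArr p f = FArr p g"
  shows "FObj p a = FObj p c" "FObj p b = FObj p d"
  using homD[OF functor_hom[OF p assms(2)]] homD[OF functor_hom[OF p assms(3)]] assms(4) by auto

lemma ker2_category:
  assumes p: "is_functor E B p"
  shows "is_category (ker2 E p)"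
proof (rule is_categoryI)
  note E = functor_cats(1)[OF p]
  show "u \<in> Obj (ker2 E p) \<and> v \<in> Obj (ker2 E p)" if "t \<in> hom (ker2 E p) u v" for t u v
    using that hom_Obj[OF E] functor_hom_eq_Obj[OF p] unfolding ker2_hom ker2_simps by blast
  show "Ide (ker2 E p) u \<in> hom (ker2 E p) u u" if "u \<in> Obj (ker2 E p)" for u
    using that by (simp add: ker2_hom ker2_simps Ide_hom[OF E] functor_Ide[OF p])
  show "Comp (ker2 E p) s t \<in> hom (ker2 E p) u w" if "t \<in> hom (ker2 E p) u v" "s \<in> hom (ker2 E p) v w" for s t u v w
    using that functor_Comp[OF p, of "fst t" "fst u" "fst v" "fst s" "fst w"]
      functor_Comp[OF p, of "snd t" "snd u" "snd v" "snd s" "snd w"]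
    by (auto simp: ker2_hom ker2_simps intro: Comp_hom[OF E])
qed (auto simp: ker2_hom ker2_simps Comp_Ide_left[OF functor_cats(1)[OF p]] Comp_Ide_right[OF functor_cats(1)[OF p]]
      Comp_assoc[OF functor_cats(1)[OF p]])

lemma ker3_category:
  assumes p: "is_functor E B p"
  shows "is_category (ker3 E p)"
proof (rule is_categoryI)
  note E = functor_cats(1)[OF p]
  show "u \<in> Obj (ker3 E p) \<and> v \<in> Obj (ker3 E p)" if "t \<in> hom (ker3 E p) u v" for t u v
    using that hom_Obj[OF E] functor_hom_eq_Obj[OF p] unfolding ker3_hom ker3_simps by blast
  show "Ide (ker3 E p) u \<in> hom (ker3 E p) u u" if "u \<in> Obj (ker3 E p)" for u
    using that by (simp add: ker3_hom ker3_simps Ide_hom[OF E] functor_Ide[OF p])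
  show "Comp (ker3 E p) s t \<in> hom (ker3 E p) u w" if "t \<in> hom (ker3 E p) u v" "s \<in> hom (ker3 E p) v w" for s t u v w
    using that functor_Comp[OF p, of "fst t" "fst u" "fst v" "fst s" "fst w"]
      functor_Comp[OF p, of "fst (snd t)" "fst (snd u)" "fst (snd v)" "fst (snd s)" "fst (snd w)"]
      functor_Comp[OF p, of "snd (snd t)" "snd (snd u)" "snd (snd v)" "snd (snd s)" "snd (snd w)"]
    by (auto simp: ker3_hom ker3_simps intro: Comp_hom[OF E])
qed (auto simp: ker3_hom ker3_simps Comp_Ide_left[OF functor_cats(1)[OF p]] Comp_Ide_right[OF functor_cats(1)[OF p]]
      Comp_assoc[OF functor_cats(1)[OF p]])

section \<open>Projections and the diagonal\<close>

lemma tuple_fun_functor: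
  assumes X: "is_category X" and Y: "is_category Y"
    and "\<And>a. a \<in> Obj X \<Longrightarrow> f a \<in> Obj Y"
    and "\<And>t a b. t \<in> hom X a b \<Longrightarrow> g t \<in> hom Y (f a) (f b)"
    and "\<And>a. a \<in> Obj X \<Longrightarrow> g (Ide X a) = Ide Y (f a)"
    and "\<And>s t a b c. t \<in> hom X a b \<Longrightarrow> s \<in> hom X b c \<Longrightarrow> g (Comp X s t) = Comp Y (g s) (g t)"
  shows "is_functor X Y (tuple_fun X f g)"
proof (rule is_functorI[OF X Y])
  show "FArr (tuple_fun X f g) t \<in> hom Y (FObj (tuple_fun X f g) a) (FObj (tuple_fun X f g) b)"
    if "t \<in> hom X a b" for t a b
    using assms(4)[OF that] hom_Obj[OF X that] homD(1)[OF that] by (simp add: tuple_fun_def)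
  show "FArr (tuple_fun X f g) (Ide X a) = Ide Y (FObj (tuple_fun X f g) a)" if "a \<in> Obj X" for a
    using assms(5)[OF that] that homD(1)[OF Ide_hom[OF X that]] by (simp add: tuple_fun_def)
  show "FArr (tuple_fun X f g) (Comp X s t) = Comp Y (FArr (tuple_fun X f g) s) (FArr (tuple_fun X f g) t)"
    if "t \<in> hom X a b" "s \<in> hom X b c" for s t a b c
    using assms(6)[OF that] homD(1)[OF that(1)] homD(1)[OF that(2)] homD(1)[OF Comp_hom[OF X that]]
    by (simp add: tuple_fun_def)
qed (auto simp: tuple_fun_def assms(3))

lemmas d_defs = d10_def d11_def d20_def d21_def d22_def s00_def

lemma d_functors:
  assumes p: "is_functor E B p"
  shows "is_functor (ker2 E p) E (d10 E p)" "is_functor (ker2 E p) E (d11 E p)"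
    "is_functor (ker3 E p) (ker2 E p) (d20 E p)" "is_functor (ker3 E p) (ker2 E p) (d21 E p)"
    "is_functor (ker3 E p) (ker2 E p) (d22 E p)" "is_functor E (ker2 E p) (s00 E)"
  unfolding d_defs
  by (rule tuple_fun_functor;
      force simp: functor_cats[OF p] ker2_category[OF p] ker3_category[OF p] ker2_hom ker2_simps ker3_hom ker3_simps)+

lemma d_simps:
  "u \<in> Obj (ker2 E p) \<Longrightarrow> FObj (d10 E p) u = snd u" "u \<in> Obj (ker2 E p) \<Longrightarrow> FObj (d11 E p) u = fst u"
  "v \<in> Obj (ker3 E p) \<Longrightarrow> FObj (d20 E p) v = snd v"
  "v \<in> Obj (ker3 E p) \<Longrightarrow> FObj (d21 E p) v = (fst v, snd (snd v))"
  "v \<in> Obj (ker3 E p) \<Longrightarrow> FObj (d22 E p) v = (fst v, fst (snd v))"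
  "a \<in> Obj E \<Longrightarrow> FObj (s00 E) a = (a, a)"
  by (auto simp: d_defs tuple_fun_def split_def)

lemma d_simps_Arr:
  "t \<in> Arr (ker2 E p) \<Longrightarrow> FArr (d10 E p) t = snd t" "t \<in> Arr (ker2 E p) \<Longrightarrow> FArr (d11 E p) t = fst t"
  "v \<in> Arr (ker3 E p) \<Longrightarrow> FArr (d20 E p) v = snd v"
  "v \<in> Arr (ker3 E p) \<Longrightarrow> FArr (d21 E p) v = (fst v, snd (snd v))"
  "v \<in> Arr (ker3 E p) \<Longrightarrow> FArr (d22 E p) v = (fst v, fst (snd v))"
  "f \<in> Arr E \<Longrightarrow> FArr (s00 E) f = (f, f)"
  by (auto simp: d_defs tuple_fun_def split_def)

text \<open>This equality allows the comparison functor to take an identity as descent datum on a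
  functor restricted along \<open>p\<close>.\<close>

lemma p_d10_d11: "functor_comp (ker2 E p) p (d10 E p) = functor_comp (ker2 E p) p (d11 E p)"
proof -
  have "FObj p (FObj (d10 E p) u) = FObj p (FObj (d11 E p) u)" if "u \<in> Obj (ker2 E p)" for u
    using that by (simp add: d_simps) (simp add: ker2_simps)
  moreover have "FArr p (FArr (d10 E p) t) = FArr p (FArr (d11 E p) t)" if "t \<in> Arr (ker2 E p)" for t
    using that by (simp add: d_simps_Arr) (auto simp: ker2_def)
  ultimately show ?thesis by (simp add: functor_comp_def cong: restrict_cong)
qed

text \<open>These are the identities that give the unit and cocycle conditions their types: the
  whiskered copies of a datum become composable and have matching end points.\<close>

lemma simplicial_identities:
  assumes p: "is_functor E B p"
  shows "functor_comp E (d10 E p) (s00 E) = functor_id E" "functor_comp E (d11 E p) (s00 E) = functor_id E"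
    "functor_comp (ker3 E p) (d11 E p) (d22 E p) = functor_comp (ker3 E p) (d11 E p) (d21 E p)"
    "functor_comp (ker3 E p) (d10 E p) (d20 E p) = functor_comp (ker3 E p) (d10 E p) (d21 E p)"
    "functor_comp (ker3 E p) (d10 E p) (d22 E p) = functor_comp (ker3 E p) (d11 E p) (d20 E p)"
proof -
  note O = functor_Obj[OF d_functors(3)[OF p]] functor_Obj[OF d_functors(4)[OF p]] functor_Obj[OF d_functors(5)[OF p]]
    functor_Obj[OF d_functors(6)[OF p]]
  note A = functor_Arr[OF d_functors(3)[OF p]] functor_Arr[OF d_functors(4)[OF p]] functor_Arr[OF d_functors(5)[OF p]]
    functor_Arr[OF d_functors(6)[OF p]]
  show "functor_comp E (d10 E p) (s00 E) = functor_id E" "functor_comp E (d11 E p) (s00 E) = functor_id E"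
    using O(4) A(4)
    by (auto simp: functor_comp_def functor_id_def d_simps d_simps_Arr intro!: restrict_ext)
  show "functor_comp (ker3 E p) (d11 E p) (d22 E p) = functor_comp (ker3 E p) (d11 E p) (d21 E p)"
    "functor_comp (ker3 E p) (d10 E p) (d20 E p) = functor_comp (ker3 E p) (d10 E p) (d21 E p)"
    "functor_comp (ker3 E p) (d10 E p) (d22 E p) = functor_comp (ker3 E p) (d11 E p) (d20 E p)"
    using O(1-3) A(1-3)
    by (auto simp: functor_comp_def d_simps d_simps_Arr intro!: restrict_ext)
qed

text \<open>One notion for two roles: a codescent cocone when \<open>Z\<close> is small on
  \<open>'u\<close>, and an object of the descent category of \<open>CAT(-, Z)\<close>. Unlike in
  \<open>codesc_cocone\<close>, the type of \<open>Z\<close> is free, so \<open>Set_cat\<close> and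
  \<open>Cat\<close> are allowed.\<close>

definition cocone_data where
  "cocone_data E p Z x \<phi> \<longleftrightarrow> is_functor E Z x \<and>
     is_nat (ker2 E p) Z (functor_comp (ker2 E p) x (d11 E p)) (functor_comp (ker2 E p) x (d10 E p)) \<phi> \<and>
     whisker_pre E \<phi> (s00 E) = nat_id E Z x \<and>
     vcomp (ker3 E p) Z (whisker_pre (ker3 E p) \<phi> (d20 E p)) (whisker_pre (ker3 E p) \<phi> (d22 E p))
       = whisker_pre (ker3 E p) \<phi> (d21 E p)"

lemma codesc_cocone_iff: "codesc_cocone E p C q \<psi> \<longleftrightarrow> small_category C \<and> cocone_data E p C q \<psi>"
  by (simp add: codesc_cocone_def cocone_data_def)

lemma restrict_eq_iff: "restrict f A = restrict g A \<longleftrightarrow> (\<forall>a\<in>A. f a = g a)"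
  by (auto simp: fun_eq_iff restrict_def)

lemma cocone_data_iff:
  "cocone_data E p Z x \<phi> \<longleftrightarrow> is_functor E Z x \<and>
     is_nat (ker2 E p) Z (functor_comp (ker2 E p) x (d11 E p)) (functor_comp (ker2 E p) x (d10 E p)) \<phi> \<and>
     (\<forall>a\<in>Obj E. \<phi> (a, a) = Ide Z (FObj x a)) \<and>
     (\<forall>v\<in>Obj (ker3 E p). Comp Z (\<phi> (snd v)) (\<phi> (fst v, fst (snd v))) = \<phi> (fst v, snd (snd v)))"
  by (simp add: cocone_data_def whisker_pre_def nat_id_def vcomp_def restrict_eq_iff d_simps)

text \<open>\<open>d11\<close> keeps the first factor and \<open>d10\<close> the second, which fixes
  the direction of the arrow.\<close>

lemma cocone_data_hom:
  assumes "cocone_data E p Z x \<phi>" "u \<in> Obj (ker2 E p)"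
  shows "\<phi> u \<in> hom Z (FObj x (fst u)) (FObj x (snd u))"
  using nat_hom[OF _ assms(2)] assms by (fastforce simp: cocone_data_def functor_comp_simps d_simps)

lemma cocone_data_postcomp:
  assumes p: "is_functor E B p" and x: "cocone_data E p Z x \<phi>" and F: "is_functor Z W F"
  shows "cocone_data E p W (functor_comp E F x) (whisker_post (ker2 E p) F \<phi>)"
  unfolding cocone_data_iff
proof (intro conjI ballI)
  have x': "is_functor E Z x"
    and n: "is_nat (ker2 E p) Z (functor_comp (ker2 E p) x (d11 E p)) (functor_comp (ker2 E p) x (d10 E p)) \<phi>"
    using x by (simp_all add: cocone_data_def)
  show "is_functor E W (functor_comp E F x)" by (rule functor_comp[OF x' F])
  show "is_nat (ker2 E p) W (functor_comp (ker2 E p) (functor_comp E F x) (d11 E p))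
     (functor_comp (ker2 E p) (functor_comp E F x) (d10 E p)) (whisker_post (ker2 E p) F \<phi>)"
    using whisker_post_nat[OF n F]
    by (simp add: functor_comp_assoc[OF d_functors(1)[OF p]] functor_comp_assoc[OF d_functors(2)[OF p]])
  show "whisker_post (ker2 E p) F \<phi> (a, a) = Ide W (FObj (functor_comp E F x) a)" if "a \<in> Obj E" for a
    using x that functor_Ide[OF F functor_Obj[OF x' that]]
    by (simp add: cocone_data_iff whisker_post_def ker2_simps functor_comp_simps)
  fix v assume v: "v \<in> Obj (ker3 E p)"
  have v': "snd v \<in> Obj (ker2 E p)" "(fst v, fst (snd v)) \<in> Obj (ker2 E p)" "(fst v, snd (snd v)) \<in> Obj (ker2 E p)"
    using v by (auto simp: ker2_simps ker3_simps)
  have "Comp Z (\<phi> (snd v)) (\<phi> (fst v, fst (snd v))) = \<phi> (fst v, snd (snd v))"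
    using x v by (simp add: cocone_data_iff)
  then show "Comp W (whisker_post (ker2 E p) F \<phi> (snd v)) (whisker_post (ker2 E p) F \<phi> (fst v, fst (snd v)))
      = whisker_post (ker2 E p) F \<phi> (fst v, snd (snd v))"
    using functor_Comp[OF F, of "\<phi> (fst v, fst (snd v))" "FObj x (fst v)" "FObj x (fst (snd v))" "\<phi> (snd v)" "FObj x (snd (snd v))"]
      cocone_data_hom[OF x v'(1)] cocone_data_hom[OF x v'(2)] v' by (simp add: whisker_post_apply)
qed

lemma whisker_post_comp:
  "whisker_post X (functor_comp Y G F) \<alpha> = whisker_post X G (whisker_post X F \<alpha>)"
  if "\<And>a. a \<in> Obj X \<Longrightarrow> \<alpha> a \<in> Arr Y"
  using that by (simp add: whisker_post_def functor_comp_simps cong: restrict_cong)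

lemma whisker_post_id:
  assumes "\<alpha> \<in> extensional (Obj X)" "\<And>a. a \<in> Obj X \<Longrightarrow> \<alpha> a \<in> Arr Y"
  shows "whisker_post X (functor_id Y) \<alpha> = \<alpha>"
  by (rule extensionalityI[OF _ assms(1)]) (auto simp: whisker_post_def functor_id_simps assms(2))

text \<open>Also a notion with two roles: the condition on an arrow of the descent category and the
  hypothesis of the two-dimensional universal property.\<close>

definition compatible where
  "compatible E p Z \<omega> \<phi> \<phi>' \<longleftrightarrow>
     vcomp (ker2 E p) Z (whisker_pre (ker2 E p) \<omega> (d10 E p)) \<phi>
       = vcomp (ker2 E p) Z \<phi>' (whisker_pre (ker2 E p) \<omega> (d11 E p))"

lemma compatible_iff:
  "compatible E p Z \<omega> \<phi> \<phi>' \<longleftrightarrow>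
     (\<forall>u\<in>Obj (ker2 E p). Comp Z (\<omega> (snd u)) (\<phi> u) = Comp Z (\<phi>' u) (\<omega> (fst u)))"
  by (simp add: compatible_def whisker_pre_def vcomp_def restrict_eq_iff d_simps)

lemma compatible_postcomp:
  assumes F: "is_functor Z W F" and x: "cocone_data E p Z x \<phi>" and y: "cocone_data E p Z y \<phi>'"
    and \<omega>: "is_nat E Z x y \<omega>" and "compatible E p Z \<omega> \<phi> \<phi>'"
  shows "compatible E p W (whisker_post E F \<omega>) (whisker_post (ker2 E p) F \<phi>) (whisker_post (ker2 E p) F \<phi>')"
  unfolding compatible_iff
proof
  fix u assume u: "u \<in> Obj (ker2 E p)"
  then have u': "fst u \<in> Obj E" "snd u \<in> Obj E" by (auto simp: ker2_simps)
  have "FArr F (Comp Z (\<omega> (snd u)) (\<phi> u)) = FArr F (Comp Z (\<phi>' u) (\<omega> (fst u)))"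
    using assms(5) u by (simp add: compatible_iff)
  then show "Comp W (whisker_post E F \<omega> (snd u)) (whisker_post (ker2 E p) F \<phi> u)
      = Comp W (whisker_post (ker2 E p) F \<phi>' u) (whisker_post E F \<omega> (fst u))"
    using u u' functor_Comp[OF F cocone_data_hom[OF x u] nat_hom[OF \<omega> u'(2)]]
      functor_Comp[OF F nat_hom[OF \<omega> u'(1)] cocone_data_hom[OF y u]]
    by (simp add: whisker_post_apply)
qed

text \<open>Naturality of \<open>\<Omega>\<close> at the arrows \<open>\<psi> u\<close>.\<close>

lemma nat_compatible:
  assumes q: "cocone_data E p C q \<psi>" and \<Omega>: "is_nat C Z H H' \<Omega>"
  shows "compatible E p Z (whisker_pre E \<Omega> q) (whisker_post (ker2 E p) H \<psi>) (whisker_post (ker2 E p) H' \<psi>)"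
  unfolding compatible_iff
proof
  fix u assume u: "u \<in> Obj (ker2 E p)"
  then have "fst u \<in> Obj E" "snd u \<in> Obj E" by (auto simp: ker2_simps)
  then show "Comp Z (whisker_pre E \<Omega> q (snd u)) (whisker_post (ker2 E p) H \<psi> u)
      = Comp Z (whisker_post (ker2 E p) H' \<psi> u) (whisker_pre E \<Omega> q (fst u))"
    using u nat_comm[OF \<Omega> cocone_data_hom[OF q u]] by (simp add: nat_apply)
qed

section \<open>The universal property of codescent for locally small targets\<close>

context
  fixes E B C :: "('u, 'u) category" and p q :: "('u, 'u, 'u, 'u) fmaps" and \<psi> :: "'u \<times> 'u \<Rightarrow> 'u"
  assumes u: "universe TYPE('u)" and Es: "small_category E" and p: "is_functor E B p"
    and codesc: "is_codesc E p C q \<psi>"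
begin

lemma codesc_data: "small_category C" "cocone_data E p C q \<psi>" "is_functor E C q"
  using codesc by (auto simp: is_codesc_def codesc_cocone_iff cocone_data_def)

lemma psi_Arr: "v \<in> Obj (ker2 E p) \<Longrightarrow> \<psi> v \<in> Arr C"
  using cocone_data_hom[OF codesc_data(2)] homD(1) by fast

lemma codesc_small:
  fixes D :: "('u, 'u) category"
  assumes D: "small_category D"
  shows "cocone_data E p D x \<phi> \<Longrightarrow> \<exists>!H. is_functor C D H \<and> functor_comp E H q = x \<and> whisker_post (ker2 E p) H \<psi> = \<phi>"
    and "is_functor C D H \<Longrightarrow> is_functor C D H' \<Longrightarrow> is_nat E D (functor_comp E H q) (functor_comp E H' q) \<omega> \<Longrightarrow>
      compatible E p D \<omega> (whisker_post (ker2 E p) H \<psi>) (whisker_post (ker2 E p) H' \<psi>) \<Longrightarrow>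
      \<exists>!\<Omega>. is_nat C D H H' \<Omega> \<and> whisker_pre E \<Omega> q = \<omega>"
  using codesc D unfolding is_codesc_def codesc_cocone_iff compatible_def by blast+

text \<open>Push the problem along \<open>F\<close> to the copy \<open>D\<close> on
  \<open>'u\<close>, solve it there, and pull back along \<open>G\<close>. Since \<open>G F\<close>
  is strictly the identity, the required equalities of functors survive.\<close>

lemma codesc_transport:
  fixes D :: "('u, 'u) category"
  assumes D: "small_category D" and inv: "inverse_functors J D F G"
  shows "cocone_data E p J x \<phi> \<Longrightarrow> \<exists>H. is_functor C J H \<and> functor_comp E H q = x \<and> whisker_post (ker2 E p) H \<psi> = \<phi>"
    and "is_nat C J H H' \<Omega> \<Longrightarrow> is_nat C J H H' \<Omega>' \<Longrightarrow> whisker_pre E \<Omega> q = whisker_pre E \<Omega>' q \<Longrightarrow> \<Omega> = \<Omega>'"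
    and "is_functor C J H \<Longrightarrow> is_functor C J H' \<Longrightarrow> is_nat E J (functor_comp E H q) (functor_comp E H' q) \<omega> \<Longrightarrow>
      compatible E p J \<omega> (whisker_post (ker2 E p) H \<psi>) (whisker_post (ker2 E p) H' \<psi>) \<Longrightarrow>
      \<exists>\<Omega>. is_nat C J H H' \<Omega> \<and> whisker_pre E \<Omega> q = \<omega>"
proof -
  have F: "is_functor J D F" and G: "is_functor D J G" and GF: "functor_comp J G F = functor_id J"
    using inv by (auto simp: inverse_functors_def)
  note q = codesc_data(3)
  have GFE: "functor_comp E G (functor_comp E F x) = x" if "is_functor E J x" for x
    using functor_comp_assoc[OF that, where H = G and G = F] GF functor_comp_id(2)[OF that] by simp
  have GFC: "functor_comp C G (functor_comp C F x) = x" if "is_functor C J x" for x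
    using functor_comp_assoc[OF that, where H = G and G = F] GF functor_comp_id(2)[OF that] by simp
  show "\<exists>H. is_functor C J H \<and> functor_comp E H q = x \<and> whisker_post (ker2 E p) H \<psi> = \<phi>"
    if x: "cocone_data E p J x \<phi>"
  proof -
    have x': "is_functor E J x" using x by (simp add: cocone_data_def)
    obtain H where H: "is_functor C D H" "functor_comp E H q = functor_comp E F x"
      "whisker_post (ker2 E p) H \<psi> = whisker_post (ker2 E p) F \<phi>"
      using codesc_small(1)[OF D cocone_data_postcomp[OF p x F]] by blast
    have \<phi>A: "\<phi> v \<in> Arr J" if "v \<in> Obj (ker2 E p)" for v using homD(1)[OF cocone_data_hom[OF x that]] .
    have "functor_comp E (functor_comp C G H) q = x"
      using functor_comp_assoc[OF q, where H = G and G = H] H(2) GFE[OF x'] by simp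
    moreover have "whisker_post (ker2 E p) (functor_comp C G H) \<psi> = whisker_post (ker2 E p) G (whisker_post (ker2 E p) F \<phi>)"
      using whisker_post_comp[of "ker2 E p" \<psi> C G H] psi_Arr H(3) by simp
    moreover have "whisker_post (ker2 E p) G (whisker_post (ker2 E p) F \<phi>) = whisker_post (ker2 E p) (functor_comp J G F) \<phi>"
      using whisker_post_comp[of "ker2 E p" \<phi> J G F] \<phi>A by simp
    moreover have "whisker_post (ker2 E p) (functor_comp J G F) \<phi> = \<phi>"
      unfolding GF by (rule whisker_post_id[OF _ \<phi>A]) (use x in \<open>simp add: cocone_data_def is_nat_def\<close>)
    ultimately show ?thesis using functor_comp[OF H(1) G] by metis
  qed
  show "\<Omega> = \<Omega>'" if \<Omega>: "is_nat C J H H' \<Omega>" "is_nat C J H H' \<Omega>'" and eq: "whisker_pre E \<Omega> q = whisker_pre E \<Omega>' q"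
  proof -
    note n = whisker_post_nat[OF \<Omega>(1) F] whisker_post_nat[OF \<Omega>(2) F]
    \<comment> \<open>After applying \<open>F\<close>, both transformations solve the same extension
      problem in \<open>D\<close>; \<open>F\<close> being faithful, equality there gives equality in
      \<open>J\<close>.\<close>
    have "\<exists>!\<Xi>. is_nat C D (functor_comp C F H) (functor_comp C F H') \<Xi> \<and> whisker_pre E \<Xi> q = whisker_pre E (whisker_post C F \<Omega>) q"
      by (rule codesc_small(2)[OF D nat_functors(1,2)[OF n(1)] whisker_pre_nat[OF q n(1)] nat_compatible[OF codesc_data(2) n(1)]])
    moreover have "whisker_pre E (whisker_post C F \<Omega>) q = whisker_pre E (whisker_post C F \<Omega>') q"
      using eq functor_Obj[OF q] by (simp add: whisker_pre_def restrict_eq_iff whisker_post_apply)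
    ultimately have eq': "whisker_post C F \<Omega> = whisker_post C F \<Omega>'" using n by metis
    show ?thesis
    proof (rule nat_eqI[OF \<Omega>])
      fix a assume a: "a \<in> Obj C"
      have "FArr F (\<Omega> a) = FArr F (\<Omega>' a)" using eq' a by (metis whisker_post_apply)
      then show "\<Omega> a = \<Omega>' a"
        by (rule ff_faithful[OF inverse_functors_ff[OF inv] nat_hom[OF \<Omega>(1) a] nat_hom[OF \<Omega>(2) a]])
    qed
  qed
  show "\<exists>\<Omega>. is_nat C J H H' \<Omega> \<and> whisker_pre E \<Omega> q = \<omega>"
    if H: "is_functor C J H" and H': "is_functor C J H'" and \<omega>: "is_nat E J (functor_comp E H q) (functor_comp E H' q) \<omega>"
      and comp: "compatible E p J \<omega> (whisker_post (ker2 E p) H \<psi>) (whisker_post (ker2 E p) H' \<psi>)"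
  proof -
    have "is_nat E D (functor_comp E (functor_comp C F H) q) (functor_comp E (functor_comp C F H') q) (whisker_post E F \<omega>)"
      using whisker_post_nat[OF \<omega> F] by (simp add: functor_comp_assoc[OF q])
    moreover have "compatible E p D (whisker_post E F \<omega>) (whisker_post (ker2 E p) (functor_comp C F H) \<psi>)
        (whisker_post (ker2 E p) (functor_comp C F H') \<psi>)"
      using compatible_postcomp[OF F cocone_data_postcomp[OF p codesc_data(2) H] cocone_data_postcomp[OF p codesc_data(2) H'] \<omega> comp]
        whisker_post_comp[of "ker2 E p" \<psi> C F H] whisker_post_comp[of "ker2 E p" \<psi> C F H'] psi_Arr by simp
    ultimately obtain \<Xi> where \<Xi>: "is_nat C D (functor_comp C F H) (functor_comp C F H') \<Xi>"
      "whisker_pre E \<Xi> q = whisker_post E F \<omega>"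
      using codesc_small(2)[OF D functor_comp[OF H F] functor_comp[OF H' F]] by blast
    have "is_nat C J H H' (whisker_post C G \<Xi>)"
      using whisker_post_nat[OF \<Xi>(1) G] by (simp add: GFC[OF H] GFC[OF H'])
    moreover have "whisker_pre E (whisker_post C G \<Xi>) q = \<omega>"
    proof (rule extensionalityI[OF _ nat_ext[OF \<omega>]])
      fix a assume a: "a \<in> Obj E"
      have "\<Xi> (FObj q a) = FArr F (\<omega> a)"
        using arg_cong[OF \<Xi>(2), of "\<lambda>k. k a"] a by (simp add: nat_apply)
      then show "whisker_pre E (whisker_post C G \<Xi>) q a = \<omega> a"
        using a functor_Obj[OF q a] inverse_functors_apply(3)[OF inv homD(1)[OF nat_hom[OF \<omega> a]]]
        by (simp add: nat_apply)
    qed (simp add: whisker_pre_def)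
    ultimately show ?thesis by blast
  qed
qed

lemma codesc_small_image:
  fixes Z :: "('o, 'm) category"
  assumes Z: "locally_small TYPE('u) Z" and S: "small TYPE('u) S"
  obtains D :: "('u, 'u) category" and F G where "small_category D" "inverse_functors (full_subcat Z S) D F G"
  using small_transport[OF locally_small_full_subcat[OF u Z S]] by blast

text \<open>The functor \<open>x\<close> has a small set of values because \<open>E\<close> is
  small, and the whole datum lives in the full subcategory on them. The extension is found there and
  included into \<open>Z\<close>.\<close>

lemma codesc_extend:
  assumes Z: "locally_small TYPE('u) Z" and x: "cocone_data E p Z x \<phi>"
  shows "\<exists>H. is_functor C Z H \<and> functor_comp E H q = x \<and> whisker_post (ker2 E p) H \<psi> = \<phi>"
proof -
  have Z': "is_category Z" using Z by (simp add: locally_small_def)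
  define S where "S = FObj x ` Obj E"
  have S: "small TYPE('u) S" unfolding S_def using Es by (intro small_image) (simp add: small_category_def)
  obtain D :: "('u, 'u) category" and F G where D: "small_category D" "inverse_functors (full_subcat Z S) D F G"
    using codesc_small_image[OF Z S] by blast
  have x': "is_functor E (full_subcat Z S) x"
    by (rule functor_into_full_subcat) (use x in \<open>auto simp: cocone_data_def S_def\<close>)
  have "cocone_data E p (full_subcat Z S) x \<phi>"
    using x x' nat_full_subcat[OF Z' functor_comp[OF d_functors(2)[OF p] x'] functor_comp[OF d_functors(1)[OF p] x']]
    by (simp add: cocone_data_iff)
  then show ?thesis using codesc_transport(1)[OF D] functor_from_full_subcat[OF Z'] by blast
qed

text \<open>Here the full subcategory must contain the values of \<open>H\<close> and
  \<open>H'\<close> on \<open>C\<close>; these form a small set because the codescent category is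
  small by definition.\<close>

lemma codesc_nat:
  assumes Z: "locally_small TYPE('u) Z" and H: "is_functor C Z H" "is_functor C Z H'"
  shows "is_nat C Z H H' \<Omega> \<Longrightarrow> is_nat C Z H H' \<Omega>' \<Longrightarrow> whisker_pre E \<Omega> q = whisker_pre E \<Omega>' q \<Longrightarrow> \<Omega> = \<Omega>'"
    and "is_nat E Z (functor_comp E H q) (functor_comp E H' q) \<omega> \<Longrightarrow>
      compatible E p Z \<omega> (whisker_post (ker2 E p) H \<psi>) (whisker_post (ker2 E p) H' \<psi>) \<Longrightarrow>
      \<exists>\<Omega>. is_nat C Z H H' \<Omega> \<and> whisker_pre E \<Omega> q = \<omega>"
proof -
  have Z': "is_category Z" using Z by (simp add: locally_small_def)
  define S where "S = FObj H ` Obj C \<union> FObj H' ` Obj C"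
  have "small TYPE('u) S" unfolding S_def
    using codesc_data(1) by (intro small_Un[OF u] small_image) (simp_all add: small_category_def)
  then obtain D :: "('u, 'u) category" and F G where D: "small_category D" "inverse_functors (full_subcat Z S) D F G"
    using codesc_small_image[OF Z] by blast
  have S: "is_functor C (full_subcat Z S) H" "is_functor C (full_subcat Z S) H'"
    by (rule functor_into_full_subcat[OF H(1)], simp add: S_def)
      (rule functor_into_full_subcat[OF H(2)], simp add: S_def)
  note q = codesc_data(3)
  note n = nat_full_subcat[OF Z' S] nat_full_subcat[OF Z' functor_comp[OF q S(1)] functor_comp[OF q S(2)]]
  show "\<Omega> = \<Omega>'" if "is_nat C Z H H' \<Omega>" "is_nat C Z H H' \<Omega>'" "whisker_pre E \<Omega> q = whisker_pre E \<Omega>' q"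
    by (rule codesc_transport(2)[OF D _ _ that(3), of H H']) (use that n in auto)
  show "\<exists>\<Omega>. is_nat C Z H H' \<Omega> \<and> whisker_pre E \<Omega> q = \<omega>"
    if "is_nat E Z (functor_comp E H q) (functor_comp E H' q) \<omega>"
      "compatible E p Z \<omega> (whisker_post (ker2 E p) H \<psi>) (whisker_post (ker2 E p) H' \<psi>)"
    using codesc_transport(3)[OF D S, of \<omega>] that n by (simp add: compatible_iff)
qed

end

section \<open>Descent categories\<close>

lemma desc_category:
  assumes A0: "is_category A0" and A1: "is_category A1"
    and D0: "is_functor A0 A1 D0" and D1: "is_functor A0 A1 D1"
  shows "is_category (desc_category A0 A1 A2 D0 D1 S0 T0 T1 T2)" (is "is_category ?D")
proof -
  let ?d = "desc_data A0 A1 A2 D0 D1 S0 T0 T1 T2"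
  have h: "t \<in> hom ?D v w \<longleftrightarrow> v \<in> ?d \<and> w \<in> ?d \<and> (\<exists>\<omega>. t = (v, \<omega>, w) \<and> \<omega> \<in> hom A0 (fst v) (fst w) \<and>
      Comp A1 (FArr D0 \<omega>) (snd v) = Comp A1 (snd w) (FArr D1 \<omega>))" for t v w
    by (cases v; cases w) (auto simp: desc_category_def hom_def)
  have d: "fst v \<in> Obj A0" "snd v \<in> hom A1 (FObj D1 (fst v)) (FObj D0 (fst v))" if "v \<in> ?d" for v
    using that by (auto simp: desc_data_def)
  have DI: "Ide ?D v = (v, Ide A0 (fst v), v)" "Comp ?D (v', \<omega>', w') (v, \<omega>, w) = (v, Comp A0 \<omega>' \<omega>, w')" for v w v' w' \<omega> \<omega>'
    by (simp_all add: desc_category_def)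
  have DO: "v \<in> Obj ?D \<longleftrightarrow> v \<in> ?d" for v by (simp add: desc_category_def)
  show ?thesis
  proof (rule is_categoryI)
    show "Ide ?D v \<in> hom ?D v v" if "v \<in> Obj ?D" for v
      using that d[of v] Ide_hom[OF A0] functor_Ide[OF D0] functor_Ide[OF D1]
      by (simp add: h DI DO Comp_Ide_left[OF A1] Comp_Ide_right[OF A1])
    fix s t v w x assume t: "t \<in> hom ?D v w" and s: "s \<in> hom ?D w x"
    obtain \<omega> \<omega>' where \<omega>: "t = (v, \<omega>, w)" "s = (w, \<omega>', x)" "\<omega> \<in> hom A0 (fst v) (fst w)" "\<omega>' \<in> hom A0 (fst w) (fst x)"
      and eq: "Comp A1 (FArr D0 \<omega>) (snd v) = Comp A1 (snd w) (FArr D1 \<omega>)"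
        "Comp A1 (FArr D0 \<omega>') (snd w) = Comp A1 (snd x) (FArr D1 \<omega>')"
      and vwx: "v \<in> ?d" "w \<in> ?d" "x \<in> ?d" using s t unfolding h by blast
    note D0h = functor_hom[OF D0 \<omega>(3)] functor_hom[OF D0 \<omega>(4)] and D1h = functor_hom[OF D1 \<omega>(3)] functor_hom[OF D1 \<omega>(4)]
    note \<phi> = d(2)[OF vwx(1)] d(2)[OF vwx(2)] d(2)[OF vwx(3)]
    have "Comp A1 (FArr D0 (Comp A0 \<omega>' \<omega>)) (snd v) = Comp A1 (FArr D0 \<omega>') (Comp A1 (snd w) (FArr D1 \<omega>))"
      using functor_Comp[OF D0 \<omega>(3,4)] Comp_assoc[OF A1 \<phi>(1) D0h] eq(1) by simp
    also have "\<dots> = Comp A1 (Comp A1 (snd x) (FArr D1 \<omega>')) (FArr D1 \<omega>)"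
      using Comp_assoc[OF A1 D1h(1) \<phi>(2) D0h(2)] eq(2) by simp
    also have "\<dots> = Comp A1 (snd x) (FArr D1 (Comp A0 \<omega>' \<omega>))"
      using Comp_assoc[OF A1 D1h(1,2) \<phi>(3)] functor_Comp[OF D1 \<omega>(3,4)] by simp
    finally show "Comp ?D s t \<in> hom ?D v x" using Comp_hom[OF A0 \<omega>(3,4)] vwx by (simp add: h DI \<omega>)
  qed (auto simp: h DI DO Comp_Ide_left[OF A0] Comp_Ide_right[OF A0] Comp_assoc[OF A0])
qed

context
  fixes E B :: "('o, 'm) category" and p and Z :: "('o2, 'm2) category"
  assumes p: "is_functor E B p"
begin

lemma Desc_category: "is_category (Desc Z E p)"
  unfolding Desc_def
  by (rule desc_category[OF CAT_category CAT_category precomp_functor[OF d_functors(1)[OF p]]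
        precomp_functor[OF d_functors(2)[OF p]]])

text \<open>Arrows of \<open>CAT\<close> carry their end points, so the descent conditions are
  equations of triples. The simplicial identities equate the outer entries, leaving the middle
  entries, which form \<open>cocone_data\<close>.\<close>

lemma Desc_Obj:
  "v \<in> Obj (Desc Z E p) \<longleftrightarrow> (\<exists>x \<phi>. v = (x, (functor_comp (ker2 E p) x (d11 E p), \<phi>, functor_comp (ker2 E p) x (d10 E p))) \<and>
     cocone_data E p Z x \<phi>)"
proof -
  note d = d_functors[OF p] and si = simplicial_identities[OF p]
  let ?x1 = "\<lambda>x. functor_comp (ker2 E p) x (d11 E p)" and ?x0 = "\<lambda>x. functor_comp (ker2 E p) x (d10 E p)"
  have eq: "FArr (precomp E (ker2 E p) (s00 E) Z) (?x1 x, \<phi>, ?x0 x) = (x, whisker_pre E \<phi> (s00 E), x)"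
    "Comp (CAT (ker3 E p) Z) (FArr (precomp (ker3 E p) (ker2 E p) (d20 E p) Z) (?x1 x, \<phi>, ?x0 x))
       (FArr (precomp (ker3 E p) (ker2 E p) (d22 E p) Z) (?x1 x, \<phi>, ?x0 x))
     = (functor_comp (ker3 E p) x (functor_comp (ker3 E p) (d11 E p) (d21 E p)),
        vcomp (ker3 E p) Z (whisker_pre (ker3 E p) \<phi> (d20 E p)) (whisker_pre (ker3 E p) \<phi> (d22 E p)),
        functor_comp (ker3 E p) x (functor_comp (ker3 E p) (d10 E p) (d21 E p)))"
    "FArr (precomp (ker3 E p) (ker2 E p) (d21 E p) Z) (?x1 x, \<phi>, ?x0 x)
     = (functor_comp (ker3 E p) x (functor_comp (ker3 E p) (d11 E p) (d21 E p)), whisker_pre (ker3 E p) \<phi> (d21 E p),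
        functor_comp (ker3 E p) x (functor_comp (ker3 E p) (d10 E p) (d21 E p)))"
    if x: "is_functor E Z x" and \<phi>: "is_nat (ker2 E p) Z (?x1 x) (?x0 x) \<phi>" for x \<phi>
    using \<phi> by (simp_all add: precomp_Arr functor_comp_assoc[OF d(3)] functor_comp_assoc[OF d(4)]
        functor_comp_assoc[OF d(5)] functor_comp_assoc[OF d(6)] si functor_comp_id[OF x])
  have "v \<in> Obj (Desc Z E p) \<longleftrightarrow> (\<exists>x \<phi>. v = (x, (?x1 x, \<phi>, ?x0 x)) \<and> is_functor E Z x \<and>
      is_nat (ker2 E p) Z (?x1 x) (?x0 x) \<phi> \<and>
      FArr (precomp E (ker2 E p) (s00 E) Z) (?x1 x, \<phi>, ?x0 x) = (x, nat_id E Z x, x) \<and>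
      Comp (CAT (ker3 E p) Z) (FArr (precomp (ker3 E p) (ker2 E p) (d20 E p) Z) (?x1 x, \<phi>, ?x0 x))
       (FArr (precomp (ker3 E p) (ker2 E p) (d22 E p) Z) (?x1 x, \<phi>, ?x0 x))
       = FArr (precomp (ker3 E p) (ker2 E p) (d21 E p) Z) (?x1 x, \<phi>, ?x0 x))"
    by (auto simp: Desc_def desc_category_def desc_data_def CAT_hom precomp_Obj)
  also have "\<dots> \<longleftrightarrow> (\<exists>x \<phi>. v = (x, (?x1 x, \<phi>, ?x0 x)) \<and> cocone_data E p Z x \<phi>)"
    unfolding cocone_data_def by (intro ex_cong1 conj_cong refl) (auto simp: eq)
  finally show ?thesis .
qed

lemma Desc_hom:
  "t \<in> hom (Desc Z E p) (x, (a, \<phi>, b)) (y, (a', \<phi>', b')) \<longleftrightarrow>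
     (x, (a, \<phi>, b)) \<in> Obj (Desc Z E p) \<and> (y, (a', \<phi>', b')) \<in> Obj (Desc Z E p) \<and>
     (\<exists>\<omega>. t = ((x, (a, \<phi>, b)), (x, \<omega>, y), (y, (a', \<phi>', b'))) \<and> is_nat E Z x y \<omega> \<and> compatible E p Z \<omega> \<phi> \<phi>')"
proof -
  have "t \<in> hom (Desc Z E p) (x, (a, \<phi>, b)) (y, (a', \<phi>', b')) \<longleftrightarrow>
     (x, (a, \<phi>, b)) \<in> Obj (Desc Z E p) \<and> (y, (a', \<phi>', b')) \<in> Obj (Desc Z E p) \<and>
     (\<exists>w. t = ((x, (a, \<phi>, b)), w, (y, (a', \<phi>', b'))) \<and> w \<in> hom (CAT E Z) x y \<and>
        Comp (CAT (ker2 E p) Z) (FArr (precomp (ker2 E p) E (d10 E p) Z) w) (a, \<phi>, b)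
        = Comp (CAT (ker2 E p) Z) (a', \<phi>', b') (FArr (precomp (ker2 E p) E (d11 E p) Z) w))"
    by (auto simp: Desc_def desc_category_def hom_def)
  then show ?thesis
    by (auto simp: CAT_hom precomp_Arr compatible_def Desc_Obj)
qed

lemma Desc_simps:
  "Ide (Desc Z E p) v = (v, Ide (CAT E Z) (fst v), v)"
  "Comp (Desc Z E p) (v', \<omega>', w) (v, \<omega>, v'') = (v, Comp (CAT E Z) \<omega>' \<omega>, w)"
  by (simp_all add: Desc_def desc_category_def)

end

text \<open>Restriction of a functor to the universal cocone. The composites with both projections
  are spelled out because a descent datum is an arrow of \<open>CAT\<close> and records its end
  points.\<close>

definition codesc_restriction where
  "codesc_restriction E p C q \<psi> Z =
     (let k = (\<lambda>H. (functor_comp E H q,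
        (functor_comp (ker2 E p) (functor_comp E H q) (d11 E p), whisker_post (ker2 E p) H \<psi>,
         functor_comp (ker2 E p) (functor_comp E H q) (d10 E p)))) in
      \<lparr>FObj = (\<lambda>H\<in>Obj (CAT C Z). k H),
       FArr = (\<lambda>(H, \<Omega>, H')\<in>Arr (CAT C Z). (k H, (functor_comp E H q, whisker_pre E \<Omega> q, functor_comp E H' q), k H'))\<rparr>)"

section \<open>Descent along p as restriction along K\<close>

context
  fixes E B C :: "('u, 'u) category" and p q K :: "('u, 'u, 'u, 'u) fmaps" and \<psi> :: "'u \<times> 'u \<Rightarrow> 'u"
    and Z :: "('o, 'm) category"
  assumes u: "universe TYPE('u)" and Es: "small_category E" and p: "is_functor E B p"
    and codesc: "is_codesc E p C q \<psi>" and Z: "locally_small TYPE('u) Z"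
    and K: "is_codesc_comparison E B p C q \<psi> K"
begin

lemma codesc_restriction_simps:
  "is_functor C Z H \<Longrightarrow> FObj (codesc_restriction E p C q \<psi> Z) H = (functor_comp E H q,
        (functor_comp (ker2 E p) (functor_comp E H q) (d11 E p), whisker_post (ker2 E p) H \<psi>,
         functor_comp (ker2 E p) (functor_comp E H q) (d10 E p)))"
  "is_nat C Z H H' \<Omega> \<Longrightarrow> FArr (codesc_restriction E p C q \<psi> Z) (H, \<Omega>, H') =
     (FObj (codesc_restriction E p C q \<psi> Z) H, (functor_comp E H q, whisker_pre E \<Omega> q, functor_comp E H' q),
      FObj (codesc_restriction E p C q \<psi> Z) H')"
  using nat_functors[of C Z H H' \<Omega>] by (simp_all add: codesc_restriction_def Let_def)

lemma codesc_restriction_Obj: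
  assumes H: "is_functor C Z H"
  shows "FObj (codesc_restriction E p C q \<psi> Z) H \<in> Obj (Desc Z E p)"
  using cocone_data_postcomp[OF p codesc_data(2)[OF u Es p codesc] H] H
  by (simp add: Desc_Obj[OF p] codesc_restriction_simps)

lemma codesc_restriction_hom:
  assumes \<Omega>: "is_nat C Z H H' \<Omega>"
  shows "FArr (codesc_restriction E p C q \<psi> Z) (H, \<Omega>, H')
    \<in> hom (Desc Z E p) (FObj (codesc_restriction E p C q \<psi> Z) H) (FObj (codesc_restriction E p C q \<psi> Z) H')"
  using codesc_restriction_Obj[OF nat_functors(1)[OF \<Omega>]] codesc_restriction_Obj[OF nat_functors(2)[OF \<Omega>]]
    nat_functors(1,2)[OF \<Omega>] whisker_pre_nat[OF codesc_data(3)[OF u Es p codesc] \<Omega>]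
    nat_compatible[OF codesc_data(2)[OF u Es p codesc] \<Omega>] \<Omega>
  by (simp add: codesc_restriction_simps Desc_hom[OF p])

lemma codesc_restriction_functor: "is_functor (CAT C Z) (Desc Z E p) (codesc_restriction E p C q \<psi> Z)"
proof (rule is_functorI[OF CAT_category Desc_category[OF p]])
  note q = codesc_data(3)[OF u Es p codesc]
  note P = precomp_functor[OF q, of Z]
  show "FObj (codesc_restriction E p C q \<psi> Z) H \<in> Obj (Desc Z E p)" if "H \<in> Obj (CAT C Z)" for H
    using that codesc_restriction_Obj by simp
  show "FArr (codesc_restriction E p C q \<psi> Z) t
      \<in> hom (Desc Z E p) (FObj (codesc_restriction E p C q \<psi> Z) H) (FObj (codesc_restriction E p C q \<psi> Z) H')"
    if "t \<in> hom (CAT C Z) H H'" for t H H'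
    using that codesc_restriction_hom by (auto simp: CAT_hom)
  show "FArr (codesc_restriction E p C q \<psi> Z) (Ide (CAT C Z) H)
      = Ide (Desc Z E p) (FObj (codesc_restriction E p C q \<psi> Z) H)" if "H \<in> Obj (CAT C Z)" for H
  proof -
    have H: "is_functor C Z H" using that by simp
    show ?thesis
      using functor_Ide[OF P that] H nat_id[OF H]
      by (simp add: codesc_restriction_simps Desc_simps[OF p] precomp_Arr precomp_Obj)
  qed
  fix t s H H' H'' assume t: "t \<in> hom (CAT C Z) H H'" and s: "s \<in> hom (CAT C Z) H' H''"
  then obtain \<Omega> \<Xi> where \<Omega>: "is_nat C Z H H' \<Omega>" "t = (H, \<Omega>, H')" and \<Xi>: "is_nat C Z H' H'' \<Xi>" "s = (H', \<Xi>, H'')"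
    by (auto simp: CAT_hom)
  show "FArr (codesc_restriction E p C q \<psi> Z) (Comp (CAT C Z) s t)
      = Comp (Desc Z E p) (FArr (codesc_restriction E p C q \<psi> Z) s) (FArr (codesc_restriction E p C q \<psi> Z) t)"
    using functor_Comp[OF P t s] \<Omega> \<Xi> vcomp_nat[OF \<Omega>(1) \<Xi>(1)]
    by (simp add: codesc_restriction_simps(2) Desc_simps[OF p] precomp_Arr)
qed (simp_all add: codesc_restriction_def Let_def)

text \<open>Faithfulness and fullness are the uniqueness and the existence of the two-dimensional
  universal property.\<close>

lemma codesc_restriction_ff: "fully_faithful (CAT C Z) (Desc Z E p) (codesc_restriction E p C q \<psi> Z)"
proof (rule fully_faithfulI[OF codesc_restriction_functor])
  fix H H'
  show "t = s" if t: "t \<in> hom (CAT C Z) H H'" and s: "s \<in> hom (CAT C Z) H H'"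
    and eq: "FArr (codesc_restriction E p C q \<psi> Z) t = FArr (codesc_restriction E p C q \<psi> Z) s" for s t
  proof -
    obtain \<Omega> \<Omega>' where \<Omega>: "is_nat C Z H H' \<Omega>" "t = (H, \<Omega>, H')" and \<Omega>': "is_nat C Z H H' \<Omega>'" "s = (H, \<Omega>', H')"
      using t s by (auto simp: CAT_hom)
    have "whisker_pre E \<Omega> q = whisker_pre E \<Omega>' q"
      using eq \<Omega> \<Omega>' by (simp add: codesc_restriction_simps(2))
    then have "\<Omega> = \<Omega>'"
      by (rule codesc_nat(1)[OF u Es p codesc Z nat_functors(1,2)[OF \<Omega>(1)] \<Omega>(1) \<Omega>'(1)])
    then show ?thesis using \<Omega> \<Omega>' by simp
  qed
  fix t assume "H \<in> Obj (CAT C Z)" "H' \<in> Obj (CAT C Z)"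
    and t: "t \<in> hom (Desc Z E p) (FObj (codesc_restriction E p C q \<psi> Z) H) (FObj (codesc_restriction E p C q \<psi> Z) H')"
  then have H: "is_functor C Z H" "is_functor C Z H'" by simp_all
  obtain \<omega> where \<omega>: "is_nat E Z (functor_comp E H q) (functor_comp E H' q) \<omega>"
    and comp: "compatible E p Z \<omega> (whisker_post (ker2 E p) H \<psi>) (whisker_post (ker2 E p) H' \<psi>)"
    and t': "t = (FObj (codesc_restriction E p C q \<psi> Z) H, (functor_comp E H q, \<omega>, functor_comp E H' q),
      FObj (codesc_restriction E p C q \<psi> Z) H')"
    using t H by (auto simp: codesc_restriction_simps(1) Desc_hom[OF p])
  obtain \<Omega> where \<Omega>: "is_nat C Z H H' \<Omega>" "whisker_pre E \<Omega> q = \<omega>"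
    using codesc_nat(2)[OF u Es p codesc Z H \<omega> comp] by blast
  then show "\<exists>f\<in>hom (CAT C Z) H H'. FArr (codesc_restriction E p C q \<psi> Z) f = t"
    by (intro bexI[of _ "(H, \<Omega>, H')"]) (simp_all add: codesc_restriction_simps(2) t' CAT_hom)
qed

text \<open>The one-dimensional universal property reaches every descent datum on the nose, so an
  identity serves as the isomorphism.\<close>

lemma codesc_restriction_ess_surj: "ess_surj (CAT C Z) (Desc Z E p) (codesc_restriction E p C q \<psi> Z)"
proof (rule ess_surjI[OF codesc_restriction_functor])
  fix v assume v: "v \<in> Obj (Desc Z E p)"
  then obtain x \<phi> where x: "cocone_data E p Z x \<phi>"
    and v': "v = (x, (functor_comp (ker2 E p) x (d11 E p), \<phi>, functor_comp (ker2 E p) x (d10 E p)))"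
    by (auto simp: Desc_Obj[OF p])
  obtain H where H: "is_functor C Z H" "functor_comp E H q = x" "whisker_post (ker2 E p) H \<psi> = \<phi>"
    using codesc_extend[OF u Es p codesc Z x] by blast
  then have "FObj (codesc_restriction E p C q \<psi> Z) H = v" by (simp add: codesc_restriction_simps v')
  then show "\<exists>a\<in>Obj (CAT C Z). \<exists>f\<in>hom (Desc Z E p) (FObj (codesc_restriction E p C q \<psi> Z) a) v. is_iso (Desc Z E p) f"
    using H(1) Ide_hom[OF Desc_category[OF p] v] iso_Ide[OF Desc_category[OF p] v]
    by (intro bexI[of _ H] bexI[of _ "Ide (Desc Z E p) v"]) simp_all
qed

text \<open>The equations \<open>K q = p\<close> and \<open>K \<psi> = id\<close> say exactly that
  restricting \<open>H K\<close> to the universal cocone yields \<open>H p\<close> with an identity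
  datum. The other factor being fully faithful and essentially surjective, descent becomes a
  statement about restriction along \<open>K\<close>.\<close>

lemma Desc_comparison_factorization:
  "Desc_comparison Z E B p = functor_comp (CAT B Z) (codesc_restriction E p C q \<psi> Z) (precomp C B K Z)"
proof -
  note q = codesc_data(3)[OF u Es p codesc]
  have K': "is_functor C B K" "functor_comp E K q = p"
    "whisker_post (ker2 E p) K \<psi> = nat_id (ker2 E p) B (functor_comp (ker2 E p) p (d11 E p))"
    using K by (auto simp: is_codesc_comparison_def)
  let ?\<Theta> = "codesc_restriction E p C q \<psi> Z"
  let ?k = "\<lambda>z. (FObj (precomp E B p Z) z, Ide (CAT (ker2 E p) Z) (FObj (precomp (ker2 E p) E (d11 E p) Z) (FObj (precomp E B p Z) z)))"
  have HKq: "functor_comp E (functor_comp C H K) q = functor_comp E H p" for H :: "('u, 'u, 'o, 'm) fmaps"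
    using functor_comp_assoc[OF q, where H = H and G = K] K'(2) by simp
  have obj: "?k H = FObj ?\<Theta> (functor_comp C H K)" if H: "is_functor B Z H" for H
  proof -
    note Hp = functor_comp[OF p H]
    note n = nat_id[OF functor_comp[OF d_functors(2)[OF p] p]]
    have "whisker_post (ker2 E p) (functor_comp C H K) \<psi> = whisker_post (ker2 E p) H (whisker_post (ker2 E p) K \<psi>)"
      by (rule whisker_post_comp) (rule psi_Arr[OF u Es p codesc])
    also have "\<dots> = nat_id (ker2 E p) Z (functor_comp (ker2 E p) (functor_comp E H p) (d11 E p))"
      unfolding K'(3) functor_comp_assoc[OF d_functors(2)[OF p]]
      by (rule nat_eqI[OF whisker_post_nat[OF n H] nat_id[OF functor_comp[OF functor_comp[OF d_functors(2)[OF p] p] H]]])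
        (simp add: nat_apply functor_comp_simps functor_Ide[OF H] functor_Obj[OF p] functor_Obj[OF d_functors(2)[OF p]])
    finally have w: "whisker_post (ker2 E p) (functor_comp C H K) \<psi>
      = nat_id (ker2 E p) Z (functor_comp (ker2 E p) (functor_comp E H p) (d11 E p))" .
    have "functor_comp (ker2 E p) (functor_comp E H p) (d10 E p) = functor_comp (ker2 E p) (functor_comp E H p) (d11 E p)"
      by (simp add: functor_comp_assoc[OF d_functors(1)[OF p]] functor_comp_assoc[OF d_functors(2)[OF p]] p_d10_d11)
    then show ?thesis
      using H Hp w functor_comp[OF K'(1) H] by (simp add: codesc_restriction_simps(1) precomp_Obj HKq)
  qed
  show ?thesis
  proof (rule functor_eqI)
    show "FObj (Desc_comparison Z E B p) H = FObj (functor_comp (CAT B Z) ?\<Theta> (precomp C B K Z)) H"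
      if "H \<in> Obj (CAT B Z)" for H
      using obj that by (simp add: Desc_comparison_def desc_comparison_def Let_def functor_comp_simps precomp_Obj)
    fix t assume t: "t \<in> Arr (CAT B Z)"
    then obtain H \<Omega> H' where t': "t = (H, \<Omega>, H')" and \<Omega>: "is_nat B Z H H' \<Omega>" by (auto simp: CAT_def)
    have w: "whisker_pre E (whisker_pre C \<Omega> K) q = whisker_pre E \<Omega> p"
      using functor_Obj[OF q] by (simp add: whisker_pre_def restrict_eq_iff functor_comp_simps flip: K'(2))
    show "FArr (Desc_comparison Z E B p) t = FArr (functor_comp (CAT B Z) ?\<Theta> (precomp C B K Z)) t"
      using t \<Omega> obj[OF nat_functors(1)[OF \<Omega>]] obj[OF nat_functors(2)[OF \<Omega>]] whisker_pre_nat[OF K'(1) \<Omega>]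
      by (simp add: t' Desc_comparison_def desc_comparison_def Let_def functor_comp_simps precomp_Arr
          codesc_restriction_simps(2) HKq w)
  qed (simp_all add: functor_comp_simps, simp_all add: Desc_comparison_def desc_comparison_def Let_def)
qed

lemma codesc_comparison_functor: "is_functor C B K"
  using K by (simp add: is_codesc_comparison_def)

lemma descent_iff: "descent Z E B p \<longleftrightarrow> restriction_ff C B K Z"
  unfolding descent_def Desc_comparison_factorization
  using ff_comp[OF _ codesc_restriction_ff]
    ff_cancel[OF precomp_functor[OF codesc_comparison_functor] codesc_restriction_ff] by blast

lemma effective_descent_iff:
  "effective_descent Z E B p \<longleftrightarrow> restriction_equivalence C B K Z"
proof -
  have "ess_surj (CAT B Z) (Desc Z E p) (Desc_comparison Z E B p) \<longleftrightarrow> restriction_ess_surj C B K Z"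
    unfolding Desc_comparison_factorization
    using ess_surj_comp[OF _ codesc_restriction_ess_surj]
      ess_surj_cancel[OF precomp_functor[OF codesc_comparison_functor] codesc_restriction_ff] by blast
  then show ?thesis
    using descent_iff by (simp add: effective_descent_def equivalence_iff descent_def)
qed

end


section \<open>Colimits and hom-functors\<close>

lemma CAT_locally_small:
  assumes u: "universe TYPE('u)" and X: "small TYPE('u) (Obj X)" and Z: "locally_small TYPE('u) Z"
  shows "locally_small TYPE('u) (CAT X Z)"
proof -
  have "small TYPE('u) (hom (CAT X Z) F G)" if F: "is_functor X Z F" and G: "is_functor X Z G" for F G
  proof -
    have "small TYPE('u) (hom Z (FObj F a) (FObj G a))" if "a \<in> Obj X" for a
      using Z functor_Obj[OF F that] functor_Obj[OF G that] by (simp add: locally_small_def)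
    then have "small TYPE('u) ((\<lambda>\<alpha>. (F, \<alpha>, G)) ` (\<Pi>\<^sub>E a\<in>Obj X. hom Z (FObj F a) (FObj G a)))"
      by (intro small_image small_PiE[OF u X])
    moreover have "hom (CAT X Z) F G \<subseteq> (\<lambda>\<alpha>. (F, \<alpha>, G)) ` (\<Pi>\<^sub>E a\<in>Obj X. hom Z (FObj F a) (FObj G a))"
      by (auto simp: CAT_hom PiE_def nat_ext intro!: imageI nat_hom)
    ultimately show ?thesis by (rule small_subset)
  qed
  then show ?thesis by (simp add: locally_small_def CAT_category)
qed

section \<open>Cocones and reindexing of colimits\<close>

lemma is_cocone_cats: "is_cocone J A D L \<mu> \<Longrightarrow> is_category J" "is_cocone J A D L \<mu> \<Longrightarrow> is_category A"
  "is_cocone J A D L \<mu> \<Longrightarrow> is_functor J A D"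
  by (auto simp: is_cocone_def functor_cats)

lemma cocone_hom: "is_cocone J A D L \<mu> \<Longrightarrow> j \<in> Obj J \<Longrightarrow> \<mu> j \<in> hom A (FObj D j) L"
  by (simp add: is_cocone_def)

lemma cocone_comm:
  "is_cocone J A D L \<mu> \<Longrightarrow> f \<in> hom J j j' \<Longrightarrow> Comp A (\<mu> j') (FArr D f) = \<mu> j"
  by (auto simp: is_cocone_def hom_def)

lemma is_coconeI:
  assumes "is_functor J A D" "L \<in> Obj A" "\<And>j. j \<in> Obj J \<Longrightarrow> \<mu> j \<in> hom A (FObj D j) L"
    "\<And>f j j'. f \<in> hom J j j' \<Longrightarrow> Comp A (\<mu> j') (FArr D f) = \<mu> j"
  shows "is_cocone J A D L \<mu>"
  unfolding is_cocone_def using assms(1-3) assms(4)[OF Arr_hom] by auto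

text \<open>Preservation of colimits is stated for index categories on \<open>'u\<close>; a category
  of elements lives on pairs and has to be replaced by a copy.\<close>

lemma colimit_reindex:
  assumes inv: "inverse_functors J J' F G" and col: "is_colimit J A D L \<mu>"
  shows "is_colimit J' A (functor_comp J' D G) L (\<lambda>j. \<mu> (FObj G j))"
proof -
  have co: "is_cocone J A D L \<mu>" using col by (simp add: is_colimit_def)
  note F = inverse_functors_apply[OF inv] and G = inverse_functors_apply[OF inverse_functors_sym[OF inv]]
  note D = is_cocone_cats(3)[OF co]
  have co': "is_cocone J' A (functor_comp J' D G) L (\<lambda>j. \<mu> (FObj G j))"
  proof (rule is_coconeI[OF functor_comp[OF G(1) D]])
    show "L \<in> Obj A" using co by (simp add: is_cocone_def)
    show "\<mu> (FObj G j) \<in> hom A (FObj (functor_comp J' D G) j) L" if "j \<in> Obj J'" for j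
      using cocone_hom[OF co functor_Obj[OF G(1) that]] that by (simp add: functor_comp_simps)
    show "Comp A (\<mu> (FObj G j')) (FArr (functor_comp J' D G) f) = \<mu> (FObj G j)" if "f \<in> hom J' j j'" for f j j'
      using cocone_comm[OF co functor_hom[OF G(1) that]] homD(1)[OF that] by (simp add: functor_comp_simps)
  qed
  show ?thesis unfolding is_colimit_def
  proof (intro conjI co' allI impI)
    fix M \<nu> assume \<nu>: "is_cocone J' A (functor_comp J' D G) M \<nu>"
    have "is_cocone J A D M (\<lambda>j. \<nu> (FObj F j))"
    proof (rule is_coconeI[OF D])
      show "M \<in> Obj A" using \<nu> by (simp add: is_cocone_def)
      show "\<nu> (FObj F j) \<in> hom A (FObj D j) M" if "j \<in> Obj J" for j
        using cocone_hom[OF \<nu> functor_Obj[OF F(1) that]] functor_Obj[OF F(1) that] F(2)[OF that]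
        by (simp add: functor_comp_simps)
      show "Comp A (\<nu> (FObj F j')) (FArr D f) = \<nu> (FObj F j)" if f: "f \<in> hom J j j'" for f j j'
        using cocone_comm[OF \<nu> functor_hom[OF F(1) f]] functor_Arr[OF F(1) homD(1)[OF f]] F(3)[OF homD(1)[OF f]]
        by (simp add: functor_comp_simps)
    qed
    then have "\<exists>!h. h \<in> hom A L M \<and> (\<forall>j\<in>Obj J. Comp A h (\<mu> j) = \<nu> (FObj F j))"
      using col by (simp add: is_colimit_def)
    moreover have "(\<forall>j\<in>Obj J. Comp A h (\<mu> j) = \<nu> (FObj F j)) \<longleftrightarrow> (\<forall>j\<in>Obj J'. Comp A h (\<mu> (FObj G j)) = \<nu> j)" for h
      using functor_Obj[OF F(1)] functor_Obj[OF G(1)] F(2) G(2) by metis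
    ultimately show "\<exists>!h. h \<in> hom A L M \<and> (\<forall>j\<in>Obj J'. Comp A h (\<mu> (FObj G j)) = \<nu> j)" by simp
  qed
qed

abbreviation (input) unique_factorization where
  "unique_factorization A J D L \<mu> P M \<nu> \<equiv>
     (\<exists>h. (\<forall>k\<in>hom A P L. h k \<in> M) \<and> (\<forall>j\<in>Obj J. \<forall>g\<in>hom A P (FObj D j). h (Comp A (\<mu> j) g) = \<nu> j g)) \<and>
     (\<forall>h h'. (\<forall>k\<in>hom A P L. h k \<in> M) \<longrightarrow> (\<forall>k\<in>hom A P L. h' k \<in> M) \<longrightarrow>
        (\<forall>j\<in>Obj J. \<forall>g\<in>hom A P (FObj D j). h (Comp A (\<mu> j) g) = \<nu> j g) \<longrightarrow>
        (\<forall>j\<in>Obj J. \<forall>g\<in>hom A P (FObj D j). h' (Comp A (\<mu> j) g) = \<nu> j g) \<longrightarrow>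
        (\<forall>k\<in>hom A P L. h k = h' k))"

text \<open>The property that \<open>Hom(P, -)\<close> carries a given cocone to a colimit, stated for plain functions.\<close>

definition hom_colimit where
  "hom_colimit (U :: 'u itself) J (A :: ('o, 'm) category) D L \<mu> P \<longleftrightarrow>
     (\<forall>(M :: 'm set) \<nu>. small U M \<longrightarrow>
        (\<forall>j\<in>Obj J. \<forall>g\<in>hom A P (FObj D j). \<nu> j g \<in> M) \<longrightarrow>
        (\<forall>f j j' g. f \<in> hom J j j' \<longrightarrow> g \<in> hom A P (FObj D j) \<longrightarrow> \<nu> j' (Comp A (FArr D f) g) = \<nu> j g) \<longrightarrow>
        unique_factorization A J D L \<mu> P M \<nu>)"

text \<open>The values of \<open>Hom(P, -)\<close> are sets of arrows of \<open>A\<close>, so the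
  test sets \<open>M\<close> are too. Plain functions in place of arrows of \<open>SET\<close> make
  it possible to move the statement along retracts and along the Yoneda bijection.\<close>

lemma hom_colimit_iff:
  fixes A :: "('o, 'm) category"
  assumes A: "locally_small TYPE('u) A" and P: "P \<in> Obj A" and co: "is_cocone J A D L \<mu>"
  shows "is_colimit J (SET TYPE('u)) (functor_comp J (hom_functor A P) D) (FObj (hom_functor A P) L)
           (\<lambda>j. FArr (hom_functor A P) (\<mu> j)) \<longleftrightarrow> hom_colimit TYPE('u) J A D L \<mu> P"
    (is "?col \<longleftrightarrow> _")
proof -
  let ?S = "SET TYPE('u) :: ('m set, _) category" and ?h = "hom_functor A P"
  note h = hom_functor[OF A P] and D = is_cocone_cats(3)[OF co]
  have A': "is_category A" by (rule is_cocone_cats(2)[OF co])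
  have L: "L \<in> Obj A" using co by (simp add: is_cocone_def)
  have smP: "small TYPE('u) (hom A P Q)" if "Q \<in> Obj A" for Q using A P that by (simp add: locally_small_def)
  have O: "FObj (functor_comp J ?h D) j = hom A P (FObj D j)" if "j \<in> Obj J" for j
    using that functor_Obj[OF D that] by (simp add: functor_comp_simps hom_functor_Obj)
  have Ar: "FArr (functor_comp J ?h D) f \<in> hom ?S (hom A P (FObj D j)) (hom A P (FObj D j'))"
    "g \<in> hom A P (FObj D j) \<Longrightarrow> app (FArr (functor_comp J ?h D) f) g = Comp A (FArr D f) g"
    if f: "f \<in> hom J j j'" for f g j j'
    using functor_hom[OF functor_comp[OF D h] f] O hom_Obj[OF is_cocone_cats(1)[OF co] f]
      homD(1)[OF f] app_hom_functor[OF functor_hom[OF D f]] by (simp_all add: functor_comp_simps)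
  have \<mu>h: "FArr ?h (\<mu> j) \<in> hom ?S (hom A P (FObj D j)) (hom A P L)" if j: "j \<in> Obj J" for j
    using functor_hom[OF h cocone_hom[OF co j]] L functor_Obj[OF D j] by (simp add: hom_functor_Obj)
  have \<mu>a: "app (FArr ?h (\<mu> j)) g = Comp A (\<mu> j) g" if j: "j \<in> Obj J" and g: "g \<in> hom A P (FObj D j)" for j g
    by (rule app_hom_functor[OF cocone_hom[OF co j] g])
  have \<mu>in: "Comp A (\<mu> j) g \<in> hom A P L" if j: "j \<in> Obj J" and g: "g \<in> hom A P (FObj D j)" for j g
    by (rule Comp_hom[OF A' g cocone_hom[OF co j]])
  have co': "is_cocone J ?S (functor_comp J ?h D) (FObj ?h L) (\<lambda>j. FArr ?h (\<mu> j))"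
  proof (rule is_coconeI[OF functor_comp[OF D h]])
    show "FObj ?h L \<in> Obj ?S" by (rule functor_Obj[OF h L])
    show "FArr ?h (\<mu> j) \<in> hom ?S (FObj (functor_comp J ?h D) j) (FObj ?h L)" if "j \<in> Obj J" for j
      using \<mu>h[OF that] that L by (simp add: O hom_functor_Obj)
    show "Comp ?S (FArr ?h (\<mu> j')) (FArr (functor_comp J ?h D) f) = FArr ?h (\<mu> j)" if f: "f \<in> hom J j j'" for f j j'
      using functor_Comp[OF h functor_hom[OF D f] cocone_hom[OF co hom_Obj(2)[OF is_cocone_cats(1)[OF co] f]]]
        cocone_comm[OF co f] homD(1)[OF f] by (simp add: functor_comp_simps)
  qed
  show ?thesis
  proof
    assume col: ?col
    show "hom_colimit TYPE('u) J A D L \<mu> P"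
      unfolding hom_colimit_def
    proof (intro allI impI)
      fix M :: "'m set" and \<nu>
      assume M: "small TYPE('u) M" and \<nu>M: "\<forall>j\<in>Obj J. \<forall>g\<in>hom A P (FObj D j). \<nu> j g \<in> M"
        and \<nu>c: "\<forall>f j j' g. f \<in> hom J j j' \<longrightarrow> g \<in> hom A P (FObj D j) \<longrightarrow> \<nu> j' (Comp A (FArr D f) g) = \<nu> j g"
      let ?\<nu> = "\<lambda>j. set_arr (hom A P (FObj D j)) (\<nu> j) M"
      have \<nu>h: "?\<nu> j \<in> hom ?S (hom A P (FObj D j)) M" if "j \<in> Obj J" for j
        by (rule set_arr_hom[OF smP[OF functor_Obj[OF D that]] M]) (use \<nu>M that in blast)
      have "is_cocone J ?S (functor_comp J ?h D) M ?\<nu>"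
      proof (rule is_coconeI[OF functor_comp[OF D h]])
        fix f j j' assume f: "f \<in> hom J j j'"
        note jj = hom_Obj[OF is_cocone_cats(1)[OF co] f]
        show "Comp ?S (?\<nu> j') (FArr (functor_comp J ?h D) f) = ?\<nu> j"
        proof (rule SET_eqI[OF SET_Comp_hom[OF Ar(1)[OF f] \<nu>h[OF jj(2)]] \<nu>h[OF jj(1)]])
          fix g assume g: "g \<in> hom A P (FObj D j)"
          then show "app (Comp ?S (?\<nu> j') (FArr (functor_comp J ?h D) f)) g = app (?\<nu> j) g"
            using \<nu>c f Comp_hom[OF A' g functor_hom[OF D f]]
            by (simp add: app_Comp[OF Ar(1)[OF f] \<nu>h[OF jj(2)] g] Ar(2)[OF f g] app_set_arr)
        qed
      qed (use M \<nu>h O in auto)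
      then have ex1: "\<exists>!k. k \<in> hom ?S (hom A P L) M \<and> (\<forall>j\<in>Obj J. Comp ?S k (FArr ?h (\<mu> j)) = ?\<nu> j)"
        using col L by (simp add: is_colimit_def hom_functor_Obj)
      have eqv: "Comp ?S k (FArr ?h (\<mu> j)) = ?\<nu> j \<longleftrightarrow> (\<forall>g\<in>hom A P (FObj D j). app k (Comp A (\<mu> j) g) = \<nu> j g)"
        if k: "k \<in> hom ?S (hom A P L) M" and j: "j \<in> Obj J" for k j
      proof
        assume e: "Comp ?S k (FArr ?h (\<mu> j)) = ?\<nu> j"
        show "\<forall>g\<in>hom A P (FObj D j). app k (Comp A (\<mu> j) g) = \<nu> j g"
        proof
          fix g assume g: "g \<in> hom A P (FObj D j)"
          show "app k (Comp A (\<mu> j) g) = \<nu> j g"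
            using arg_cong[OF e, of "\<lambda>t. app t g"] by (simp add: app_Comp[OF \<mu>h[OF j] k g] \<mu>a[OF j g] app_set_arr[OF g])
        qed
      next
        assume "\<forall>g\<in>hom A P (FObj D j). app k (Comp A (\<mu> j) g) = \<nu> j g"
        then show "Comp ?S k (FArr ?h (\<mu> j)) = ?\<nu> j"
          by (intro SET_eqI[OF SET_Comp_hom[OF \<mu>h[OF j] k] \<nu>h[OF j]])
            (simp add: app_Comp[OF \<mu>h[OF j] k] \<mu>a[OF j] app_set_arr)
      qed
      show "unique_factorization A J D L \<mu> P M \<nu>"
      proof (intro conjI allI impI ballI)
        obtain k where k: "k \<in> hom ?S (hom A P L) M" "\<forall>j\<in>Obj J. Comp ?S k (FArr ?h (\<mu> j)) = ?\<nu> j"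
          using ex1 by blast
        then show "\<exists>h. (\<forall>k\<in>hom A P L. h k \<in> M) \<and> (\<forall>j\<in>Obj J. \<forall>g\<in>hom A P (FObj D j). h (Comp A (\<mu> j) g) = \<nu> j g)"
          using app_in[OF k(1)] eqv[OF k(1)] by (intro exI[of _ "app k"]) blast
        fix h h' x assume hh: "\<forall>k\<in>hom A P L. h k \<in> M" "\<forall>k\<in>hom A P L. h' k \<in> M"
          and e: "\<forall>j\<in>Obj J. \<forall>g\<in>hom A P (FObj D j). h (Comp A (\<mu> j) g) = \<nu> j g"
            "\<forall>j\<in>Obj J. \<forall>g\<in>hom A P (FObj D j). h' (Comp A (\<mu> j) g) = \<nu> j g"
          and x: "x \<in> hom A P L"
        \<comment> \<open>Plain functions are free outside \<open>hom A P L\<close>; after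
          restriction they are arrows of \<open>SET\<close>, to which the uniqueness clause
          applies.\<close>
        have H: "set_arr (hom A P L) h M \<in> hom ?S (hom A P L) M" "set_arr (hom A P L) h' M \<in> hom ?S (hom A P L) M"
          by (rule set_arr_hom[OF smP[OF L] M], use hh in blast)+
        have "\<forall>j\<in>Obj J. Comp ?S (set_arr (hom A P L) h M) (FArr ?h (\<mu> j)) = ?\<nu> j"
          "\<forall>j\<in>Obj J. Comp ?S (set_arr (hom A P L) h' M) (FArr ?h (\<mu> j)) = ?\<nu> j"
          using e \<mu>in by (simp_all add: eqv[OF H(1)] eqv[OF H(2)] app_set_arr)
        then have "set_arr (hom A P L) h M = set_arr (hom A P L) h' M" using ex1 H by blast
        then show "h x = h' x" using app_set_arr[OF x] by metis
      qed
    qed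
  next
    assume hc: "hom_colimit TYPE('u) J A D L \<mu> P"
    show ?col unfolding is_colimit_def
    proof (intro conjI co' allI impI)
      fix M \<nu> assume \<nu>: "is_cocone J ?S (functor_comp J ?h D) M \<nu>"
      have M: "small TYPE('u) M" using \<nu> by (simp add: is_cocone_def)
      have \<nu>h: "\<nu> j \<in> hom ?S (hom A P (FObj D j)) M" if "j \<in> Obj J" for j
        using cocone_hom[OF \<nu> that] that by (simp add: O)
      have c: "app (\<nu> j') (Comp A (FArr D f) g) = app (\<nu> j) g" if f: "f \<in> hom J j j'" and g: "g \<in> hom A P (FObj D j)" for f j j' g
        using arg_cong[OF cocone_comm[OF \<nu> f], of "\<lambda>t. app t g"]
          app_Comp[OF Ar(1)[OF f] \<nu>h[OF hom_Obj(2)[OF is_cocone_cats(1)[OF co] f]] g] Ar(2)[OF f g] by simp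
      have inM: "\<forall>j\<in>Obj J. \<forall>g\<in>hom A P (FObj D j). app (\<nu> j) g \<in> M" using app_in[OF \<nu>h] by blast
      have ex: "\<exists>h. (\<forall>k\<in>hom A P L. h k \<in> M) \<and> (\<forall>j\<in>Obj J. \<forall>g\<in>hom A P (FObj D j). h (Comp A (\<mu> j) g) = app (\<nu> j) g)"
        and un: "\<And>h h' k. (\<forall>k\<in>hom A P L. h k \<in> M) \<Longrightarrow> (\<forall>k\<in>hom A P L. h' k \<in> M) \<Longrightarrow>
           (\<forall>j\<in>Obj J. \<forall>g\<in>hom A P (FObj D j). h (Comp A (\<mu> j) g) = app (\<nu> j) g) \<Longrightarrow>
           (\<forall>j\<in>Obj J. \<forall>g\<in>hom A P (FObj D j). h' (Comp A (\<mu> j) g) = app (\<nu> j) g) \<Longrightarrow> k \<in> hom A P L \<Longrightarrow> h k = h' k"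
        using hc[unfolded hom_colimit_def, THEN spec[of _ M], THEN spec[of _ "\<lambda>j. app (\<nu> j)"]] M inM c by blast+
      obtain h where h': "\<forall>k\<in>hom A P L. h k \<in> M" "\<forall>j\<in>Obj J. \<forall>g\<in>hom A P (FObj D j). h (Comp A (\<mu> j) g) = app (\<nu> j) g"
        using ex by blast
      have eqv: "Comp ?S k (FArr ?h (\<mu> j)) = \<nu> j \<longleftrightarrow> (\<forall>g\<in>hom A P (FObj D j). app k (Comp A (\<mu> j) g) = app (\<nu> j) g)"
        if k: "k \<in> hom ?S (hom A P L) M" and j: "j \<in> Obj J" for k j
      proof
        assume e: "Comp ?S k (FArr ?h (\<mu> j)) = \<nu> j"
        show "\<forall>g\<in>hom A P (FObj D j). app k (Comp A (\<mu> j) g) = app (\<nu> j) g"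
        proof
          fix g assume g: "g \<in> hom A P (FObj D j)"
          show "app k (Comp A (\<mu> j) g) = app (\<nu> j) g"
            using app_Comp[OF \<mu>h[OF j] k g] by (simp add: e \<mu>a[OF j g])
        qed
      next
        assume "\<forall>g\<in>hom A P (FObj D j). app k (Comp A (\<mu> j) g) = app (\<nu> j) g"
        then show "Comp ?S k (FArr ?h (\<mu> j)) = \<nu> j"
          by (intro SET_eqI[OF SET_Comp_hom[OF \<mu>h[OF j] k] \<nu>h[OF j]])
            (simp add: app_Comp[OF \<mu>h[OF j] k] \<mu>a[OF j])
      qed
      have H: "set_arr (hom A P L) h M \<in> hom ?S (hom A P L) M"
        by (rule set_arr_hom[OF smP[OF L] M]) (use h' in blast)
      have "\<exists>!k. k \<in> hom ?S (hom A P L) M \<and> (\<forall>j\<in>Obj J. Comp ?S k (FArr ?h (\<mu> j)) = \<nu> j)"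
      proof (intro ex1I conjI)
        show "set_arr (hom A P L) h M \<in> hom ?S (hom A P L) M" by (rule H)
        show "\<forall>j\<in>Obj J. Comp ?S (set_arr (hom A P L) h M) (FArr ?h (\<mu> j)) = \<nu> j"
          using h'(2) \<mu>in by (simp add: eqv[OF H] app_set_arr)
        fix k assume k: "k \<in> hom ?S (hom A P L) M \<and> (\<forall>j\<in>Obj J. Comp ?S k (FArr ?h (\<mu> j)) = \<nu> j)"
        then have k': "k \<in> hom ?S (hom A P L) M"
          and e: "\<forall>j\<in>Obj J. \<forall>g\<in>hom A P (FObj D j). app k (Comp A (\<mu> j) g) = app (\<nu> j) g"
          using eqv by blast+
        show "k = set_arr (hom A P L) h M"
        proof (rule SET_eqI[OF k' H])
          fix x assume x: "x \<in> hom A P L"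
          have "\<forall>k'\<in>hom A P L. app k k' \<in> M" using app_in[OF k'] by blast
          from un[OF this h'(1) e h'(2) x] show "app k x = app (set_arr (hom A P L) h M) x"
            by (simp add: app_set_arr[OF x])
        qed
      qed
      then show "\<exists>!k. k \<in> hom ?S (FObj ?h L) M \<and> (\<forall>j\<in>Obj J. Comp ?S k (FArr ?h (\<mu> j)) = \<nu> j)"
        using L by (simp add: hom_functor_Obj)
    qed
  qed
qed

text \<open>\<open>Hom(P, -)\<close> is a retract of \<open>Hom(Q, -)\<close>. Precomposition with
  \<open>s\<close> turns a cocone for \<open>P\<close> into one for \<open>Q\<close>, and
  precomposition with \<open>r\<close> brings the factorization back.\<close>

lemma hom_colimit_retract:
  fixes A :: "('o, 'm) category"
  assumes A: "is_category A" and co: "is_cocone J A D L \<mu>"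
    and ret: "retract A P Q" and Q: "hom_colimit U J A D L \<mu> Q"
  shows "hom_colimit U J A D L \<mu> P"
  unfolding hom_colimit_def
proof (intro allI impI)
  obtain s r where s: "s \<in> hom A P Q" and r: "r \<in> hom A Q P" and rs: "Comp A r s = Ide A P"
    using ret unfolding retract_def by blast
  note D = is_cocone_cats(3)[OF co] and \<mu> = cocone_hom[OF co]
  fix M :: "'m set" and \<nu>
  assume M: "small U M" and \<nu>M: "\<forall>j\<in>Obj J. \<forall>g\<in>hom A P (FObj D j). \<nu> j g \<in> M"
    and \<nu>c: "\<forall>f j j' g. f \<in> hom J j j' \<longrightarrow> g \<in> hom A P (FObj D j) \<longrightarrow> \<nu> j' (Comp A (FArr D f) g) = \<nu> j g"
  let ?\<nu> = "\<lambda>j g. \<nu> j (Comp A g s)"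
  have 1: "\<forall>j\<in>Obj J. \<forall>g\<in>hom A Q (FObj D j). ?\<nu> j g \<in> M" using \<nu>M Comp_hom[OF A s] by blast
  have 2: "\<forall>f j j' g. f \<in> hom J j j' \<longrightarrow> g \<in> hom A Q (FObj D j) \<longrightarrow> ?\<nu> j' (Comp A (FArr D f) g) = ?\<nu> j g"
    using \<nu>c Comp_hom[OF A s] Comp_assoc[OF A s _ functor_hom[OF D]] by metis
  have ex: "\<exists>h. (\<forall>k\<in>hom A Q L. h k \<in> M) \<and> (\<forall>j\<in>Obj J. \<forall>g\<in>hom A Q (FObj D j). h (Comp A (\<mu> j) g) = ?\<nu> j g)"
    and un: "\<And>h h' k. (\<forall>k\<in>hom A Q L. h k \<in> M) \<Longrightarrow> (\<forall>k\<in>hom A Q L. h' k \<in> M) \<Longrightarrow>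
       (\<forall>j\<in>Obj J. \<forall>g\<in>hom A Q (FObj D j). h (Comp A (\<mu> j) g) = ?\<nu> j g) \<Longrightarrow>
       (\<forall>j\<in>Obj J. \<forall>g\<in>hom A Q (FObj D j). h' (Comp A (\<mu> j) g) = ?\<nu> j g) \<Longrightarrow> k \<in> hom A Q L \<Longrightarrow> h k = h' k"
    using Q[unfolded hom_colimit_def, THEN spec[of _ M], THEN spec[of _ ?\<nu>]] M 1 2 by blast+
  show "unique_factorization A J D L \<mu> P M \<nu>"
  proof (intro conjI allI impI ballI)
    obtain h where h: "\<forall>k\<in>hom A Q L. h k \<in> M" "\<forall>j\<in>Obj J. \<forall>g\<in>hom A Q (FObj D j). h (Comp A (\<mu> j) g) = ?\<nu> j g"
      using ex by blast
    have "h (Comp A (Comp A (\<mu> j) g) r) = \<nu> j g" if j: "j \<in> Obj J" and g: "g \<in> hom A P (FObj D j)" for j g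
      using h(2) j Comp_hom[OF A r g] Comp_assoc[OF A r g \<mu>[OF j]] section_cancel'[OF A s r rs g] by simp
    then show "\<exists>h. (\<forall>k\<in>hom A P L. h k \<in> M) \<and> (\<forall>j\<in>Obj J. \<forall>g\<in>hom A P (FObj D j). h (Comp A (\<mu> j) g) = \<nu> j g)"
      using h(1) Comp_hom[OF A r] by (intro exI[of _ "\<lambda>k. h (Comp A k r)"]) blast
    fix h h' x assume hM: "\<forall>k\<in>hom A P L. h k \<in> M" "\<forall>k\<in>hom A P L. h' k \<in> M"
      and e: "\<forall>j\<in>Obj J. \<forall>g\<in>hom A P (FObj D j). h (Comp A (\<mu> j) g) = \<nu> j g"
        "\<forall>j\<in>Obj J. \<forall>g\<in>hom A P (FObj D j). h' (Comp A (\<mu> j) g) = \<nu> j g"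
      and x: "x \<in> hom A P L"
    have ext: "\<forall>j\<in>Obj J. \<forall>g\<in>hom A Q (FObj D j). k (Comp A (Comp A (\<mu> j) g) s) = ?\<nu> j g"
      if "\<forall>j\<in>Obj J. \<forall>g\<in>hom A P (FObj D j). k (Comp A (\<mu> j) g) = \<nu> j g" for k
      using that Comp_hom[OF A s] Comp_assoc[OF A s _ \<mu>] by simp
    \<comment> \<open>Every \<open>x\<close> equals \<open>x r s\<close>, so functions on arrows out
      of \<open>P\<close> can be compared through arrows out of \<open>Q\<close>.\<close>
    have "h (Comp A (Comp A x r) s) = h' (Comp A (Comp A x r) s)"
      by (rule un[of "\<lambda>k. h (Comp A k s)" "\<lambda>k. h' (Comp A k s)", OF _ _ ext[OF e(1)] ext[OF e(2)] Comp_hom[OF A r x]])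
        (use hM Comp_hom[OF A s] in blast)+
    then show "h x = h' x" by (simp add: section_cancel'[OF A s r rs x])
  qed
qed

text \<open>The universal property splits the inclusion of the union of the images of the legs.\<close>

lemma SET_colimit_surj:
  assumes col: "is_colimit J (SET U) D L \<mu>" and x: "x \<in> L"
  shows "\<exists>j\<in>Obj J. \<exists>y\<in>FObj D j. x = app (\<mu> j) y"
proof -
  have co: "is_cocone J (SET U) D L \<mu>" using col by (simp add: is_colimit_def)
  have L: "small U L" using co by (simp add: is_cocone_def)
  note D = is_cocone_cats(3)[OF co] and \<mu> = cocone_hom[OF co]
  define M where "M = {x \<in> L. \<exists>j\<in>Obj J. \<exists>y\<in>FObj D j. x = app (\<mu> j) y}"
  have MsubL: "M \<subseteq> L" by (auto simp: M_def)
  have M: "small U M" using L MsubL unfolding small_def by (meson lesspoll_trans1 subset_imp_lepoll)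
  have \<mu>M: "app (\<mu> j) y \<in> M" if "j \<in> Obj J" "y \<in> FObj D j" for j y
    using app_in[OF \<mu>[OF that(1)] that(2)] that by (auto simp: M_def)
  have smD: "small U (FObj D j)" if "j \<in> Obj J" for j by (rule SET_functor_small[OF D that])
  let ?\<nu> = "\<lambda>j. set_arr (FObj D j) (app (\<mu> j)) M"
  have \<nu>: "?\<nu> j \<in> hom (SET U) (FObj D j) M" if "j \<in> Obj J" for j
    by (rule set_arr_hom[OF smD[OF that] M \<mu>M[OF that]])
  have i: "set_arr M (\<lambda>x. x) L \<in> hom (SET U) M L" by (rule set_arr_hom[OF M L]) (use MsubL in blast)
  have "is_cocone J (SET U) D M ?\<nu>"
  proof (rule is_coconeI[OF D])
    fix f j j' assume f: "f \<in> hom J j j'"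
    note jj = hom_Obj[OF is_cocone_cats(1)[OF co] f] and Df = functor_hom[OF D f]
    show "Comp (SET U) (?\<nu> j') (FArr D f) = ?\<nu> j"
      by (rule SET_eqI[OF SET_Comp_hom[OF Df \<nu>[OF jj(2)]] \<nu>[OF jj(1)]])
        (simp add: app_Comp[OF Df \<nu>[OF jj(2)]] app_set_arr app_in[OF Df]
          app_Comp[OF Df \<mu>[OF jj(2)], symmetric] cocone_comm[OF co f])
  qed (use M \<nu> in auto)
  then obtain h where h: "h \<in> hom (SET U) L M" "\<forall>j\<in>Obj J. Comp (SET U) h (\<mu> j) = ?\<nu> j"
    using col unfolding is_colimit_def by blast
  have 1: "Comp (SET U) (Comp (SET U) (set_arr M (\<lambda>x. x) L) h) (\<mu> j) = \<mu> j" if j: "j \<in> Obj J" for j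
  proof -
    have "Comp (SET U) (set_arr M (\<lambda>x. x) L) (?\<nu> j) = \<mu> j"
      by (rule SET_eqI[OF SET_Comp_hom[OF \<nu>[OF j] i] \<mu>[OF j]])
        (simp add: app_Comp[OF \<nu>[OF j] i] app_set_arr \<mu>M[OF j])
    then show ?thesis using Comp_assoc[OF SET_category \<mu>[OF j] h(1) i] h(2) j by simp
  qed
  have 2: "Comp (SET U) (Ide (SET U) L) (\<mu> j) = \<mu> j" if j: "j \<in> Obj J" for j
    by (rule Comp_Ide_left[OF SET_category \<mu>[OF j]])
  have "\<exists>!k. k \<in> hom (SET U) L L \<and> (\<forall>j\<in>Obj J. Comp (SET U) k (\<mu> j) = \<mu> j)"
    using col co by (simp add: is_colimit_def)
  then have eq: "Comp (SET U) (set_arr M (\<lambda>x. x) L) h = Ide (SET U) L"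
    using 1 2 SET_Comp_hom[OF h(1) i] SET_Ide_hom[OF L] by blast
  have "app h x \<in> M" by (rule app_in[OF h(1) x])
  moreover have "app h x = x"
    using arg_cong[OF eq, of "\<lambda>t. app t x"] app_in[OF h(1) x]
    by (simp add: app_Comp[OF h(1) i x] app_set_arr app_Ide[OF x])
  ultimately show ?thesis by (simp add: M_def)
qed

text \<open>Made for the right adjoint of evaluation, whose values are sets of functions into arrows
  of a presheaf category. They are small but do not consist of elements of \<open>'u\<close>, so
  they are coded object by object.\<close>

lemma set_functor_encode:
  fixes A :: "'o \<Rightarrow> 'b set" and W :: "('o, 'm) category"
  assumes W: "is_category W" and sm: "\<And>a. a \<in> Obj W \<Longrightarrow> small TYPE('u) (A a)"
    and cl: "\<And>f a b x. f \<in> hom W a b \<Longrightarrow> x \<in> A a \<Longrightarrow> \<phi> f x \<in> A b"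
    and id: "\<And>a x. a \<in> Obj W \<Longrightarrow> x \<in> A a \<Longrightarrow> \<phi> (Ide W a) x = x"
    and comp: "\<And>f g a b c x. f \<in> hom W a b \<Longrightarrow> g \<in> hom W b c \<Longrightarrow> x \<in> A a \<Longrightarrow> \<phi> (Comp W g f) x = \<phi> g (\<phi> f x)"
  shows "\<exists>Q enc dec. is_functor W (SET TYPE('u) :: ('u set, _) category) Q \<and>
    (\<forall>a\<in>Obj W. \<forall>x\<in>A a. enc a x \<in> FObj Q a \<and> dec a (enc a x) = x) \<and>
    (\<forall>a\<in>Obj W. \<forall>y\<in>FObj Q a. dec a y \<in> A a) \<and>
    (\<forall>f a b x. f \<in> hom W a b \<longrightarrow> x \<in> A a \<longrightarrow> app (FArr Q f) (enc a x) = enc b (\<phi> f x))"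
proof -
  have "\<forall>a\<in>Obj W. \<exists>e :: 'b \<Rightarrow> 'u. inj_on e (A a)" using small_encoding[OF sm] by blast
  then obtain enc :: "'o \<Rightarrow> 'b \<Rightarrow> 'u" where enc: "\<And>a. a \<in> Obj W \<Longrightarrow> inj_on (enc a) (A a)" by metis
  define dec where "dec a = inv_into (A a) (enc a)" for a
  have de: "dec a (enc a x) = x" if "a \<in> Obj W" "x \<in> A a" for a x
    using inv_into_f_f[OF enc[OF that(1)] that(2)] by (simp add: dec_def)
  have decA: "dec a y \<in> A a" if "y \<in> enc a ` A a" for a y
    unfolding dec_def by (rule inv_into_into[OF that])
  define \<phi>' where "\<phi>' f y = enc (Cod W f) (\<phi> f (dec (Dom W f) y))" for f y
  have \<phi>': "\<phi>' f (enc a x) = enc b (\<phi> f x)" if f: "f \<in> hom W a b" and x: "x \<in> A a" for f a b x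
    using homD[OF f] de[OF hom_Obj(1)[OF W f] x] by (simp add: \<phi>'_def)
  let ?Q = "set_functor W (\<lambda>a. enc a ` A a) \<phi>'"
  have Q: "is_functor W (SET TYPE('u)) ?Q"
  proof (rule set_functor[OF W])
    show "small TYPE('u) (enc a ` A a)" if "a \<in> Obj W" for a by (rule small_image[OF sm[OF that]])
    show "\<phi>' f y \<in> enc b ` A b" if f: "f \<in> hom W a b" and y: "y \<in> enc a ` A a" for f a b y
      using y \<phi>'[OF f] cl[OF f] by auto
    show "\<phi>' (Ide W a) y = y" if a: "a \<in> Obj W" and y: "y \<in> enc a ` A a" for a y
      using y \<phi>'[OF Ide_hom[OF W a]] id[OF a] by auto
    show "\<phi>' (Comp W g f) y = \<phi>' g (\<phi>' f y)"
      if f: "f \<in> hom W a b" and g: "g \<in> hom W b c" and y: "y \<in> enc a ` A a" for f g a b c y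
      using y \<phi>'[OF f] \<phi>'[OF g] \<phi>'[OF Comp_hom[OF W f g]] comp[OF f g] cl[OF f] by auto
  qed
  show ?thesis
  proof (rule exI[of _ ?Q], rule exI[of _ enc], rule exI[of _ dec], intro conjI ballI allI impI Q)
    show "enc a x \<in> FObj ?Q a" "dec a (enc a x) = x" if "a \<in> Obj W" "x \<in> A a" for a x
      using that de by (simp_all add: set_functor_simps)
    show "dec a y \<in> A a" if "a \<in> Obj W" "y \<in> FObj ?Q a" for a y
      using that decA by (simp add: set_functor_simps)
    show "app (FArr ?Q f) (enc a x) = enc b (\<phi> f x)" if "f \<in> hom W a b" "x \<in> A a" for f a b x
      using that \<phi>' by (simp add: set_functor_simps app_set_arr)
  qed
qed


section \<open>The Cauchy completion as retracts of representables\<close>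

text \<open>A covariant set-valued functor on \<open>W\<close> plays the role of a presheaf on \<open>X\<close>, where
  \<open>W\<close> is the opposite of \<open>X\<close>.\<close>

type_synonym 'u presheaf = "('u, 'u, 'u set, 'u set \<times> ('u \<Rightarrow> 'u) \<times> 'u set) fmaps"
type_synonym 'u presheaf_arr = "'u presheaf \<times> ('u \<Rightarrow> 'u set \<times> ('u \<Rightarrow> 'u) \<times> 'u set) \<times> 'u presheaf"

context
  fixes W :: "('u, 'u) category"
  assumes u: "universe TYPE('u)" and Ws: "small_category W"
begin

lemma W_cat: "is_category W" "locally_small TYPE('u) W" "small TYPE('u) (Obj W)"
  using Ws small_locally_small by (auto simp: small_category_def)

abbreviation (input) \<A> where "\<A> \<equiv> CAT W (Set_cat :: ('u set, _) category)"
abbreviation (input) rep where "rep c \<equiv> hom_functor W c"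

text \<open>\<open>elem\<close> and \<open>yon\<close> are the two directions of the Yoneda
  bijection, taken on the triples that are the arrows of \<open>\<A>\<close>.\<close>

definition elem :: "'u \<Rightarrow> 'u presheaf_arr \<Rightarrow> 'u" where
  "elem c t = app (fst (snd t) c) (Ide W c)"

definition yon :: "'u presheaf \<Rightarrow> 'u \<Rightarrow> 'u \<Rightarrow> 'u presheaf_arr" where
  "yon Q c x = (rep c, yoneda W Q c x, Q)"

lemma rep_Obj: "c \<in> Obj W \<Longrightarrow> rep c \<in> Obj \<A>"
  by (simp add: hom_functor[OF W_cat(2)])

lemma presheaves_locally_small: "locally_small TYPE('u) \<A>"
  by (rule CAT_locally_small[OF u W_cat(3) SET_locally_small[OF u]])

lemma yon_hom: "is_functor W Set_cat Q \<Longrightarrow> c \<in> Obj W \<Longrightarrow> x \<in> FObj Q c \<Longrightarrow> yon Q c x \<in> hom \<A> (rep c) Q"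
  unfolding yon_def by (rule CAT_homI[OF yoneda[OF W_cat(2)]])

lemma elem_yon:
  assumes Q: "is_functor W Set_cat Q" and c: "c \<in> Obj W" and x: "x \<in> FObj Q c"
  shows "elem c (yon Q c x) = x"
  using SET_functor_Ide[OF Q c x] by (simp add: elem_def yon_def app_yoneda[OF Ide_hom[OF W_cat(1) c] c])

lemma elem_in:
  assumes t: "t \<in> hom \<A> (rep c) Q" and c: "c \<in> Obj W"
  shows "elem c t \<in> FObj Q c"
proof -
  obtain \<alpha> where \<alpha>: "t = (rep c, \<alpha>, Q)" "is_nat W Set_cat (rep c) Q \<alpha>" using t by (auto simp: CAT_hom)
  show ?thesis
    using SET_nat_in[OF \<alpha>(2) c, of "Ide W c"] Ide_hom[OF W_cat(1) c] c by (simp add: elem_def \<alpha>(1) hom_functor_Obj)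
qed

lemma elem_inj:
  assumes t: "t \<in> hom \<A> (rep c) Q" and s: "s \<in> hom \<A> (rep c) Q" and c: "c \<in> Obj W" and eq: "elem c t = elem c s"
  shows "t = s"
proof -
  obtain \<alpha> where \<alpha>: "t = (rep c, \<alpha>, Q)" "is_nat W Set_cat (rep c) Q \<alpha>" using t by (auto simp: CAT_hom)
  obtain \<beta> where \<beta>: "s = (rep c, \<beta>, Q)" "is_nat W Set_cat (rep c) Q \<beta>" using s by (auto simp: CAT_hom)
  have "\<alpha> = \<beta>"
  proof (rule SET_nat_eqI[OF \<alpha>(2) \<beta>(2)])
    fix a g assume a: "a \<in> Obj W" and "g \<in> FObj (rep c) a"
    then have g: "g \<in> hom W c a" by (simp add: hom_functor_Obj)
    show "app (\<alpha> a) g = app (\<beta> a) g"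
      using eq by (simp add: yoneda_element[OF W_cat(2) \<alpha>(2) c g] yoneda_element[OF W_cat(2) \<beta>(2) c g]
          elem_def \<alpha>(1) \<beta>(1))
  qed
  then show ?thesis by (simp add: \<alpha>(1) \<beta>(1))
qed

lemma yon_elem:
  assumes t: "t \<in> hom \<A> (rep c) Q" and c: "c \<in> Obj W"
  shows "yon Q c (elem c t) = t"
proof (rule elem_inj[OF _ t c])
  have Q: "is_functor W Set_cat Q" using hom_Obj(2)[OF CAT_category t] by simp
  show "yon Q c (elem c t) \<in> hom \<A> (rep c) Q" by (rule yon_hom[OF Q c elem_in[OF t c]])
  show "elem c (yon Q c (elem c t)) = elem c t" by (rule elem_yon[OF Q c elem_in[OF t c]])
qed

lemma app_presheaf_comp:
  assumes "is_nat W Set_cat P Q \<alpha>" "is_nat W Set_cat Q R \<beta>" "a \<in> Obj W" "x \<in> FObj P a"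
  shows "app (vcomp W Set_cat \<beta> \<alpha> a) x = app (\<beta> a) (app (\<alpha> a) x)"
  using app_Comp[OF nat_hom[OF assms(1,3)] nat_hom[OF assms(2,3)] assms(4)] assms(3) by (simp add: nat_apply)

lemma elem_Comp:
  assumes t: "t \<in> hom \<A> (rep c) Q" and \<beta>: "is_nat W Set_cat Q R \<beta>" and c: "c \<in> Obj W"
  shows "elem c (Comp \<A> (Q, \<beta>, R) t) = app (\<beta> c) (elem c t)"
proof -
  obtain \<alpha> where \<alpha>: "t = (rep c, \<alpha>, Q)" "is_nat W Set_cat (rep c) Q \<alpha>" using t by (auto simp: CAT_hom)
  show ?thesis
    using app_presheaf_comp[OF \<alpha>(2) \<beta> c, of "Ide W c"] Ide_hom[OF W_cat(1) c] c
    by (simp add: elem_def \<alpha>(1) hom_functor_Obj)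
qed

lemma yon_Comp:
  assumes \<beta>: "is_nat W Set_cat Q R \<beta>" and c: "c \<in> Obj W" and x: "x \<in> FObj Q c"
  shows "Comp \<A> (Q, \<beta>, R) (yon Q c x) = yon R c (app (\<beta> c) x)"
proof (rule elem_inj[OF _ _ c])
  note Q = nat_functors(1)[OF \<beta>] and R = nat_functors(2)[OF \<beta>]
  note y = yon_hom[OF Q c x]
  show "Comp \<A> (Q, \<beta>, R) (yon Q c x) \<in> hom \<A> (rep c) R" by (rule Comp_hom[OF CAT_category y CAT_homI[OF \<beta>]])
  show "yon R c (app (\<beta> c) x) \<in> hom \<A> (rep c) R" by (rule yon_hom[OF R c SET_nat_in[OF \<beta> c x]])
  show "elem c (Comp \<A> (Q, \<beta>, R) (yon Q c x)) = elem c (yon R c (app (\<beta> c) x))"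
    by (simp only: elem_Comp[OF y \<beta> c] elem_yon[OF Q c x] elem_yon[OF R c SET_nat_in[OF \<beta> c x]])
qed

text \<open>Evaluation at \<open>c\<close> has the right adjoint sending a set \<open>M\<close> to the functor of maps from
  \<open>W(-, c)\<close> to \<open>M\<close>, so it preserves colimits.\<close>

lemma rep_hom_colimit:
  assumes c: "c \<in> Obj W" and col: "is_colimit J \<A> D L \<mu>"
  shows "hom_colimit TYPE('u) J \<A> D L \<mu> (rep c)"
  unfolding hom_colimit_def
proof (intro allI impI)
  note W = W_cat(1)
  have co: "is_cocone J \<A> D L \<mu>" using col by (simp add: is_colimit_def)
  note D = is_cocone_cats(3)[OF co] and \<mu> = cocone_hom[OF co] and J = is_cocone_cats(1)[OF co]
  have L: "is_functor W Set_cat L" using co by (simp add: is_cocone_def)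
  have Dj: "is_functor W Set_cat (FObj D j)" if "j \<in> Obj J" for j using functor_Obj[OF D that] by simp
  fix M :: "'u presheaf_arr set" and \<nu>
  assume M: "small TYPE('u) M" and \<nu>M: "\<forall>j\<in>Obj J. \<forall>g\<in>hom \<A> (rep c) (FObj D j). \<nu> j g \<in> M"
    and \<nu>c: "\<forall>f j j' g. f \<in> hom J j j' \<longrightarrow> g \<in> hom \<A> (rep c) (FObj D j) \<longrightarrow> \<nu> j' (Comp \<A> (FArr D f) g) = \<nu> j g"
  have smA: "small TYPE('u) (hom W x c \<rightarrow>\<^sub>E M)" if x: "x \<in> Obj W" for x
    by (rule small_PiE[OF u _ M]) (use W_cat(2) x c in \<open>simp add: locally_small_def\<close>)
  define \<phi> where "\<phi> f k = (\<lambda>v\<in>hom W (Cod W f) c. k (Comp W v f))" for f and k :: "'u \<Rightarrow> 'u presheaf_arr"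
  have \<phi>a: "\<phi> f k v = k (Comp W v f)" if "f \<in> hom W a b" "v \<in> hom W b c" for f k v a b
    using homD[OF that(1)] that(2) by (simp add: \<phi>_def)
  have \<phi>e: "\<phi> f k \<in> extensional (hom W b c)" if "f \<in> hom W a b" for f k a b
    using homD[OF that] by (simp add: \<phi>_def)
  have l1: "\<phi> f x \<in> hom W b c \<rightarrow>\<^sub>E M" if f: "f \<in> hom W a b" and x: "x \<in> hom W a c \<rightarrow>\<^sub>E M" for f a b x
      using \<phi>e[OF f] \<phi>a[OF f] Comp_hom[OF W f] x by (auto simp: PiE_def Pi_def)
  have l2: "\<phi> (Ide W a) x = x" if a: "a \<in> Obj W" and x: "x \<in> hom W a c \<rightarrow>\<^sub>E M" for a x
      by (rule extensionalityI[OF \<phi>e[OF Ide_hom[OF W a]]])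
        (use x in \<open>auto simp: \<phi>a[OF Ide_hom[OF W a]] Comp_Ide_right[OF W] PiE_def\<close>)
  have l3: "\<phi> (Comp W g f) x = \<phi> g (\<phi> f x)" if f: "f \<in> hom W a b" and g: "g \<in> hom W b d" and "x \<in> hom W a c \<rightarrow>\<^sub>E M" for f g a b d x
      by (rule extensionalityI[OF \<phi>e[OF Comp_hom[OF W f g]] \<phi>e[OF g]])
        (simp add: \<phi>a[OF Comp_hom[OF W f g]] \<phi>a[OF g] \<phi>a[OF f] Comp_hom[OF W g] Comp_assoc[OF W f g])
  have ex: "\<exists>(R :: 'u presheaf) enc dec. is_functor W (SET TYPE('u)) R \<and>
    (\<forall>a\<in>Obj W. \<forall>x\<in>hom W a c \<rightarrow>\<^sub>E M. enc a x \<in> FObj R a \<and> dec a (enc a x) = x) \<and>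
    (\<forall>a\<in>Obj W. \<forall>y\<in>FObj R a. dec a y \<in> hom W a c \<rightarrow>\<^sub>E M) \<and>
    (\<forall>f a b x. f \<in> hom W a b \<longrightarrow> x \<in> hom W a c \<rightarrow>\<^sub>E M \<longrightarrow> app (FArr R f) (enc a x) = enc b (\<phi> f x))"
    by (rule set_functor_encode[OF W]) (fact smA l1 l2 l3)+
  then obtain R :: "'u presheaf" and enc dec where R: "is_functor W (SET TYPE('u)) R"
    and enc': "\<forall>a\<in>Obj W. \<forall>x\<in>hom W a c \<rightarrow>\<^sub>E M. enc a x \<in> FObj R a \<and> dec a (enc a x) = x"
    and dec': "\<forall>a\<in>Obj W. \<forall>y\<in>FObj R a. dec a y \<in> hom W a c \<rightarrow>\<^sub>E M"
    and Ra': "\<forall>f a b x. f \<in> hom W a b \<longrightarrow> x \<in> hom W a c \<rightarrow>\<^sub>E M \<longrightarrow> app (FArr R f) (enc a x) = enc b (\<phi> f x)"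
    by (elim exE conjE)
  note enc = enc'[rule_format, THEN conjunct1] and de = enc'[rule_format, THEN conjunct2]
    and dec = dec'[rule_format] and Ra = Ra'[rule_format]
  \<comment> \<open>the transpose of a map from \<open>Q c\<close> to \<open>M\<close>\<close>
  define tr where "tr Q k x z = enc x (\<lambda>v\<in>hom W x c. k (app (FArr Q v) z))"
    for Q :: "'u presheaf" and k x z
  have trA: "(\<lambda>v\<in>hom W x c. k (app (FArr Q v) z)) \<in> hom W x c \<rightarrow>\<^sub>E M"
    if Q: "is_functor W Set_cat Q" and k: "\<forall>y\<in>FObj Q c. k y \<in> M" and z: "z \<in> FObj Q x" for Q k x z
    using SET_functor_in[OF Q _ z] k by auto
  have tr: "is_nat W Set_cat Q R (set_nat W Q (tr Q k) R)"
    if Q: "is_functor W Set_cat Q" and k: "\<forall>y\<in>FObj Q c. k y \<in> M" for Q k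
  proof (rule set_nat[OF Q R])
    show "tr Q k a z \<in> FObj R a" if "a \<in> Obj W" "z \<in> FObj Q a" for a z
      unfolding tr_def by (rule enc[OF that(1) trA[OF Q k that(2)]])
    fix f a b z assume f: "f \<in> hom W a b" and z: "z \<in> FObj Q a"
    have "\<phi> f (\<lambda>v\<in>hom W a c. k (app (FArr Q v) z)) = (\<lambda>v\<in>hom W b c. k (app (FArr Q v) (app (FArr Q f) z)))"
      by (rule extensionalityI[OF \<phi>e[OF f] restrict_extensional])
        (simp add: \<phi>a[OF f] Comp_hom[OF W f] SET_functor_Comp[OF Q f _ z])
    then show "tr Q k b (app (FArr Q f) z) = app (FArr R f) (tr Q k a z)"
      using Ra[OF f trA[OF Q k z]] by (simp add: tr_def)
  qed
  have tr_app: "app (set_nat W Q (tr Q k) R x) z = tr Q k x z" if "x \<in> Obj W" "z \<in> FObj Q x" for Q k x z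
    by (rule app_set_nat[OF that])
  \<comment> \<open>Evaluating a transpose at the identity of \<open>c\<close> returns the original
    map; this is the counit of the adjunction and serves both existence and uniqueness.\<close>
  have tr_dec: "dec c (tr Q k c z) (Ide W c) = k z"
    if Q: "is_functor W Set_cat Q" and k: "\<forall>y\<in>FObj Q c. k y \<in> M" and z: "z \<in> FObj Q c" for Q k z
    using de[OF c trA[OF Q k z]] Ide_hom[OF W c] SET_functor_Ide[OF Q c z] by (simp add: tr_def)
  \<comment> \<open>The given cocone lives on arrows out of the representable; Yoneda rewrites it as
    one on elements of \<open>D j\<close> at \<open>c\<close>, where it can be transposed.\<close>
  define k\<nu> where "k\<nu> j z = \<nu> j (yon (FObj D j) c z)" for j z
  have k\<nu>: "\<forall>z\<in>FObj (FObj D j) c. k\<nu> j z \<in> M" if "j \<in> Obj J" for j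
    using \<nu>M yon_hom[OF Dj[OF that] c] that by (simp add: k\<nu>_def)
  define \<tau> where "\<tau> j = (FObj D j, set_nat W (FObj D j) (tr (FObj D j) (k\<nu> j)) R, R)" for j
  have \<tau>n: "is_nat W Set_cat (FObj D j) R (set_nat W (FObj D j) (tr (FObj D j) (k\<nu> j)) R)" if "j \<in> Obj J" for j
    by (rule tr[OF Dj[OF that] k\<nu>[OF that]])
  \<comment> \<open>Used as a congruence rule, so that the simplifier can compare values of a
    transpose along each \<open>v\<close> from \<open>x\<close> to \<open>c\<close>.\<close>
  have tr_cong: "tr Q k x z = tr Q' k' x z'"
    if "\<And>v. v \<in> hom W x c \<Longrightarrow> k (app (FArr Q v) z) = k' (app (FArr Q' v) z')" for Q k x z Q' k' z'
    unfolding tr_def using that by (simp cong: restrict_cong)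
  have \<mu>n: "\<exists>\<alpha>. \<mu> j = (FObj D j, \<alpha>, L) \<and> is_nat W Set_cat (FObj D j) L \<alpha>" if "j \<in> Obj J" for j
    using \<mu>[OF that] by (auto simp: CAT_hom)
  have \<tau>co: "is_cocone J \<A> D R \<tau>"
  proof (rule is_coconeI[OF D])
    show "\<tau> j \<in> hom \<A> (FObj D j) R" if "j \<in> Obj J" for j
      unfolding \<tau>_def by (rule CAT_homI[OF \<tau>n[OF that]])
    fix f j j' assume f: "f \<in> hom J j j'"
    note jj = hom_Obj[OF J f]
    obtain \<delta> where \<delta>: "FArr D f = (FObj D j, \<delta>, FObj D j')" "is_nat W Set_cat (FObj D j) (FObj D j') \<delta>"
      using functor_hom[OF D f] by (auto simp: CAT_hom)
    have kk: "k\<nu> j' (app (\<delta> c) z) = k\<nu> j z" if z: "z \<in> FObj (FObj D j) c" for z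
      using \<nu>c[rule_format, OF f yon_hom[OF Dj[OF jj(1)] c z]]
      by (simp add: k\<nu>_def \<delta>(1) yon_Comp[OF \<delta>(2) c z])
    have "vcomp W Set_cat (set_nat W (FObj D j') (tr (FObj D j') (k\<nu> j')) R) \<delta>
        = set_nat W (FObj D j) (tr (FObj D j) (k\<nu> j)) R"
    proof (rule SET_nat_eqI[OF vcomp_nat[OF \<delta>(2) \<tau>n[OF jj(2)]] \<tau>n[OF jj(1)]])
      fix x z assume x: "x \<in> Obj W" and z: "z \<in> FObj (FObj D j) x"
      have "k\<nu> j' (app (FArr (FObj D j') v) (app (\<delta> x) z)) = k\<nu> j (app (FArr (FObj D j) v) z)" if v: "v \<in> hom W x c" for v
        using SET_nat_comm[OF \<delta>(2) v z] kk[OF SET_functor_in[OF Dj[OF jj(1)] v z]] by simp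
      then show "app (vcomp W Set_cat (set_nat W (FObj D j') (tr (FObj D j') (k\<nu> j')) R) \<delta> x) z
          = app (set_nat W (FObj D j) (tr (FObj D j) (k\<nu> j)) R x) z"
        by (simp add: app_presheaf_comp[OF \<delta>(2) \<tau>n[OF jj(2)] x z] tr_app[OF x z]
            tr_app[OF x SET_nat_in[OF \<delta>(2) x z]] cong: tr_cong)
    qed
    then show "Comp \<A> (\<tau> j') (FArr D f) = \<tau> j" by (simp add: \<tau>_def \<delta>(1))
  qed (use R in simp)
  then have ex1: "\<exists>!t. t \<in> hom \<A> L R \<and> (\<forall>j\<in>Obj J. Comp \<A> t (\<mu> j) = \<tau> j)"
    using col by (simp add: is_colimit_def)
  show "unique_factorization \<A> J D L \<mu> (rep c) M \<nu>"
  proof (intro conjI allI impI ballI)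
    obtain t where t: "t \<in> hom \<A> L R" "\<forall>j\<in>Obj J. Comp \<A> t (\<mu> j) = \<tau> j" using ex1 by blast
    obtain \<theta> where \<theta>: "t = (L, \<theta>, R)" "is_nat W Set_cat L R \<theta>" using t(1) by (auto simp: CAT_hom)
    define h where "h k = dec c (app (\<theta> c) (elem c k)) (Ide W c)" for k
    have "h k \<in> M" if k: "k \<in> hom \<A> (rep c) L" for k
      using dec[OF c SET_nat_in[OF \<theta>(2) c elem_in[OF k c]]] Ide_hom[OF W c] by (auto simp: h_def PiE_def Pi_def)
    moreover have "h (Comp \<A> (\<mu> j) g) = \<nu> j g" if j: "j \<in> Obj J" and g: "g \<in> hom \<A> (rep c) (FObj D j)" for j g
    proof -
      obtain \<alpha> where \<alpha>: "\<mu> j = (FObj D j, \<alpha>, L)" "is_nat W Set_cat (FObj D j) L \<alpha>" using \<mu>n[OF j] by blast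
      have "vcomp W Set_cat \<theta> \<alpha> = set_nat W (FObj D j) (tr (FObj D j) (k\<nu> j)) R"
        using bspec[OF t(2) j] by (simp add: \<theta>(1) \<alpha>(1) \<tau>_def)
      then have "app (\<theta> c) (app (\<alpha> c) (elem c g)) = tr (FObj D j) (k\<nu> j) c (elem c g)"
        using app_presheaf_comp[OF \<alpha>(2) \<theta>(2) c elem_in[OF g c]] by (simp add: tr_app[OF c elem_in[OF g c]])
      then have "h (Comp \<A> (\<mu> j) g) = k\<nu> j (elem c g)"
        using elem_Comp[OF g \<alpha>(2) c] tr_dec[OF Dj[OF j] k\<nu>[OF j] elem_in[OF g c]] by (simp add: h_def \<alpha>(1))
      then show ?thesis using yon_elem[OF g c] by (simp add: k\<nu>_def)
    qed
    ultimately show "\<exists>h. (\<forall>k\<in>hom \<A> (rep c) L. h k \<in> M) \<and>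
        (\<forall>j\<in>Obj J. \<forall>g\<in>hom \<A> (rep c) (FObj D j). h (Comp \<A> (\<mu> j) g) = \<nu> j g)" by blast
    fix h h' x assume hM: "\<forall>k\<in>hom \<A> (rep c) L. h k \<in> M" "\<forall>k\<in>hom \<A> (rep c) L. h' k \<in> M"
      and e: "\<forall>j\<in>Obj J. \<forall>g\<in>hom \<A> (rep c) (FObj D j). h (Comp \<A> (\<mu> j) g) = \<nu> j g"
        "\<forall>j\<in>Obj J. \<forall>g\<in>hom \<A> (rep c) (FObj D j). h' (Comp \<A> (\<mu> j) g) = \<nu> j g"
      and x: "x \<in> hom \<A> (rep c) L"
    have kM: "\<forall>y\<in>FObj L c. k (yon L c y) \<in> M" if "\<forall>g\<in>hom \<A> (rep c) L. k g \<in> M" for k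
      using that yon_hom[OF L c] by blast
    \<comment> \<open>Any solution \<open>k\<close> of the factorization problem transposes to an
      arrow from \<open>L\<close> to \<open>R\<close> compatible with \<open>\<tau>\<close>. The
      colimit \<open>L\<close> has only one such arrow, so two solutions share a transpose and
      agree.\<close>
    have fac: "(L, set_nat W L (tr L (\<lambda>y. k (yon L c y))) R, R) \<in> hom \<A> L R \<and>
        (\<forall>j\<in>Obj J. Comp \<A> (L, set_nat W L (tr L (\<lambda>y. k (yon L c y))) R, R) (\<mu> j) = \<tau> j)"
      if kM': "\<forall>g\<in>hom \<A> (rep c) L. k g \<in> M"
        and ke: "\<forall>j\<in>Obj J. \<forall>g\<in>hom \<A> (rep c) (FObj D j). k (Comp \<A> (\<mu> j) g) = \<nu> j g" for k
    proof (intro conjI ballI)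
      let ?t = "set_nat W L (tr L (\<lambda>y. k (yon L c y))) R"
      have n: "is_nat W Set_cat L R ?t" by (rule tr[OF L kM[OF kM']])
      show "(L, ?t, R) \<in> hom \<A> L R" by (rule CAT_homI[OF n])
      fix j assume j: "j \<in> Obj J"
      obtain \<alpha> where \<alpha>: "\<mu> j = (FObj D j, \<alpha>, L)" "is_nat W Set_cat (FObj D j) L \<alpha>" using \<mu>n[OF j] by blast
      have "vcomp W Set_cat ?t \<alpha> = set_nat W (FObj D j) (tr (FObj D j) (k\<nu> j)) R"
      proof (rule SET_nat_eqI[OF vcomp_nat[OF \<alpha>(2) n] \<tau>n[OF j]])
        fix a z assume a: "a \<in> Obj W" and z: "z \<in> FObj (FObj D j) a"
        have "k (yon L c (app (FArr L v) (app (\<alpha> a) z))) = k\<nu> j (app (FArr (FObj D j) v) z)" if v: "v \<in> hom W a c" for v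
        proof -
          note vz = SET_functor_in[OF Dj[OF j] v z]
          have "yon L c (app (FArr L v) (app (\<alpha> a) z)) = Comp \<A> (\<mu> j) (yon (FObj D j) c (app (FArr (FObj D j) v) z))"
            using SET_nat_comm[OF \<alpha>(2) v z] yon_Comp[OF \<alpha>(2) c vz] by (simp add: \<alpha>(1))
          then show ?thesis using ke[rule_format, OF j yon_hom[OF Dj[OF j] c vz]] by (simp add: k\<nu>_def)
        qed
        then show "app (vcomp W Set_cat ?t \<alpha> a) z = app (set_nat W (FObj D j) (tr (FObj D j) (k\<nu> j)) R a) z"
          by (simp add: app_presheaf_comp[OF \<alpha>(2) n a z] tr_app[OF a z] tr_app[OF a SET_nat_in[OF \<alpha>(2) a z]] cong: tr_cong)
      qed
      then show "Comp \<A> (L, ?t, R) (\<mu> j) = \<tau> j" by (simp add: \<alpha>(1) \<tau>_def)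
    qed
    have "(L, set_nat W L (tr L (\<lambda>y. h (yon L c y))) R, R) = (L, set_nat W L (tr L (\<lambda>y. h' (yon L c y))) R, R)"
      using ex1 fac[OF hM(1) e(1)] fac[OF hM(2) e(2)] by blast
    then have e3: "set_nat W L (tr L (\<lambda>y. h (yon L c y))) R c = set_nat W L (tr L (\<lambda>y. h' (yon L c y))) R c" by simp
    have e4: "tr L (\<lambda>y. h (yon L c y)) c (elem c x) = tr L (\<lambda>y. h' (yon L c y)) c (elem c x)"
      using arg_cong[OF e3, of "\<lambda>t. app t (elem c x)"] by (simp only: tr_app[OF c elem_in[OF x c]])
    have "h (yon L c (elem c x)) = h' (yon L c (elem c x))"
      using arg_cong[OF e4, of "\<lambda>r. dec c r (Ide W c)"]
      by (simp only: tr_dec[OF L kM[OF hM(1)] elem_in[OF x c]] tr_dec[OF L kM[OF hM(2)] elem_in[OF x c]])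
    then show "h x = h' x" by (simp add: yon_elem[OF x c])
  qed
qed

lemma retract_rep_preserves:
  assumes c: "c \<in> Obj W" and ret: "retract \<A> P (rep c)"
  shows "preserves_small_colimits TYPE('u) \<A> (SET TYPE('u)) (hom_functor \<A> P)"
  unfolding preserves_small_colimits_def
proof (intro allI impI)
  fix J :: "('u, 'u) category" and D L \<mu> assume col: "is_colimit J \<A> D L \<mu>"
  have co: "is_cocone J \<A> D L \<mu>" using col by (simp add: is_colimit_def)
  have P: "P \<in> Obj \<A>" using ret hom_Obj(1)[OF CAT_category] unfolding retract_def by blast
  show "is_colimit J (SET TYPE('u)) (functor_comp J (hom_functor \<A> P) D) (FObj (hom_functor \<A> P) L)
      (\<lambda>j. FArr (hom_functor \<A> P) (\<mu> j))"
    using hom_colimit_iff[OF presheaves_locally_small P co]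
      hom_colimit_retract[OF CAT_category co ret rep_hom_colimit[OF c col]] by simp
qed

text \<open>An arrow from \<open>a\<close> to \<open>b\<close> induces one from \<open>rep b\<close>
  to \<open>rep a\<close>, so the functor starts at \<open>op_cat W\<close>. For \<open>W\<close>
  the opposite of \<open>X\<close> this is the usual Yoneda embedding of \<open>X\<close> into
  presheaves.\<close>

definition Yon :: "('u, 'u, 'u presheaf, 'u presheaf_arr) fmaps" where
  "Yon = \<lparr>FObj = (\<lambda>c\<in>Obj W. rep c), FArr = (\<lambda>f\<in>Arr W. yon (rep (Dom W f)) (Cod W f) f)\<rparr>"

lemma Yon_simps: "c \<in> Obj W \<Longrightarrow> FObj Yon c = rep c" "f \<in> hom W a b \<Longrightarrow> FArr Yon f = yon (rep a) b f"
  by (auto simp: Yon_def hom_def)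

lemma Yon_ff: "fully_faithful (op_cat W) \<A> Yon"
proof (rule fully_faithfulI)
  note W = W_cat(1)
  have h: "yon (rep a) b f \<in> hom \<A> (rep b) (rep a)" if f: "f \<in> hom W a b" for f a b
    using yon_hom[OF hom_functor[OF W_cat(2) hom_Obj(1)[OF W f]] hom_Obj(2)[OF W f]] f hom_Obj[OF W f]
    by (simp add: hom_functor_Obj)
  have el: "elem b (yon (rep a) b f) = f" if f: "f \<in> hom W a b" for f a b
    using elem_yon[OF hom_functor[OF W_cat(2) hom_Obj(1)[OF W f]] hom_Obj(2)[OF W f]] f hom_Obj[OF W f]
    by (simp add: hom_functor_Obj)
  show "is_functor (op_cat W) \<A> Yon"
  proof (rule is_functorI[OF op_cat_category[OF W] CAT_category])
    show "FObj Yon a \<in> Obj \<A>" if "a \<in> Obj (op_cat W)" for a using that rep_Obj by (simp add: Yon_simps)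
    show "FArr Yon f \<in> hom \<A> (FObj Yon a) (FObj Yon b)" if "f \<in> hom (op_cat W) a b" for f a b
      using that h[of f b a] hom_Obj[OF W, of f b a] by (simp add: Yon_simps)
    show "FArr Yon (Ide (op_cat W) a) = Ide \<A> (FObj Yon a)" if "a \<in> Obj (op_cat W)" for a
    proof -
      have a: "a \<in> Obj W" using that by simp
      note i = Ide_hom[OF W a]
      have r: "rep a \<in> Obj \<A>" by (rule rep_Obj[OF a])
      have "yon (rep a) a (Ide W a) = Ide \<A> (rep a)"
      proof (rule elem_inj[OF h[OF i] Ide_hom[OF CAT_category r] a])
        show "elem a (yon (rep a) a (Ide W a)) = elem a (Ide \<A> (rep a))"
          using i a by (simp add: el[OF i]) (simp add: elem_def nat_apply app_Ide hom_functor_Obj)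
      qed
      then show ?thesis using a by (simp add: Yon_simps(1) Yon_simps(2)[OF i])
    qed
    fix f g a b d assume "f \<in> hom (op_cat W) a b" "g \<in> hom (op_cat W) b d"
    then have f: "f \<in> hom W b a" and g: "g \<in> hom W d b" by simp_all
    note gf = Comp_hom[OF W g f]
    have "yon (rep d) a (Comp W f g) = Comp \<A> (yon (rep d) b g) (yon (rep b) a f)"
    proof (rule elem_inj[OF h[OF gf] Comp_hom[OF CAT_category h[OF f] h[OF g]] hom_Obj(2)[OF W f]])
      have n: "is_nat W Set_cat (rep b) (rep d) (yoneda W (rep d) b g)"
        using h[OF g] by (simp add: yon_def CAT_hom)
      show "elem a (yon (rep d) a (Comp W f g)) = elem a (Comp \<A> (yon (rep d) b g) (yon (rep b) a f))"
        using elem_Comp[OF h[OF f] n hom_Obj(2)[OF W f]] app_hom_functor[OF f g]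
        by (simp add: el[OF gf] el[OF f] yon_def[of "rep d" b] app_yoneda[OF f hom_Obj(2)[OF W f]])
    qed
    then show "FArr Yon (Comp (op_cat W) g f) = Comp \<A> (FArr Yon g) (FArr Yon f)"
      by (simp add: Yon_simps(2)[OF f] Yon_simps(2)[OF g] Yon_simps(2)[OF gf])
  qed (simp_all add: Yon_def)
  fix a b
  show "f = g" if "f \<in> hom (op_cat W) a b" "g \<in> hom (op_cat W) a b" "FArr Yon f = FArr Yon g" for f g
  proof -
    have f: "f \<in> hom W b a" and g: "g \<in> hom W b a" using that by simp_all
    have "elem a (yon (rep b) a f) = elem a (yon (rep b) a g)"
      using that(3) by (simp add: Yon_simps(2)[OF f] Yon_simps(2)[OF g])
    then show ?thesis by (simp only: el[OF f] el[OF g])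
  qed
  fix t assume a: "a \<in> Obj (op_cat W)" and b: "b \<in> Obj (op_cat W)" and "t \<in> hom \<A> (FObj Yon a) (FObj Yon b)"
  then have t: "t \<in> hom \<A> (rep a) (rep b)" and ab: "a \<in> Obj W" "b \<in> Obj W" by (simp_all add: Yon_simps)
  have f: "elem a t \<in> hom W b a" using elem_in[OF t ab(1)] ab by (simp add: hom_functor_Obj)
  have "FArr Yon (elem a t) = t" using yon_elem[OF t ab(1)] by (simp add: Yon_simps(2)[OF f])
  then show "\<exists>f\<in>hom (op_cat W) a b. FArr Yon f = t" using f by (intro bexI[of _ "elem a t"]) simp_all
qed

text \<open>Arrows are reversed with respect to \<open>W\<close>, so that the projection to
  \<open>op_cat W\<close> can be followed by \<open>Yon\<close>. An arrow stores the element over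
  \<open>Dom W f\<close>; the element at the other end is computed from it.\<close>

definition elements where
  "elements P = \<lparr>Obj = (SIGMA c : Obj W. FObj P c), Arr = (SIGMA f : Arr W. FObj P (Dom W f)),
     Dom = (\<lambda>(f, x). (Cod W f, app (FArr P f) x)), Cod = (\<lambda>(f, x). (Dom W f, x)),
     Ide = (\<lambda>(c, x). (Ide W c, x)), Comp = (\<lambda>(g, y) (f, x). (Comp W f g, y))\<rparr>"

lemma elements_Obj: "v \<in> Obj (elements P) \<longleftrightarrow> fst v \<in> Obj W \<and> snd v \<in> FObj P (fst v)"
  by (cases v) (auto simp: elements_def)

lemma elements_hom:
  "t \<in> hom (elements P) v w \<longleftrightarrow> (\<exists>f. f \<in> hom W (fst w) (fst v) \<and> snd w \<in> FObj P (fst w) \<and>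
     snd v = app (FArr P f) (snd w) \<and> t = (f, snd w))"
  by (cases t; cases v; cases w) (auto simp: elements_def hom_def)

lemma elements_simps:
  "Ide (elements P) v = (Ide W (fst v), snd v)" "Comp (elements P) s t = (Comp W (fst t) (fst s), snd s)"
  by (auto simp: elements_def split_def)

lemma elements_category:
  assumes P: "is_functor W Set_cat P"
  shows "is_category (elements P)"
proof (rule is_categoryI)
  note W = W_cat(1)
  show "v \<in> Obj (elements P) \<and> w \<in> Obj (elements P)" if t: "t \<in> hom (elements P) v w" for t v w
  proof -
    obtain f where f: "f \<in> hom W (fst w) (fst v)" "snd w \<in> FObj P (fst w)" "snd v = app (FArr P f) (snd w)"
      using t unfolding elements_hom by blast
    then show ?thesis using hom_Obj[OF W f(1)] SET_functor_in[OF P f(1,2)] by (simp add: elements_Obj)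
  qed
  show "Ide (elements P) v \<in> hom (elements P) v v" if "v \<in> Obj (elements P)" for v
    using that Ide_hom[OF W, of "fst v"] SET_functor_Ide[OF P, of "fst v" "snd v"]
    by (simp add: elements_hom elements_Obj elements_simps)
  show "Comp (elements P) s t \<in> hom (elements P) u w"
    if t: "t \<in> hom (elements P) u v" and s: "s \<in> hom (elements P) v w" for s t u v w
  proof -
    obtain f where f: "f \<in> hom W (fst v) (fst u)" "snd u = app (FArr P f) (snd v)" "t = (f, snd v)"
      using t unfolding elements_hom by blast
    obtain g where g: "g \<in> hom W (fst w) (fst v)" "snd w \<in> FObj P (fst w)" "snd v = app (FArr P g) (snd w)" "s = (g, snd w)"
      using s unfolding elements_hom by blast
    show ?thesis
      using f g Comp_hom[OF W g(1) f(1)] SET_functor_Comp[OF P g(1) f(1) g(2)]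
      by (simp add: elements_hom elements_simps)
  qed
qed (auto simp: elements_hom elements_simps W_cat(1) Comp_Ide_left[OF W_cat(1)] Comp_Ide_right[OF W_cat(1)]
      Comp_assoc[OF W_cat(1)])

lemma elements_small:
  fixes P :: "'u presheaf"
  assumes P: "is_functor W Set_cat P"
  shows "small TYPE('u) (Obj (elements P))" "small TYPE('u) (Arr (elements P))"
proof -
  have "Dom W f \<in> Obj W" if "f \<in> Arr W" for f using hom_Obj(1)[OF W_cat(1) Arr_hom[OF that]] .
  then show "small TYPE('u) (Obj (elements P))" "small TYPE('u) (Arr (elements P))"
    using Ws SET_functor_small[OF P] unfolding elements_def small_category_def
    by (auto intro!: small_Sigma[OF u])
qed

definition elements_proj where
  "elements_proj P = tuple_fun (elements P) fst fst"

lemma elements_proj_functor: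
  assumes P: "is_functor W Set_cat P"
  shows "is_functor (elements P) (op_cat W) (elements_proj P)"
  unfolding elements_proj_def
  by (rule tuple_fun_functor[OF elements_category[OF P] op_cat_category[OF W_cat(1)]])
    (auto simp: elements_Obj elements_hom elements_simps)

text \<open>By Yoneda a cocone on the diagram of representables is a choice of an element of
  \<open>M c\<close> for every element of \<open>P c\<close>. Compatibility along the arrows of
  \<open>elements P\<close> is naturality of that choice.\<close>

lemma density:
  assumes P: "is_functor W Set_cat P"
  shows "is_colimit (elements P) \<A> (functor_comp (elements P) Yon (elements_proj P)) P (\<lambda>v. yon P (fst v) (snd v))"
proof -
  note W = W_cat(1)
  let ?J = "elements P" and ?D = "functor_comp (elements P) Yon (elements_proj P)"
  note pr = elements_proj_functor[OF P] and J = elements_category[OF P]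
  note D = functor_comp[OF pr ff_functor[OF Yon_ff]]
  have DO: "FObj ?D v = rep (fst v)" if "v \<in> Obj ?J" for v
    using that by (simp add: functor_comp_simps elements_proj_def tuple_fun_def Yon_simps(1) elements_Obj)
  have DA: "FArr ?D t = yon (rep (fst w)) (fst v) (fst t)" if t: "t \<in> hom ?J v w" for t v w
  proof -
    have "fst t \<in> hom W (fst w) (fst v)" using t by (auto simp: elements_hom)
    then show ?thesis using homD(1)[OF t] by (simp add: functor_comp_simps elements_proj_def tuple_fun_def Yon_simps(2))
  qed
  have v: "fst v \<in> Obj W" "snd v \<in> FObj P (fst v)" if "v \<in> Obj ?J" for v using that by (simp_all add: elements_Obj)
  have co: "is_cocone ?J \<A> ?D P (\<lambda>v. yon P (fst v) (snd v))"
  proof (rule is_coconeI[OF D])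
    show "yon P (fst v) (snd v) \<in> hom \<A> (FObj ?D v) P" if "v \<in> Obj ?J" for v
      using yon_hom[OF P v[OF that]] DO[OF that] by simp
    fix t v' w assume t: "t \<in> hom ?J v' w"
    obtain f where f: "f \<in> hom W (fst w) (fst v')" "snd w \<in> FObj P (fst w)" "snd v' = app (FArr P f) (snd w)" "fst t = f"
      using t unfolding elements_hom by auto
    note o = hom_Obj[OF W f(1)]
    have n: "is_nat W Set_cat (rep (fst w)) P (yoneda W P (fst w) (snd w))" by (rule yoneda[OF W_cat(2) P o(1) f(2)])
    have "Comp \<A> (yon P (fst w) (snd w)) (yon (rep (fst w)) (fst v') f) = yon P (fst v') (app (yoneda W P (fst w) (snd w) (fst v')) f)"
      unfolding yon_def[of P "fst w"] by (rule yon_Comp[OF n o(2)]) (simp add: hom_functor_Obj o f)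
    then show "Comp \<A> (yon P (fst w) (snd w)) (FArr ?D t) = yon P (fst v') (snd v')"
      by (simp add: DA[OF t] f(3,4) app_yoneda[OF f(1) o(2)])
  qed (use P in simp)
  show ?thesis unfolding is_colimit_def
  proof (intro conjI co allI impI)
    fix M \<nu> assume \<nu>: "is_cocone ?J \<A> ?D M \<nu>"
    have M: "is_functor W Set_cat M" using \<nu> by (simp add: is_cocone_def)
    have \<nu>h: "\<nu> (c, x) \<in> hom \<A> (rep c) M" if "c \<in> Obj W" "x \<in> FObj P c" for c x
      using cocone_hom[OF \<nu>, of "(c, x)"] DO[of "(c, x)"] that by (simp add: elements_Obj)
    define \<tau> where "\<tau> c x = elem c (\<nu> (c, x))" for c x
    have \<tau>: "is_nat W Set_cat P M (set_nat W P \<tau> M)"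
    proof (rule set_nat[OF P M])
      show "\<tau> c x \<in> FObj M c" if "c \<in> Obj W" "x \<in> FObj P c" for c x
        unfolding \<tau>_def by (rule elem_in[OF \<nu>h[OF that] that(1)])
      fix f c d x assume f: "f \<in> hom W c d" and x: "x \<in> FObj P c"
      note o = hom_Obj[OF W f]
      obtain \<alpha> where \<alpha>: "\<nu> (c, x) = (rep c, \<alpha>, M)" "is_nat W Set_cat (rep c) M \<alpha>"
        using \<nu>h[OF o(1) x] by (auto simp: CAT_hom)
      have t: "(f, x) \<in> hom ?J (d, app (FArr P f) x) (c, x)" using f x by (simp add: elements_hom)
      have y: "yon (rep c) d f \<in> hom \<A> (rep d) (rep c)" "elem d (yon (rep c) d f) = f"
        using yon_hom[OF hom_functor[OF W_cat(2) o(1)] o(2)] elem_yon[OF hom_functor[OF W_cat(2) o(1)] o(2)] f o(2)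
        by (simp_all add: hom_functor_Obj)
      have "\<nu> (d, app (FArr P f) x) = Comp \<A> (\<nu> (c, x)) (yon (rep c) d f)"
        using cocone_comm[OF \<nu> t] DA[OF t] by simp
      then have "\<tau> d (app (FArr P f) x) = app (\<alpha> d) f"
        using elem_Comp[OF y(1) \<alpha>(2) o(2)] y(2) by (simp add: \<tau>_def \<alpha>(1))
      also have "\<dots> = app (FArr M f) (\<tau> c x)"
        using yoneda_element[OF W_cat(2) \<alpha>(2) o(1) f] by (simp add: \<tau>_def elem_def \<alpha>(1))
      finally show "\<tau> d (app (FArr P f) x) = app (FArr M f) (\<tau> c x)" .
    qed
    \<comment> \<open>Turns the condition on a mediating arrow at \<open>(c, x)\<close> into an
      equation between elements, from which existence and uniqueness are both immediate.\<close>
    have eqv: "Comp \<A> (P, \<theta>, M) (yon P c x) = \<nu> (c, x) \<longleftrightarrow> app (\<theta> c) x = \<tau> c x"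
      if \<theta>: "is_nat W Set_cat P M \<theta>" and c: "c \<in> Obj W" and x: "x \<in> FObj P c" for \<theta> c x
      using yon_Comp[OF \<theta> c x] elem_yon[OF M c SET_nat_in[OF \<theta> c x]] yon_elem[OF \<nu>h[OF c x] c]
      unfolding \<tau>_def by metis
    show "\<exists>!h. h \<in> hom \<A> P M \<and> (\<forall>v\<in>Obj ?J. Comp \<A> h (yon P (fst v) (snd v)) = \<nu> v)"
    proof (rule ex1I)
      show "(P, set_nat W P \<tau> M, M) \<in> hom \<A> P M \<and>
          (\<forall>v\<in>Obj ?J. Comp \<A> (P, set_nat W P \<tau> M, M) (yon P (fst v) (snd v)) = \<nu> v)"
      proof (intro conjI ballI CAT_homI[OF \<tau>])
        fix v assume "v \<in> Obj ?J"
        from eqv[OF \<tau> v[OF this]] app_set_nat[OF v[OF this], of \<tau> M]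
        show "Comp \<A> (P, set_nat W P \<tau> M, M) (yon P (fst v) (snd v)) = \<nu> v" by simp
      qed
      fix h assume h: "h \<in> hom \<A> P M \<and> (\<forall>v\<in>Obj ?J. Comp \<A> h (yon P (fst v) (snd v)) = \<nu> v)"
      then obtain \<theta> where \<theta>: "h = (P, \<theta>, M)" "is_nat W Set_cat P M \<theta>" by (auto simp: CAT_hom)
      have "\<theta> = set_nat W P \<tau> M"
      proof (rule SET_nat_eqI[OF \<theta>(2) \<tau>])
        fix c x assume cx: "c \<in> Obj W" "x \<in> FObj P c"
        then have "Comp \<A> (P, \<theta>, M) (yon P c x) = \<nu> (c, x)" using bspec[OF conjunct2[OF h], of "(c, x)"] \<theta>(1) by (simp add: elements_Obj)
        then show "app (\<theta> c) x = app (set_nat W P \<tau> M c) x" using eqv[OF \<theta>(2) cx] by (simp add: app_set_nat[OF cx])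
      qed
      then show "h = (P, set_nat W P \<tau> M, M)" by (simp add: \<theta>(1))
    qed
  qed
qed

text \<open>Colimits of sets are covered by their legs. Hence the identity of \<open>P\<close>, an
  element of the colimit \<open>Hom(P, P)\<close>, occurs at some stage \<open>(c, x)\<close>, and
  there it exhibits a section of \<open>yon P c x\<close>.\<close>

lemma preserves_retract_rep:
  assumes P: "P \<in> Obj \<A>" and pres: "preserves_small_colimits TYPE('u) \<A> (SET TYPE('u)) (hom_functor \<A> P)"
  shows "\<exists>c\<in>Obj W. retract \<A> P (rep c)"
proof -
  have P': "is_functor W Set_cat P" using P by simp
  note J = elements_category[OF P'] and sm = elements_small[OF P'] and den = density[OF P']
  let ?D = "functor_comp (elements P) Yon (elements_proj P)"
  obtain J' :: "('u, 'u) category" and F G where J': "small_category J'" "inverse_functors (elements P) J' F G"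
    using small_transport[OF J sm] by blast
  note G = inverse_functors_apply(1)[OF inverse_functors_sym[OF J'(2)]]
  note col = colimit_reindex[OF J'(2) den]
  let ?D' = "functor_comp J' ?D G"
  have D': "is_functor J' \<A> ?D'"
    using col by (simp add: is_colimit_def is_cocone_def)
  have col': "is_colimit J' (SET TYPE('u)) (functor_comp J' (hom_functor \<A> P) ?D') (FObj (hom_functor \<A> P) P)
      (\<lambda>j. FArr (hom_functor \<A> P) (yon P (fst (FObj G j)) (snd (FObj G j))))"
    using pres J'(1) col unfolding preserves_small_colimits_def by blast
  have "Ide \<A> P \<in> FObj (hom_functor \<A> P) P"
    using Ide_hom[OF CAT_category P] P by (simp add: hom_functor_Obj)
  from SET_colimit_surj[OF col' this] obtain j g where j: "j \<in> Obj J'" and g: "g \<in> FObj (functor_comp J' (hom_functor \<A> P) ?D') j"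
    and eq: "Ide \<A> P = app (FArr (hom_functor \<A> P) (yon P (fst (FObj G j)) (snd (FObj G j)))) g"
    by blast
  define c x where "c = fst (FObj G j)" and "x = snd (FObj G j)"
  have v: "FObj G j \<in> Obj (elements P)" by (rule functor_Obj[OF G j])
  then have c: "c \<in> Obj W" "x \<in> FObj P c" by (simp_all add: elements_Obj c_def x_def)
  have "FObj ?D' j = rep c"
    using j v c(1) by (simp add: functor_comp_simps elements_proj_def tuple_fun_def Yon_simps(1) c_def)
  then have g': "g \<in> hom \<A> P (rep c)"
    using g j rep_Obj[OF c(1)] by (simp add: functor_comp_simps(1)[OF j, of "hom_functor \<A> P"] hom_functor_Obj)
  have y: "yon P c x \<in> hom \<A> (rep c) P" by (rule yon_hom[OF P' c])
  have "Comp \<A> (yon P c x) g = Ide \<A> P"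
    using eq app_hom_functor[OF y g'] by (simp add: c_def x_def)
  then show ?thesis using g' y c(1) unfolding retract_def by blast
qed

lemma preserves_iff_retract_rep:
  assumes "P \<in> Obj \<A>"
  shows "preserves_small_colimits TYPE('u) \<A> (SET TYPE('u)) (hom_functor \<A> P) \<longleftrightarrow> (\<exists>c\<in>Obj W. retract \<A> P (rep c))"
  using retract_rep_preserves preserves_retract_rep[OF assms] by blast

end


section \<open>Universal arrows and left Kan extensions\<close>

text \<open>Split each component by choice. Conjugating \<open>P f\<close> by the chosen arrows
  gives the action of \<open>Q\<close>, and naturality of the idempotent makes the pieces
  natural.\<close>

lemma CAT_splits_idempotents:
  assumes split: "splits_idempotents Z"
  shows "splits_idempotents (CAT X Z)"
  unfolding splits_idempotents_def
proof (intro conjI CAT_category allI impI)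
  have Z: "is_category Z" using split by (simp add: splits_idempotents_def)
  fix P e assume "e \<in> hom (CAT X Z) P P" and ee: "Comp (CAT X Z) e e = e"
  then obtain \<epsilon> where e: "e = (P, \<epsilon>, P)" and \<epsilon>: "is_nat X Z P P \<epsilon>" by (auto simp: CAT_hom)
  note P = nat_functors(1)[OF \<epsilon>] and X = nat_functors(3)[OF \<epsilon>]
  have \<epsilon>\<epsilon>: "Comp Z (\<epsilon> a) (\<epsilon> a) = \<epsilon> a" if a: "a \<in> Obj X" for a
  proof -
    have "vcomp X Z \<epsilon> \<epsilon> = \<epsilon>" using ee by (simp add: e)
    then have "vcomp X Z \<epsilon> \<epsilon> a = \<epsilon> a" by simp
    then show ?thesis using a by (simp add: nat_apply)
  qed
  have "\<forall>a\<in>Obj X. \<exists>q s r. s \<in> hom Z q (FObj P a) \<and> r \<in> hom Z (FObj P a) q \<and> Comp Z r s = Ide Z q \<and> Comp Z s r = \<epsilon> a"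
  proof
    fix a assume a: "a \<in> Obj X"
    show "\<exists>q s r. s \<in> hom Z q (FObj P a) \<and> r \<in> hom Z (FObj P a) q \<and> Comp Z r s = Ide Z q \<and> Comp Z s r = \<epsilon> a"
      using split nat_hom[OF \<epsilon> a] \<epsilon>\<epsilon>[OF a] unfolding splits_idempotents_def by blast
  qed
  then obtain q s r where s: "\<And>a. a \<in> Obj X \<Longrightarrow> s a \<in> hom Z (q a) (FObj P a)"
    and r: "\<And>a. a \<in> Obj X \<Longrightarrow> r a \<in> hom Z (FObj P a) (q a)"
    and rs: "\<And>a. a \<in> Obj X \<Longrightarrow> Comp Z (r a) (s a) = Ide Z (q a)"
    and sr: "\<And>a. a \<in> Obj X \<Longrightarrow> Comp Z (s a) (r a) = \<epsilon> a" by metis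
  define Q where "Q = \<lparr>FObj = restrict q (Obj X), FArr = (\<lambda>f\<in>Arr X. Comp Z (r (Cod X f)) (Comp Z (FArr P f) (s (Dom X f))))\<rparr>"
  have QO: "FObj Q a = q a" if "a \<in> Obj X" for a using that by (simp add: Q_def)
  have QA: "FArr Q f = Comp Z (r b) (Comp Z (FArr P f) (s a))" if "f \<in> hom X a b" for f a b
    using homD[OF that] by (simp add: Q_def)
  have sQ: "Comp Z (s b) (FArr Q f) = Comp Z (FArr P f) (s a)" if f: "f \<in> hom X a b" for f a b
  proof -
    note ab = hom_Obj[OF X f] and Pf = functor_hom[OF P f]
    have "Comp Z (s b) (FArr Q f) = Comp Z (Comp Z (s b) (r b)) (Comp Z (FArr P f) (s a))"
      using Comp_assoc[OF Z Comp_hom[OF Z s[OF ab(1)] Pf] r[OF ab(2)] s[OF ab(2)]] by (simp add: QA[OF f])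
    also have "\<dots> = Comp Z (Comp Z (\<epsilon> b) (FArr P f)) (s a)"
      using Comp_assoc[OF Z s[OF ab(1)] Pf nat_hom[OF \<epsilon> ab(2)]] sr[OF ab(2)] by simp
    also have "\<dots> = Comp Z (FArr P f) (Comp Z (Comp Z (s a) (r a)) (s a))"
      using Comp_assoc[OF Z s[OF ab(1)] nat_hom[OF \<epsilon> ab(1)] Pf] nat_comm[OF \<epsilon> f] sr[OF ab(1)] by simp
    also have "\<dots> = Comp Z (FArr P f) (s a)"
      using section_cancel'[OF Z s[OF ab(1)] r[OF ab(1)] rs[OF ab(1)] s[OF ab(1)]] by simp
    finally show ?thesis .
  qed
  have rP: "Comp Z (r b) (FArr P f) = Comp Z (FArr Q f) (r a)" if f: "f \<in> hom X a b" for f a b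
  proof -
    note ab = hom_Obj[OF X f] and Pf = functor_hom[OF P f]
    have "Comp Z (FArr Q f) (r a) = Comp Z (r b) (Comp Z (FArr P f) (Comp Z (s a) (r a)))"
      using homD[OF Pf] homD[OF s[OF ab(1)]] homD[OF r[OF ab(1)]] homD[OF r[OF ab(2)]]
      by (simp add: QA[OF f] Arr_rules[OF Z])
    also have "\<dots> = Comp Z (r b) (Comp Z (s b) (Comp Z (r b) (FArr P f)))"
      using sr[OF ab(1)] sr[OF ab(2)] nat_comm[OF \<epsilon> f] Comp_assoc[OF Z Pf r[OF ab(2)] s[OF ab(2)]] by simp
    also have "\<dots> = Comp Z (r b) (FArr P f)"
      by (rule section_cancel[OF Z s[OF ab(2)] r[OF ab(2)] rs[OF ab(2)] Comp_hom[OF Z Pf r[OF ab(2)]]])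
    finally show ?thesis by simp
  qed
  have Qh: "FArr Q f \<in> hom Z (q a) (q b)" if f: "f \<in> hom X a b" for f a b
    using Comp_hom[OF Z Comp_hom[OF Z s[OF hom_Obj(1)[OF X f]] functor_hom[OF P f]] r[OF hom_Obj(2)[OF X f]]]
    by (simp add: QA[OF f])
  have Q: "is_functor X Z Q"
  proof (rule is_functorI[OF X Z])
    show "FObj Q a \<in> Obj Z" if "a \<in> Obj X" for a using hom_Obj(1)[OF Z s[OF that]] QO[OF that] by simp
    show "FArr Q f \<in> hom Z (FObj Q a) (FObj Q b)" if "f \<in> hom X a b" for f a b
      using Qh[OF that] QO hom_Obj[OF X that] by simp
    show "FArr Q (Ide X a) = Ide Z (FObj Q a)" if a: "a \<in> Obj X" for a
      using QA[OF Ide_hom[OF X a]] functor_Ide[OF P a] Comp_Ide_left[OF Z s[OF a]] rs[OF a] QO[OF a] by simp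
    fix f g a b c assume f: "f \<in> hom X a b" and g: "g \<in> hom X b c"
    have abc: "a \<in> Obj X" "b \<in> Obj X" "c \<in> Obj X" using hom_Obj[OF X f] hom_Obj[OF X g] by auto
    note Pf = functor_hom[OF P f] and Pg = functor_hom[OF P g]
    have "FArr Q (Comp X g f) = Comp Z (r c) (Comp Z (FArr P g) (Comp Z (FArr P f) (s a)))"
      using QA[OF Comp_hom[OF X f g]] functor_Comp[OF P f g] Comp_assoc[OF Z s[OF abc(1)] Pf Pg] by simp
    also have "\<dots> = Comp Z (r c) (Comp Z (FArr P g) (Comp Z (s b) (FArr Q f)))" using sQ[OF f] by simp
    also have "\<dots> = Comp Z (FArr Q g) (FArr Q f)"
      using homD[OF Pg] homD[OF s[OF abc(2)]] homD[OF r[OF abc(3)]] homD[OF Qh[OF f]]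
      by (simp add: QA[OF g] Arr_rules[OF Z])
    finally show "FArr Q (Comp X g f) = Comp Z (FArr Q g) (FArr Q f)" .
  qed (auto simp: Q_def)
  have \<sigma>: "is_nat X Z Q P (restrict s (Obj X))"
    by (rule is_natI[OF Q P]) (use s sQ hom_Obj[OF X] in \<open>auto simp: QO\<close>)
  have \<rho>: "is_nat X Z P Q (restrict r (Obj X))"
    by (rule is_natI[OF P Q]) (use r rP hom_Obj[OF X] in \<open>auto simp: QO\<close>)
  have 1: "vcomp X Z (restrict r (Obj X)) (restrict s (Obj X)) = nat_id X Z Q"
    by (rule nat_eqI[OF vcomp_nat[OF \<sigma> \<rho>] nat_id[OF Q]]) (simp add: nat_apply rs QO)
  have 2: "vcomp X Z (restrict s (Obj X)) (restrict r (Obj X)) = \<epsilon>"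
    by (rule nat_eqI[OF vcomp_nat[OF \<rho> \<sigma>] \<epsilon>]) (simp add: nat_apply sr)
  show "\<exists>b. \<exists>s\<in>hom (CAT X Z) b P. \<exists>r\<in>hom (CAT X Z) P b. Comp (CAT X Z) r s = Ide (CAT X Z) b \<and> Comp (CAT X Z) s r = e"
    using CAT_homI[OF \<sigma>] CAT_homI[OF \<rho>] 1 2 e
    by (intro exI[of _ Q] bexI[of _ "(Q, restrict s (Obj X), P)"] bexI[of _ "(P, restrict r (Obj X), Q)"]) simp_all
qed

text \<open>Kan extension along \<open>T\<close> is the case where \<open>U\<close> is restriction
  along \<open>T\<close>. In this abstract form retracts can be treated without any formula for Kan
  extensions.\<close>

definition universal_arrow where
  "universal_arrow A' A U P Q \<eta> \<longleftrightarrow> Q \<in> Obj A' \<and> \<eta> \<in> hom A P (FObj U Q) \<and>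
     (\<forall>R\<in>Obj A'. \<forall>\<gamma>\<in>hom A P (FObj U R). \<exists>!\<beta>. \<beta> \<in> hom A' Q R \<and> Comp A (FArr U \<beta>) \<eta> = \<gamma>)"

lemma universal_arrow_hom: "universal_arrow A' A U P Q \<eta> \<Longrightarrow> \<eta> \<in> hom A P (FObj U Q)"
  by (simp add: universal_arrow_def)

lemma universal_arrow_ex1:
  "universal_arrow A' A U P Q \<eta> \<Longrightarrow> R \<in> Obj A' \<Longrightarrow> \<gamma> \<in> hom A P (FObj U R) \<Longrightarrow>
     \<exists>!\<beta>. \<beta> \<in> hom A' Q R \<and> Comp A (FArr U \<beta>) \<eta> = \<gamma>"
  unfolding universal_arrow_def by blast

lemma universal_arrow_eqI:
  assumes U: "is_functor A' A U" and un: "universal_arrow A' A U P Q \<eta>"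
    and \<beta>: "\<beta> \<in> hom A' Q R" "\<beta>' \<in> hom A' Q R" and eq: "Comp A (FArr U \<beta>) \<eta> = Comp A (FArr U \<beta>') \<eta>"
  shows "\<beta> = \<beta>'"
proof -
  have "\<exists>!k. k \<in> hom A' Q R \<and> Comp A (FArr U k) \<eta> = Comp A (FArr U \<beta>') \<eta>"
    by (rule universal_arrow_ex1[OF un hom_Obj(2)[OF functor_cats(1)[OF U] \<beta>(1)]
          Comp_hom[OF functor_cats(2)[OF U] universal_arrow_hom[OF un] functor_hom[OF U \<beta>(2)]]])
  then show ?thesis using \<beta> eq by blast
qed

lemma universal_arrow_iso:
  assumes U: "is_functor A' A U" and un: "universal_arrow A' A U P Q \<eta>" and un': "universal_arrow A' A U P Q' \<eta>'"
  shows "\<exists>\<theta>\<in>hom A' Q Q'. is_iso A' \<theta> \<and> Comp A (FArr U \<theta>) \<eta> = \<eta>'"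
proof -
  note A' = functor_cats(1)[OF U] and A = functor_cats(2)[OF U]
  have Q: "Q \<in> Obj A'" "Q' \<in> Obj A'" using un un' by (simp_all add: universal_arrow_def)
  obtain \<theta> where \<theta>: "\<theta> \<in> hom A' Q Q'" "Comp A (FArr U \<theta>) \<eta> = \<eta>'"
    using universal_arrow_ex1[OF un Q(2) universal_arrow_hom[OF un']] by blast
  obtain \<theta>' where \<theta>': "\<theta>' \<in> hom A' Q' Q" "Comp A (FArr U \<theta>') \<eta>' = \<eta>"
    using universal_arrow_ex1[OF un' Q(1) universal_arrow_hom[OF un]] by blast
  note \<eta> = universal_arrow_hom[OF un] and \<eta>' = universal_arrow_hom[OF un']
  have "Comp A' \<theta>' \<theta> = Ide A' Q"
    by (rule universal_arrow_eqI[OF U un Comp_hom[OF A' \<theta>(1) \<theta>'(1)] Ide_hom[OF A' Q(1)]])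
      (simp add: functor_Comp[OF U \<theta>(1) \<theta>'(1)] functor_Ide[OF U Q(1)] Comp_Ide_left[OF A \<eta>]
        Comp_assoc[OF A \<eta> functor_hom[OF U \<theta>(1)] functor_hom[OF U \<theta>'(1)]] \<theta>(2) \<theta>'(2))
  moreover have "Comp A' \<theta> \<theta>' = Ide A' Q'"
    by (rule universal_arrow_eqI[OF U un' Comp_hom[OF A' \<theta>'(1) \<theta>(1)] Ide_hom[OF A' Q(2)]])
      (simp add: functor_Comp[OF U \<theta>'(1) \<theta>(1)] functor_Ide[OF U Q(2)] Comp_Ide_left[OF A \<eta>']
        Comp_assoc[OF A \<eta>' functor_hom[OF U \<theta>'(1)] functor_hom[OF U \<theta>(1)]] \<theta>(2) \<theta>'(2))
  ultimately show ?thesis using \<theta> isoI[OF \<theta>(1) \<theta>'(1)] by blast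
qed

text \<open>The idempotent \<open>s r\<close> on \<open>P\<close> induces an idempotent
  \<open>e\<close> on \<open>Q\<close> by universality, and a splitting of \<open>e\<close> carries
  the universal arrow for \<open>P'\<close>. This produces Kan extensions of retracts of
  representables from those of representables.\<close>

lemma universal_arrow_retract:
  assumes U: "is_functor A' A U" and split: "splits_idempotents A'"
    and un: "universal_arrow A' A U P Q \<eta>" and ret: "retract A P' P"
  shows "\<exists>Q' \<eta>'. universal_arrow A' A U P' Q' \<eta>'"
proof -
  note A' = functor_cats(1)[OF U] and A = functor_cats(2)[OF U] and \<eta> = universal_arrow_hom[OF un]
  have Q: "Q \<in> Obj A'" using un by (simp add: universal_arrow_def)
  obtain s r where s: "s \<in> hom A P' P" and r: "r \<in> hom A P P'" and rs: "Comp A r s = Ide A P'"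
    using ret unfolding retract_def by blast
  note sr = Comp_hom[OF A r s]
  have srs: "Comp A (Comp A s r) s = s" by (rule section_cancel'[OF A s r rs s])
  have srsr: "Comp A (Comp A s r) (Comp A s r) = Comp A s r"
    using Comp_assoc[OF A r s sr] srs by simp
  \<comment> \<open>\<open>e\<close> is the unique arrow with \<open>U e\<close> after
    \<open>\<eta>\<close> equal to \<open>\<eta>\<close> after \<open>s r\<close>; its idempotence
    is inherited through uniqueness.\<close>
  obtain e where e: "e \<in> hom A' Q Q" "Comp A (FArr U e) \<eta> = Comp A \<eta> (Comp A s r)"
    using universal_arrow_ex1[OF un Q Comp_hom[OF A sr \<eta>]] by blast
  note Ue = functor_hom[OF U e(1)]
  have "Comp A' e e = e"
  proof (rule universal_arrow_eqI[OF U un Comp_hom[OF A' e(1) e(1)] e(1)])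
    have "Comp A (FArr U (Comp A' e e)) \<eta> = Comp A (FArr U e) (Comp A \<eta> (Comp A s r))"
      using functor_Comp[OF U e(1) e(1)] Comp_assoc[OF A \<eta> Ue Ue] e(2) by simp
    also have "\<dots> = Comp A (Comp A \<eta> (Comp A s r)) (Comp A s r)"
      using Comp_assoc[OF A sr \<eta> Ue] e(2) by simp
    also have "\<dots> = Comp A (FArr U e) \<eta>" using Comp_assoc[OF A sr sr \<eta>] srsr e(2) by simp
    finally show "Comp A (FArr U (Comp A' e e)) \<eta> = Comp A (FArr U e) \<eta>" .
  qed
  then obtain Q' \<sigma> \<rho> where \<sigma>: "\<sigma> \<in> hom A' Q' Q" and \<rho>: "\<rho> \<in> hom A' Q Q'"
    and \<rho>\<sigma>: "Comp A' \<rho> \<sigma> = Ide A' Q'" and \<sigma>\<rho>: "Comp A' \<sigma> \<rho> = e"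
    using split e(1) unfolding splits_idempotents_def by blast
  have Q': "Q' \<in> Obj A'" by (rule hom_Obj(1)[OF A' \<sigma>])
  note U\<sigma> = functor_hom[OF U \<sigma>] and U\<rho> = functor_hom[OF U \<rho>]
  define \<eta>' where "\<eta>' = Comp A (FArr U \<rho>) (Comp A \<eta> s)"
  have \<eta>': "\<eta>' \<in> hom A P' (FObj U Q')" unfolding \<eta>'_def by (rule Comp_hom[OF A Comp_hom[OF A s \<eta>] U\<rho>])
  have k1: "Comp A (FArr U \<rho>) \<eta> = Comp A \<eta>' r"
  proof -
    have "Comp A' \<rho> e = \<rho>"
      using Comp_assoc[OF A' \<rho> \<sigma> \<rho>] \<rho>\<sigma> Comp_Ide_left[OF A' \<rho>] by (simp add: \<sigma>\<rho>)
    then have "Comp A (FArr U \<rho>) \<eta> = Comp A (FArr U \<rho>) (Comp A (FArr U e) \<eta>)"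
      using functor_Comp[OF U e(1) \<rho>] Comp_assoc[OF A \<eta> Ue U\<rho>] by simp
    also have "\<dots> = Comp A \<eta>' r"
      using homD[OF U\<rho>] homD[OF \<eta>] homD[OF s] homD[OF r] by (simp add: e(2) \<eta>'_def Arr_rules[OF A])
    finally show ?thesis .
  qed
  have k2: "Comp A (FArr U \<sigma>) \<eta>' = Comp A \<eta> s"
  proof -
    have "Comp A (FArr U \<sigma>) \<eta>' = Comp A (FArr U e) (Comp A \<eta> s)"
      using Comp_assoc[OF A Comp_hom[OF A s \<eta>] U\<rho> U\<sigma>] functor_Comp[OF U \<rho> \<sigma>] \<sigma>\<rho> by (simp add: \<eta>'_def)
    also have "\<dots> = Comp A \<eta> (Comp A (Comp A s r) s)"
      using Comp_assoc[OF A s \<eta> Ue] Comp_assoc[OF A s sr \<eta>] e(2) by simp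
    finally show ?thesis using srs by simp
  qed
  have "universal_arrow A' A U P' Q' \<eta>'"
    unfolding universal_arrow_def
  proof (intro conjI Q' \<eta>' ballI)
    fix R \<gamma> assume R: "R \<in> Obj A'" and \<gamma>: "\<gamma> \<in> hom A P' (FObj U R)"
    note \<gamma>r = Comp_hom[OF A r \<gamma>]
    obtain \<beta>0 where \<beta>0: "\<beta>0 \<in> hom A' Q R" "Comp A (FArr U \<beta>0) \<eta> = Comp A \<gamma> r"
      using universal_arrow_ex1[OF un R \<gamma>r] by blast
    show "\<exists>!\<beta>. \<beta> \<in> hom A' Q' R \<and> Comp A (FArr U \<beta>) \<eta>' = \<gamma>"
    proof (intro ex1I conjI)
      show "Comp A' \<beta>0 \<sigma> \<in> hom A' Q' R" by (rule Comp_hom[OF A' \<sigma> \<beta>0(1)])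
      show "Comp A (FArr U (Comp A' \<beta>0 \<sigma>)) \<eta>' = \<gamma>"
        using functor_Comp[OF U \<sigma> \<beta>0(1)] Comp_assoc[OF A \<eta>' U\<sigma> functor_hom[OF U \<beta>0(1)]] k2
          Comp_assoc[OF A s \<eta> functor_hom[OF U \<beta>0(1)]] \<beta>0(2) section_cancel'[OF A s r rs \<gamma>] by simp
      fix \<beta> assume "\<beta> \<in> hom A' Q' R \<and> Comp A (FArr U \<beta>) \<eta>' = \<gamma>"
      then have \<beta>: "\<beta> \<in> hom A' Q' R" "Comp A (FArr U \<beta>) \<eta>' = \<gamma>" by auto
      have "Comp A' \<beta> \<rho> = \<beta>0"
      proof (rule universal_arrow_eqI[OF U un Comp_hom[OF A' \<rho> \<beta>(1)] \<beta>0(1)])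
        show "Comp A (FArr U (Comp A' \<beta> \<rho>)) \<eta> = Comp A (FArr U \<beta>0) \<eta>"
          using functor_Comp[OF U \<rho> \<beta>(1)] Comp_assoc[OF A \<eta> U\<rho> functor_hom[OF U \<beta>(1)]] k1
            Comp_assoc[OF A r \<eta>' functor_hom[OF U \<beta>(1)]] \<beta>(2) \<beta>0(2) by simp
      qed
      then show "\<beta> = Comp A' \<beta>0 \<sigma>" using section_cancel'[OF A' \<sigma> \<rho> \<rho>\<sigma> \<beta>(1)] by simp
    qed
  qed
  then show ?thesis by blast
qed

section \<open>Left Kan extensions as universal arrows\<close>

lemma is_lan_iff:
  assumes T: "is_functor X Y T"
  shows "is_lan X Y Z T P Q \<eta> \<longleftrightarrow>
    universal_arrow (CAT Y Z) (CAT X Z) (precomp X Y T Z) P Q (P, \<eta>, functor_comp X Q T)"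
proof -
  have eq: "(\<exists>!\<beta>. is_nat Y Z Q R \<beta> \<and> vcomp X Z (whisker_pre X \<beta> T) \<eta> = \<gamma>) \<longleftrightarrow>
      (\<exists>!t. t \<in> hom (CAT Y Z) Q R \<and>
        Comp (CAT X Z) (FArr (precomp X Y T Z) t) (P, \<eta>, functor_comp X Q T) = (P, \<gamma>, functor_comp X R T))" for R \<gamma>
  proof -
    have k: "Comp (CAT X Z) (FArr (precomp X Y T Z) (Q, \<beta>, R)) (P, \<eta>, functor_comp X Q T) = (P, \<gamma>, functor_comp X R T)
        \<longleftrightarrow> vcomp X Z (whisker_pre X \<beta> T) \<eta> = \<gamma>" if "is_nat Y Z Q R \<beta>" for \<beta>
      using that by (simp add: precomp_Arr)
    show ?thesis
    proof
      assume "\<exists>!\<beta>. is_nat Y Z Q R \<beta> \<and> vcomp X Z (whisker_pre X \<beta> T) \<eta> = \<gamma>"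
      then obtain \<beta> where \<beta>: "is_nat Y Z Q R \<beta>" "vcomp X Z (whisker_pre X \<beta> T) \<eta> = \<gamma>"
        and un: "\<And>\<beta>'. is_nat Y Z Q R \<beta>' \<Longrightarrow> vcomp X Z (whisker_pre X \<beta>' T) \<eta> = \<gamma> \<Longrightarrow> \<beta>' = \<beta>" by blast
      show "\<exists>!t. t \<in> hom (CAT Y Z) Q R \<and>
        Comp (CAT X Z) (FArr (precomp X Y T Z) t) (P, \<eta>, functor_comp X Q T) = (P, \<gamma>, functor_comp X R T)"
      proof (rule ex1I[of _ "(Q, \<beta>, R)"])
        show "(Q, \<beta>, R) \<in> hom (CAT Y Z) Q R \<and> Comp (CAT X Z) (FArr (precomp X Y T Z) (Q, \<beta>, R))
            (P, \<eta>, functor_comp X Q T) = (P, \<gamma>, functor_comp X R T)"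
          using CAT_homI[OF \<beta>(1)] k[OF \<beta>(1)] \<beta>(2) by blast
        fix t assume t: "t \<in> hom (CAT Y Z) Q R \<and>
          Comp (CAT X Z) (FArr (precomp X Y T Z) t) (P, \<eta>, functor_comp X Q T) = (P, \<gamma>, functor_comp X R T)"
        obtain \<beta>' where \<beta>': "t = (Q, \<beta>', R)" "is_nat Y Z Q R \<beta>'" using conjunct1[OF t] by (auto simp: CAT_hom)
        have "\<beta>' = \<beta>" by (rule un[OF \<beta>'(2)]) (use k[OF \<beta>'(2)] conjunct2[OF t] \<beta>'(1) in blast)
        then show "t = (Q, \<beta>, R)" by (simp add: \<beta>'(1))
      qed
    next
      assume "\<exists>!t. t \<in> hom (CAT Y Z) Q R \<and>
        Comp (CAT X Z) (FArr (precomp X Y T Z) t) (P, \<eta>, functor_comp X Q T) = (P, \<gamma>, functor_comp X R T)"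
      then obtain t where t: "t \<in> hom (CAT Y Z) Q R"
          "Comp (CAT X Z) (FArr (precomp X Y T Z) t) (P, \<eta>, functor_comp X Q T) = (P, \<gamma>, functor_comp X R T)"
        and un: "\<And>t'. t' \<in> hom (CAT Y Z) Q R \<Longrightarrow>
          Comp (CAT X Z) (FArr (precomp X Y T Z) t') (P, \<eta>, functor_comp X Q T) = (P, \<gamma>, functor_comp X R T) \<Longrightarrow> t' = t" by blast
      obtain \<beta> where \<beta>: "t = (Q, \<beta>, R)" "is_nat Y Z Q R \<beta>" using t(1) by (auto simp: CAT_hom)
      show "\<exists>!\<beta>. is_nat Y Z Q R \<beta> \<and> vcomp X Z (whisker_pre X \<beta> T) \<eta> = \<gamma>"
      proof (rule ex1I[of _ \<beta>])
        show "is_nat Y Z Q R \<beta> \<and> vcomp X Z (whisker_pre X \<beta> T) \<eta> = \<gamma>"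
          using k[OF \<beta>(2)] t(2) \<beta> by blast
        fix \<beta>' assume \<beta>': "is_nat Y Z Q R \<beta>' \<and> vcomp X Z (whisker_pre X \<beta>' T) \<eta> = \<gamma>"
        have "(Q, \<beta>', R) = t"
          by (rule un[OF CAT_homI[OF conjunct1[OF \<beta>']]]) (use k[OF conjunct1[OF \<beta>']] conjunct2[OF \<beta>'] in blast)
        then show "\<beta>' = \<beta>" by (simp add: \<beta>(1))
      qed
    qed
  qed
  \<comment> \<open>A name for the unique existence keeps it closed while the outer quantifiers over
    functors and transformations are matched with those over objects and arrows of
    \<open>CAT\<close>.\<close>
  define \<Phi> where "\<Phi> R g \<longleftrightarrow> (\<exists>!t. t \<in> hom (CAT Y Z) Q R \<and>
      Comp (CAT X Z) (FArr (precomp X Y T Z) t) (P, \<eta>, functor_comp X Q T) = g)" for R g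
  have "(\<forall>R \<gamma>. is_functor Y Z R \<and> is_nat X Z P (functor_comp X R T) \<gamma> \<longrightarrow> \<Phi> R (P, \<gamma>, functor_comp X R T)) \<longleftrightarrow>
      (\<forall>R\<in>Obj (CAT Y Z). \<forall>g\<in>hom (CAT X Z) P (FObj (precomp X Y T Z) R). \<Phi> R g)"
    by (auto simp: CAT_hom precomp_Obj)
  then show ?thesis
    unfolding is_lan_def universal_arrow_def eq \<Phi>_def[symmetric] by (auto simp: CAT_hom precomp_Obj)
qed

text \<open>The left Kan extension of the representable of \<open>c\<close> is the representable of
  \<open>T c\<close>: arrows out of either side into \<open>R\<close>, respectively
  \<open>R T\<close>, are classified by the elements of \<open>R (T c)\<close>.\<close>

lemma rep_universal_arrow:
  fixes W V :: "('u, 'u) category"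
  assumes u: "universe TYPE('u)" and Ws: "small_category W" and Vs: "small_category V"
    and T: "is_functor W V T" and c: "c \<in> Obj W"
  shows "universal_arrow (CAT V Set_cat) (CAT W Set_cat) (precomp W V T Set_cat) (hom_functor W c)
    (hom_functor V (FObj T c)) (yon W (functor_comp W (hom_functor V (FObj T c)) T) c (Ide V (FObj T c)))"
    (is "universal_arrow ?A' ?A ?U ?P ?Q ?\<eta>")
proof -
  have V: "is_category V" using Vs by (simp add: small_category_def)
  note Tc = functor_Obj[OF T c]
  have Q: "is_functor V Set_cat ?Q" by (rule hom_functor[OF small_locally_small[OF Vs] Tc])
  note QT = functor_comp[OF T Q]
  have x: "Ide V (FObj T c) \<in> FObj (functor_comp W ?Q T) c"
    using c Tc Ide_hom[OF V Tc] by (simp add: functor_comp_simps hom_functor_Obj)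
  have \<eta>: "?\<eta> \<in> hom ?A ?P (functor_comp W ?Q T)" by (rule yon_hom[OF u Ws QT c x])
  \<comment> \<open>Transposing along the unit does not change the classifying element. The
    universal property thereby reduces to the Yoneda bijection on both sides.\<close>
  have key: "elem W c (Comp ?A (FArr ?U \<beta>) ?\<eta>) = elem V (FObj T c) \<beta>" if \<beta>: "\<beta> \<in> hom ?A' ?Q R" for \<beta> R
  proof -
    obtain b where b: "\<beta> = (?Q, b, R)" "is_nat V Set_cat ?Q R b" using \<beta> by (auto simp: CAT_hom)
    show ?thesis
      using elem_Comp[OF u Ws \<eta> whisker_pre_nat[OF T b(2)] c] elem_yon[OF u Ws QT c x] c
      by (simp add: b(1) precomp_Arr[OF b(2)] nat_apply) (simp add: elem_def[OF u Vs])
  qed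
  show ?thesis unfolding universal_arrow_def
  proof (intro conjI ballI)
    show "?Q \<in> Obj ?A'" using Q by simp
    show "?\<eta> \<in> hom ?A ?P (FObj ?U ?Q)" using \<eta> by (simp add: precomp_Obj[OF Q])
    fix R \<gamma> assume R0: "R \<in> Obj ?A'" and "\<gamma> \<in> hom ?A ?P (FObj ?U R)"
    then have R: "is_functor V Set_cat R" and \<gamma>: "\<gamma> \<in> hom ?A ?P (functor_comp W R T)" by (simp_all add: precomp_Obj)
    have el: "elem W c \<gamma> \<in> FObj R (FObj T c)" using elem_in[OF u Ws \<gamma> c] c by (simp add: functor_comp_simps)
    note U = precomp_functor[OF T, of Set_cat]
    have eqv: "Comp ?A (FArr ?U \<beta>) ?\<eta> = \<gamma> \<longleftrightarrow> elem V (FObj T c) \<beta> = elem W c \<gamma>" if \<beta>: "\<beta> \<in> hom ?A' ?Q R" for \<beta>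
    proof
      have h: "Comp ?A (FArr ?U \<beta>) ?\<eta> \<in> hom ?A ?P (functor_comp W R T)"
        using Comp_hom[OF CAT_category \<eta>, of "FArr ?U \<beta>"] functor_hom[OF U \<beta>] by (simp add: precomp_Obj R Q)
      show "elem V (FObj T c) \<beta> = elem W c \<gamma> \<Longrightarrow> Comp ?A (FArr ?U \<beta>) ?\<eta> = \<gamma>"
        by (rule elem_inj[OF u Ws h \<gamma> c]) (simp add: key[OF \<beta>])
    qed (use key[OF \<beta>] in simp)
    show "\<exists>!\<beta>. \<beta> \<in> hom ?A' ?Q R \<and> Comp ?A (FArr ?U \<beta>) ?\<eta> = \<gamma>"
    proof (intro ex1I conjI)
      show y: "yon V R (FObj T c) (elem W c \<gamma>) \<in> hom ?A' ?Q R" by (rule yon_hom[OF u Vs R Tc el])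
      show "Comp ?A (FArr ?U (yon V R (FObj T c) (elem W c \<gamma>))) ?\<eta> = \<gamma>"
        using elem_yon[OF u Vs R Tc el] by (simp add: eqv[OF y])
      fix \<beta> assume \<beta>: "\<beta> \<in> hom ?A' ?Q R \<and> Comp ?A (FArr ?U \<beta>) ?\<eta> = \<gamma>"
      show "\<beta> = yon V R (FObj T c) (elem W c \<gamma>)"
        by (rule elem_inj[OF u Vs conjunct1[OF \<beta>] y Tc])
          (use conjunct2[OF \<beta>] eqv[OF conjunct1[OF \<beta>]] elem_yon[OF u Vs R Tc el] in simp)
    qed
  qed
qed


section \<open>The functor between Cauchy completions\<close>

text \<open>Allows the selecting predicate of \<open>Cauchy\<close> to be replaced by the object set
  of the result, so that general facts on full subcategories apply to it.\<close>

lemma full_subcat_Obj: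
  assumes "is_category A"
  shows "full_subcat A (Obj (full_subcat A S)) = full_subcat A S"
proof -
  have "{f \<in> Arr A. Dom A f \<in> Obj A \<inter> S \<and> Cod A f \<in> Obj A \<inter> S} = {f \<in> Arr A. Dom A f \<in> S \<and> Cod A f \<in> S}"
    using assms by (auto simp: is_category_def)
  then show ?thesis by (simp add: full_subcat_def)
qed

lemma retract_full_subcat:
  assumes "a \<in> S" "b \<in> S"
  shows "retract (full_subcat C S) a b \<longleftrightarrow> retract C a b"
  using assms by (simp add: retract_def full_subcat_hom Bex_def)

lemma ff_into_full_subcat:
  assumes F: "fully_faithful X Z F" and S: "\<And>a. a \<in> Obj X \<Longrightarrow> FObj F a \<in> S"
  shows "fully_faithful X (full_subcat Z S) F"
proof (rule fully_faithfulI[OF functor_into_full_subcat[OF ff_functor[OF F] S]])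
  show "f = g" if "f \<in> hom X a b" "g \<in> hom X a b" "FArr F f = FArr F g" for f g a b
    by (rule ff_faithful[OF F that])
  show "\<exists>f\<in>hom X a b. FArr F f = h" if "a \<in> Obj X" "b \<in> Obj X" "h \<in> hom (full_subcat Z S) (FObj F a) (FObj F b)" for a b h
    using ff_full[OF F that(1,2), of h] that(3) by (auto simp: full_subcat_hom)
qed

lemma splits_idempotents_full_subcat:
  assumes C: "splits_idempotents C" and S: "\<And>a b. b \<in> Obj C \<Longrightarrow> b \<in> S \<Longrightarrow> retract C a b \<Longrightarrow> a \<in> S"
  shows "splits_idempotents (full_subcat C S)"
  unfolding splits_idempotents_def
proof (intro conjI allI impI)
  have C': "is_category C" using C by (simp add: splits_idempotents_def)
  then show "is_category (full_subcat C S)" by (rule full_subcat_category)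
  fix a e assume "e \<in> hom (full_subcat C S) a a" and "Comp (full_subcat C S) e e = e"
  then have e: "e \<in> hom C a a" "Comp C e e = e" and a: "a \<in> S" by (simp_all add: full_subcat_hom)
  then obtain b s r where b: "s \<in> hom C b a" "r \<in> hom C a b" "Comp C r s = Ide C b" "Comp C s r = e"
    using C unfolding splits_idempotents_def by blast
  then have "b \<in> S" using S[OF hom_Obj(1)[OF C' e(1)] a] unfolding retract_def by blast
  then show "\<exists>b. \<exists>s\<in>hom (full_subcat C S) b a. \<exists>r\<in>hom (full_subcat C S) a b.
      Comp (full_subcat C S) r s = Ide (full_subcat C S) b \<and> Comp (full_subcat C S) s r = e"
    using b a by (intro exI[of _ b] bexI[of _ s] bexI[of _ r]) (simp_all add: full_subcat_hom)
qed

text \<open>If \<open>b\<close> is a retract of \<open>F a\<close>, its idempotent lifts to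
  \<open>a\<close> and splits there through some \<open>c\<close>. Then \<open>F c\<close> and
  \<open>b\<close> split the same idempotent of \<open>Y\<close> and are isomorphic.\<close>

lemma splits_ess_surj:
  assumes F: "fully_faithful X Y F" and split: "splits_idempotents X"
    and ret: "\<And>b. b \<in> Obj Y \<Longrightarrow> \<exists>a\<in>Obj X. retract Y b (FObj F a)"
  shows "ess_surj X Y F"
proof (rule ess_surjI[OF ff_functor[OF F]])
  note F' = ff_functor[OF F]
  note X = functor_cats(1)[OF F'] and Y = functor_cats(2)[OF F']
  fix b assume "b \<in> Obj Y"
  then obtain a s r where a: "a \<in> Obj X" and s: "s \<in> hom Y b (FObj F a)" and r: "r \<in> hom Y (FObj F a) b"
    and rs: "Comp Y r s = Ide Y b" using ret unfolding retract_def by blast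
  obtain e where e: "e \<in> hom X a a" "FArr F e = Comp Y s r" using ff_full[OF F a a Comp_hom[OF Y r s]] by blast
  have "Comp Y (Comp Y s r) (Comp Y s r) = Comp Y s r"
    using Comp_assoc[OF Y r s Comp_hom[OF Y r s]] section_cancel'[OF Y s r rs s] by simp
  then have "Comp X e e = e"
    using ff_faithful[OF F Comp_hom[OF X e(1) e(1)] e(1)] functor_Comp[OF F' e(1) e(1)] e(2) by simp
  then obtain c s' r' where s': "s' \<in> hom X c a" and r': "r' \<in> hom X a c" and rs': "Comp X r' s' = Ide X c"
    and sr': "Comp X s' r' = e" using split e(1) unfolding splits_idempotents_def by blast
  have c: "c \<in> Obj X" by (rule hom_Obj(1)[OF X s'])
  note Fs = functor_hom[OF F' s'] and Fr = functor_hom[OF F' r']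
  have Fsr: "Comp Y (FArr F s') (FArr F r') = Comp Y s r" using functor_Comp[OF F' r' s'] sr' e(2) by simp
  have Frs: "Comp Y (FArr F r') (FArr F s') = Ide Y (FObj F c)"
    using functor_Comp[OF F' s' r'] rs' functor_Ide[OF F' c] by simp
  have "is_iso Y (Comp Y r (FArr F s'))"
  proof (rule isoI[OF Comp_hom[OF Y Fs r] Comp_hom[OF Y s Fr]])
    have "Comp Y (Comp Y (FArr F r') s) (Comp Y r (FArr F s')) = Comp Y (FArr F r') (Comp Y (Comp Y s r) (FArr F s'))"
      using homD[OF Fs] homD[OF Fr] homD[OF s] homD[OF r] by (simp add: Arr_rules[OF Y])
    also have "\<dots> = Comp Y (FArr F r') (FArr F s')"
      using section_cancel'[OF Y Fs Fr Frs Fs] by (simp flip: Fsr)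
    finally show "Comp Y (Comp Y (FArr F r') s) (Comp Y r (FArr F s')) = Ide Y (FObj F c)" using Frs by simp
    have "Comp Y (Comp Y r (FArr F s')) (Comp Y (FArr F r') s) = Comp Y r (Comp Y (Comp Y (FArr F s') (FArr F r')) s)"
      using homD[OF Fs] homD[OF Fr] homD[OF s] homD[OF r] by (simp add: Arr_rules[OF Y])
    then show "Comp Y (Comp Y r (FArr F s')) (Comp Y (FArr F r') s) = Ide Y b"
      using section_cancel'[OF Y s r rs s] rs by (simp add: Fsr)
  qed
  then show "\<exists>a\<in>Obj X. \<exists>f\<in>hom Y (FObj F a) b. is_iso Y f" using c Comp_hom[OF Y Fs r] by blast
qed

lemma op_cat_op_cat: "op_cat (op_cat C) = C"
  by (cases C) (simp add: op_cat_def)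

lemma op_cat_small: "small_category C \<Longrightarrow> small_category (op_cat C)"
  by (simp add: small_category_def op_cat_category)

section \<open>The Cauchy completion of a small category\<close>

context
  fixes X :: "('u, 'u) category"
  assumes u: "universe TYPE('u)" and Xs: "small_category X"
begin

lemma PSh_category: "is_category (PSh X)"
  by (simp add: PSh_def CAT_category)

text \<open>The working description of the completion. \<open>op_cat X\<close> enters because
  presheaves on \<open>X\<close> are treated as covariant functors on its opposite.\<close>

lemma Cauchy_Obj:
  "P \<in> Obj (Cauchy X) \<longleftrightarrow> P \<in> Obj (PSh X) \<and> (\<exists>c\<in>Obj X. retract (PSh X) P (hom_functor (op_cat X) c))"
  using preserves_iff_retract_rep[OF u op_cat_small[OF Xs], of P] unfolding Cauchy_def PSh_def by auto

lemma Cauchy_hom: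
  "t \<in> hom (Cauchy X) P Q \<longleftrightarrow> t \<in> hom (PSh X) P Q \<and> P \<in> Obj (Cauchy X) \<and> Q \<in> Obj (Cauchy X)"
  using hom_Obj[OF PSh_category, of t P Q] unfolding Cauchy_def full_subcat_hom full_subcat_simps by blast

lemma Cauchy_simps: "Ide (Cauchy X) = Ide (PSh X)" "Comp (Cauchy X) = Comp (PSh X)"
  by (simp_all add: Cauchy_def)

lemma Cauchy_category: "is_category (Cauchy X)"
  unfolding Cauchy_def by (rule full_subcat_category[OF PSh_category])

lemma Cauchy_full_subcat: "Cauchy X = full_subcat (PSh X) (Obj (Cauchy X))"
  unfolding Cauchy_def by (rule full_subcat_Obj[OF PSh_category, symmetric])

lemma rep_Cauchy:
  assumes c: "c \<in> Obj X"
  shows "hom_functor (op_cat X) c \<in> Obj (Cauchy X)"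
proof -
  have r: "hom_functor (op_cat X) c \<in> Obj (PSh X)"
    using rep_Obj[OF u op_cat_small[OF Xs], of c] c by (simp add: PSh_def)
  then show ?thesis
    using c iso_retract(1)[OF iso_Ide[OF PSh_category r] Ide_hom[OF PSh_category r]] unfolding Cauchy_Obj by blast
qed

lemma Cauchy_retract_closed:
  assumes Q: "Q \<in> Obj (Cauchy X)" and ret: "retract (PSh X) P Q"
  shows "P \<in> Obj (Cauchy X)"
proof -
  have "P \<in> Obj (PSh X)" using ret hom_Obj(1)[OF PSh_category] unfolding retract_def by blast
  then show ?thesis using Q retract_trans[OF PSh_category ret] unfolding Cauchy_Obj by blast
qed

lemma Cauchy_retract: "P \<in> Obj (Cauchy X) \<Longrightarrow> Q \<in> Obj (Cauchy X) \<Longrightarrow> retract (Cauchy X) P Q \<longleftrightarrow> retract (PSh X) P Q"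
  using retract_full_subcat[of P "Obj (Cauchy X)" Q "PSh X"] by (simp flip: Cauchy_full_subcat)

lemma Cauchy_splits: "splits_idempotents (Cauchy X)"
proof -
  have "splits_idempotents (PSh X)" unfolding PSh_def by (rule CAT_splits_idempotents[OF SET_splits])
  from splits_idempotents_full_subcat[OF this Cauchy_retract_closed]
  show ?thesis by (simp flip: Cauchy_full_subcat)
qed

text \<open>Density is the description of the objects as retracts of representables. The embedding
  is \<open>Yon\<close> of the opposite category, and taking opposites twice gives back
  \<open>X\<close> strictly.\<close>

lemma yoneda_retract_dense: "retract_dense X (Cauchy X) (Yon (op_cat X))"
proof -
  have YO: "FObj (Yon (op_cat X)) c = hom_functor (op_cat X) c" if "c \<in> Obj X" for c
    using Yon_simps(1)[OF u op_cat_small[OF Xs], of c] that by simp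
  have "fully_faithful X (PSh X) (Yon (op_cat X))"
    using Yon_ff[OF u op_cat_small[OF Xs]] by (simp add: op_cat_op_cat PSh_def)
  then have "fully_faithful X (full_subcat (PSh X) (Obj (Cauchy X))) (Yon (op_cat X))"
    by (rule ff_into_full_subcat) (simp add: YO rep_Cauchy)
  then show ?thesis
    unfolding retract_dense_def Cauchy_full_subcat[symmetric]
    using Cauchy_Obj Cauchy_retract rep_Cauchy YO by metis
qed

end

section \<open>Left Kan extension on Cauchy completions\<close>

context
  fixes C B :: "('u, 'u) category" and K :: "('u, 'u, 'u, 'u) fmaps"
  assumes u: "universe TYPE('u)" and Cs: "small_category C" and Bs: "small_category B"
    and K: "is_functor C B K"
begin

abbreviation (input) \<U> where "\<U> \<equiv> precomp (op_cat C) (op_cat B) K (Set_cat :: ('u set, _) category)"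
abbreviation (input) \<L> where "\<L> P \<equiv> lan_obj (op_cat C) (op_cat B) (Set_cat :: ('u set, _) category) K P"
abbreviation (input) unit where
  "unit P \<equiv> (P, lan_unit (op_cat C) (op_cat B) (Set_cat :: ('u set, _) category) K P, functor_comp (op_cat C) (\<L> P) K)"

lemma U_functor: "is_functor (PSh B) (PSh C) \<U>"
  unfolding PSh_def by (rule precomp_functor[OF op_cat_functor[OF K]])

lemma rep_universal:
  "c \<in> Obj C \<Longrightarrow> universal_arrow (PSh B) (PSh C) \<U> (hom_functor (op_cat C) c) (hom_functor (op_cat B) (FObj K c))
    (yon (op_cat C) (functor_comp (op_cat C) (hom_functor (op_cat B) (FObj K c)) K) c (Ide B (FObj K c)))"
  using rep_universal_arrow[OF u op_cat_small[OF Cs] op_cat_small[OF Bs] op_cat_functor[OF K], of c]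
  by (simp add: PSh_def)

text \<open>\<open>lan\<close> is defined by choice and carries information only where a Kan
  extension exists. For objects of the completion existence follows from the representable case by
  splitting an idempotent.\<close>

lemma lan_universal:
  assumes P: "P \<in> Obj (Cauchy C)"
  shows "universal_arrow (PSh B) (PSh C) \<U> P (\<L> P) (unit P)"
proof -
  obtain c where c: "c \<in> Obj C" "retract (PSh C) P (hom_functor (op_cat C) c)"
    using P unfolding Cauchy_Obj[OF u Cs] by blast
  have split: "splits_idempotents (PSh B)" unfolding PSh_def by (rule CAT_splits_idempotents[OF SET_splits])
  obtain Q h where Q: "universal_arrow (PSh B) (PSh C) \<U> P Q h"
    using universal_arrow_retract[OF U_functor split rep_universal[OF c(1)] c(2)] by blast
  have Q': "is_functor (op_cat B) Set_cat Q" using Q by (simp add: universal_arrow_def PSh_def)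
  obtain \<eta> where \<eta>: "h = (P, \<eta>, functor_comp (op_cat C) Q K)"
    using universal_arrow_hom[OF Q] by (auto simp: PSh_def CAT_hom precomp_Obj[OF Q'])
  have "is_lan (op_cat C) (op_cat B) Set_cat K P Q \<eta>"
    using Q by (simp add: is_lan_iff[OF op_cat_functor[OF K]] PSh_def \<eta>)
  then have ex: "\<exists>w. case_prod (is_lan (op_cat C) (op_cat B) (Set_cat :: ('u set, _) category) K P) w" by auto
  have "case_prod (is_lan (op_cat C) (op_cat B) (Set_cat :: ('u set, _) category) K P) (lan (op_cat C) (op_cat B) Set_cat K P)"
    using someI_ex[OF ex] by (simp add: lan_def)
  then have "is_lan (op_cat C) (op_cat B) (Set_cat :: ('u set, _) category) K P (\<L> P) (lan_unit (op_cat C) (op_cat B) Set_cat K P)"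
    by (simp add: lan_obj_def lan_unit_def split_def)
  then show ?thesis by (simp add: is_lan_iff[OF op_cat_functor[OF K]] PSh_def)
qed

abbreviation (input) \<L>m where
  "\<L>m t \<equiv> (\<L> (fst t), lan_nat (op_cat C) (op_cat B) (Set_cat :: ('u set, _) category) K (fst t) (snd (snd t)) (fst (snd t)), \<L> (snd (snd t)))"

text \<open>Unique existence in the universal property shows that the definite description in the
  definition denotes. The second equation, naturality of the unit, is how its value is used
  afterwards.\<close>

lemma lan_nat:
  assumes t: "t \<in> hom (PSh C) P P'" and P: "P \<in> Obj (Cauchy C)" and P': "P' \<in> Obj (Cauchy C)"
  shows "\<L>m t \<in> hom (PSh B) (\<L> P) (\<L> P')" "Comp (PSh C) (FArr \<U> (\<L>m t)) (unit P) = Comp (PSh C) (unit P') t"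
proof -
  note un = lan_universal[OF P] and un' = lan_universal[OF P']
  have L: "\<L> P \<in> Obj (PSh B)" "\<L> P' \<in> Obj (PSh B)" using un un' by (simp_all add: universal_arrow_def)
  obtain \<alpha> where \<alpha>: "t = (P, \<alpha>, P')" "is_nat (op_cat C) Set_cat P P' \<alpha>" using t by (auto simp: PSh_def CAT_hom)
  have "\<exists>!\<beta>. \<beta> \<in> hom (PSh B) (\<L> P) (\<L> P') \<and> Comp (PSh C) (FArr \<U> \<beta>) (unit P) = Comp (PSh C) (unit P') t"
    by (rule universal_arrow_ex1[OF un L(2) Comp_hom[OF PSh_category[OF u Cs] t universal_arrow_hom[OF un']]])
  then obtain \<beta> where \<beta>: "\<beta> \<in> hom (PSh B) (\<L> P) (\<L> P')" "Comp (PSh C) (FArr \<U> \<beta>) (unit P) = Comp (PSh C) (unit P') t"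
    and uniq: "\<And>\<beta>'. \<beta>' \<in> hom (PSh B) (\<L> P) (\<L> P') \<Longrightarrow> Comp (PSh C) (FArr \<U> \<beta>') (unit P) = Comp (PSh C) (unit P') t \<Longrightarrow> \<beta>' = \<beta>"
    by blast
  obtain b where b: "\<beta> = (\<L> P, b, \<L> P')" "is_nat (op_cat B) Set_cat (\<L> P) (\<L> P') b"
    using \<beta>(1) by (auto simp: PSh_def CAT_hom)
  have eqv: "Comp (PSh C) (FArr \<U> (\<L> P, b', \<L> P')) (unit P) = Comp (PSh C) (unit P') t \<longleftrightarrow>
      vcomp (op_cat C) Set_cat (whisker_pre (op_cat C) b' K) (lan_unit (op_cat C) (op_cat B) Set_cat K P)
        = vcomp (op_cat C) Set_cat (lan_unit (op_cat C) (op_cat B) Set_cat K P') \<alpha>"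
    if "is_nat (op_cat B) Set_cat (\<L> P) (\<L> P') b'" for b'
    using that by (simp add: PSh_def precomp_Arr \<alpha>(1))
  have "lan_nat (op_cat C) (op_cat B) Set_cat K P P' \<alpha> = b"
    unfolding lan_nat_def
  proof (rule the_equality)
    show "is_nat (op_cat B) Set_cat (\<L> P) (\<L> P') b \<and>
      vcomp (op_cat C) Set_cat (whisker_pre (op_cat C) b K) (lan_unit (op_cat C) (op_cat B) Set_cat K P)
        = vcomp (op_cat C) Set_cat (lan_unit (op_cat C) (op_cat B) Set_cat K P') \<alpha>"
      using b(2) \<beta>(2) eqv[OF b(2)] by (simp add: b(1))
    fix b' assume b': "is_nat (op_cat B) Set_cat (\<L> P) (\<L> P') b' \<and>
      vcomp (op_cat C) Set_cat (whisker_pre (op_cat C) b' K) (lan_unit (op_cat C) (op_cat B) Set_cat K P)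
        = vcomp (op_cat C) Set_cat (lan_unit (op_cat C) (op_cat B) Set_cat K P') \<alpha>"
    have "(\<L> P, b', \<L> P') = \<beta>"
      by (rule uniq) (use b' eqv in \<open>auto simp: PSh_def CAT_hom\<close>)
    then show "b' = b" by (simp add: b(1))
  qed
  then have "\<L>m t = \<beta>" by (simp add: \<alpha>(1) b(1))
  then show "\<L>m t \<in> hom (PSh B) (\<L> P) (\<L> P')" "Comp (PSh C) (FArr \<U> (\<L>m t)) (unit P) = Comp (PSh C) (unit P') t"
    using \<beta> by simp_all
qed

lemma lan_unique:
  assumes P: "P \<in> Obj (Cauchy C)" and "\<beta> \<in> hom (PSh B) (\<L> P) R" "\<beta>' \<in> hom (PSh B) (\<L> P) R"
    and "Comp (PSh C) (FArr \<U> \<beta>) (unit P) = Comp (PSh C) (FArr \<U> \<beta>') (unit P)"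
  shows "\<beta> = \<beta>'"
  by (rule universal_arrow_eqI[OF U_functor lan_universal[OF P] assms(2-4)])

lemma unit_hom: "P \<in> Obj (Cauchy C) \<Longrightarrow> unit P \<in> hom (PSh C) P (FObj \<U> (\<L> P))"
  by (rule universal_arrow_hom[OF lan_universal])

lemma lan_Obj: "P \<in> Obj (Cauchy C) \<Longrightarrow> \<L> P \<in> Obj (PSh B)"
  using lan_universal by (simp add: universal_arrow_def)

lemma lan_nat_Ide:
  assumes P: "P \<in> Obj (Cauchy C)"
  shows "\<L>m (Ide (PSh C) P) = Ide (PSh B) (\<L> P)"
proof -
  have P': "P \<in> Obj (PSh C)" using P by (simp add: Cauchy_Obj[OF u Cs])
  note i = Ide_hom[OF PSh_category[OF u Cs] P']
  note n = lan_nat[OF i P P]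
  show ?thesis
    by (rule lan_unique[OF P n(1) Ide_hom[OF PSh_category[OF u Bs] lan_Obj[OF P]]])
      (simp only: n(2) functor_Ide[OF U_functor lan_Obj[OF P]] Comp_Ide_left[OF PSh_category[OF u Cs] unit_hom[OF P]]
        Comp_Ide_right[OF PSh_category[OF u Cs] unit_hom[OF P]])
qed

lemma lan_nat_Comp:
  assumes t: "t \<in> hom (PSh C) P P'" and s: "s \<in> hom (PSh C) P' P''"
    and P: "P \<in> Obj (Cauchy C)" and P': "P' \<in> Obj (Cauchy C)" and P'': "P'' \<in> Obj (Cauchy C)"
  shows "\<L>m (Comp (PSh C) s t) = Comp (PSh B) (\<L>m s) (\<L>m t)"
proof -
  note A = PSh_category[OF u Cs] and A' = PSh_category[OF u Bs]
  note st = Comp_hom[OF A t s]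
  note n = lan_nat[OF t P P'] and m = lan_nat[OF s P' P''] and k = lan_nat[OF st P P'']
  note Un = functor_hom[OF U_functor n(1)] and Um = functor_hom[OF U_functor m(1)]
  have "Comp (PSh C) (FArr \<U> (Comp (PSh B) (\<L>m s) (\<L>m t))) (unit P) = Comp (PSh C) (FArr \<U> (\<L>m s)) (Comp (PSh C) (unit P') t)"
    by (simp only: functor_Comp[OF U_functor n(1) m(1)] Comp_assoc[OF A unit_hom[OF P] Un Um] n(2))
  also have "\<dots> = Comp (PSh C) (Comp (PSh C) (unit P'') s) t"
    by (simp only: Comp_assoc[OF A t unit_hom[OF P'] Um, symmetric] m(2))
  also have "\<dots> = Comp (PSh C) (unit P'') (Comp (PSh C) s t)"
    by (rule Comp_assoc[OF A t s unit_hom[OF P'']])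
  finally have "Comp (PSh C) (FArr \<U> (Comp (PSh B) (\<L>m s) (\<L>m t))) (unit P)
      = Comp (PSh C) (FArr \<U> (\<L>m (Comp (PSh C) s t))) (unit P)" by (simp only: k(2))
  from lan_unique[OF P k(1) Comp_hom[OF A' n(1) m(1)] this[symmetric]] show ?thesis .
qed

text \<open>The chosen extension of a representable is only isomorphic to the representable at
  \<open>K c\<close>. Recording the effect on units pins the isomorphism down, which makes its
  naturality in \<open>c\<close> provable.\<close>

lemma lan_rep_iso:
  assumes c: "c \<in> Obj C"
  shows "\<exists>\<theta>\<in>hom (PSh B) (\<L> (hom_functor (op_cat C) c)) (hom_functor (op_cat B) (FObj K c)). is_iso (PSh B) \<theta> \<and>
    Comp (PSh C) (FArr \<U> \<theta>) (unit (hom_functor (op_cat C) c))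
      = yon (op_cat C) (functor_comp (op_cat C) (hom_functor (op_cat B) (FObj K c)) K) c (Ide B (FObj K c))"
  by (rule universal_arrow_iso[OF U_functor lan_universal[OF rep_Cauchy[OF u Cs c]] rep_universal[OF c]])

text \<open>Retracts are preserved, and representables go to representables up to isomorphism. The
  argument uses the action on arrows directly, because the functor into \<open>Cauchy B\<close>
  exists only once this is known.\<close>

lemma lan_Cauchy:
  assumes P: "P \<in> Obj (Cauchy C)"
  shows "\<L> P \<in> Obj (Cauchy B)"
proof -
  note A' = PSh_category[OF u Bs]
  obtain c s r where c: "c \<in> Obj C" and s: "s \<in> hom (PSh C) P (hom_functor (op_cat C) c)"
    and r: "r \<in> hom (PSh C) (hom_functor (op_cat C) c) P" and rs: "Comp (PSh C) r s = Ide (PSh C) P"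
    using P unfolding Cauchy_Obj[OF u Cs] retract_def by blast
  note rep = rep_Cauchy[OF u Cs c]
  have "Comp (PSh B) (\<L>m r) (\<L>m s) = Ide (PSh B) (\<L> P)"
    by (simp only: lan_nat_Comp[OF s r P rep P, symmetric] rs lan_nat_Ide[OF P])
  then have 1: "retract (PSh B) (\<L> P) (\<L> (hom_functor (op_cat C) c))"
    using lan_nat(1)[OF s P rep] lan_nat(1)[OF r rep P] unfolding retract_def by blast
  obtain \<theta> where \<theta>: "is_iso (PSh B) \<theta>"
    "\<theta> \<in> hom (PSh B) (\<L> (hom_functor (op_cat C) c)) (hom_functor (op_cat B) (FObj K c))"
    using lan_rep_iso[OF c] by blast
  note 2 = iso_retract(2)[OF \<theta>]
  show ?thesis
    using retract_trans[OF A' 1 2] lan_Obj[OF P] functor_Obj[OF K c] unfolding Cauchy_Obj[OF u Bs] by blast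
qed

section \<open>The induced functor and the Yoneda embeddings\<close>

lemma Cauchy_map_simps:
  "P \<in> Obj (Cauchy C) \<Longrightarrow> FObj (Cauchy_map C B K) P = \<L> P"
  "t \<in> hom (Cauchy C) P P' \<Longrightarrow> FArr (Cauchy_map C B K) t = \<L>m t"
  using homD(1)[of t "Cauchy C" P P'] by (simp_all add: Cauchy_map_def split_def)

lemma Cauchy_map_functor: "is_functor (Cauchy C) (Cauchy B) (Cauchy_map C B K)"
proof (rule is_functorI[OF Cauchy_category[OF u Cs] Cauchy_category[OF u Bs]])
  show "FObj (Cauchy_map C B K) P \<in> Obj (Cauchy B)" if "P \<in> Obj (Cauchy C)" for P
    using lan_Cauchy[OF that] by (simp only: Cauchy_map_simps(1)[OF that])
  show "FArr (Cauchy_map C B K) t \<in> hom (Cauchy B) (FObj (Cauchy_map C B K) P) (FObj (Cauchy_map C B K) P')"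
    if t: "t \<in> hom (Cauchy C) P P'" for t P P'
  proof -
    have P: "P \<in> Obj (Cauchy C)" "P' \<in> Obj (Cauchy C)" and t': "t \<in> hom (PSh C) P P'"
      using t unfolding Cauchy_hom[OF u Cs] by auto
    show ?thesis
      unfolding Cauchy_map_simps(1)[OF P(1)] Cauchy_map_simps(1)[OF P(2)] Cauchy_map_simps(2)[OF t] Cauchy_hom[OF u Bs]
      using lan_nat(1)[OF t' P] lan_Cauchy[OF P(1)] lan_Cauchy[OF P(2)] by blast
  qed
  show "FArr (Cauchy_map C B K) (Ide (Cauchy C) P) = Ide (Cauchy B) (FObj (Cauchy_map C B K) P)"
    if P: "P \<in> Obj (Cauchy C)" for P
    using lan_nat_Ide[OF P] Cauchy_map_simps(2)[OF Ide_hom[OF Cauchy_category[OF u Cs] P]]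
    by (simp only: Cauchy_map_simps(1)[OF P] Cauchy_simps[OF u Cs] Cauchy_simps[OF u Bs])
  show "FArr (Cauchy_map C B K) (Comp (Cauchy C) s t) = Comp (Cauchy B) (FArr (Cauchy_map C B K) s) (FArr (Cauchy_map C B K) t)"
    if t: "t \<in> hom (Cauchy C) P P'" and s: "s \<in> hom (Cauchy C) P' P''" for s t P P' P''
  proof -
    have "t \<in> hom (PSh C) P P'" "s \<in> hom (PSh C) P' P''" "P \<in> Obj (Cauchy C)" "P' \<in> Obj (Cauchy C)" "P'' \<in> Obj (Cauchy C)"
      using t s unfolding Cauchy_hom[OF u Cs] by auto
    from lan_nat_Comp[OF this] show ?thesis
      using Cauchy_map_simps(2)[OF Comp_hom[OF Cauchy_category[OF u Cs] t s]]
      by (simp only: Cauchy_map_simps(2)[OF t] Cauchy_map_simps(2)[OF s] Cauchy_simps[OF u Cs] Cauchy_simps[OF u Bs])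
  qed
qed (simp_all add: Cauchy_map_def)

text \<open>The isomorphism consists of the arrows from \<open>lan_rep_iso\<close>. Its naturality
  is checked after composing with the unit, where both sides are arrows out of a representable and
  are compared by one element.\<close>

lemma Cauchy_map_yoneda:
  "\<exists>\<theta>. is_nat_iso C (Cauchy B) (functor_comp C (Cauchy_map C B K) (Yon (op_cat C))) (functor_comp C (Yon (op_cat B)) K) \<theta>"
proof -
  note A = PSh_category[OF u Cs] and A' = PSh_category[OF u Bs] and B' = Cauchy_category[OF u Bs]
  note oC = op_cat_small[OF Cs] and oB = op_cat_small[OF Bs]
  let ?h = "hom_functor (op_cat C)" and ?k = "\<lambda>c. hom_functor (op_cat B) (FObj K c)"
  let ?\<eta> = "\<lambda>c. yon (op_cat C) (functor_comp (op_cat C) (?k c) K) c (Ide B (FObj K c))"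
  note YC = ff_functor[OF conjunct1[OF yoneda_retract_dense[OF u Cs, unfolded retract_dense_def]]]
  note YB = ff_functor[OF conjunct1[OF yoneda_retract_dense[OF u Bs, unfolded retract_dense_def]]]
  note KY = functor_comp[OF YC Cauchy_map_functor] and YK = functor_comp[OF K YB]
  have YCO: "FObj (Yon (op_cat C)) c = ?h c" if "c \<in> Obj C" for c using Yon_simps(1)[OF u oC, of c] that by simp
  have YBO: "FObj (Yon (op_cat B)) b = hom_functor (op_cat B) b" if "b \<in> Obj B" for b using Yon_simps(1)[OF u oB, of b] that by simp
  have KYO: "FObj (functor_comp C (Cauchy_map C B K) (Yon (op_cat C))) c = \<L> (?h c)" if c: "c \<in> Obj C" for c
    using c Cauchy_map_simps(1)[OF rep_Cauchy[OF u Cs c]] by (simp add: functor_comp_simps YCO)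
  have YKO: "FObj (functor_comp C (Yon (op_cat B)) K) c = ?k c" if c: "c \<in> Obj C" for c
    using c functor_Obj[OF K c] by (simp add: functor_comp_simps YBO)
  obtain \<theta> where \<theta>: "\<And>c. c \<in> Obj C \<Longrightarrow> \<theta> c \<in> hom (PSh B) (\<L> (?h c)) (?k c)"
    and \<theta>i: "\<And>c. c \<in> Obj C \<Longrightarrow> is_iso (PSh B) (\<theta> c)"
    and \<theta>\<eta>: "\<And>c. c \<in> Obj C \<Longrightarrow> Comp (PSh C) (FArr \<U> (\<theta> c)) (unit (?h c)) = ?\<eta> c"
    using lan_rep_iso by metis
  have \<theta>': "\<theta> c \<in> hom (Cauchy B) (\<L> (?h c)) (?k c)" if c: "c \<in> Obj C" for c
    using \<theta>[OF c] lan_Cauchy[OF rep_Cauchy[OF u Cs c]] rep_Cauchy[OF u Bs functor_Obj[OF K c]]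
    by (simp add: Cauchy_hom[OF u Bs])
  have "is_nat C (Cauchy B) (functor_comp C (Cauchy_map C B K) (Yon (op_cat C))) (functor_comp C (Yon (op_cat B)) K) (restrict \<theta> (Obj C))"
  proof (rule is_natI[OF KY YK])
    show "restrict \<theta> (Obj C) c \<in> hom (Cauchy B) (FObj (functor_comp C (Cauchy_map C B K) (Yon (op_cat C))) c)
        (FObj (functor_comp C (Yon (op_cat B)) K) c)" if c: "c \<in> Obj C" for c
      using \<theta>'[OF c] by (simp only: KYO[OF c] YKO[OF c] restrict_apply' c)
    fix f c d assume f: "f \<in> hom C c d"
    note cd = hom_Obj[OF functor_cats(1)[OF K] f]
    note Yf = functor_hom[OF YC f, unfolded YCO[OF cd(1)] YCO[OF cd(2)]]
    have Yf': "FArr (Yon (op_cat C)) f \<in> hom (PSh C) (?h c) (?h d)" using Yf unfolding Cauchy_hom[OF u Cs] by blast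
    note rc = rep_Cauchy[OF u Cs cd(1)] and rd = rep_Cauchy[OF u Cs cd(2)]
    note n = lan_nat[OF Yf' rc rd]
    note Kf = functor_hom[OF K f]
    note Kc = functor_Obj[OF K cd(1)] and Kd = functor_Obj[OF K cd(2)]
    have YKf: "FArr (Yon (op_cat B)) (FArr K f) \<in> hom (PSh B) (?k c) (?k d)"
      using functor_hom[OF YB Kf] unfolding Cauchy_hom[OF u Bs] YBO[OF Kc] YBO[OF Kd] by blast
    have Yfe: "FArr (Yon (op_cat C)) f = yon (op_cat C) (?h d) c f" using Yon_simps(2)[OF u oC, of f d c] f by simp
    have YKfe: "FArr (Yon (op_cat B)) (FArr K f) = yon (op_cat B) (?k d) (FObj K c) (FArr K f)"
      using Yon_simps(2)[OF u oB, of "FArr K f" "FObj K d" "FObj K c"] Kf by simp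
    have kf: "is_functor (op_cat B) Set_cat (?k c)" "is_functor (op_cat B) Set_cat (?k d)"
      using YKf hom_Obj[OF A'] by (auto simp: PSh_def)
    note ko = op_cat_functor[OF K]
    have ic: "Ide B (FObj K c) \<in> FObj (functor_comp (op_cat C) (?k c) K) c"
      using cd Kc Ide_hom[OF functor_cats(2)[OF K] Kc] by (simp add: functor_comp_simps hom_functor_Obj)
    have id: "Ide B (FObj K d) \<in> FObj (functor_comp (op_cat C) (?k d) K) d"
      using cd Kd Ide_hom[OF functor_cats(2)[OF K] Kd] by (simp add: functor_comp_simps hom_functor_Obj)
    have cO: "c \<in> Obj (op_cat C)" "d \<in> Obj (op_cat C)" using cd by simp_all
    have \<eta>c: "?\<eta> c \<in> hom (PSh C) (?h c) (functor_comp (op_cat C) (?k c) K)"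
      unfolding PSh_def by (rule yon_hom[OF u oC functor_comp[OF ko kf(1)] cO(1) ic])
    have \<eta>d: "?\<eta> d \<in> hom (PSh C) (?h d) (functor_comp (op_cat C) (?k d) K)"
      unfolding PSh_def by (rule yon_hom[OF u oC functor_comp[OF ko kf(2)] cO(2) id])
    obtain \<kappa> where \<kappa>: "FArr (Yon (op_cat B)) (FArr K f) = (?k c, \<kappa>, ?k d)" "is_nat (op_cat B) Set_cat (?k c) (?k d) \<kappa>"
      using YKf by (auto simp: PSh_def CAT_hom)
    obtain \<zeta> where \<zeta>: "?\<eta> d = (?h d, \<zeta>, functor_comp (op_cat C) (?k d) K)" "is_nat (op_cat C) Set_cat (?h d) (functor_comp (op_cat C) (?k d) K) \<zeta>"
      using \<eta>d by (auto simp: PSh_def CAT_hom)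
    have \<kappa>e: "\<kappa> = yoneda (op_cat B) (?k d) (FObj K c) (FArr K f)"
      using \<kappa>(1) unfolding YKfe yon_def[OF u oB] by simp
    have \<zeta>e: "\<zeta> = yoneda (op_cat C) (functor_comp (op_cat C) (?k d) K) d (Ide B (FObj K d))"
      using \<zeta>(1) unfolding yon_def[OF u oC] by simp
    have U\<kappa>: "FArr \<U> (FArr (Yon (op_cat B)) (FArr K f))
        = (functor_comp (op_cat C) (?k c) K, whisker_pre (op_cat C) \<kappa> K, functor_comp (op_cat C) (?k d) K)"
      by (simp add: \<kappa>(1) precomp_Arr[OF \<kappa>(2)])
    \<comment> \<open>The canonical units themselves are natural in \<open>c\<close>: the element
      classifying either composite is \<open>K f\<close>.\<close>
    have base: "Comp (PSh C) (FArr \<U> (FArr (Yon (op_cat B)) (FArr K f))) (?\<eta> c) = Comp (PSh C) (?\<eta> d) (FArr (Yon (op_cat C)) f)"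
    proof -
      have h1: "Comp (PSh C) (FArr \<U> (FArr (Yon (op_cat B)) (FArr K f))) (?\<eta> c) \<in> hom (PSh C) (?h c) (functor_comp (op_cat C) (?k d) K)"
        using Comp_hom[OF A \<eta>c] functor_hom[OF U_functor YKf] by (simp add: precomp_Obj kf)
      have h2: "Comp (PSh C) (?\<eta> d) (FArr (Yon (op_cat C)) f) \<in> hom (PSh C) (?h c) (functor_comp (op_cat C) (?k d) K)"
        by (rule Comp_hom[OF A Yf' \<eta>d])
      have Kf': "FArr K f \<in> hom (op_cat B) (FObj K d) (FObj K c)" using Kf by simp
      have f': "f \<in> hom (op_cat C) d c" using f by simp
      have "elem (op_cat C) c (Comp (PSh C) (FArr \<U> (FArr (Yon (op_cat B)) (FArr K f))) (?\<eta> c)) = app (\<kappa> (FObj K c)) (Ide B (FObj K c))"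
        using elem_Comp[OF u oC \<eta>c[unfolded PSh_def] whisker_pre_nat[OF ko \<kappa>(2)] cO(1)]
          elem_yon[OF u oC functor_comp[OF ko kf(1)] cO(1) ic] cO(1)
        by (simp add: U\<kappa> PSh_def whisker_pre_apply)
      also have "\<dots> = FArr K f"
        using app_yoneda[of "Ide B (FObj K c)" "op_cat B" "FObj K c" "FObj K c" "?k d" "FArr K f"]
          Ide_hom[OF functor_cats(2)[OF K] Kc] Kc SET_functor_Ide[OF kf(2), of "FObj K c" "FArr K f"] Kf
        by (simp add: \<kappa>e hom_functor_Obj)
      also have "\<dots> = app (\<zeta> c) f"
        using app_yoneda[OF f' cO(1), of "functor_comp (op_cat C) (?k d) K" "Ide B (FObj K d)"]
          app_hom_functor[OF Kf', of "Ide B (FObj K d)" "FObj K d"] Ide_hom[OF functor_cats(2)[OF K] Kd]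
          Comp_Ide_left[OF functor_cats(2)[OF K] Kf] homD(1)[OF f'] by (simp add: \<zeta>e functor_comp_simps)
      also have "\<dots> = elem (op_cat C) c (Comp (PSh C) (?\<eta> d) (FArr (Yon (op_cat C)) f))"
        using elem_Comp[OF u oC Yf'[unfolded PSh_def] \<zeta>(2) cO(1)]
          elem_yon[OF u oC hom_functor[OF small_locally_small[OF oC] cO(2)] cO(1), of f] f cd
        by (simp add: \<zeta>(1) PSh_def Yfe hom_functor_Obj)
      finally show ?thesis
        by (rule elem_inj[OF u oC h1[unfolded PSh_def] h2[unfolded PSh_def] cO(1), folded PSh_def])
    qed
    have "Comp (PSh B) (\<theta> d) (\<L>m (FArr (Yon (op_cat C)) f)) = Comp (PSh B) (FArr (Yon (op_cat B)) (FArr K f)) (\<theta> c)"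
    proof (rule lan_unique[OF rc Comp_hom[OF A' n(1) \<theta>[OF cd(2)]] Comp_hom[OF A' \<theta>[OF cd(1)] YKf]])
      note U = U_functor
      have "Comp (PSh C) (FArr \<U> (Comp (PSh B) (\<theta> d) (\<L>m (FArr (Yon (op_cat C)) f)))) (unit (?h c))
          = Comp (PSh C) (FArr \<U> (\<theta> d)) (Comp (PSh C) (unit (?h d)) (FArr (Yon (op_cat C)) f))"
        by (simp only: functor_Comp[OF U n(1) \<theta>[OF cd(2)]] n(2)
            Comp_assoc[OF A unit_hom[OF rc] functor_hom[OF U n(1)] functor_hom[OF U \<theta>[OF cd(2)]]])
      also have "\<dots> = Comp (PSh C) (?\<eta> d) (FArr (Yon (op_cat C)) f)"
        by (simp only: \<theta>\<eta>[OF cd(2)] Comp_assoc[OF A Yf' unit_hom[OF rd] functor_hom[OF U \<theta>[OF cd(2)]], symmetric])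
      also have "\<dots> = Comp (PSh C) (FArr \<U> (Comp (PSh B) (FArr (Yon (op_cat B)) (FArr K f)) (\<theta> c))) (unit (?h c))"
        by (simp only: functor_Comp[OF U \<theta>[OF cd(1)] YKf] base[symmetric] \<theta>\<eta>[OF cd(1)]
            Comp_assoc[OF A unit_hom[OF rc] functor_hom[OF U \<theta>[OF cd(1)]] functor_hom[OF U YKf]])
      finally show "Comp (PSh C) (FArr \<U> (Comp (PSh B) (\<theta> d) (\<L>m (FArr (Yon (op_cat C)) f)))) (unit (?h c))
          = Comp (PSh C) (FArr \<U> (Comp (PSh B) (FArr (Yon (op_cat B)) (FArr K f)) (\<theta> c))) (unit (?h c))" .
    qed
    then show "Comp (Cauchy B) (restrict \<theta> (Obj C) d) (FArr (functor_comp C (Cauchy_map C B K) (Yon (op_cat C))) f)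
        = Comp (Cauchy B) (FArr (functor_comp C (Yon (op_cat B)) K) f) (restrict \<theta> (Obj C) c)"
      by (simp only: functor_comp_simps(2)[OF homD(1)[OF f]] Cauchy_map_simps(2)[OF Yf] Cauchy_simps[OF u Bs] restrict_apply' cd)
  qed simp
  moreover have "is_iso (Cauchy B) (restrict \<theta> (Obj C) c)" if c: "c \<in> Obj C" for c
  proof -
    obtain g where "g \<in> hom (PSh B) (?k c) (\<L> (?h c))" "Comp (PSh B) g (\<theta> c) = Ide (PSh B) (\<L> (?h c))"
      "Comp (PSh B) (\<theta> c) g = Ide (PSh B) (?k c)" using isoE[OF \<theta>i[OF c] \<theta>[OF c]] by blast
    then have "is_iso (Cauchy B) (\<theta> c)"
      using \<theta>'[OF c] by (intro isoI[of "\<theta> c" _ "\<L> (?h c)" "?k c" g]) (auto simp: Cauchy_hom[OF u Bs] Cauchy_simps[OF u Bs])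
    then show ?thesis using c by simp
  qed
  ultimately show ?thesis unfolding is_nat_iso_def by blast
qed

section \<open>Transfer of the conditions on K\<close>

lemma yoneda_functors:
  "retract_dense C (Cauchy C) (Yon (op_cat C))" "is_functor C (Cauchy C) (Yon (op_cat C))"
  "retract_dense B (Cauchy B) (Yon (op_cat B))" "is_functor B (Cauchy B) (Yon (op_cat B))"
  "fully_faithful B (Cauchy B) (Yon (op_cat B))"
  using yoneda_retract_dense[OF u Cs] yoneda_retract_dense[OF u Bs] by (auto simp: retract_dense_def ff_functor)

text \<open>Restriction turns the square of Yoneda embeddings into a square of restriction functors,
  commuting up to isomorphism, in which both embeddings act fully faithfully. The first claim
  cancels the embedding of \<open>C\<close> on the left. The second has to cancel the embedding of
  \<open>B\<close> on the right, for which its restriction functor must also be essentially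
  surjective; split idempotents in \<open>Z\<close> ensure that.\<close>

lemma ff_precomp_Cauchy_map:
  assumes Z: "is_category Z"
  shows "restriction_ff C B K Z \<Longrightarrow>
      restriction_ff (Cauchy C) (Cauchy B) (Cauchy_map C B K) Z"
    and "splits_idempotents Z \<Longrightarrow>
      restriction_ff (Cauchy C) (Cauchy B) (Cauchy_map C B K) Z \<Longrightarrow>
      restriction_ff C B K Z"
proof -
  note Y = yoneda_functors and M = Cauchy_map_functor
  let ?YC = "precomp C (Cauchy C) (Yon (op_cat C)) Z" and ?YB = "precomp B (Cauchy B) (Yon (op_cat B)) Z"
  let ?M = "precomp (Cauchy C) (Cauchy B) (Cauchy_map C B K) Z" and ?K = "precomp C B K Z"
  obtain \<theta> where "is_nat_iso C (Cauchy B) (functor_comp C (Cauchy_map C B K) (Yon (op_cat C))) (functor_comp C (Yon (op_cat B)) K) \<theta>"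
    using Cauchy_map_yoneda by blast
  from precomp_nat_iso[OF this, of Z] obtain \<Theta> where
    "is_nat_iso (CAT (Cauchy B) Z) (CAT C Z) (functor_comp (CAT (Cauchy B) Z) ?YC ?M) (functor_comp (CAT (Cauchy B) Z) ?K ?YB) \<Theta>"
    by (auto simp: precomp_comp[OF Y(2) M] precomp_comp[OF K Y(4)])
  note iff = ff_iso_iff[OF this]
  note ffC = retract_dense_ff_precomp[OF Y(1) Z] and ffB = retract_dense_ff_precomp[OF Y(3) Z]
  show "fully_faithful (CAT (Cauchy B) Z) (CAT (Cauchy C) Z) ?M" if "fully_faithful (CAT B Z) (CAT C Z) ?K"
    using ff_cancel[OF precomp_functor[OF M] ffC] ff_comp[OF ffB that] iff by blast
  show "fully_faithful (CAT B Z) (CAT C Z) ?K"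
    if split: "splits_idempotents Z" and ff: "fully_faithful (CAT (Cauchy B) Z) (CAT (Cauchy C) Z) ?M"
    using ff_cancel_retract_dense[OF ess_surj_retract_dense[OF ffB retract_dense_ess_surj_precomp[OF Y(3) split]] precomp_functor[OF K]]
      ff_comp[OF ff ffC] iff by blast
qed

lemma lax_epi_Cauchy_map_iff:
  "lax_epi TYPE('u) (Cauchy C) (Cauchy B) (Cauchy_map C B K) \<longleftrightarrow> lax_epi TYPE('u) C B K"
proof
  assume lax: "lax_epi TYPE('u) C B K"
  show "lax_epi TYPE('u) (Cauchy C) (Cauchy B) (Cauchy_map C B K)"
    unfolding lax_epi_def
  proof (intro conjI Cauchy_map_functor allI impI)
    fix Z :: "('u, 'u) category" assume Z: "small_category Z"
    then have "is_category Z" by (simp add: small_category_def)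
    then show "restriction_ff (Cauchy C) (Cauchy B) (Cauchy_map C B K) Z"
      by (rule ff_precomp_Cauchy_map(1)) (use lax Z in \<open>simp add: lax_epi_def\<close>)
  qed
next
  assume lax: "lax_epi TYPE('u) (Cauchy C) (Cauchy B) (Cauchy_map C B K)"
  have "restriction_ff C B K (Set_cat :: ('u set, _) category)"
  proof (rule ff_precomp_full_subcats[OF u K _ SET_category])
    show "small TYPE('u) (Obj B)" using Bs by (simp add: small_category_def)
    fix S :: "'u set set" assume S: "small TYPE('u) S" "S \<subseteq> Obj Set_cat"
    \<comment> \<open>Closure under subsets keeps the family small, since power sets are small, and
      contains the fixed-point sets that split idempotents. So the full subcategory is both an
      admissible test category and one into which functors extend to the completion.\<close>
    define S' where "S' = (\<Union>A\<in>S. Pow A)"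
    have "small TYPE('u) (Pow A)" if "A \<in> S" for A
      using subsetD[OF S(2) that] by (intro small_Pow[OF u]) simp
    then have "small TYPE('u) S'" unfolding S'_def by (rule small_UN[OF u S(1)])
    note Z = locally_small_full_subcat[OF u SET_locally_small[OF u] this]
    have "splits_idempotents (full_subcat (Set_cat :: ('u set, _) category) S')"
      by (rule SET_splits_idempotents) (auto simp: S'_def)
    then have "restriction_ff C B K (full_subcat Set_cat S')"
      using ff_precomp_Cauchy_map(2)[OF Z(1)] lax_epi_ff_small[OF lax Z] by blast
    moreover have "S \<subseteq> S'" by (auto simp: S'_def)
    ultimately show "\<exists>S'. S \<subseteq> S' \<and> restriction_ff C B K (full_subcat Set_cat S')" by blast
  qed
  then show "lax_epi TYPE('u) C B K" by (simp add: lax_epi_iff_ff_SET[OF u Cs Bs K])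
qed

text \<open>Full faithfulness moves across the Yoneda square in both directions. Retracts are
  chained through the square and reflected by the embedding of \<open>B\<close>; conversely, since
  \<open>Cauchy C\<close> splits idempotents, reaching each object as a retract already gives
  essential surjectivity.\<close>

lemma equivalence_Cauchy_map_iff:
  "is_equivalence (Cauchy C) (Cauchy B) (Cauchy_map C B K) \<longleftrightarrow> retract_dense C B K"
proof -
  note Y = yoneda_functors and M = Cauchy_map_functor
  note CB = Cauchy_category[OF u Bs]
  obtain \<theta> where \<theta>: "is_nat_iso C (Cauchy B) (functor_comp C (Cauchy_map C B K) (Yon (op_cat C))) (functor_comp C (Yon (op_cat B)) K) \<theta>"
    using Cauchy_map_yoneda by blast
  note iff = ff_iso_iff[OF \<theta>]
  have \<theta>r: "retract (Cauchy B) (FObj (Cauchy_map C B K) (FObj (Yon (op_cat C)) c)) (FObj (Yon (op_cat B)) (FObj K c))"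
    "retract (Cauchy B) (FObj (Yon (op_cat B)) (FObj K c)) (FObj (Cauchy_map C B K) (FObj (Yon (op_cat C)) c))"
    if c: "c \<in> Obj C" for c
    using iso_retract[OF nat_iso_iso[OF \<theta> c] nat_hom[OF nat_iso_nat[OF \<theta>] c]] c by (simp_all add: functor_comp_simps)
  have denseC: "\<exists>c\<in>Obj C. retract (Cauchy C) P (FObj (Yon (op_cat C)) c)" if "P \<in> Obj (Cauchy C)" for P
    using Y(1) that by (simp add: retract_dense_def)
  have denseB: "\<exists>b\<in>Obj B. retract (Cauchy B) P (FObj (Yon (op_cat B)) b)" if "P \<in> Obj (Cauchy B)" for P
    using Y(3) that by (simp add: retract_dense_def)
  show ?thesis
  proof
    assume "is_equivalence (Cauchy C) (Cauchy B) (Cauchy_map C B K)"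
    then have ff: "fully_faithful (Cauchy C) (Cauchy B) (Cauchy_map C B K)"
      and es: "ess_surj (Cauchy C) (Cauchy B) (Cauchy_map C B K)" by (simp_all add: equivalence_iff)
    have "fully_faithful C (Cauchy C) (Yon (op_cat C))" using Y(1) by (simp add: retract_dense_def)
    then have ffK: "fully_faithful C B K" using ff_cancel[OF K Y(5)] ff_comp[OF _ ff] iff by blast
    have "\<exists>c\<in>Obj C. retract B b (FObj K c)" if b: "b \<in> Obj B" for b
    proof -
      note Yb = functor_Obj[OF Y(4) b]
      obtain P f where P: "P \<in> Obj (Cauchy C)" "f \<in> hom (Cauchy B) (FObj (Cauchy_map C B K) P) (FObj (Yon (op_cat B)) b)" "is_iso (Cauchy B) f"
        using es Yb unfolding ess_surj_def by blast
      obtain c where c: "c \<in> Obj C" "retract (Cauchy C) P (FObj (Yon (op_cat C)) c)" using denseC[OF P(1)] by blast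
      have "retract (Cauchy B) (FObj (Yon (op_cat B)) b) (FObj (Yon (op_cat B)) (FObj K c))"
        by (rule retract_trans[OF CB iso_retract(1)[OF P(3,2)] retract_trans[OF CB functor_retract[OF M c(2)] \<theta>r(1)[OF c(1)]]])
      then show ?thesis using ff_reflects_retract[OF Y(5) b functor_Obj[OF K c(1)]] c(1) by blast
    qed
    then show "retract_dense C B K" using ffK by (simp add: retract_dense_def)
  next
    assume rd: "retract_dense C B K"
    then have "fully_faithful C B K" by (simp add: retract_dense_def)
    from ff_comp[OF this Y(5)] have ff: "fully_faithful (Cauchy C) (Cauchy B) (Cauchy_map C B K)"
      using ff_cancel_retract_dense[OF Y(1) M] iff by blast
    have "\<exists>P\<in>Obj (Cauchy C). retract (Cauchy B) Q (FObj (Cauchy_map C B K) P)" if Q: "Q \<in> Obj (Cauchy B)" for Q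
    proof -
      obtain b where b: "b \<in> Obj B" "retract (Cauchy B) Q (FObj (Yon (op_cat B)) b)" using denseB[OF Q] by blast
      obtain c where c: "c \<in> Obj C" "retract B b (FObj K c)" using rd b(1) unfolding retract_dense_def by blast
      have "retract (Cauchy B) Q (FObj (Cauchy_map C B K) (FObj (Yon (op_cat C)) c))"
        by (rule retract_trans[OF CB b(2) retract_trans[OF CB functor_retract[OF Y(4) c(2)] \<theta>r(2)[OF c(1)]]])
      then show ?thesis using functor_Obj[OF Y(2) c(1)] by blast
    qed
    then have "ess_surj (Cauchy C) (Cauchy B) (Cauchy_map C B K)"
      by (rule splits_ess_surj[OF ff Cauchy_splits[OF u Cs]])
    then show "is_equivalence (Cauchy C) (Cauchy B) (Cauchy_map C B K)" using ff by (simp add: equivalence_iff)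
  qed
qed

end


theorem theorem6p3p2:
  fixes E B C :: "('u, 'u) category"
    and p q K :: "('u, 'u, 'u, 'u) fmaps"
    and \<psi> :: "'u \<times> 'u \<Rightarrow> 'u"
  assumes "universe TYPE('u)"
    and "small_category E" and "small_category B"
    and "is_functor E B p"
    and "is_codesc E p C q \<psi>"
    and "is_codesc_comparison E B p C q \<psi> K"
  shows "all_equivalent
           [effective_descent (Cat :: (('u, 'u) category, _) category) E B p,
            is_equivalence (CAT B (Cat :: (('u, 'u) category, _) category)) (CAT C Cat)
              (precomp C B K Cat),
            effective_descent (Set_cat :: ('u set, _) category) E B p,
            is_equivalence (CAT B (Set_cat :: ('u set, _) category)) (CAT C Set_cat)
              (precomp C B K Set_cat),
            fully_faithful C B K \<and> lax_epi TYPE('u) C B K,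
            is_equivalence (Cauchy C) (Cauchy B) (Cauchy_map C B K)]
       \<and> all_equivalent
           [descent (Cat :: (('u, 'u) category, _) category) E B p,
            fully_faithful (CAT B (Cat :: (('u, 'u) category, _) category)) (CAT C Cat)
              (precomp C B K Cat),
            descent (Set_cat :: ('u set, _) category) E B p,
            fully_faithful (CAT B (Set_cat :: ('u set, _) category)) (CAT C Set_cat)
              (precomp C B K Set_cat),
            lax_epi TYPE('u) C B K,
            lax_epi TYPE('u) (Cauchy C) (Cauchy B) (Cauchy_map C B K)]"
proof -
  note u = assms(1)
  note Cs = codesc_data(1)[OF u assms(2,4,5)]
  have K: "is_functor C B K" using assms(6) by (simp add: is_codesc_comparison_def)
  note small = u Cs assms(3) K
  note cat = effective_descent_iff[OF u assms(2,4,5) Cat_locally_small[OF u] assms(6)]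
    descent_iff[OF u assms(2,4,5) Cat_locally_small[OF u] assms(6)]
  note set = effective_descent_iff[OF u assms(2,4,5) SET_locally_small[OF u] assms(6)]
    descent_iff[OF u assms(2,4,5) SET_locally_small[OF u] assms(6)]
  \<comment> \<open>The rewriting sends every entry of the first list to
    \<open>retract_dense C B K\<close> and every entry of the second to
    \<open>lax_epi TYPE('u) C B K\<close>.\<close>
  show ?thesis
    unfolding all_equivalent_def
    by (simp add: cat set lax_epi_retract_dense[OF small] lax_epi_iff_ff_Cat[OF small, symmetric]
        lax_epi_iff_ff_SET[OF small, symmetric] retract_dense_iff_equivalence_Cat[OF small, symmetric]
        retract_dense_iff_equivalence_SET[OF small, symmetric] lax_epi_Cauchy_map_iff[OF small]
        equivalence_Cauchy_map_iff[OF small])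
qed

end
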